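(* Let $M$ be a compact manifold and $A$ a Lie algebroid over $M$. Let $\Omega_0,\Omega_1\in\Gamma(\wedge^2A^* )$ be two symplectic structures on the Lie algebroid $A$ which can be connected by a smooth family $t\mapsto\Omega_t$ ($t\in[0,1]$) of symplectic structures on $A$. Assume that there exists a smooth path $t\mapsto\xi_t\in\Gamma(A^* )$ such that $\dot\Omega_t=-d_A\xi_t$ for all $t$, where $\dot\Omega_t=\frac{d}{dt}\Omega_t$. Then $\Omega_0$ and $\Omega_1$ are isomorphic; that is, there is a Lie algebroid automorphism $\phi$ of $A$, isotopic to the identity, such that $\phi^*\Omega_1=\Omega_0$.
   Context: $d_A:\Gamma(\wedge^kA^* )\to\Gamma(\wedge^{k+1}A^* )$ is the Lie algebroid cohomology differential of $A$. A symplectic structure (symplectic form) on a Lie algebroid $A\to M$ is a smooth section $\Omega$ of $\wedge^2A^*$ which is $d_A$-closed and non-degenerate (the bundle map $A\to A^*$, $a\mapsto\Omega(a,\cdot)$, is an isomorphism). A Lie algebroid automorphism of $A$ is a vector bundle automorphism of $A$, covering a diffeomorphism of $M$, compatible with anchor and bracket. *)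

theory Defs
  imports "HOL-Analysis.Analysis"
begin

section \<open>Smooth maps between normed spaces\<close>

primrec k_smooth_on :: "nat \<Rightarrow> 'a::real_normed_vector set \<Rightarrow> ('a \<Rightarrow> 'b::real_normed_vector) \<Rightarrow> bool" where
  "k_smooth_on 0 S f \<longleftrightarrow> continuous_on S f"
| "k_smooth_on (Suc k) S f \<longleftrightarrow>
     (\<forall>x\<in>S. f differentiable (at x)) \<and>
     (\<forall>v. k_smooth_on k S (\<lambda>x. frechet_derivative f (at x) v))"

text \<open>On a set that need not be open, such as \<open>[0,1] \<times> U\<close>, a function is smooth if near every
  point of the set it is the restriction of a smooth function defined on an open set. The
  definition is only used for finite-dimensional domains, where smoothness of all directional
  derivatives is the usual notion.\<close>

definition smooth_on :: "'a::real_normed_vector set \<Rightarrow> ('a \<Rightarrow> 'b::real_normed_vector) \<Rightarrow> bool" where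
  "smooth_on S f \<longleftrightarrow>
     (\<forall>x\<in>S. \<exists>W g. open W \<and> x \<in> W \<and> (\<forall>k. k_smooth_on k W g) \<and> (\<forall>y\<in>S \<inter> W. f y = g y))"

section \<open>Manifolds\<close>

text \<open>The manifold is the whole type \<open>'m\<close>, charts take values in the model space \<open>'b\<close>. Model spaces
  and model fibres are finite-dimensional normed spaces, and not of class \<open>euclidean_space\<close>,
  because the latter excludes dimension \<open>0\<close> (a Lie algebra is a Lie algebroid over a point).\<close>

type_synonym ('m, 'b) atlas = "('m set \<times> ('m \<Rightarrow> 'b)) set"

definition finite_dim :: "'a::real_vector itself \<Rightarrow> bool" where
  "finite_dim _ \<longleftrightarrow> (\<exists>B::'a set. finite B \<and> span B = UNIV)"

definition smooth_manifold ::
  "('m::{t2_space,second_countable_topology}, 'b::real_normed_vector) atlas \<Rightarrow> bool" where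
  "smooth_manifold \<A> \<longleftrightarrow>
     finite_dim TYPE('b) \<and>
     \<Union>(fst ` \<A>) = UNIV \<and>
     (\<forall>(U, c)\<in>\<A>. open U \<and> open (c ` U) \<and> homeomorphism U (c ` U) c (inv_into U c)) \<and>
     (\<forall>(U, c)\<in>\<A>. \<forall>(V, d)\<in>\<A>. smooth_on (c ` (U \<inter> V)) (d \<circ> inv_into U c))"

definition smooth_fun_on ::
  "('m, 'b::real_normed_vector) atlas \<Rightarrow> 'm set \<Rightarrow> ('m \<Rightarrow> 'w::real_normed_vector) \<Rightarrow> bool" where
  "smooth_fun_on \<A> D f \<longleftrightarrow> (\<forall>(U, c)\<in>\<A>. smooth_on (c ` (U \<inter> D)) (f \<circ> inv_into U c))"

abbreviation smooth_functions :: "('m, 'b::real_normed_vector) atlas \<Rightarrow> ('m \<Rightarrow> real) set" where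
  "smooth_functions \<A> \<equiv> {f. smooth_fun_on \<A> UNIV f}"

definition smooth_map_on ::
  "('m::topological_space, 'b::real_normed_vector) atlas \<Rightarrow>
   ('n::topological_space, 'c::real_normed_vector) atlas \<Rightarrow> 'm set \<Rightarrow> ('m \<Rightarrow> 'n) \<Rightarrow> bool" where
  "smooth_map_on \<A> \<B> D F \<longleftrightarrow>
     continuous_on D F \<and> (\<forall>(V, d)\<in>\<B>. smooth_fun_on \<A> (D \<inter> F -` V) (d \<circ> F))"

text \<open>The product atlas of \<open>\<real> \<times> M\<close>; a family of objects on \<open>M\<close> indexed by \<open>t \<in> [0,1]\<close> is smooth if
  it is jointly smooth on \<open>[0,1] \<times> M\<close>.\<close>

definition line_times :: "('m, 'b) atlas \<Rightarrow> (real \<times> 'm, real \<times> 'b) atlas" where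
  "line_times \<A> = (\<lambda>(U, c). (UNIV \<times> U, map_prod id c)) ` \<A>"

text \<open>Tangent vectors at \<open>x\<close> are the derivations of the smooth functions at \<open>x\<close>; their values on
  other functions are irrelevant.\<close>

definition tangent_space ::
  "('m, 'b::real_normed_vector) atlas \<Rightarrow> 'm \<Rightarrow> (('m \<Rightarrow> real) \<Rightarrow> real) set" where
  "tangent_space \<A> x = {D. \<forall>f\<in>smooth_functions \<A>. \<forall>g\<in>smooth_functions \<A>.
     (\<forall>r. D (\<lambda>y. r * f y) = r * D f) \<and>
     D (\<lambda>y. f y + g y) = D f + D g \<and>
     D (\<lambda>y. f y * g y) = f x * D g + g x * D f}"

section \<open>Vector bundles\<close>

text \<open>The fibres are subspaces of one real vector space \<open>'v\<close> carrying no topology. This is no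
  restriction, since \<open>'v\<close> may be the direct sum of all fibres. Different fibres may intersect, so
  a point of the total space is a pair of \<open>x\<close> and \<open>a \<in> fibre E x\<close>. The smooth structure is given
  by a bundle atlas \<open>frames E\<close> of (inverses of) local trivialisations: \<open>(U, \<tau>) \<in> frames E\<close> consists
  of linear isomorphisms \<open>\<tau> x\<close> from the model fibre \<open>'f\<close> onto \<open>fibre E x\<close> for \<open>x \<in> U\<close>.\<close>

record ('m, 'b, 'v, 'f) vbundle =
  base :: "('m, 'b) atlas"
  fibre :: "'m \<Rightarrow> 'v set"
  frames :: "('m set \<times> ('m \<Rightarrow> 'f \<Rightarrow> 'v)) set"

definition linear_between ::
  "'v::real_vector set \<Rightarrow> 'w::real_vector set \<Rightarrow> ('v \<Rightarrow> 'w) \<Rightarrow> bool" where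
  "linear_between S T h \<longleftrightarrow> h ` S \<subseteq> T \<and>
     (\<forall>a\<in>S. \<forall>b\<in>S. h (a + b) = h a + h b) \<and> (\<forall>r. \<forall>a\<in>S. h (r *\<^sub>R a) = r *\<^sub>R h a)"

definition vector_bundle ::
  "('m::{t2_space,second_countable_topology}, 'b::real_normed_vector, 'v::real_vector,
    'f::real_normed_vector, 'z) vbundle_scheme \<Rightarrow> bool" where
  "vector_bundle E \<longleftrightarrow>
     smooth_manifold (base E) \<and>
     finite_dim TYPE('f) \<and>
     (\<forall>x. subspace (fibre E x)) \<and>
     \<Union>(fst ` frames E) = UNIV \<and>
     (\<forall>(U, \<tau>)\<in>frames E. open U \<and> (\<forall>x\<in>U. linear (\<tau> x) \<and> bij_betw (\<tau> x) UNIV (fibre E x))) \<and>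
     (\<forall>(U, \<tau>)\<in>frames E. \<forall>(V, \<sigma>)\<in>frames E. \<forall>v.
        smooth_fun_on (base E) (U \<inter> V) (\<lambda>x. inv (\<sigma> x) (\<tau> x v)))"

definition sections ::
  "('m, 'b::real_normed_vector, 'v, 'f::real_normed_vector, 'z) vbundle_scheme \<Rightarrow> ('m \<Rightarrow> 'v) set" where
  "sections E = {X. (\<forall>x. X x \<in> fibre E x) \<and>
     (\<forall>(U, \<tau>)\<in>frames E. smooth_fun_on (base E) U (\<lambda>x. inv (\<tau> x) (X x)))}"

text \<open>Sections of \<open>\<Lambda>\<^sup>k E\<^sup>*\<close>: the value at \<open>x\<close> is an alternating \<open>k\<close>-linear form, whose arguments
  are passed as a list of length \<open>k\<close>.\<close>

definition alternating_form :: "nat \<Rightarrow> 'v::real_vector set \<Rightarrow> ('v list \<Rightarrow> real) \<Rightarrow> bool" where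
  "alternating_form k S \<omega> \<longleftrightarrow> (\<forall>as. length as = k \<and> set as \<subseteq> S \<longrightarrow>
     (\<forall>i<k. linear_between S UNIV (\<lambda>a. \<omega> (as[i := a]))) \<and>
     (\<not> distinct as \<longrightarrow> \<omega> as = 0))"

definition forms ::
  "nat \<Rightarrow> ('m, 'b::real_normed_vector, 'v::real_vector, 'f, 'z) vbundle_scheme \<Rightarrow>
   ('m \<Rightarrow> 'v list \<Rightarrow> real) set" where
  "forms k E = {\<omega>. (\<forall>x. alternating_form k (fibre E x) (\<omega> x)) \<and>
     (\<forall>(U, \<tau>)\<in>frames E. \<forall>vs. length vs = k \<longrightarrow>
        smooth_fun_on (base E) U (\<lambda>x. \<omega> x (map (\<tau> x) vs)))}"

definition smooth_form_family ::
  "nat \<Rightarrow> ('m, 'b::real_normed_vector, 'v::real_vector, 'f, 'z) vbundle_scheme \<Rightarrow>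
   (real \<Rightarrow> 'm \<Rightarrow> 'v list \<Rightarrow> real) \<Rightarrow> bool" where
  "smooth_form_family k E \<omega> \<longleftrightarrow>
     (\<forall>t\<in>{0..1}. \<omega> t \<in> forms k E) \<and>
     (\<forall>(U, \<tau>)\<in>frames E. \<forall>vs. length vs = k \<longrightarrow>
        smooth_fun_on (line_times (base E)) ({0..1} \<times> U) (\<lambda>(t, x). \<omega> t x (map (\<tau> x) vs)))"

text \<open>A bundle map covering \<open>F\<close> maps \<open>(x, a)\<close> to \<open>(F x, \<Phi> x a)\<close>.\<close>

definition bundle_map ::
  "('m::topological_space, 'b::real_normed_vector, 'v::real_vector, 'f::real_normed_vector, 'z)
     vbundle_scheme \<Rightarrow> ('m \<Rightarrow> 'm) \<Rightarrow> ('m \<Rightarrow> 'v \<Rightarrow> 'v) \<Rightarrow> bool" where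
  "bundle_map E F \<Phi> \<longleftrightarrow>
     smooth_map_on (base E) (base E) UNIV F \<and>
     (\<forall>x. linear_between (fibre E x) (fibre E (F x)) (\<Phi> x)) \<and>
     (\<forall>(U, \<tau>)\<in>frames E. \<forall>(V, \<sigma>)\<in>frames E. \<forall>v.
        smooth_fun_on (base E) (U \<inter> F -` V) (\<lambda>x. inv (\<sigma> (F x)) (\<Phi> x (\<tau> x v))))"

definition bundle_automorphism ::
  "('m::topological_space, 'b::real_normed_vector, 'v::real_vector, 'f::real_normed_vector, 'z)
     vbundle_scheme \<Rightarrow> ('m \<Rightarrow> 'm) \<Rightarrow> ('m \<Rightarrow> 'v \<Rightarrow> 'v) \<Rightarrow> bool" where
  "bundle_automorphism E F \<Phi> \<longleftrightarrow>
     bij F \<and> (\<forall>x. bij_betw (\<Phi> x) (fibre E x) (fibre E (F x))) \<and>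
     bundle_map E F \<Phi> \<and>
     bundle_map E (inv F) (\<lambda>y. inv_into (fibre E (inv F y)) (\<Phi> (inv F y)))"

definition push_section ::
  "('m \<Rightarrow> 'm) \<Rightarrow> ('m \<Rightarrow> 'v \<Rightarrow> 'v) \<Rightarrow> ('m \<Rightarrow> 'v) \<Rightarrow> ('m \<Rightarrow> 'v)" where
  "push_section F \<Phi> X = (\<lambda>y. \<Phi> (inv F y) (X (inv F y)))"

definition pullback_form ::
  "('m \<Rightarrow> 'm) \<Rightarrow> ('m \<Rightarrow> 'v \<Rightarrow> 'v) \<Rightarrow> ('m \<Rightarrow> 'v list \<Rightarrow> real) \<Rightarrow> ('m \<Rightarrow> 'v list \<Rightarrow> real)" where
  "pullback_form F \<Phi> \<omega> = (\<lambda>x as. \<omega> (F x) (map (\<Phi> x) as))"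

section \<open>Lie algebroids\<close>

text \<open>\<open>anchor A x a\<close> is the tangent vector at \<open>x\<close> that the anchor assigns to \<open>a \<in> fibre A x\<close>, and
  \<open>bracket A\<close> is the bracket of sections. That the anchor preserves brackets
  is a consequence of the axioms below.\<close>

record ('m, 'b, 'v, 'f) algebroid = "('m, 'b, 'v, 'f) vbundle" +
  anchor :: "'m \<Rightarrow> 'v \<Rightarrow> ('m \<Rightarrow> real) \<Rightarrow> real"
  bracket :: "('m \<Rightarrow> 'v) \<Rightarrow> ('m \<Rightarrow> 'v) \<Rightarrow> ('m \<Rightarrow> 'v)"

definition lie_algebroid ::
  "('m::{t2_space,second_countable_topology}, 'b::real_normed_vector, 'v::real_vector,
    'f::real_normed_vector) algebroid \<Rightarrow> bool" where
  "lie_algebroid A \<longleftrightarrow>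
     vector_bundle A \<and>
     (\<forall>x. \<forall>a\<in>fibre A x. anchor A x a \<in> tangent_space (base A) x) \<and>
     (\<forall>x. \<forall>f\<in>smooth_functions (base A). linear_between (fibre A x) UNIV (\<lambda>a. anchor A x a f)) \<and>
     (\<forall>X\<in>sections A. \<forall>f\<in>smooth_functions (base A).
        (\<lambda>x. anchor A x (X x) f) \<in> smooth_functions (base A)) \<and>
     (\<forall>X\<in>sections A. \<forall>Y\<in>sections A. bracket A X Y \<in> sections A) \<and>
     (\<forall>X\<in>sections A. \<forall>Y\<in>sections A. \<forall>Z\<in>sections A. \<forall>r s.
        bracket A (\<lambda>x. r *\<^sub>R X x + s *\<^sub>R Y x) Z =
          (\<lambda>x. r *\<^sub>R bracket A X Z x + s *\<^sub>R bracket A Y Z x)) \<and>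
     (\<forall>X\<in>sections A. \<forall>Y\<in>sections A. bracket A X Y = (\<lambda>x. - bracket A Y X x)) \<and>
     (\<forall>X\<in>sections A. \<forall>Y\<in>sections A. \<forall>Z\<in>sections A. \<forall>x.
        bracket A X (bracket A Y Z) x + bracket A Y (bracket A Z X) x
          + bracket A Z (bracket A X Y) x = 0) \<and>
     (\<forall>X\<in>sections A. \<forall>Y\<in>sections A. \<forall>f\<in>smooth_functions (base A).
        bracket A X (\<lambda>x. f x *\<^sub>R Y x) =
          (\<lambda>x. f x *\<^sub>R bracket A X Y x + anchor A x (X x) f *\<^sub>R Y x))"

definition remove_nth :: "nat \<Rightarrow> 'a list \<Rightarrow> 'a list" where
  "remove_nth i xs = take i xs @ drop (Suc i) xs"

definition eval_form :: "('m \<Rightarrow> 'v list \<Rightarrow> real) \<Rightarrow> ('m \<Rightarrow> 'v) list \<Rightarrow> 'm \<Rightarrow> real" where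
  "eval_form \<omega> Xs = (\<lambda>x. \<omega> x (map (\<lambda>X. X x) Xs))"

text \<open>The differential of a \<open>k\<close>-form, as the alternating \<open>C\<^sup>\<infinity>(M)\<close>-multilinear map on lists of \<open>k + 1\<close>
  sections given by the Koszul formula.\<close>

definition d_A ::
  "('m, 'b, 'v, 'f, 'z) algebroid_scheme \<Rightarrow> ('m \<Rightarrow> 'v list \<Rightarrow> real) \<Rightarrow>
   ('m \<Rightarrow> 'v) list \<Rightarrow> 'm \<Rightarrow> real" where
  "d_A A \<omega> Xs = (\<lambda>x.
     (\<Sum>i<length Xs. (-1) ^ i * anchor A x ((Xs ! i) x) (eval_form \<omega> (remove_nth i Xs))) +
     (\<Sum>j<length Xs. \<Sum>i<j. (-1) ^ (i + j) *
        eval_form \<omega> (bracket A (Xs ! i) (Xs ! j) # remove_nth i (remove_nth j Xs)) x))"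

definition closed_form ::
  "nat \<Rightarrow> ('m, 'b::real_normed_vector, 'v, 'f::real_normed_vector, 'z) algebroid_scheme \<Rightarrow>
   ('m \<Rightarrow> 'v list \<Rightarrow> real) \<Rightarrow> bool" where
  "closed_form k A \<omega> \<longleftrightarrow>
     (\<forall>Xs. length Xs = Suc k \<and> set Xs \<subseteq> sections A \<longrightarrow> (\<forall>x. d_A A \<omega> Xs x = 0))"

text \<open>Every linear form on a fibre is \<open>\<Omega>(a, \<cdot>)\<close> for exactly one \<open>a\<close>, i.e. \<open>a \<mapsto> \<Omega>(a, \<cdot>)\<close> is a
  bijection onto the dual fibre.\<close>

definition nondegenerate ::
  "('m, 'b, 'v::real_vector, 'f, 'z) vbundle_scheme \<Rightarrow> ('m \<Rightarrow> 'v list \<Rightarrow> real) \<Rightarrow> bool" where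
  "nondegenerate E \<Omega> \<longleftrightarrow> (\<forall>x. \<forall>\<alpha>::'v \<Rightarrow> real. linear_between (fibre E x) UNIV \<alpha> \<longrightarrow>
     (\<exists>!a. a \<in> fibre E x \<and> (\<forall>b\<in>fibre E x. \<Omega> x [a, b] = \<alpha> b)))"

definition symplectic_form ::
  "('m, 'b::real_normed_vector, 'v::real_vector, 'f::real_normed_vector, 'z) algebroid_scheme \<Rightarrow>
   ('m \<Rightarrow> 'v list \<Rightarrow> real) \<Rightarrow> bool" where
  "symplectic_form A \<Omega> \<longleftrightarrow> \<Omega> \<in> forms 2 A \<and> closed_form 2 A \<Omega> \<and> nondegenerate A \<Omega>"

text \<open>Compatibility with the anchor is \<open>\<rho>(\<Phi> a) = dF(\<rho>(a))\<close>, where \<open>dF(D)(f) = D(f \<circ> F)\<close>.\<close>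

definition algebroid_automorphism ::
  "('m::topological_space, 'b::real_normed_vector, 'v::real_vector, 'f::real_normed_vector, 'z)
     algebroid_scheme \<Rightarrow> ('m \<Rightarrow> 'm) \<Rightarrow> ('m \<Rightarrow> 'v \<Rightarrow> 'v) \<Rightarrow> bool" where
  "algebroid_automorphism A F \<Phi> \<longleftrightarrow>
     bundle_automorphism A F \<Phi> \<and>
     (\<forall>x. \<forall>a\<in>fibre A x. \<forall>f\<in>smooth_functions (base A).
        anchor A (F x) (\<Phi> x a) f = anchor A x a (f \<circ> F)) \<and>
     (\<forall>X\<in>sections A. \<forall>Y\<in>sections A.
        bracket A (push_section F \<Phi> X) (push_section F \<Phi> Y) = push_section F \<Phi> (bracket A X Y))"

text \<open>An isotopy is a smooth family, indexed by \<open>[0,1]\<close>, of Lie algebroid automorphisms.\<close>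

definition isotopic_to_identity ::
  "('m::topological_space, 'b::real_normed_vector, 'v::real_vector, 'f::real_normed_vector, 'z)
     algebroid_scheme \<Rightarrow> ('m \<Rightarrow> 'm) \<Rightarrow> ('m \<Rightarrow> 'v \<Rightarrow> 'v) \<Rightarrow> bool" where
  "isotopic_to_identity A F \<Phi> \<longleftrightarrow> (\<exists>G \<Psi>.
     (\<forall>t\<in>{0..1}. algebroid_automorphism A (G t) (\<Psi> t)) \<and>
     smooth_map_on (line_times (base A)) (base A) ({0..1} \<times> UNIV) (\<lambda>(t, x). G t x) \<and>
     (\<forall>(U, \<tau>)\<in>frames A. \<forall>(V, \<sigma>)\<in>frames A. \<forall>v.
        smooth_fun_on (line_times (base A)) {(t, x). t \<in> {0..1} \<and> x \<in> U \<and> G t x \<in> V}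
          (\<lambda>(t, x). inv (\<sigma> (G t x)) (\<Psi> t x (\<tau> x v)))) \<and>
     (\<forall>x. G 0 x = x \<and> (\<forall>a\<in>fibre A x. \<Psi> 0 x a = a)) \<and>
     (\<forall>x. G 1 x = F x \<and> (\<forall>a\<in>fibre A x. \<Psi> 1 x a = \<Phi> x a)))"

end

theory Submission
  imports Defs
begin

text \<open>Moser's argument. Since \<open>\<Omega>\<^sub>t\<close> is non-degenerate there is a family of sections \<open>X\<^sub>t\<close> with
  \<open>\<iota>\<^bsub>X\<^sub>t\<^esub> \<Omega>\<^sub>t = \<xi>\<^sub>t\<close>; as \<open>\<Omega>\<^sub>t\<close> is closed, the flow of \<open>X\<^sub>t\<close> on \<open>A\<close> pulls every \<open>\<Omega>\<^sub>t\<close> back to \<open>\<Omega>\<^sub>0\<close>.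
  Flows are only constructed for sections supported in a chart domain over which \<open>A\<close> is trivial,
  where they solve an ordinary differential equation in a normed space and a linear one in the
  fibre; such a flow preserves anchor and bracket because the defects satisfy homogeneous linear
  transport equations.
  The path is therefore fragmented: on a short interval \<open>[s, s']\<close>, \<open>\<Omega>\<^sub>s - \<Omega>\<^bsub>s'\<^esub> = d\<eta>\<close> is the sum
  of the exact forms \<open>d(\<chi>\<^sub>i \<eta>)\<close>, with a partition of unity \<open>\<chi>\<^sub>i\<close> supported in charts; these are subtracted
  from \<open>\<Omega>\<^sub>s\<close> one at a time, the interval being so short that all forms on the way are non-degenerate.
  By compactness, finitely many such intervals lead from \<open>0\<close> to \<open>1\<close>.\<close>

text \<open>Cutting off the Moser section itself would destroy the equation that keeps the pullback
  constant, because \<open>d\<close> does not commute with multiplication by a function. The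
  primitive is cut off instead: the section dual to \<open>\<chi>\<^sub>i \<eta>\<close> is then
  supported in the chart of its own accord, and the form subtracted stays exact. The price is the
  extra term \<open>d\<chi>\<^sub>i \<and> \<eta>\<close>. Its first factor need not be small, but
  \<eta>, the integral of the reparametrised \<xi> from s to s', tends to zero with s' - s; hence
  the partition of unity is fixed before the length of the intervals. The other obstacle is that the
  fibres carry no topology, so a path of sections has no immediate derivative. Sections are expanded
  in finitely many global generators and tangent vectors in finitely many operators on functions;
  anchor and bracket become finite sums with smooth functions as coefficients, which can be
  differentiated in time as usual.\<close>

section \<open>Finite-dimensional normed spaces and their coordinates\<close>

text \<open>Induction on the basis. By the induction hypothesis the coefficients of a Cauchy
  sequence in the span of \<open>F\<close> are Cauchy, so that span is closed and the new vector
  \<open>a\<close> has a positive distance \<open>d\<close> from it. The distance bounds the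
  coefficient of \<open>a\<close>, and subtracting that term leaves a vector in the span of
  \<open>F\<close>.\<close>

lemma independent_coefficient_bound:
  fixes B :: "'a::real_normed_vector set"
  assumes "finite B" "independent B"
  shows "\<exists>C\<ge>0. \<forall>u. \<forall>b\<in>B. \<bar>u b\<bar> \<le> C * norm (\<Sum>b\<in>B. u b *\<^sub>R b)" using assms
proof (induction B)
  case empty
  then show ?case by auto
next
  case (insert a F)
  have indF: "independent F" and aF: "a \<notin> span F"
    using insert.hyps insert.prems by (auto simp: independent_insert)
  obtain C where C0: "C \<ge> 0"
    and C: "!!u b. b \<in> F ==> \<bar>u b\<bar> \<le> C * norm (\<Sum>b\<in>F. u b *\<^sub>R b)" using insert.IH[OF indF] by blast
  have "\<exists>d>0. \<forall>u. d \<le> norm (a - (\<Sum>b\<in>F. u b *\<^sub>R b))"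
  proof (rule ccontr)
    assume "\<not> ?thesis"
    then have "\<forall>n. \<exists>u. norm (a - (\<Sum>b\<in>F. u b *\<^sub>R b)) < inverse (real (Suc n))"
      by (metis inverse_positive_iff_positive not_less of_nat_0_less_iff zero_less_Suc)
    then obtain u where u: "!!n. norm (a - (\<Sum>b\<in>F. u n b *\<^sub>R b)) < inverse (real (Suc n))" by metis
    let ?w = "%n. \<Sum>b\<in>F. u n b *\<^sub>R b"
    have "(%n. norm (a - ?w n)) \<longlonglongrightarrow> 0"
      by (rule tendsto_sandwich[OF _ _ tendsto_const LIMSEQ_inverse_real_of_nat])
         (use less_imp_le[OF u] in \<open>auto intro!: eventuallyI simp del: of_nat_Suc\<close>)
    then have "(%n. a - ?w n) \<longlonglongrightarrow> 0" by (rule tendsto_norm_zero_cancel)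
    from tendsto_diff[OF tendsto_const[of a] this] have w: "?w \<longlonglongrightarrow> a" by simp
    then have Cau: "Cauchy ?w" by (rule LIMSEQ_imp_Cauchy)
    have "convergent (%n. u n b)" if b: "b \<in> F" for b
    proof -
      have "Cauchy (%n. u n b)"
      proof (rule metric_CauchyI)
        fix e :: real assume e: "e > 0"
        obtain M where M: "!!m n. m \<ge> M ==> n \<ge> M ==> dist (?w m) (?w n) < e / (C + 1)"
          using metric_CauchyD[OF Cau, of "e / (C + 1)"] e C0 by auto
        show "\<exists>M. \<forall>m\<ge>M. \<forall>n\<ge>M. dist (u m b) (u n b) < e"
        proof (intro exI allI impI)
          fix m n assume mn: "M \<le> m" "M \<le> n"
          have "\<bar>u m b - u n b\<bar> \<le> C * norm (\<Sum>b\<in>F. (u m b - u n b) *\<^sub>R b)"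
            using C[OF b, of "%b. u m b - u n b"] by simp
          also have "\<dots> = C * dist (?w m) (?w n)" by (simp add: dist_norm scaleR_diff_left sum_subtractf)
          also have "\<dots> \<le> C * (e / (C + 1))" using M[OF mn] C0 by (intro mult_left_mono) auto
          also have "\<dots> < e" using e C0 by (simp add: field_simps)
          finally show "dist (u m b) (u n b) < e" by (simp add: dist_real_def)
        qed
      qed
      then show ?thesis by (simp add: Cauchy_convergent)
    qed
    then obtain v where v: "!!b. b \<in> F ==> (%n. u n b) \<longlonglongrightarrow> v b" unfolding convergent_def by metis
    have "?w \<longlonglongrightarrow> (\<Sum>b\<in>F. v b *\<^sub>R b)" by (intro tendsto_sum tendsto_scaleR v tendsto_const)
    then have "a = (\<Sum>b\<in>F. v b *\<^sub>R b)" using w LIMSEQ_unique by blast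
    moreover have "(\<Sum>b\<in>F. v b *\<^sub>R b) \<in> span F" by (intro span_sum span_scale span_base)
    ultimately show False using aF by simp
  qed
  then obtain d where d: "d > 0" and dist: "!!u. d \<le> norm (a - (\<Sum>b\<in>F. u b *\<^sub>R b))" by blast
  show ?case
  proof (intro exI[of _ "1 / d + C * (1 + norm a / d)"] conjI allI ballI)
    show "0 \<le> 1 / d + C * (1 + norm a / d)" using d C0 by simp
    fix u b assume b: "b \<in> insert a F"
    define y where "y = (\<Sum>b\<in>insert a F. u b *\<^sub>R b)"
    have y: "y = u a *\<^sub>R a + (\<Sum>b\<in>F. u b *\<^sub>R b)" using insert.hyps by (simp add: y_def)
    have ua: "\<bar>u a\<bar> \<le> norm y / d"
    proof (cases "u a = 0")
      case False
      \<comment> \<open>Division by the coefficient of \<open>a\<close> turns \<open>y\<close> into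
        \<open>a\<close> minus an element of the span, whose norm is at least
        \<open>d\<close>.\<close>
      have "y = u a *\<^sub>R (a - (\<Sum>b\<in>F. (- u b / u a) *\<^sub>R b))"
        using False by (simp add: y scaleR_right_diff_distrib scaleR_add_right scaleR_sum_right sum_negf)
      then have "norm y = \<bar>u a\<bar> * norm (a - (\<Sum>b\<in>F. (- u b / u a) *\<^sub>R b))" by simp
      moreover have "\<bar>u a\<bar> * d \<le> \<bar>u a\<bar> * norm (a - (\<Sum>b\<in>F. (- u b / u a) *\<^sub>R b))"
        by (intro mult_left_mono dist) simp
      ultimately show ?thesis using d by (simp add: pos_le_divide_eq)
    qed (use d in simp)
    have "\<bar>u b\<bar> \<le> (1 / d + C * (1 + norm a / d)) * norm y"
    proof (cases "b = a")
      case True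
      have "0 \<le> C * (1 + norm a / d) * norm y" using C0 d by simp
      then show ?thesis using ua True by (simp add: distrib_right)
    next
      case False
      then have "\<bar>u b\<bar> \<le> C * norm (\<Sum>b\<in>F. u b *\<^sub>R b)" using b C by blast
      also have "(\<Sum>b\<in>F. u b *\<^sub>R b) = y - u a *\<^sub>R a" by (simp add: y)
      also have "C * norm (y - u a *\<^sub>R a) \<le> C * (norm y + norm y / d * norm a)"
        using norm_triangle_ineq4[of y "u a *\<^sub>R a"] mult_right_mono[OF ua, of "norm a"] C0
        by (intro mult_left_mono) auto
      also have "\<dots> = C * (1 + norm a / d) * norm y" by (simp add: algebra_simps)
      also have "\<dots> \<le> (1 / d + C * (1 + norm a / d)) * norm y" using d by (intro mult_right_mono) auto
      finally show ?thesis .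
    qed
    then show "\<bar>u b\<bar> \<le> (1 / d + C * (1 + norm a / d)) * norm (\<Sum>b\<in>insert a F. u b *\<^sub>R b)" by (simp only: y_def)
  qed
qed

text \<open>The choice is arbitrary, and junk unless the space is finite-dimensional.\<close>

definition basis :: "'a::real_normed_vector set" where
  "basis = (SOME B. finite B \<and> independent B \<and> span B = UNIV)"

definition coord :: "'a::real_normed_vector => 'a => real" where "coord b x = representation basis x b"

text \<open>Continuity of the coordinates is the point: it comes from the coefficient bound, and
  with it every expansion over \<open>basis\<close> may be differentiated term by term. An index
  outside \<open>basis\<close> gives the zero functional, which is why boundedness holds for all
  \<open>b\<close>.\<close>

lemma basis:
  assumes "finite_dim TYPE('a::real_normed_vector)"
  shows "finite (basis :: 'a set)" "bounded_linear (coord b)" "(x :: 'a) = (\<Sum>b\<in>basis. coord b x *\<^sub>R b)"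
    "b' \<in> basis ==> coord b b' = (if b = (b' :: 'a) then 1 else 0)"
    "independent (basis :: 'a set)" "span basis = (UNIV :: 'a set)"
proof -
  obtain S :: "'a set" where S: "finite S" "span S = UNIV" using assms unfolding finite_dim_def by blast
  obtain B where B: "B \<subseteq> S" "independent B" "S \<subseteq> span B" using maximal_independent_subset by blast
  have "finite B" "span B = UNIV" using B S finite_subset span_mono[OF B(3)] by (auto simp: span_span)
  then have "finite B \<and> independent B \<and> span B = UNIV" using B(2) by blast
  then have "finite (basis :: 'a set) \<and> independent (basis :: 'a set) \<and> span basis = (UNIV :: 'a set)"
    unfolding basis_def by (rule someI)
  then show fB: "finite (basis :: 'a set)" and ind: "independent (basis :: 'a set)"
    and sB: "span basis = (UNIV :: 'a set)" by auto
  obtain C where C: "!!u b. b \<in> (basis :: 'a set) ==> \<bar>u b\<bar> \<le> C * norm (\<Sum>b\<in>basis. u b *\<^sub>R b)"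
    using independent_coefficient_bound[OF fB ind] by blast
  show sum: "x = (\<Sum>b\<in>basis. coord b x *\<^sub>R b)" for x :: 'a
    using sum_representation_eq[of basis x basis] ind sB fB by (auto simp: coord_def)
  show "bounded_linear (coord b)" for b :: 'a
  proof (cases "b \<in> basis")
    case True
    show ?thesis by (rule bounded_linear_intro[where K = C])
        (use True C[of b "%b. coord b _"] sum ind sB in
          \<open>auto simp: coord_def representation_add representation_scale mult.commute\<close>)
  next
    case False
    then have "coord b = (%x. 0)" using representation_ne_zero by (intro ext) (auto simp: coord_def)
    then show ?thesis by simp
  qed
  show "b' \<in> basis ==> coord b b' = (if b = b' then 1 else 0)"
    by (auto simp: coord_def representation_basis[OF ind])
qed

lemma finite_dim_prod:
  assumes "finite_dim TYPE('a::real_vector)" "finite_dim TYPE('b::real_vector)"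
  shows "finite_dim TYPE('a \<times> 'b)"
proof -
  obtain A :: "'a set" and B :: "'b set" where A: "finite A" "span A = UNIV" and B: "finite B" "span B = UNIV"
    using assms unfolding finite_dim_def by blast
  let ?S = "(%a. (a, 0::'b)) ` A \<union> (%b. (0::'a, b)) ` B"
  have "(a, b) \<in> span ?S" for a b
  proof -
    have "linear (%a. (a, 0::'b))" "linear (%b. (0::'a, b))" by (auto intro!: linearI)
    then have "span ((%a. (a, 0::'b)) ` A) = (%a. (a, 0::'b)) ` UNIV"
      "span ((%b. (0::'a, b)) ` B) = (%b. (0::'a, b)) ` UNIV" using A B linear_span_image by metis+
    then have "(a, 0) \<in> span ((%a. (a, 0::'b)) ` A)" "(0, b) \<in> span ((%b. (0::'a, b)) ` B)" by auto
    then have "(a, 0) \<in> span ?S" "(0, b) \<in> span ?S" by (meson in_mono span_mono sup_ge1 sup_ge2)+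
    then have "(a, 0) + (0, b) \<in> span ?S" by (rule span_add)
    then show ?thesis by simp
  qed
  then have "span ?S = UNIV" by auto
  moreover have "finite ?S" using A B by simp
  ultimately show ?thesis unfolding finite_dim_def by blast
qed

lemma finite_dim_real: "finite_dim TYPE(real)"
proof -
  have "x \<in> span {1}" for x :: real using span_scale[OF span_base[of 1 "{1::real}"], of x] by simp
  then show ?thesis unfolding finite_dim_def by (intro exI[of _ "{1}"]) auto
qed

lemma linear_imp_bounded_linear_finite_dim:
  fixes f :: "'a::real_normed_vector => 'b::real_normed_vector"
  assumes "finite_dim TYPE('a)" "linear f"
  shows "bounded_linear f"
proof -
  note B = basis[OF assms(1)]
  have "f x = (\<Sum>b\<in>basis. coord b x *\<^sub>R f b)" for x
    by (subst B(3)[of x]) (simp add: linear_sum[OF assms(2)] linear_cmul[OF assms(2)])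
  then have eq: "(%x. \<Sum>b\<in>basis. coord b x *\<^sub>R f b) = f" by (intro ext) (rule sym)
  have "bounded_linear (%x. \<Sum>b\<in>basis. coord b x *\<^sub>R f b)"
    by (intro bounded_linear_sum bounded_linear_compose[OF bounded_linear_scaleR_left B(2)])
  then show ?thesis unfolding eq .
qed

lemma linear_inj_imp_bij_finite_dim:
  fixes f :: "'a::real_normed_vector => 'a"
  assumes "finite_dim TYPE('a)" "linear f" "inj f"
  shows "bij f"
proof -
  note B = basis[OF assms(1)]
  interpret finite_dimensional_vector_space "scaleR :: real => 'a => 'a" basis
    by unfold_locales (use B in \<open>auto simp: dependent_raw_def[symmetric] span_raw_def[symmetric]\<close>)
  show ?thesis using linear_inj_imp_surj[OF assms(2)[unfolded linear_def] assms(3)] assms(3) by (simp add: bij_def)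
qed

lemma linear_expand:
  assumes "!!x. x = (\<Sum>b\<in>B. crd b x *\<^sub>R b)" "linear A"
  shows "A v = (\<Sum>b\<in>B. crd b v *\<^sub>R A b)"
  by (subst assms(1)[of v]) (simp add: linear_sum[OF assms(2)] linear_cmul[OF assms(2)])

text \<open>One constant serves all linear maps at once. It takes the place of the operator norm for
  families of linear maps that are controlled one basis vector at a time.\<close>

lemma finite_dim_linear_bound:
  assumes "finite_dim TYPE('a::real_normed_vector)"
  obtains N where "N > 0" "!!(A :: 'a::real_normed_vector => 'b::real_normed_vector) e v.
    linear A ==> e \<ge> 0 ==> (!!b. b \<in> basis ==> norm (A b) \<le> e) ==> norm (A v) \<le> N * e * norm v"
proof -
  note B = basis[OF assms]
  have "\<exists>K>0. \<forall>v. \<bar>coord b v\<bar> \<le> norm v * K" for b :: 'a using bounded_linear.pos_bounded[OF B(2)] by simp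
  then obtain K where K: "!!b. K b > 0" "!!(b :: 'a) v. \<bar>coord b v\<bar> \<le> norm v * K b" by metis
  have "norm (A v) \<le> ((\<Sum>b\<in>basis. K b) + 1) * e * norm v"
    if A: "linear A" and e: "e \<ge> 0" "!!b. b \<in> basis ==> norm (A b) \<le> e" for A :: "'a => 'b" and e v
  proof -
    have "norm (A v) = norm (\<Sum>b\<in>basis. coord b v *\<^sub>R A b)" by (subst linear_expand[OF B(3) A]) (rule refl)
    also have "\<dots> \<le> (\<Sum>b\<in>basis. (norm v * K b) * e)"
      by (rule sum_norm_le) (auto intro!: mult_mono K e simp: K(1) less_imp_le)
    also have "\<dots> = (\<Sum>b\<in>basis. K b) * e * norm v" by (simp add: sum_distrib_left sum_distrib_right mult_ac)
    also have "\<dots> \<le> ((\<Sum>b\<in>basis. K b) + 1) * e * norm v" using e(1) by (simp add: distrib_right)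
    finally show ?thesis .
  qed
  \<comment> \<open>The summand 1 keeps the constant positive in dimension zero.\<close>
  moreover have "(\<Sum>b\<in>basis. K b) + 1 > 0" by (intro add_nonneg_pos sum_nonneg less_imp_le K) simp
  ultimately show ?thesis using that by blast
qed

subsection \<open>Smooth maps on open sets\<close>

abbreviation C_inf_on :: "'a::real_normed_vector set => ('a => 'b::real_normed_vector) => bool" where
  "C_inf_on S f \<equiv> \<forall>k. k_smooth_on k S f"

lemma k_smooth_on_subset: "k_smooth_on k S f ==> T \<subseteq> S ==> k_smooth_on k T f"
  by (induction k arbitrary: f) (auto intro: continuous_on_subset)

lemma k_smooth_on_imp_continuous_on: "k_smooth_on k S f ==> continuous_on S f"
  by (cases k) (auto intro!: continuous_at_imp_continuous_on differentiable_imp_continuous_within)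

lemma k_smooth_on_Suc_imp: "k_smooth_on (Suc k) S f ==> k_smooth_on k S f"
proof (induction k arbitrary: f)
  case 0
  then show ?case using k_smooth_on_imp_continuous_on[OF 0] by simp
next
  case (Suc k)
  then show ?case by (subst (asm) k_smooth_on.simps(2), subst k_smooth_on.simps(2)) blast
qed

lemma has_derivative_cong_open:
  assumes "open S" "x \<in> S" "!!y. y \<in> S ==> f y = g y"
  shows "(f has_derivative f') (at x) \<longleftrightarrow> (g has_derivative f') (at x)"
  using has_derivative_transform_within_open[OF _ assms(1,2), of f f' UNIV g]
    has_derivative_transform_within_open[OF _ assms(1,2), of g f' UNIV f] assms(3) by metis

lemma k_smooth_on_cong:
  assumes "open S" "!!y. y \<in> S ==> f y = g y"
  shows "k_smooth_on k S f \<longleftrightarrow> k_smooth_on k S g" using assms(2)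
proof (induction k arbitrary: f g)
  case 0
  then show ?case by (simp cong: continuous_on_cong)
next
  case (Suc k)
  have eq: "(f has_derivative f') (at x) \<longleftrightarrow> (g has_derivative f') (at x)" if "x \<in> S" for x f'
    by (rule has_derivative_cong_open[OF assms(1) that Suc.prems])
  have "f differentiable (at x) \<longleftrightarrow> g differentiable (at x)" if "x \<in> S" for x
    unfolding differentiable_def using eq[OF that] by simp
  moreover have "frechet_derivative f (at x) = frechet_derivative g (at x)" if "x \<in> S" for x
    unfolding frechet_derivative_def using eq[OF that] by simp
  then have "k_smooth_on k S (%x. frechet_derivative f (at x) v) \<longleftrightarrow>
      k_smooth_on k S (%x. frechet_derivative g (at x) v)" for v by (intro Suc.IH) simp
  ultimately show ?case by simp
qed

lemma k_smooth_on_SucI: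
  assumes "open S" "!!x. x \<in> S ==> (f has_derivative f' x) (at x)"
    "!!v. k_smooth_on k S (%x. f' x v)"
  shows "k_smooth_on (Suc k) S f"
proof -
  have "frechet_derivative f (at x) = f' x" if "x \<in> S" for x
    using frechet_derivative_at[OF assms(2)[OF that]] by simp
  then have "k_smooth_on k S (%x. frechet_derivative f (at x) v)" for v
    using k_smooth_on_cong[OF assms(1), of "%x. frechet_derivative f (at x) v" "%x. f' x v"] assms(3) by simp
  then show ?thesis using assms(2) by (auto simp: differentiable_def)
qed

lemma k_smooth_on_SucD:
  assumes "k_smooth_on (Suc k) S f"
  shows "x \<in> S ==> (f has_derivative frechet_derivative f (at x)) (at x)"
    "k_smooth_on k S (%x. frechet_derivative f (at x) v)"
  using assms by (auto simp: frechet_derivative_works[symmetric])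

lemma k_smooth_on_local:
  assumes "open S" "!!x. x \<in> S ==> \<exists>W. open W \<and> x \<in> W \<and> k_smooth_on k W f"
  shows "k_smooth_on k S f" using assms(2)
proof (induction k arbitrary: f)
  case 0
  then show ?case unfolding k_smooth_on.simps(1)
    by (intro continuous_at_imp_continuous_on ballI) (meson continuous_on_eq_continuous_at)
next
  case (Suc k)
  have "k_smooth_on k S (%x. frechet_derivative f (at x) v)" for v
    by (rule Suc.IH) (use Suc.prems in fastforce)
  then show ?case using Suc.prems by fastforce
qed

lemma C_inf_on_local:
  assumes "open S" "!!x. x \<in> S ==> \<exists>W. open W \<and> x \<in> W \<and> C_inf_on W f"
  shows "C_inf_on S f" by (intro allI k_smooth_on_local[OF assms(1)]) (use assms(2) in fast)

lemma k_smooth_on_const [simp]: "k_smooth_on k S (%x. c)"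
  by (induction k arbitrary: c) (auto simp: frechet_derivative_const)

lemma k_smooth_on_bounded_linear_compose:
  assumes "bounded_linear h" "open S" "k_smooth_on k S f"
  shows "k_smooth_on k S (%x. h (f x))" using assms(3)
proof (induction k arbitrary: f)
  case 0
  then show ?case using bounded_linear.continuous_on[OF assms(1)] by simp
next
  case (Suc k)
  show ?case by (rule k_smooth_on_SucI[OF assms(2) bounded_linear.has_derivative[OF assms(1)
          k_smooth_on_SucD(1)[OF Suc.prems]]])
      (auto intro!: Suc.IH k_smooth_on_SucD(2)[OF Suc.prems])
qed

lemma k_smooth_on_id: "open S ==> k_smooth_on k S (%x. x)"
  by (cases k) (auto intro!: k_smooth_on_SucI[where f' = "%x v. v"] simp del: k_smooth_on.simps(2))

lemma k_smooth_on_bounded_linear: "bounded_linear h ==> open S ==> k_smooth_on k S h"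
  using k_smooth_on_bounded_linear_compose[OF _ _ k_smooth_on_id] by blast

lemma k_smooth_on_add:
  assumes "open S" "k_smooth_on k S f" "k_smooth_on k S g"
  shows "k_smooth_on k S (%x. f x + g x)" using assms(2,3)
proof (induction k arbitrary: f g)
  case 0
  then show ?case by (auto intro: continuous_on_add)
next
  case (Suc k)
  show ?case by (rule k_smooth_on_SucI[OF assms(1) has_derivative_add[OF
          k_smooth_on_SucD(1)[OF Suc.prems(1)] k_smooth_on_SucD(1)[OF Suc.prems(2)]]])
      (auto intro!: Suc.IH k_smooth_on_SucD(2)[OF Suc.prems(1)] k_smooth_on_SucD(2)[OF Suc.prems(2)])
qed

lemma k_smooth_on_minus:
  assumes "open S" "k_smooth_on k S f"
  shows "k_smooth_on k S (%x. - f x)"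
  using k_smooth_on_bounded_linear_compose[OF bounded_linear_minus[OF bounded_linear_ident] assms] .

lemma k_smooth_on_diff:
  assumes "open S" "k_smooth_on k S f" "k_smooth_on k S g"
  shows "k_smooth_on k S (%x. f x - g x)"
  using k_smooth_on_add[OF assms(1,2) k_smooth_on_minus[OF assms(1,3)]] by simp

lemma k_smooth_on_sum:
  assumes "open S" "!!i. i \<in> I ==> k_smooth_on k S (f i)"
  shows "k_smooth_on k S (%x. \<Sum>i\<in>I. f i x)"
  using assms(2) by (induction I rule: infinite_finite_induct) (auto intro!: k_smooth_on_add[OF assms(1)])

lemma (in bounded_bilinear) k_smooth_on:
  assumes "open S" "k_smooth_on k S f" "k_smooth_on k S g"
  shows "k_smooth_on k S (%x. prod (f x) (g x))" using assms(2,3)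
proof (induction k arbitrary: f g)
  case 0
  then show ?case by (auto intro: continuous_on)
next
  case (Suc k)
  show ?case by (rule k_smooth_on_SucI[OF assms(1) FDERIV[OF
          k_smooth_on_SucD(1)[OF Suc.prems(1)] k_smooth_on_SucD(1)[OF Suc.prems(2)]]])
      (auto intro!: Suc.IH k_smooth_on_add[OF assms(1)] k_smooth_on_SucD(2)[OF Suc.prems(1)]
        k_smooth_on_SucD(2)[OF Suc.prems(2)]
        k_smooth_on_Suc_imp[OF Suc.prems(1)] k_smooth_on_Suc_imp[OF Suc.prems(2)])
qed

lemmas k_smooth_on_scaleR = bounded_bilinear.k_smooth_on[OF bounded_bilinear_scaleR]
lemmas k_smooth_on_mult = bounded_bilinear.k_smooth_on[OF bounded_bilinear_mult]

lemma k_smooth_on_Pair: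
  assumes "open S" "k_smooth_on k S f" "k_smooth_on k S g"
  shows "k_smooth_on k S (%x. (f x, g x))"
proof -
  have "k_smooth_on k S (%x. (f x, 0) + (0, g x))"
    by (intro k_smooth_on_add assms k_smooth_on_bounded_linear_compose[where h = "%x. (x, 0)"]
        k_smooth_on_bounded_linear_compose[where h = "%x. (0, x)"]
        bounded_linear_Pair bounded_linear_ident bounded_linear_zero)
  then show ?thesis by simp
qed

text \<open>In the chain rule both the base point and the direction of the derivative of
  \<open>f\<close> vary, whereas \<open>k_smooth_on\<close> speaks of fixed directions. Expanding
  the direction in the basis of the middle space turns the derivative into a sum of products of
  functions of class \<open>k\<close>, to which the induction hypothesis applies.\<close>

lemma k_smooth_on_compose:
  fixes f :: "'b::real_normed_vector => 'c::real_normed_vector"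
    and g :: "'a::real_normed_vector => 'b"
  assumes "finite_dim TYPE('b)" "open S" "open T" "g ` S \<subseteq> T"
    "k_smooth_on k T f" "k_smooth_on k S g"
  shows "k_smooth_on k S (%x. f (g x))"
proof -
  note B = basis[OF assms(1)]
  show ?thesis using assms(5,6)
  proof (induction k arbitrary: f)
    case 0
    then show ?case using continuous_on_compose2[of T f S g] assms(4) by simp
  next
    case (Suc k)
    have der: "((%x. f (g x)) has_derivative
        (%v. \<Sum>b\<in>basis. coord b (frechet_derivative g (at x) v) *\<^sub>R frechet_derivative f (at (g x)) b)) (at x)"
      if "x \<in> S" for x
    proof -
      have "g x \<in> T" using that assms(4) by blast
      from has_derivative_compose[OF k_smooth_on_SucD(1)[OF Suc.prems(2) that]
        k_smooth_on_SucD(1)[OF Suc.prems(1) this]]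
      have d: "((%x. f (g x)) has_derivative
         (%v. frechet_derivative f (at (g x)) (frechet_derivative g (at x) v))) (at x)" .
      have lin: "linear (frechet_derivative f (at (g x)))"
        using k_smooth_on_SucD(1)[OF Suc.prems(1) \<open>g x \<in> T\<close>] has_derivative_linear by blast
      have "frechet_derivative f (at (g x)) w = (\<Sum>b\<in>basis. coord b w *\<^sub>R frechet_derivative f (at (g x)) b)" for w
        by (subst B(3)[of w]) (simp add: linear_sum[OF lin] linear_cmul[OF lin])
      then show ?thesis by (intro has_derivative_eq_rhs[OF d] ext)
    qed
    show ?case by (rule k_smooth_on_SucI[OF assms(2) der])
        (auto intro!: k_smooth_on_sum k_smooth_on_scaleR assms(2)
          k_smooth_on_bounded_linear_compose[OF B(2)] Suc.IH
          k_smooth_on_SucD(2)[OF Suc.prems(1)] k_smooth_on_SucD(2)[OF Suc.prems(2)]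
          k_smooth_on_Suc_imp[OF Suc.prems(2)] simp del: k_smooth_on.simps)
  qed
qed

lemma k_smooth_on_inverse:
  fixes f :: "'a::real_normed_vector => real"
  assumes "open S" "k_smooth_on k S f" "!!x. x \<in> S ==> f x \<noteq> 0"
  shows "k_smooth_on k S (%x. inverse (f x))" using assms(2)
proof (induction k)
  case 0
  then show ?case using assms(3) by (auto intro: continuous_on_inverse)
next
  case (Suc k)
  have IH: "k_smooth_on k S (%x. inverse (f x))" by (rule Suc.IH[OF k_smooth_on_Suc_imp[OF Suc.prems]])
  have "((%x. inverse (f x)) has_derivative
      (%v. - (inverse (f x) * frechet_derivative f (at x) v * inverse (f x)))) (at x)"
    if "x \<in> S" for x
    using Deriv.has_derivative_inverse[OF assms(3)[OF that] k_smooth_on_SucD(1)[OF Suc.prems that]] by simp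
  then show ?case by (rule k_smooth_on_SucI[OF assms(1)])
      (assumption, intro k_smooth_on_minus k_smooth_on_mult assms(1) IH k_smooth_on_SucD(2)[OF Suc.prems])
qed

subsection \<open>A smooth step function\<close>

text \<open>The powers make the family closed under differentiation, up to linear combinations, so
  that the smoothness of all its members is a single induction.\<close>

definition flat_exp :: "nat => real => real" where
  "flat_exp n x = (if x > 0 then inverse x ^ n * exp (- inverse x) else 0)"

lemma flat_exp_at_0: "(flat_exp n \<longlongrightarrow> 0) (at 0)"
proof -
  have "((%y. y ^ n / exp y) \<longlongrightarrow> 0) (at_top :: real filter)" by (rule tendsto_power_div_exp_0)
  from filterlim_compose[OF this filterlim_inverse_at_top_right]
  have "((%x. inverse x ^ n / exp (inverse x)) \<longlongrightarrow> 0) (at_right (0::real))" .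
  then have "(flat_exp n \<longlongrightarrow> 0) (at_right 0)" by (rule Lim_transform_eventually)
      (auto simp: eventually_at_right_less flat_exp_def exp_minus field_simps
        intro!: eventually_mono[OF eventually_at_right_less])
  moreover have "(flat_exp n \<longlongrightarrow> 0) (at_left 0)" by (rule Lim_transform_eventually[OF tendsto_const])
      (auto simp: flat_exp_def eventually_at_filter)
  ultimately show ?thesis by (simp add: filterlim_split_at)
qed

lemma flat_exp_has_derivative:
  "(flat_exp n has_real_derivative flat_exp (n + 2) x - real n * flat_exp (n + 1) x) (at x)"
proof (cases x "0::real" rule: linorder_cases)
  case less
  have "((%x. 0) has_real_derivative 0) (at x)" by simp
  then have "(flat_exp n has_real_derivative 0) (at x)"
    by (rule has_field_derivative_transform_within_open[where S = "{..<0}"]) (use less in \<open>auto simp: flat_exp_def\<close>)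
  then show ?thesis using less by (simp add: flat_exp_def)
next
  case equal
  \<comment> \<open>The difference quotient at 0 is \<open>flat_exp (Suc n)\<close> itself, which
    tends to 0.\<close>
  have "((%h. (flat_exp n (0 + h) - flat_exp n 0) / h) \<longlongrightarrow> 0) (at 0)"
    by (rule Lim_transform_eventually[OF flat_exp_at_0[of "Suc n"]])
      (auto simp: flat_exp_def eventually_at_filter field_simps)
  then show ?thesis using equal by (simp add: DERIV_def flat_exp_def)
next
  case greater
  have "((%x. inverse x ^ n * exp (- inverse x)) has_real_derivative
      flat_exp (n + 2) x - real n * flat_exp (n + 1) x) (at x)" using greater
    by (cases n) (auto intro!: derivative_eq_intros simp: flat_exp_def field_simps power2_eq_square,
        metis Suc_pred neq0_conv power_Suc)
  then show ?thesis by (rule has_field_derivative_transform_within_open[where S = "{0<..}"])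
      (use greater in \<open>auto simp: flat_exp_def\<close>)
qed

lemma k_smooth_on_flat_exp: "k_smooth_on k UNIV (flat_exp n)"
proof (induction k arbitrary: n)
  case 0
  have "isCont (flat_exp n) x" for x using flat_exp_has_derivative DERIV_isCont by blast
  then show ?case by (simp add: continuous_at_imp_continuous_on)
next
  case (Suc k)
  have "k_smooth_on k UNIV (%x. v * (flat_exp (n + 2) x + (- real n) * flat_exp (n + 1) x))" for v
    by (intro k_smooth_on_mult k_smooth_on_add Suc.IH k_smooth_on_const open_UNIV)
  then have "k_smooth_on k UNIV (%x. (flat_exp (n + 2) x - real n * flat_exp (n + 1) x) * v)" for v
    by (simp add: mult.commute)
  then show ?case
    by (intro k_smooth_on_SucI[OF open_UNIV flat_exp_has_derivative[unfolded has_field_derivative_def]])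
qed

text \<open>The denominator is positive because \<open>x\<close> and \<open>1 - x\<close> cannot
  both be non-positive. The function serves twice: as the profile of bump functions, and as a change
  of time that extends families from the interval [0,1] to the whole line.\<close>

definition smooth_step :: "real => real" where
  "smooth_step x = flat_exp 0 x * inverse (flat_exp 0 x + flat_exp 0 (1 - x))"

lemma flat_exp_sum_pos: "flat_exp 0 x + flat_exp 0 (1 - x) > 0" by (auto simp: flat_exp_def add_pos_pos)

lemma smooth_step_le_0 [simp]: "x \<le> 0 ==> smooth_step x = 0"
  and smooth_step_ge_1 [simp]: "x \<ge> 1 ==> smooth_step x = 1" by (auto simp: smooth_step_def flat_exp_def)

lemma smooth_step_bounds: "0 \<le> smooth_step x" "smooth_step x \<le> 1"
proof -
  have "flat_exp 0 x \<ge> 0" "flat_exp 0 (1 - x) \<ge> 0" by (auto simp: flat_exp_def)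
  then show "0 \<le> smooth_step x" "smooth_step x \<le> 1"
    using flat_exp_sum_pos[of x] by (auto simp: smooth_step_def field_simps)
qed

lemma C_inf_on_smooth_step: "C_inf_on UNIV smooth_step"
proof
  fix k
  have "k_smooth_on k UNIV (%x::real. 1 + (-1) * x)"
    by (intro k_smooth_on_add k_smooth_on_mult k_smooth_on_const k_smooth_on_id open_UNIV)
  then have "k_smooth_on k UNIV (%x::real. 1 - x)" by simp
  then have "k_smooth_on k UNIV (%x. flat_exp 0 (1 - x))"
    by (intro k_smooth_on_compose[OF finite_dim_real open_UNIV open_UNIV _ k_smooth_on_flat_exp]) auto
  then show "k_smooth_on k UNIV smooth_step" unfolding smooth_step_def[abs_def]
    by (intro k_smooth_on_mult k_smooth_on_inverse k_smooth_on_add k_smooth_on_flat_exp open_UNIV)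
      (use flat_exp_sum_pos in \<open>auto simp: less_le\<close>)
qed

subsection \<open>Inverses of smooth families of linear maps\<close>

lemma open_vimage_Int:
  assumes "continuous_on S f" "open S" "open T" shows "open (f -` T \<inter> S)"
  using continuous_on_open_vimage[OF assms(2), of f] assms by simp

lemma linear_inv_of_bij:
  assumes "linear f" "bij f" shows "linear (inv f)"
proof (rule linearI)
  have f: "f (inv f x) = x" "inv f (f y) = y" for x y
    using assms(2) by (simp_all add: bij_is_surj surj_f_inv_f bij_is_inj)
  show "inv f (x + y) = inv f x + inv f y" for x y
    using f(2)[of "inv f x + inv f y"] by (simp add: linear_add[OF assms(1)] f(1))
  show "inv f (r *\<^sub>R x) = r *\<^sub>R inv f x" for r x
    using f(2)[of "r *\<^sub>R inv f x"] by (simp add: linear_cmul[OF assms(1)] f(1))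
qed

text \<open>An invertible map stretches every vector by at least a definite factor, and a change of
  the map that is small on the basis at most halves that factor. The parameter space is merely
  topological, since the lemma also serves for the openness of non-degeneracy, where points of the
  manifold are among the parameters.\<close>

lemma injective_linear_lower_bound:
  fixes L :: "'p::topological_space => 'f::real_normed_vector => 'f"
  assumes fd: "finite_dim TYPE('f)" and "open S" "p0 \<in> S"
    and lin: "!!p. p \<in> S ==> linear (L p)" and inj: "inj (L p0)"
    and cont: "!!v. continuous_on S (%p. L p v)"
  obtains m W where "m > 0" "open W" "p0 \<in> W" "W \<subseteq> S"
    "!!p v. p \<in> W ==> m * norm v \<le> norm (L p v)"
proof -
  obtain N where N: "N > 0" "!!(A :: 'f => 'f) e v.
      linear A ==> e \<ge> 0 ==> (!!b. b \<in> basis ==> norm (A b) \<le> e) ==> norm (A v) \<le> N * e * norm v"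
    by (rule finite_dim_linear_bound[OF fd]) blast
  have "linear (inv (L p0))"
    by (rule linear_inv_of_bij[OF lin[OF assms(3)] linear_inj_imp_bij_finite_dim[OF fd lin[OF assms(3)] inj]])
  then obtain C where C: "C > 0" "!!w. norm (inv (L p0) w) \<le> norm w * C"
    using linear_imp_bounded_linear_finite_dim[OF fd] bounded_linear.pos_bounded by blast
  \<comment> \<open>Chosen so that the perturbation is at most \<open>norm v / (2 * C)\<close>, half
    of the lower bound for \<open>L p0\<close>.\<close>
  define e where "e = 1 / (2 * C * N)"
  have e: "e > 0" using C N(1) by (simp add: e_def)
  define W where "W = (\<Inter>b\<in>basis. {p\<in>S. norm (L p b - L p0 b) < e}) \<inter> S"
  have "open ((%p. norm (L p b - L p0 b)) -` {..<e} \<inter> S)" for b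
    by (intro open_vimage_Int continuous_intros cont assms(2) open_lessThan)
  moreover have "(%p. norm (L p b - L p0 b)) -` {..<e} \<inter> S = {p\<in>S. norm (L p b - L p0 b) < e}" for b by auto
  ultimately have oW: "open W" unfolding W_def using basis(1)[OF fd] assms(2) by auto
  have est: "norm v / (2 * C) \<le> norm (L p v)" if "p \<in> W" for p v
  proof -
    have p: "p \<in> S" "!!b. b \<in> basis ==> norm (L p b - L p0 b) < e" using that by (auto simp: W_def)
    have "norm (L p v - L p0 v) \<le> N * e * norm v"
      by (rule N(2)[OF linear_compose_sub[OF lin lin]]) (use p assms(3) e in \<open>auto intro: less_imp_le\<close>)
    also have "\<dots> = norm v / (2 * C)" using N(1) by (simp add: e_def)
    finally have "norm (L p v - L p0 v) \<le> norm v / (2 * C)" .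
    moreover have "norm v / C \<le> norm (L p0 v)" using C(2)[of "L p0 v"] C(1) inj by (simp add: inv_f_f field_simps)
    moreover have "norm (L p0 v) \<le> norm (L p v) + norm (L p v - L p0 v)"
      by (metis norm_minus_commute norm_triangle_sub add.commute)
    moreover have "norm v / C = norm v / (2 * C) + norm v / (2 * C)" by simp
    ultimately show ?thesis by linarith
  qed
  show ?thesis by (rule that[of "1 / (2 * C)" W]) (use C oW assms(3) e est in \<open>auto simp: W_def\<close>)
qed

text \<open>A product rule in which the second factor is only continuous: \<open>f y\<close> is of
  the order of \<open>y - x\<close> and \<open>g y - g x\<close> tends to zero, so their product has
  derivative zero. It allows differentiating an inverse family before the inverse is known to be
  differentiable.\<close>

lemma has_derivative_scaleR_vanishing:
  assumes f: "(f has_derivative f') (at x)" "f x = 0" and g: "isCont g x"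
  shows "((%y. f y *\<^sub>R g y) has_derivative (%h. f' h *\<^sub>R g x)) (at x)"
proof -
  obtain K where K: "K > 0" "!!h. norm (f' h) \<le> norm h * K"
    using bounded_linear.pos_bounded[OF has_derivative_bounded_linear[OF f(1)]] by blast
  obtain d where d: "d > 0" "!!y. norm (y - x) < d ==> norm (f y - f' (y - x)) \<le> norm (y - x)"
    using f unfolding has_derivative_within_alt by (metis UNIV_I diff_0_right mult_1 zero_less_one)
  have "((%y. f y *\<^sub>R (g y - g x)) has_derivative (%h. 0)) (at x)" unfolding has_derivative_within_alt
  proof (intro conjI allI impI bounded_linear_zero)
    fix e :: real assume e: "e > 0"
    obtain d' where d': "d' > 0" "!!y. dist y x < d' ==> dist (g y) (g x) < e / (K + 1)"
      using g e K(1) unfolding continuous_at_eps_delta by (metis add_pos_pos divide_pos_pos zero_less_one)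
    have "norm (f y *\<^sub>R (g y - g x)) \<le> e * norm (y - x)" if y: "norm (y - x) < min d d'" for y
    proof -
      have "norm (f y) \<le> norm (f' (y - x)) + norm (f y - f' (y - x))" by (rule norm_triangle_sub)
      also have "\<dots> \<le> norm (y - x) * (K + 1)" using K(2)[of "y - x"] d(2)[of y] y by (simp add: distrib_left)
      finally have "norm (f y) * norm (g y - g x) \<le> norm (y - x) * (K + 1) * (e / (K + 1))"
        using d'(2)[of y] y K(1) by (intro mult_mono) (auto simp: dist_norm)
      then show ?thesis using K(1) by (simp add: mult.commute)
    qed
    then show "\<exists>d>0. \<forall>y\<in>UNIV. norm (y - x) < d \<longrightarrow>
        norm (f y *\<^sub>R (g y - g x) - f x *\<^sub>R (g x - g x) - 0) \<le> e * norm (y - x)"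
      using d(1) d'(1) by (intro exI[of _ "min d d'"]) simp
  qed
  from has_derivative_add[OF this has_derivative_scaleR_left[OF f(1), of "g x"]]
  show ?thesis by (simp add: scaleR_diff_right)
qed

text \<open>The solution of \<open>L p y = w\<close> equals the solution at \<open>p0\<close> plus
  the inverse of \<open>L p\<close> applied to the residual of the latter. The residual vanishes at
  \<open>p0\<close>, so continuity of the inverse is enough to differentiate the product. The
  resulting formula for the derivative contains only the inverse and first derivatives of
  \<open>L\<close>, which closes the induction.\<close>

lemma k_smooth_on_inv_linear:
  fixes L :: "'p::real_normed_vector => 'f::real_normed_vector => 'f"
  assumes fd: "finite_dim TYPE('f)" and S: "open S"
    and lin: "!!p. p \<in> S ==> linear (L p)" and inj: "!!p. p \<in> S ==> inj (L p)"
    and smooth: "!!v. k_smooth_on k S (%p. L p v)"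
  shows "k_smooth_on k S (%p. inv (L p) w)"
proof -
  note B = basis[OF fd]
  have bij: "bij (L p)" if "p \<in> S" for p using linear_inj_imp_bij_finite_dim[OF fd lin inj] that by blast
  have lininv: "linear (inv (L p))" if "p \<in> S" for p by (rule linear_inv_of_bij[OF lin[OF that] bij[OF that]])
  have LL: "L p (inv (L p) x) = x" if "p \<in> S" for p x
    using bij[OF that] by (simp add: bij_is_surj surj_f_inv_f)
  have bound: "\<exists>m>0. \<exists>W. open W \<and> p0 \<in> W \<and> W \<subseteq> S \<and> (\<forall>p\<in>W. \<forall>v. m * norm v \<le> norm (L p v))"
    if "p0 \<in> S" for p0 using injective_linear_lower_bound[OF fd S that, of L] lin inj that
      k_smooth_on_imp_continuous_on[OF smooth] by metis
  have expand: "A v = (\<Sum>b\<in>basis. coord b v *\<^sub>R A b)" if "linear A" for A :: "'f => 'f" and v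
    by (subst B(3)[of v]) (simp add: linear_sum[OF that] linear_cmul[OF that])
  show ?thesis using smooth
  proof (induction k arbitrary: w)
    \<comment> \<open>\<open>L p\<close> maps the difference of the two solutions to the change of
      \<open>L\<close> at the fixed vector \<open>?y\<close>; the lower bound \<open>m\<close> then
      controls that difference.\<close>
    case 0
    have "isCont (%p. inv (L p) w) p0" if p0: "p0 \<in> S" for p0
    proof -
      obtain m W where m: "m > 0" "open W" "p0 \<in> W" "W \<subseteq> S"
        "!!p v. p \<in> W ==> m * norm v \<le> norm (L p v)" using bound[OF p0] by blast
      let ?y = "inv (L p0) w"
      have est: "norm (inv (L p) w - ?y) \<le> norm (L p0 ?y - L p ?y) / m" if "p \<in> W" for p
      proof -
        have "p \<in> S" using that m by blast
        have "L p (inv (L p) w - ?y) = L p0 ?y - L p ?y"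
          using LL[OF \<open>p \<in> S\<close>] LL[OF p0] linear_diff[OF lin[OF \<open>p \<in> S\<close>]] by simp
        then have "m * norm (inv (L p) w - ?y) \<le> norm (L p0 ?y - L p ?y)"
          using m(5)[OF that, of "inv (L p) w - ?y"] by simp
        then show ?thesis using m(1) by (simp add: pos_le_divide_eq mult.commute)
      qed
      have "((%p. norm (L p0 ?y - L p ?y) / m) \<longlongrightarrow> norm (L p0 ?y - L p0 ?y) / m) (at p0)"
        using 0[of ?y] p0 S m(1)
        by (intro tendsto_intros) (auto simp: continuous_on_eq_continuous_at isCont_def)
      then have lim: "((%p. norm (L p0 ?y - L p ?y) / m) \<longlongrightarrow> 0) (at p0)" by simp
      have ev: "\<forall>\<^sub>F p in at p0. p \<in> W" using m(2,3) eventually_at_topological by blast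
      have "((%p. inv (L p) w - ?y) \<longlongrightarrow> 0) (at p0)"
        by (rule Lim_null_comparison[OF eventually_mono[OF ev est] lim])
      then show ?thesis by (simp add: isCont_def LIM_zero_iff)
    qed
    then show ?case by (simp add: continuous_at_imp_continuous_on)
  next
    case (Suc k)
    let ?y = "%p. inv (L p) w"
    let ?D = "%p h. \<Sum>b\<in>basis. coord b (- (\<Sum>c\<in>basis. coord c (?y p) *\<^sub>R frechet_derivative (%q. L q c) (at p) h)) *\<^sub>R inv (L p) b"
    have IH: "k_smooth_on k S (%p. inv (L p) c)" for c by (rule Suc.IH[OF k_smooth_on_Suc_imp[OF Suc.prems]])
    have der: "(?y has_derivative ?D p0) (at p0)" if p0: "p0 \<in> S" for p0
    proof (rule has_derivative_transform_within_open[OF _ S p0])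
      \<comment> \<open>The residual \<open>w - L p (?y p0)\<close>, expanded over the basis so that
        its derivative only involves the given smooth functions \<open>L p c\<close>.\<close>
      let ?r = "%p. w - (\<Sum>c\<in>basis. coord c (?y p0) *\<^sub>R L p c)"
      have r: "?r p = w - L p (?y p0)" if "p \<in> S" for p by (subst expand[OF lin[OF that]]) (rule refl)
      have "(?r has_derivative (%h. 0 - (\<Sum>c\<in>basis. coord c (?y p0) *\<^sub>R frechet_derivative (%q. L q c) (at p0) h))) (at p0)"
        by (intro has_derivative_diff has_derivative_const has_derivative_sum has_derivative_scaleR_right
            k_smooth_on_SucD(1)[OF Suc.prems p0])
      then have d: "((%p. coord b (?r p) *\<^sub>R inv (L p) b) has_derivative (%h. coord b (0 -
          (\<Sum>c\<in>basis. coord c (?y p0) *\<^sub>R frechet_derivative (%q. L q c) (at p0) h)) *\<^sub>R inv (L p0) b)) (at p0)" for b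
        using k_smooth_on_imp_continuous_on[OF IH] S p0 r[OF p0] LL[OF p0] linear_simps(3)[OF B(2)]
        by (intro has_derivative_scaleR_vanishing bounded_linear.has_derivative[OF B(2)])
          (auto simp: continuous_on_eq_continuous_at)
      show "((%p. ?y p0 + (\<Sum>b\<in>basis. coord b (?r p) *\<^sub>R inv (L p) b)) has_derivative ?D p0) (at p0)"
        using has_derivative_add[OF has_derivative_const[of "?y p0"] has_derivative_sum[of basis, OF d]] by simp
      fix p assume p: "p \<in> S"
      have "(\<Sum>b\<in>basis. coord b (?r p) *\<^sub>R inv (L p) b) = inv (L p) (?r p)"
        by (rule expand[OF lininv[OF p], symmetric])
      also have "\<dots> = ?y p - ?y p0"
        unfolding r[OF p] using inv_f_f[OF inj[OF p]] by (simp add: linear_diff[OF lininv[OF p]])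
      finally show "?y p0 + (\<Sum>b\<in>basis. coord b (?r p) *\<^sub>R inv (L p) b) = ?y p" by simp
    qed
    show ?case by (rule k_smooth_on_SucI[OF S der], assumption)
        (intro k_smooth_on_minus k_smooth_on_sum k_smooth_on_scaleR S IH
          k_smooth_on_bounded_linear_compose[OF B(2)] k_smooth_on_SucD(2)[OF Suc.prems])
  qed
qed

subsection \<open>Symmetry of second derivatives\<close>

text \<open>Two applications of the mean value theorem: one in the direction \<open>u\<close> to the
  difference of \<open>f\<close> along \<open>v\<close>, and one in the direction \<open>v\<close>
  to the derivative along \<open>u\<close>. The square of side \<open>s\<close> is all that has to
  lie in \<open>S\<close>.\<close>

lemma second_difference_quotient:
  fixes f :: "'a::real_normed_vector => real"
  assumes f: "k_smooth_on (Suc (Suc k)) S f"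
    and s: "s > 0" "!!\<sigma> \<tau>. 0 \<le> \<sigma> ==> \<sigma> \<le> s ==> 0 \<le> \<tau> ==> \<tau> \<le> s ==> x + \<sigma> *\<^sub>R u + \<tau> *\<^sub>R v \<in> S"
  obtains \<sigma> \<tau> where "0 \<le> \<sigma>" "\<sigma> \<le> s" "0 \<le> \<tau>" "\<tau> \<le> s"
    "f (x + s *\<^sub>R u + s *\<^sub>R v) - f (x + s *\<^sub>R u) - f (x + s *\<^sub>R v) + f x =
      s * s * frechet_derivative (%y. frechet_derivative f (at y) u) (at (x + \<sigma> *\<^sub>R u + \<tau> *\<^sub>R v)) v"
proof -
  let ?f' = "%y. frechet_derivative f (at y)"
  let ?f'' = "%y. frechet_derivative (%y. ?f' y u) (at y)"
  have d1: "(f has_derivative ?f' y) (at y)" if "y \<in> S" for y by (rule k_smooth_on_SucD(1)[OF f that])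
  have d2: "((%y. ?f' y u) has_derivative ?f'' y) (at y)" if "y \<in> S" for y
    by (rule k_smooth_on_SucD(1)[OF k_smooth_on_SucD(2)[OF f] that])
  have line1: "((%\<sigma>. f (x + \<sigma> *\<^sub>R u + c *\<^sub>R v)) has_real_derivative ?f' (x + \<sigma> *\<^sub>R u + c *\<^sub>R v) u) (at \<sigma>)"
    if "x + \<sigma> *\<^sub>R u + c *\<^sub>R v \<in> S" for \<sigma> c
  proof -
    have "((%\<sigma>. x + \<sigma> *\<^sub>R u + c *\<^sub>R v) has_derivative (%h. h *\<^sub>R u)) (at \<sigma>)"
      by (auto intro!: derivative_eq_intros)
    from has_derivative_compose[OF this d1[OF that]]
    show ?thesis using linear_cmul[OF has_derivative_linear[OF d1[OF that]]]
      by (simp add: has_field_derivative_def mult_commute_abs)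
  qed
  have line2: "((%\<tau>. ?f' (x + c *\<^sub>R u + \<tau> *\<^sub>R v) u) has_real_derivative ?f'' (x + c *\<^sub>R u + \<tau> *\<^sub>R v) v) (at \<tau>)"
    if "x + c *\<^sub>R u + \<tau> *\<^sub>R v \<in> S" for \<tau> c
  proof -
    have "((%\<tau>. x + c *\<^sub>R u + \<tau> *\<^sub>R v) has_derivative (%h. h *\<^sub>R v)) (at \<tau>)"
      by (auto intro!: derivative_eq_intros)
    from has_derivative_compose[OF this d2[OF that]]
    show ?thesis using linear_cmul[OF has_derivative_linear[OF d2[OF that]]]
      by (simp add: has_field_derivative_def mult_commute_abs)
  qed
  let ?g = "%\<sigma>. f (x + \<sigma> *\<^sub>R u + s *\<^sub>R v) - f (x + \<sigma> *\<^sub>R u + 0 *\<^sub>R v)"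
  have "(?g has_real_derivative ?f' (x + \<sigma> *\<^sub>R u + s *\<^sub>R v) u - ?f' (x + \<sigma> *\<^sub>R u + 0 *\<^sub>R v) u) (at \<sigma>)"
    if "0 \<le> \<sigma>" "\<sigma> \<le> s" for \<sigma> by (intro DERIV_diff line1 s(2) that) (use s in auto)
  from MVT2[OF s(1) this] obtain \<sigma> where \<sigma>: "0 < \<sigma>" "\<sigma> < s"
    "?g s - ?g 0 = (s - 0) * (?f' (x + \<sigma> *\<^sub>R u + s *\<^sub>R v) u - ?f' (x + \<sigma> *\<^sub>R u + 0 *\<^sub>R v) u)" by auto
  have "((%\<tau>. ?f' (x + \<sigma> *\<^sub>R u + \<tau> *\<^sub>R v) u) has_real_derivative ?f'' (x + \<sigma> *\<^sub>R u + \<tau> *\<^sub>R v) v) (at \<tau>)"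
    if "0 \<le> \<tau>" "\<tau> \<le> s" for \<tau> by (intro line2 s(2) that) (use \<sigma> in auto)
  from MVT2[OF s(1) this] obtain \<tau> where \<tau>: "0 < \<tau>" "\<tau> < s"
    "?f' (x + \<sigma> *\<^sub>R u + s *\<^sub>R v) u - ?f' (x + \<sigma> *\<^sub>R u + 0 *\<^sub>R v) u = (s - 0) * ?f'' (x + \<sigma> *\<^sub>R u + \<tau> *\<^sub>R v) v"
    by auto
  show ?thesis by (rule that[of \<sigma> \<tau>]) (use \<sigma>(1,2) \<tau>(1,2) \<sigma>(3)[unfolded \<tau>(3)] in \<open>auto simp: algebra_simps\<close>)
qed

text \<open>The second difference is symmetric in \<open>u\<close> and \<open>v\<close>, and it
  represents each of the two mixed derivatives at some point near \<open>x\<close>. Continuity of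
  the mixed derivatives at \<open>x\<close> does the rest.\<close>

lemma second_derivative_symmetric:
  fixes f :: "'a::real_normed_vector => real"
  assumes S: "open S" "x \<in> S" and f: "k_smooth_on (Suc (Suc 0)) S f"
  shows "frechet_derivative (%y. frechet_derivative f (at y) u) (at x) v =
    frechet_derivative (%y. frechet_derivative f (at y) v) (at x) u"
proof (rule ccontr)
  let ?D = "%u v y. frechet_derivative (%y. frechet_derivative f (at y) u) (at y) v"
  assume ne: "?D u v x \<noteq> ?D v u x"
  \<comment> \<open>Half of the gap: a number cannot be closer than \<open>e\<close> to both
    sides.\<close>
  define e where "e = \<bar>?D u v x - ?D v u x\<bar> / 2"
  have e: "e > 0" using ne by (simp add: e_def)
  have cont: "isCont (?D u v) x" for u v using k_smooth_on_SucD(2)[OF k_smooth_on_SucD(2)[OF f]] S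
    by (simp add: continuous_on_eq_continuous_at)
  have "\<forall>\<^sub>F y in nhds x. dist (?D u v y) (?D u v x) < e \<and> dist (?D v u y) (?D v u x) < e \<and> y \<in> S"
    using tendstoD[OF cont[of u v, unfolded isCont_def, THEN tendsto_at_iff_tendsto_nhds[THEN iffD1]] e]
      tendstoD[OF cont[of v u, unfolded isCont_def, THEN tendsto_at_iff_tendsto_nhds[THEN iffD1]] e]
      eventually_nhds_in_open[OF S] by (intro eventually_conj)
  then obtain d where d: "d > 0"
    "!!y. dist y x < d ==> dist (?D u v y) (?D u v x) < e \<and> dist (?D v u y) (?D v u x) < e \<and> y \<in> S"
    unfolding eventually_nhds_metric by blast
  define N where "N = norm u + norm v + 1"
  \<comment> \<open>Every point of the square of side \<open>s\<close> is then within
    \<open>d / 2\<close> of \<open>x\<close>; the summand 1 in \<open>N\<close> covers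
    \<open>u = v = 0\<close>.\<close>
  define s where "s = d / (2 * N)"
  have pos: "N > 0" by (simp add: N_def add_nonneg_pos)
  then have s: "s > 0" using d by (simp add: s_def)
  have near: "dist (x + \<sigma> *\<^sub>R u + \<tau> *\<^sub>R v) x < d" "dist (x + \<sigma> *\<^sub>R v + \<tau> *\<^sub>R u) x < d"
    if "0 \<le> \<sigma>" "\<sigma> \<le> s" "0 \<le> \<tau>" "\<tau> \<le> s" for \<sigma> \<tau>
  proof -
    have b: "norm (a *\<^sub>R u + c *\<^sub>R v) < d" if "0 \<le> a" "a \<le> s" "0 \<le> c" "c \<le> s" for a c
    proof -
      have "norm (a *\<^sub>R u + c *\<^sub>R v) \<le> s * norm u + s * norm v"
        by (rule order_trans[OF norm_triangle_ineq]) (use that in \<open>auto intro!: add_mono mult_right_mono\<close>)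
      also have "\<dots> \<le> s * N" using s by (simp add: N_def algebra_simps)
      also have "\<dots> = d / 2" using pos by (simp add: s_def)
      also have "\<dots> < d" using d by simp
      finally show ?thesis .
    qed
    show "dist (x + \<sigma> *\<^sub>R u + \<tau> *\<^sub>R v) x < d" "dist (x + \<sigma> *\<^sub>R v + \<tau> *\<^sub>R u) x < d"
      using b[OF that] b[OF that(3,4,1,2)] by (simp_all add: dist_norm add.commute add.left_commute algebra_simps)
  qed
  obtain \<sigma> \<tau> where 1: "0 \<le> \<sigma>" "\<sigma> \<le> s" "0 \<le> \<tau>" "\<tau> \<le> s"
    "f (x + s *\<^sub>R u + s *\<^sub>R v) - f (x + s *\<^sub>R u) - f (x + s *\<^sub>R v) + f x = s * s * ?D u v (x + \<sigma> *\<^sub>R u + \<tau> *\<^sub>R v)"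
    using second_difference_quotient[OF f s, of x u v] d(2)[OF near(1)] by metis
  obtain \<sigma>' \<tau>' where 2: "0 \<le> \<sigma>'" "\<sigma>' \<le> s" "0 \<le> \<tau>'" "\<tau>' \<le> s"
    "f (x + s *\<^sub>R v + s *\<^sub>R u) - f (x + s *\<^sub>R v) - f (x + s *\<^sub>R u) + f x = s * s * ?D v u (x + \<sigma>' *\<^sub>R v + \<tau>' *\<^sub>R u)"
    using second_difference_quotient[OF f s, of x v u] d(2)[OF near(2)] by metis
  have "s * s * ?D u v (x + \<sigma> *\<^sub>R u + \<tau> *\<^sub>R v) = s * s * ?D v u (x + \<sigma>' *\<^sub>R v + \<tau>' *\<^sub>R u)"
    using 1(5) 2(5) by (simp add: algebra_simps)
  then have "?D u v (x + \<sigma> *\<^sub>R u + \<tau> *\<^sub>R v) = ?D v u (x + \<sigma>' *\<^sub>R v + \<tau>' *\<^sub>R u)" using s by simp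
  moreover have "dist (?D u v (x + \<sigma> *\<^sub>R u + \<tau> *\<^sub>R v)) (?D u v x) < e"
    using d(2)[OF near(1)[OF 1(1-4)]] by blast
  moreover have "dist (?D v u (x + \<sigma>' *\<^sub>R v + \<tau>' *\<^sub>R u)) (?D v u x) < e"
    using d(2)[OF near(2)[OF 2(1-4)]] by blast
  ultimately show False unfolding e_def dist_real_def by (simp add: abs_if field_simps split: if_splits)
qed

subsection \<open>Smoothness on arbitrary sets\<close>

lemma smooth_onD:
  assumes "smooth_on S f" "x \<in> S"
  obtains W g where "open W" "x \<in> W" "C_inf_on W g" "!!y. y \<in> S ==> y \<in> W ==> f y = g y"
  using assms unfolding smooth_on_def by (metis IntI)

lemma smooth_on_open: "open S ==> smooth_on S f \<longleftrightarrow> C_inf_on S f"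
proof
  assume S: "open S" and f: "smooth_on S f"
  show "C_inf_on S f"
  proof (rule C_inf_on_local[OF S])
    fix x assume x: "x \<in> S"
    obtain W g where W: "open W" "x \<in> W" "C_inf_on W g" "!!y. y \<in> S ==> y \<in> W ==> f y = g y"
      by (rule smooth_onD[OF f x]) blast
    have "C_inf_on (S \<inter> W) f"
      using k_smooth_on_cong[of "S \<inter> W" f g] W S k_smooth_on_subset[of _ W g "S \<inter> W"] by auto
    then show "\<exists>W. open W \<and> x \<in> W \<and> C_inf_on W f" using S W x by blast
  qed
next
  assume "open S" "C_inf_on S f"
  then show "smooth_on S f" unfolding smooth_on_def by blast
qed

lemma smooth_on_subset:
  assumes "smooth_on S f" "T \<subseteq> S" shows "smooth_on T f" unfolding smooth_on_def
proof
  fix x assume "x \<in> T"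
  then have "x \<in> S" using assms(2) by blast
  from smooth_onD[OF assms(1) this] obtain W g where
    W: "open W" "x \<in> W" "C_inf_on W g" "!!y. y \<in> S ==> y \<in> W ==> f y = g y" by blast
  show "\<exists>W g. open W \<and> x \<in> W \<and> C_inf_on W g \<and> (\<forall>y\<in>T \<inter> W. f y = g y)"
    by (rule exI[of _ W], rule exI[of _ g]) (use W assms(2) in auto)
qed

lemma smooth_on_cong: "smooth_on S f ==> (!!x. x \<in> S ==> f x = g x) ==> smooth_on S g"
  unfolding smooth_on_def by (metis IntD1)

lemma smooth_on_local:
  assumes "!!x. x \<in> S ==> \<exists>W. open W \<and> x \<in> W \<and> smooth_on (S \<inter> W) f"
  shows "smooth_on S f" unfolding smooth_on_def
proof
  fix x assume x: "x \<in> S"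
  obtain W where W: "open W" "x \<in> W" "smooth_on (S \<inter> W) f" using assms[OF x] by blast
  obtain V g where V: "open V" "x \<in> V" "C_inf_on V g" "!!y. y \<in> S \<inter> W ==> y \<in> V ==> f y = g y"
    by (rule smooth_onD[OF W(3)]) (use x W in blast)+
  show "\<exists>W g. open W \<and> x \<in> W \<and> C_inf_on W g \<and> (\<forall>y\<in>S \<inter> W. f y = g y)"
    by (rule exI[of _ "W \<inter> V"], rule exI[of _ g])
      (use V W k_smooth_on_subset[of _ V g "W \<inter> V"] in auto)
qed

lemma smooth_on_imp_continuous_on:
  assumes "smooth_on S f" shows "continuous_on S f" unfolding continuous_on_eq_continuous_within
proof
  fix x assume x: "x \<in> S"
  obtain W g where W: "open W" "x \<in> W" "C_inf_on W g" "!!y. y \<in> S ==> y \<in> W ==> f y = g y"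
    by (rule smooth_onD[OF assms x]) blast
  have "continuous_on W g" using W(3) k_smooth_on_imp_continuous_on by blast
  then have "isCont g x" using W by (simp add: continuous_on_eq_continuous_at)
  then have "continuous (at x within S) g" by (rule continuous_at_imp_continuous_at_within)
  moreover have "\<forall>\<^sub>F y in at x within S. g y = f y"
    unfolding eventually_at_topological using W by (intro exI[of _ W]) auto
  moreover have "g x = f x" using W x by simp
  ultimately show "continuous (at x within S) f"
    unfolding continuous_within by (metis Lim_transform_eventually)
qed

text \<open>Transfers a closure property from open sets to arbitrary sets: the local smooth
  extensions of \<open>f\<close> and \<open>g\<close> are combined on the intersection of their
  domains.\<close>

lemma smooth_on_combine:
  fixes f :: "'a::real_normed_vector => 'b::real_normed_vector"
    and g :: "'a => 'c::real_normed_vector" and h :: "'b => 'c => 'd::real_normed_vector"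
  assumes "smooth_on S f" "smooth_on S g"
    and H: "!!(W :: 'a set) f g. open W ==> C_inf_on W f ==> C_inf_on W g ==> C_inf_on W (%x. h (f x) (g x))"
  shows "smooth_on S (%x. h (f x) (g x))" unfolding smooth_on_def
proof
  fix x assume x: "x \<in> S"
  obtain V f' where V: "open V" "x \<in> V" "C_inf_on V f'" "!!y. y \<in> S ==> y \<in> V ==> f y = f' y"
    by (rule smooth_onD[OF assms(1) x]) blast
  obtain W g' where W: "open W" "x \<in> W" "C_inf_on W g'" "!!y. y \<in> S ==> y \<in> W ==> g y = g' y"
    by (rule smooth_onD[OF assms(2) x]) blast
  have "C_inf_on (V \<inter> W) (%x. h (f' x) (g' x))"
    by (rule H) (use V W k_smooth_on_subset[of _ V f'] k_smooth_on_subset[of _ W g'] in auto)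
  then show "\<exists>W k. open W \<and> x \<in> W \<and> C_inf_on W k \<and> (\<forall>y\<in>S \<inter> W. h (f y) (g y) = k y)"
    by (intro exI[of _ "V \<inter> W"] exI[of _ "%x. h (f' x) (g' x)"]) (use V W in auto)
qed

lemma smooth_on_const: "smooth_on S (%x. c)"
  unfolding smooth_on_def by (intro ballI exI[of _ UNIV] exI[of _ "%x. c"]) auto

lemma smooth_on_add: "smooth_on S f ==> smooth_on S g ==> smooth_on S (%x. f x + g x)"
  by (rule smooth_on_combine) (auto intro: k_smooth_on_add)

lemma smooth_on_diff: "smooth_on S f ==> smooth_on S g ==> smooth_on S (%x. f x - g x)"
  by (rule smooth_on_combine) (auto intro: k_smooth_on_diff)

lemma smooth_on_scaleR: "smooth_on S f ==> smooth_on S g ==> smooth_on S (%x. f x *\<^sub>R g x)"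
  by (rule smooth_on_combine) (auto intro: k_smooth_on_scaleR)

lemma smooth_on_mult:
  fixes f g :: "'a::real_normed_vector => real"
  shows "smooth_on S f ==> smooth_on S g ==> smooth_on S (%x. f x * g x)" using smooth_on_scaleR[of S f g] by simp

lemma smooth_on_Pair: "smooth_on S f ==> smooth_on S g ==> smooth_on S (%x. (f x, g x))"
  by (rule smooth_on_combine) (auto intro: k_smooth_on_Pair)

lemma smooth_on_minus: "smooth_on S f ==> smooth_on S (%x. - f x)"
  using smooth_on_diff[OF smooth_on_const[of S 0], of f] by simp

lemma smooth_on_sum:
  "(!!i. i \<in> I ==> smooth_on S (f i)) ==> smooth_on S (%x. \<Sum>i\<in>I. f i x)"
  by (induction I rule: infinite_finite_induct) (auto intro: smooth_on_add smooth_on_const)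

lemma smooth_on_bounded_linear_compose:
  assumes "bounded_linear h" "smooth_on S f" shows "smooth_on S (%x. h (f x))"
  using smooth_on_combine[OF assms(2,2), of "%a b. h a"] k_smooth_on_bounded_linear_compose[OF assms(1)]
  by blast

lemma smooth_on_compose:
  fixes f :: "'b::real_normed_vector => 'c::real_normed_vector"
  assumes fd: "finite_dim TYPE('b)" and f: "smooth_on T f" and g: "smooth_on S g"
    and ST: "!!x. x \<in> S ==> g x \<in> T"
  shows "smooth_on S (%x. f (g x))" unfolding smooth_on_def
proof
  fix x assume x: "x \<in> S"
  obtain W g' where W: "open W" "x \<in> W" "C_inf_on W g'" "!!y. y \<in> S ==> y \<in> W ==> g y = g' y"
    by (rule smooth_onD[OF g x]) blast
  obtain V f' where V: "open V" "g x \<in> V" "C_inf_on V f'" "!!y. y \<in> T ==> y \<in> V ==> f y = f' y"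
    by (rule smooth_onD[OF f ST[OF x]]) blast
  have "continuous_on W g'" using W(3) k_smooth_on_imp_continuous_on by blast
  then have o: "open (g' -` V \<inter> W)" by (rule open_vimage_Int) (use V W in auto)
  have "C_inf_on (g' -` V \<inter> W) (%x. f' (g' x))"
  proof
    fix k
    show "k_smooth_on k (g' -` V \<inter> W) (%x. f' (g' x))"
    proof (rule k_smooth_on_compose[OF fd o V(1)])
      show "k_smooth_on k V f'" using V(3) by (rule spec)
      show "k_smooth_on k (g' -` V \<inter> W) g'" by (rule k_smooth_on_subset[OF spec[OF W(3)]]) simp
    qed auto
  qed
  moreover have "f (g y) = f' (g' y)" if "y \<in> S" "y \<in> W" "g' y \<in> V" for y
    using W(4)[OF that(1,2)] V(4)[OF ST[OF that(1)]] that(3) by simp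
  moreover have "g' x \<in> V" using W(4)[OF x W(2)] V(2) by simp
  ultimately show "\<exists>W k. open W \<and> x \<in> W \<and> C_inf_on W k \<and> (\<forall>y\<in>S \<inter> W. f (g y) = k y)"
    by (intro exI[of _ "g' -` V \<inter> W"] exI[of _ "%x. f' (g' x)"]) (use o W(2) in auto)
qed

lemma smooth_on_id: "smooth_on S (%x. x)"
  by (rule smooth_on_subset[of UNIV]) (auto simp: smooth_on_open k_smooth_on_id)

lemma smooth_on_bounded_linear: "bounded_linear h ==> smooth_on S h"
  using smooth_on_bounded_linear_compose[OF _ smooth_on_id] by blast

subsection \<open>Ordinary differential equations: existence and estimates\<close>

lemma antiderivative_exists:
  fixes g :: "real => 'a::banach"
  assumes "continuous_on UNIV g"
  obtains G where "G 0 = 0" "!!t. (G has_vector_derivative g t) (at t)"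
proof -
  \<comment> \<open>One of the two integrals always runs over an empty interval or a single point
    and is 0; the difference is the integral from 0 to \<open>t\<close> with its sign.\<close>
  define G where "G = (%t. integral {0..t} g - integral {t..0} g)"
  have int: "g integrable_on {a..b}" for a b
    by (rule integrable_continuous_real) (use assms continuous_on_subset in blast)
  have "(G has_vector_derivative g t) (at t)" for t
  proof -
    \<comment> \<open>The interval reaches beyond 0 and beyond \<open>t\<close>, so \<open>t\<close>
      is interior to it and the derivative within the interval is a full one.\<close>
    define a b where "a = - \<bar>t\<bar> - 1" and "b = \<bar>t\<bar> + 1"
    have eq: "G s = integral {a..s} g - integral {a..0} g" if "s \<in> {a..b}" for s
    proof (cases "s \<ge> 0")
      case True
      have "integral {s..0} g = 0" using True by (cases "s = 0") auto
      moreover have "integral {a..0} g + integral {0..s} g = integral {a..s} g"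
        by (rule Henstock_Kurzweil_Integration.integral_combine[OF _ _ int]) (use True that in \<open>auto simp: a_def\<close>)
      ultimately show ?thesis by (simp add: G_def algebra_simps)
    next
      case False
      have "integral {0..s} g = 0" using False by auto
      moreover have "integral {a..s} g + integral {s..0} g = integral {a..0} g"
        by (rule Henstock_Kurzweil_Integration.integral_combine[OF _ _ int]) (use False that in auto)
      ultimately show ?thesis by (simp add: G_def algebra_simps)
    qed
    have "((%s. integral {a..s} g - integral {a..0} g) has_vector_derivative g t - 0) (at t within {a..b})"
      by (intro has_vector_derivative_diff has_vector_derivative_const integral_has_vector_derivative)
        (use assms continuous_on_subset in \<open>auto simp: a_def b_def\<close>)
    then have "(G has_vector_derivative g t - 0) (at t within {a..b})"
      by (intro has_vector_derivative_transform[OF _ eq]) (auto simp: a_def b_def)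
    then have "(G has_vector_derivative g t) (at t within {a..b})" by simp
    moreover have "t \<in> interior {a..b}" by (auto simp: a_def b_def)
    ultimately show ?thesis using at_within_interior[of t "{a..b}"] by metis
  qed
  moreover have "G 0 = 0" by (simp add: G_def)
  ultimately show ?thesis using that by blast
qed

lemma has_vector_derivative_reflect:
  assumes "!!t. (u has_vector_derivative d t) (at t)"
  shows "((%t. u (- t)) has_vector_derivative - d (- t)) (at t)"
proof -
  have "((%t. - t) has_real_derivative - 1) (at t)" by (auto intro!: derivative_eq_intros)
  from vector_diff_chain_at[OF this[unfolded has_real_derivative_iff_has_vector_derivative] assms]
  show ?thesis by (simp add: o_def)
qed

text \<open>Integrates the bound \<open>K * \<bar>s\<bar> ^ n\<close> once; iterated, this yields
  the factorials of the Picard estimate. Negative times are reduced to positive ones by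
  reflection.\<close>

lemma vector_derivative_power_bound:
  fixes G :: "real => 'a::real_normed_vector"
  assumes "G 0 = 0" "!!t. (G has_vector_derivative g t) (at t)"
    "!!s. \<bar>s\<bar> \<le> T ==> norm (g s) \<le> K * \<bar>s\<bar> ^ n" "\<bar>t\<bar> \<le> T"
  shows "norm (G t) \<le> K * \<bar>t\<bar> ^ Suc n / real (Suc n)"
proof -
  have pos: "norm (G t) \<le> K * t ^ Suc n / real (Suc n)"
    if G: "G 0 = 0" "!!t. (G has_vector_derivative g t) (at t)"
      and b: "!!s. \<bar>s\<bar> \<le> T ==> norm (g s) \<le> K * \<bar>s\<bar> ^ n" and t: "0 < t" "t \<le> T"
    for G g :: "real => 'a" and t
  proof -
    have "norm (G t - G 0) \<le> K * t ^ Suc n / real (Suc n) - K * 0 ^ Suc n / real (Suc n)"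
    proof (rule differentiable_bound_general[OF t(1), where f' = g and \<phi>' = "%s. K * s ^ n"])
      show "continuous_on {0..t} G"
        using G(2) by (intro continuous_at_imp_continuous_on ballI has_vector_derivative_continuous) auto
      show "continuous_on {0..t} (%s. K * s ^ Suc n / real (Suc n))" by (intro continuous_intros) auto
      show "((%s. K * s ^ Suc n / real (Suc n)) has_vector_derivative K * s ^ n) (at s)" for s
        unfolding has_real_derivative_iff_has_vector_derivative[symmetric]
        by (auto intro!: derivative_eq_intros simp del: of_nat_Suc power_Suc)
      show "norm (g s) \<le> K * s ^ n" if "0 < s" "s < t" for s using b[of s] that t by simp
    qed (rule G(2))
    then show ?thesis using G(1) by simp
  qed
  consider "t = 0" | "t > 0" | "t < 0" by linarith
  then show ?thesis
  proof cases
    case 2 then show ?thesis using pos[OF assms(1-3), of t] assms(4) by simp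
  next
    case 3
    have "norm (G (- (- t))) \<le> K * (- t) ^ Suc n / real (Suc n)"
      by (rule pos[where G = "%t. G (- t)" and g = "%t. - g (- t)"])
        (use assms(1,4) assms(3)[of "- _"] has_vector_derivative_reflect[OF assms(2)] 3 in auto)
    then show ?thesis using 3 by simp
  qed (use assms(1) in simp)
qed

text \<open>The norm of \<open>u\<close> need not be differentiable, so it is compared with
  \<open>p\<close>, the initial norm plus the integral of the assumed bound. This majorant is
  differentiable and satisfies the scalar inequality \<open>p' \<le> L * p + e\<close>.\<close>

lemma gronwall:
  fixes u :: "real => 'a::real_normed_vector"
  assumes u: "!!t. (u has_vector_derivative d t) (at t)"
    and d: "!!t. \<bar>t\<bar> \<le> T ==> norm (d t) \<le> L * norm (u t) + e"
    and e: "e \<ge> 0" and L: "L \<ge> 0" and t: "\<bar>t\<bar> \<le> T"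
  shows "norm (u t) \<le> (norm (u 0) + e * T) * exp (L * T)"
proof -
  have T: "T \<ge> 0" using t by simp
  have pos: "norm (u t) \<le> (norm (u 0) + e * T) * exp (L * T)"
    if u: "!!t. (u has_vector_derivative d t) (at t)"
      and d: "!!t. \<bar>t\<bar> \<le> T ==> norm (d t) \<le> L * norm (u t) + e" and t: "0 < t" "t \<le> T"
    for u d :: "real => 'a" and t
  proof -
    have cu: "continuous_on S u" for S
      using u by (intro continuous_at_imp_continuous_on ballI has_vector_derivative_continuous) auto
    have "continuous_on UNIV (%t. L * norm (u t) + e)" by (intro continuous_intros cu)
    then obtain I where I: "I 0 = 0" "!!t. (I has_vector_derivative L * norm (u t) + e) (at t)"
      using antiderivative_exists by blast
    have I': "(I has_real_derivative L * norm (u t) + e) (at t)" for t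
      using I(2) by (simp add: has_real_derivative_iff_has_vector_derivative)
    define p where "p = (%t. norm (u 0) + I t)"
    have p': "(p has_real_derivative L * norm (u t) + e) (at t)" for t
      unfolding p_def by (auto intro!: derivative_eq_intros I')
    have up: "norm (u s) \<le> p s" if "0 \<le> s" "s \<le> t" for s
    proof (cases "s = 0")
      case False
      then have s: "0 < s" using that by simp
      have "norm (u s - u 0) \<le> p s - p 0"
        by (rule differentiable_bound_general[OF s cu _ u, where \<phi>' = "%t. L * norm (u t) + e"])
          (use that t d p' in \<open>auto simp: has_real_derivative_iff_has_vector_derivative[symmetric]
            intro!: continuous_at_imp_continuous_on DERIV_isCont\<close>)
      then show ?thesis using norm_triangle_sub[of "u s" "u 0"] I(1) by (simp add: p_def)
    qed (simp add: p_def I)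
    \<comment> \<open>The integrating factor turns the inequality for \<open>p\<close> into
      monotonicity of \<open>q\<close>; the term \<open>e * s\<close> absorbs the inhomogeneity, as
      \<open>exp (- L * s) \<le> 1\<close> for \<open>s \<ge> 0\<close>.\<close>
    define q where "q = (%s. p s * exp (- L * s) - e * s)"
    have q': "(q has_real_derivative (L * norm (u s) + e - L * p s) * exp (- L * s) - e) (at s)" for s
      unfolding q_def by (auto intro!: derivative_eq_intros p' simp: algebra_simps)
    have "q t \<le> q 0"
    proof (rule DERIV_nonpos_imp_nonincreasing[of 0 t])
      fix s assume s: "0 \<le> s" "s \<le> t"
      have "L * norm (u s) \<le> L * p s" using up[OF s] L by (rule mult_left_mono)
      then have "(L * norm (u s) + e - L * p s) * exp (- L * s) \<le> e * exp (- L * s)"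
        by (intro mult_right_mono) auto
      also have "\<dots> \<le> e * 1" using e L s by (intro mult_left_mono) auto
      finally show "\<exists>y. (q has_real_derivative y) (at s) \<and> y \<le> 0" using q'[of s] by force
    qed (use t in simp)
    then have "p t * exp (- L * t) \<le> norm (u 0) + e * t" by (simp add: q_def p_def I)
    then have "p t \<le> (norm (u 0) + e * t) * exp (L * t)" by (simp add: exp_minus field_simps)
    also have "\<dots> \<le> (norm (u 0) + e * T) * exp (L * T)"
      using t e L by (intro mult_mono add_mono mult_left_mono) (auto intro: mult_left_mono)
    finally show ?thesis using up[of t] t by simp
  qed
  consider "t = 0" | "t > 0" | "t < 0" by linarith
  then show ?thesis
  proof cases
    case 1
    have "norm (u 0) * 1 \<le> (norm (u 0) + e * T) * exp (L * T)" using e L T by (intro mult_mono) auto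
    then show ?thesis using 1 by simp
  next
    case 2 then show ?thesis using pos[OF u d, of t] t by simp
  next
    case 3
    have "norm (u (- (- t))) \<le> (norm (u (- 0)) + e * T) * exp (L * T)"
      by (rule pos[where u = "%t. u (- t)" and d = "%t. - d (- t)"])
        (use t d[of "- _"] has_vector_derivative_reflect[OF u] 3 in auto)
    then show ?thesis by simp
  qed
qed

text \<open>A Lipschitz constant that is global in \<open>x\<close> and uniform on bounded time
  intervals makes the Picard iterates converge on the whole line, so the solution exists for all
  times.\<close>

lemma picard_lindeloef_banach:
  fixes f :: "real => 'x::banach => 'x"
  assumes cont: "continuous_on UNIV (%(t, x). f t x)"
    and lip: "!!T. \<exists>L. \<forall>t x y. \<bar>t\<bar> \<le> T \<longrightarrow> norm (f t x - f t y) \<le> L * norm (x - y)"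
  obtains y where "y 0 = x0" "!!t. (y has_vector_derivative f t (y t)) (at t)"
proof -
  have contf: "continuous_on UNIV (%t. f t (g t))" if "continuous_on UNIV g" for g
    using continuous_on_compose2[OF cont continuous_on_Pair[OF continuous_on_id that]] by simp
  have "\<exists>A. \<forall>g. continuous_on UNIV g \<longrightarrow> A g 0 = (0::'x) \<and> (\<forall>t. (A g has_vector_derivative g t) (at t))"
    by (intro choice allI) (metis (no_types, lifting) antiderivative_exists)
  then obtain A where A: "!!g. continuous_on UNIV g ==> A g 0 = (0::'x)"
    "!!g t. continuous_on UNIV g ==> (A g has_vector_derivative g t) (at t)" by blast
  have contA: "continuous_on UNIV (A g)" if "continuous_on UNIV g" for g using A(2)[OF that]
    by (intro continuous_at_imp_continuous_on ballI has_vector_derivative_continuous) auto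
  define y where "y = rec_nat (%t. x0) (%n g t. x0 + A (%s. f s (g s)) t)"
  have y0: "y 0 = (%t. x0)" and yS: "y (Suc n) = (%t. x0 + A (%s. f s (y n s)) t)" for n
    by (simp_all add: y_def)
  have cy: "continuous_on UNIV (y n)" for n
    by (induction n) (auto simp: y0 yS intro!: continuous_intros contA contf)
  have ny0: "y n 0 = x0" for n by (cases n) (simp_all add: y0 yS A(1)[OF contf[OF cy]])
  have yS': "(y (Suc n) has_vector_derivative f t (y n t)) (at t)" for n t
    unfolding yS using has_vector_derivative_add[OF has_vector_derivative_const A(2)[OF contf[OF cy]]] by simp
  have y0': "(y 0 has_vector_derivative 0) (at t)" for t by (simp add: y0)
  define z where "z = (%t. x0 + (\<Sum>i. y (Suc i) t - y i t))"
  have sum: "(\<Sum>i<n. y (Suc i) t - y i t) = y n t - x0" for n t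
    using sum_lessThan_telescope[of "%i. y i t" n] by (simp add: y0)
  have unif: "uniform_limit {t. \<bar>t\<bar> \<le> T} y z sequentially"
    and liplim: "\<exists>L\<ge>0. \<forall>t x y. \<bar>t\<bar> \<le> T \<longrightarrow> norm (f t x - f t y) \<le> L * norm (x - y)"
    if T: "T \<ge> 0" for T
  proof -
    obtain L0 where L0: "!!t x y. \<bar>t\<bar> \<le> T ==> norm (f t x - f t y) \<le> L0 * norm (x - y)" using lip[of T] by blast
    define L where "L = max L0 0"
    have L: "L \<ge> 0" "!!t x y. \<bar>t\<bar> \<le> T ==> norm (f t x - f t y) \<le> L * norm (x - y)"
    proof -
      show "L \<ge> 0" by (simp add: L_def)
      show "norm (f t x - f t y) \<le> L * norm (x - y)" if "\<bar>t\<bar> \<le> T" for t x y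
        using L0[OF that, of x y] mult_right_mono[of L0 L "norm (x - y)"] by (simp add: L_def)
    qed
    then show "\<exists>L\<ge>0. \<forall>t x y. \<bar>t\<bar> \<le> T \<longrightarrow> norm (f t x - f t y) \<le> L * norm (x - y)" by blast
    have "compact ((%t. f t x0) ` {-T..T})"
      by (intro compact_continuous_image compact_Icc continuous_on_subset[OF contf[of "%t. x0"]]) auto
    then obtain M where M: "!!t. t \<in> {-T..T} ==> norm (f t x0) \<le> M"
      using compact_imp_bounded bounded_iff by (metis image_eqI)
    have M0: "M \<ge> 0" using M[of 0] T by (simp add: order_trans[OF norm_ge_zero])
    \<comment> \<open>Each iteration integrates once more and so contributes to the factorial that
      makes the differences summable; \<open>M\<close> bounds \<open>f\<close> along the constant
      initial iterate.\<close>
    have bd: "norm (y (Suc n) t - y n t) \<le> M * L ^ n / fact (Suc n) * \<bar>t\<bar> ^ Suc n" if "\<bar>t\<bar> \<le> T" for n t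
      using that
    proof (induction n arbitrary: t)
      case 0
      have "norm (y (Suc 0) t - y 0 t) \<le> M * \<bar>t\<bar> ^ Suc 0 / real (Suc 0)"
        by (rule vector_derivative_power_bound[OF _ has_vector_derivative_diff[OF yS' y0'] _ 0])
          (use M in \<open>auto simp: ny0 y0 abs_le_iff\<close>)
      then show ?case by simp
    next
      case (Suc n)
      let ?K = "L * (M * L ^ n / fact (Suc n))"
      have "norm (y (Suc (Suc n)) t - y (Suc n) t) \<le> ?K * \<bar>t\<bar> ^ Suc (Suc n) / real (Suc (Suc n))"
      proof (rule vector_derivative_power_bound[OF _ has_vector_derivative_diff[OF yS' yS'] _ Suc.prems])
        fix s assume s: "\<bar>s\<bar> \<le> T"
        have "norm (f s (y (Suc n) s) - f s (y n s)) \<le> L * norm (y (Suc n) s - y n s)" by (rule L(2)[OF s])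
        also have "\<dots> \<le> L * (M * L ^ n / fact (Suc n) * \<bar>s\<bar> ^ Suc n)"
          by (rule mult_left_mono[OF Suc.IH[OF s] L(1)])
        finally show "norm (f s (y (Suc n) s) - f s (y n s)) \<le> ?K * \<bar>s\<bar> ^ Suc n" by (simp add: mult.assoc)
      qed (simp add: ny0)
      also have "\<dots> = M * L ^ Suc n / fact (Suc (Suc n)) * \<bar>t\<bar> ^ Suc (Suc n)"
        by (subst fact_Suc[of "Suc n"]) (simp add: field_simps del: fact_Suc)
      finally show ?case .
    qed
    have "uniform_limit {t. \<bar>t\<bar> \<le> T} (%n t. \<Sum>i<n. y (Suc i) t - y i t)
        (%t. \<Sum>i. y (Suc i) t - y i t) sequentially"
    proof (rule Weierstrass_m_test)
      fix n t assume t: "t \<in> {t. \<bar>t\<bar> \<le> T}"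
      have "norm (y (Suc n) t - y n t) \<le> M * L ^ n / fact (Suc n) * \<bar>t\<bar> ^ Suc n" using bd t by simp
      also have "\<dots> \<le> M * L ^ n / fact n * T ^ Suc n"
        using t T M0 L(1) by (intro mult_mono power_mono divide_left_mono) (auto simp: fact_mono)
      also have "\<dots> = M * T * (inverse (fact n) * (L * T) ^ n)" by (simp add: field_simps power_mult_distrib)
      finally show "norm (y (Suc n) t - y n t) \<le> M * T * (inverse (fact n) * (L * T) ^ n)" .
    qed (intro summable_mult summable_exp)
    then have "uniform_limit {t. \<bar>t\<bar> \<le> T} (%n t. x0 + (\<Sum>i<n. y (Suc i) t - y i t)) z sequentially"
      unfolding z_def by (intro uniform_limit_intros)
    then show "uniform_limit {t. \<bar>t\<bar> \<le> T} y z sequentially" by (simp add: sum)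
  qed
  have cz: "continuous_on UNIV z"
  proof (rule continuous_at_imp_continuous_on, rule ballI)
    fix t :: real
    let ?T = "\<bar>t\<bar> + 1"
    have "continuous_on {s. \<bar>s\<bar> \<le> ?T} z"
      by (rule uniform_limit_theorem[OF _ unif]) (auto intro!: always_eventually continuous_on_subset[OF cy])
    then have "continuous_on {s. \<bar>s\<bar> < ?T} z" by (rule continuous_on_subset) auto
    moreover have "{s. \<bar>s\<bar> < ?T} = {- ?T<..< ?T}" by auto
    ultimately have "\<forall>s\<in>{- ?T<..< ?T}. isCont z s"
      by (metis continuous_on_eq_continuous_at open_greaterThanLessThan)
    moreover have "t \<in> {- ?T<..< ?T}" by (simp add: abs_real_def)
    ultimately show "isCont z t" by blast
  qed
  \<comment> \<open>One more Picard iteration, applied to the limit. It has the right derivative by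
    construction; that it equals \<open>z\<close> follows by passing to the limit in the
    recursion.\<close>
  define Z where "Z = (%t. x0 + A (%s. f s (z s)) t)"
  have Z': "(Z has_vector_derivative f t (z t)) (at t)" for t
    unfolding Z_def using has_vector_derivative_add[OF has_vector_derivative_const A(2)[OF contf[OF cz]]] by simp
  have Z0: "Z 0 = x0" by (simp add: Z_def A(1)[OF contf[OF cz]])
  have "Z t = z t" for t
  proof -
    let ?T = "\<bar>t\<bar>"
    obtain L where L: "L \<ge> 0" "!!s x y. \<bar>s\<bar> \<le> ?T ==> norm (f s x - f s y) \<le> L * norm (x - y)"
      using liplim[of ?T] by auto
    have "(%n. y (Suc n) t) \<longlonglongrightarrow> Z t"
    proof (rule LIMSEQ_I)
      fix r :: real assume r: "r > 0"
      define e where "e = r / (L * ?T + 1)"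
      have den: "L * ?T + 1 > 0" using L(1) by (simp add: add_nonneg_pos)
      then have e: "e > 0" using r by (simp add: e_def)
      obtain N where N: "!!n s. n \<ge> N ==> \<bar>s\<bar> \<le> ?T ==> dist (y n s) (z s) < e"
        using uniform_limitD[OF unif[of ?T] e] by (auto simp: eventually_sequentially)
      have "norm (y (Suc n) t - Z t) < r" if n: "n \<ge> N" for n
      proof -
        have "norm (y (Suc n) t - Z t) \<le> (L * e) * \<bar>t\<bar> ^ Suc 0 / real (Suc 0)"
        proof (rule vector_derivative_power_bound[OF _ has_vector_derivative_diff[OF yS' Z'] _ order_refl])
          fix s assume s: "\<bar>s\<bar> \<le> \<bar>t\<bar>"
          have "norm (f s (y n s) - f s (z s)) \<le> L * norm (y n s - z s)" by (rule L(2)[OF s])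
          also have "\<dots> \<le> L * e" using N[OF n s] L(1) by (intro mult_left_mono) (auto simp: dist_norm)
          finally show "norm (f s (y n s) - f s (z s)) \<le> L * e * \<bar>s\<bar> ^ 0" by simp
        qed (simp add: ny0 Z0)
        also have "\<dots> = (L * ?T) * e" by simp
        also have "\<dots> < (L * ?T + 1) * e" using e by simp
        also have "\<dots> = r" using den by (simp add: e_def)
        finally show ?thesis .
      qed
      then show "\<exists>N. \<forall>n\<ge>N. norm (y (Suc n) t - Z t) < r" by blast
    qed
    moreover have "(%n. y n t) \<longlonglongrightarrow> z t" by (rule tendsto_uniform_limitI[OF unif[of ?T]]) auto
    then have "(%n. y (Suc n) t) \<longlonglongrightarrow> z t" by (rule LIMSEQ_Suc)
    ultimately show ?thesis by (rule LIMSEQ_unique)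
  qed
  then have "Z = z" by (rule ext)
  then show ?thesis using that[of z] Z0 Z' by simp
qed

text \<open>A finite-dimensional normed space need not be an instance of \<open>banach\<close> as a type, so the
  equation is transported to its dual, a type of bounded linear maps into \<open>real\<close>.\<close>

lemma picard_lindeloef:
  fixes f :: "real => 'a::real_normed_vector => 'a"
  assumes fd: "finite_dim TYPE('a)" and cont: "continuous_on UNIV (%(t, x). f t x)"
    and lip: "!!T. \<exists>L. \<forall>t x y. \<bar>t\<bar> \<le> T \<longrightarrow> norm (f t x - f t y) \<le> L * norm (x - y)"
  obtains y where "y 0 = x0" "!!t. (y has_vector_derivative f t (y t)) (at t)"
proof -
  note crd = basis(2,3,4)[OF fd]
  define J :: "'a => 'a \<Rightarrow>\<^sub>L real" where "J = (%x. \<Sum>b\<in>basis. coord b x *\<^sub>R Blinfun (coord b))"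
  define P :: "('a \<Rightarrow>\<^sub>L real) => 'a" where "P = (%\<phi>. \<Sum>b\<in>basis. blinfun_apply \<phi> b *\<^sub>R b)"
  have J: "bounded_linear J" unfolding J_def
    by (intro bounded_linear_sum bounded_linear_compose[OF bounded_linear_scaleR_left crd(1)])
  have P: "bounded_linear P" unfolding P_def
    by (intro bounded_linear_sum bounded_linear_compose[OF bounded_linear_scaleR_left]
        blinfun.bounded_linear_left)
  have PJ: "P (J x) = x" for x
  proof -
    have "blinfun_apply (J x) b = coord b x" if "b \<in> basis" for b
      using that basis(1)[OF fd] by (simp add: J_def blinfun.sum_left blinfun.scaleR_left
          bounded_linear_Blinfun_apply[OF crd(1)] crd(3) if_distrib cong: if_cong)
    then show ?thesis using crd(2)[of x] by (simp add: P_def)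
  qed
  obtain KJ where KJ: "KJ > 0" "!!x. norm (J x) \<le> norm x * KJ" using bounded_linear.pos_bounded[OF J] by blast
  obtain KP where KP: "KP > 0" "!!x. norm (P x) \<le> norm x * KP" using bounded_linear.pos_bounded[OF P] by blast
  obtain u where u: "u 0 = J x0" "!!t. (u has_vector_derivative J (f t (P (u t)))) (at t)"
  proof (rule picard_lindeloef_banach[where f = "%t u. J (f t (P u))"])
    have "continuous_on UNIV (%(t, u). f t (P u))"
      using continuous_on_compose2[OF cont, of UNIV "%(t, u). (t, P u)"]
        continuous_on_Pair[OF continuous_on_fst[OF continuous_on_id]
          bounded_linear.continuous_on[OF P continuous_on_snd[OF continuous_on_id]], of UNIV]
      by (simp add: split_beta)
    then show "continuous_on UNIV (%(t, u). J (f t (P u)))"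
      unfolding split_beta by (rule bounded_linear.continuous_on[OF J])
    fix T
    obtain L where L: "!!t x y. \<bar>t\<bar> \<le> T ==> norm (f t x - f t y) \<le> L * norm (x - y)" using lip by blast
    have "norm (J (f t (P x)) - J (f t (P y))) \<le> (\<bar>L\<bar> * KP * KJ) * norm (x - y)" if "\<bar>t\<bar> \<le> T" for t x y
    proof -
      have "norm (J (f t (P x)) - J (f t (P y))) \<le> norm (f t (P x) - f t (P y)) * KJ"
        using KJ(2) by (metis J linear_simps(2))
      also have "norm (f t (P x) - f t (P y)) \<le> \<bar>L\<bar> * norm (P x - P y)"
        by (rule order_trans[OF L[OF that]]) (simp add: mult_right_mono)
      also have "norm (P x - P y) \<le> norm (x - y) * KP" using KP(2) by (metis P linear_simps(2))
      finally show ?thesis using KJ(1) by (simp add: mult_left_mono mult_right_mono mult_ac)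
    qed
    then show "\<exists>L. \<forall>t x y. \<bar>t\<bar> \<le> T \<longrightarrow> norm (J (f t (P x)) - J (f t (P y))) \<le> L * norm (x - y)" by blast
  qed blast
  have "((%t. P (u t)) has_vector_derivative P (J (f t (P (u t))))) (at t)" for t
    by (rule bounded_linear.has_vector_derivative[OF P u(2)])
  then show ?thesis using that[of "%t. P (u t)"] u(1) by (simp add: PJ)
qed

subsection \<open>Smooth dependence on parameters\<close>

text \<open>Global in \<open>y\<close>, so that the Gronwall estimate applies without first
  confining solutions to a bounded set; local in \<open>p\<close>, since the constant of a linear
  equation varies with its parameter.\<close>

definition locally_uniformly_lipschitz ::
  "(real \<times> 'p::metric_space \<times> 'e::real_normed_vector => 'e) => bool" where
  "locally_uniformly_lipschitz f \<longleftrightarrow> (\<forall>T p0. \<exists>L\<ge>0. \<exists>d>0. \<forall>t p y y'. \<bar>t\<bar> \<le> T \<longrightarrow> dist p p0 < d \<longrightarrow>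
     norm (f (t, p, y) - f (t, p, y')) \<le> L * norm (y - y'))"

text \<open>The tube lemma around the compact segment \<open>{q0} \<times> {-T..T}\<close>:
  continuity at \<open>q0\<close> is uniform over bounded times.\<close>

lemma uniformly_close_on_compact:
  fixes g :: "real \<times> 'q::metric_space => 'c::metric_space"
  assumes g: "continuous_on UNIV g" and e: "e > 0"
  obtains d where "d > 0" "!!t q. \<bar>t\<bar> \<le> T ==> dist q q0 < d ==> dist (g (t, q)) (g (t, q0)) < e"
proof -
  define W where "W = {(q, t). dist (g (t, q)) (g (t, q0)) < e}"
  have "continuous_on UNIV (%(q, t). dist (g (t, q)) (g (t, q0)))" unfolding split_beta
    by (intro continuous_intros continuous_on_compose2[OF g]) auto
  from open_vimage[OF open_lessThan[of e] this]
  have "open ((%(q, t). dist (g (t, q)) (g (t, q0))) -` {..<e})" .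
  moreover have "W = (%(q, t). dist (g (t, q)) (g (t, q0))) -` {..<e}" by (auto simp: W_def)
  ultimately have oW: "open W" by simp
  have "{q0} \<times> {-T..T} \<subseteq> W" using e by (auto simp: W_def)
  from Elementary_Topology.tube_lemma[OF compact_Icc oW this]
  obtain X where X: "q0 \<in> X" "open X" "X \<times> {-T..T} \<subseteq> W" by blast
  obtain d where d: "d > 0" "!!q. dist q q0 < d ==> q \<in> X" using X(1,2) open_dist by blast
  show ?thesis
  proof (rule that[OF d(1)])
    fix t q assume "\<bar>t\<bar> \<le> T" "dist q q0 < d"
    then have "(q, t) \<in> W" using X(3) d(2) by (auto simp: abs_le_iff)
    then show "dist (g (t, q)) (g (t, q0)) < e" by (simp add: W_def)
  qed
qed

lemma linear_family_bound:
  fixes A :: "real \<times> 'p::metric_space => 'e::real_normed_vector => 'c::real_normed_vector"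
  assumes fd: "finite_dim TYPE('e)" and lin: "!!x. linear (A x)"
    and cont: "!!c. continuous_on UNIV (%x. A x c)"
  obtains L d where "L \<ge> 0" "d > 0"
    "!!t p e. \<bar>t\<bar> \<le> T ==> dist p p0 < d ==> norm (A (t, p) e) \<le> L * norm e"
proof -
  obtain N where N: "N > 0" "!!(A :: 'e => 'c) e v.
      linear A ==> e \<ge> 0 ==> (!!b. b \<in> basis ==> norm (A b) \<le> e) ==> norm (A v) \<le> N * e * norm v"
    by (rule finite_dim_linear_bound[OF fd]) blast
  have "\<exists>M d. M \<ge> 0 \<and> d > 0 \<and> (\<forall>t p. \<bar>t\<bar> \<le> T \<longrightarrow> dist p p0 < d \<longrightarrow> norm (A (t, p) b) \<le> M)" for b
  proof -
    obtain d where d: "d > 0" "!!t p. \<bar>t\<bar> \<le> T ==> dist p p0 < d ==> dist (A (t, p) b) (A (t, p0) b) < 1"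
      using uniformly_close_on_compact[OF cont zero_less_one] by metis
    have "compact ((%t. A (t, p0) b) ` {-T..T})"
      by (intro compact_continuous_image compact_Icc continuous_on_compose2[OF cont]) (auto intro!: continuous_intros)
    then obtain M where M: "!!t. t \<in> {-T..T} ==> norm (A (t, p0) b) \<le> M"
      using compact_imp_bounded[of "(%t. A (t, p0) b) ` {-T..T}"] unfolding bounded_iff by blast
    have "norm (A (t, p) b) \<le> max M 0 + 1" if "\<bar>t\<bar> \<le> T" "dist p p0 < d" for t p
    proof -
      have "norm (A (t, p) b) \<le> norm (A (t, p0) b) + norm (A (t, p) b - A (t, p0) b)"
        by (rule norm_triangle_sub)
      also have "norm (A (t, p) b - A (t, p0) b) \<le> 1" using d(2)[OF that] by (simp add: dist_norm)
      also have "norm (A (t, p0) b) \<le> max M 0" using M[of t] that(1) by (auto simp: abs_le_iff)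
      finally show ?thesis by simp
    qed
    then show ?thesis using d(1) by (intro exI[of _ "max M 0 + 1"] exI[of _ d]) auto
  qed
  then obtain M d where Md: "!!b. M b \<ge> 0" "!!b. d b > 0"
    "!!b t p. \<bar>t\<bar> \<le> T ==> dist p p0 < d b ==> norm (A (t, p) b) \<le> M b" by metis
  \<comment> \<open>The inserted 1 keeps the minimum meaningful when the basis is empty.\<close>
  define d0 where "d0 = Min (insert 1 (d ` basis))"
  have d0: "d0 > 0" "!!b. b \<in> basis ==> d0 \<le> d b" using basis(1)[OF fd] Md(2) by (auto simp: d0_def)
  show ?thesis
  proof (rule that[of "N * (\<Sum>b\<in>basis. M b)" d0])
    have M: "(\<Sum>b\<in>basis. M b) \<ge> 0" by (rule sum_nonneg) (rule Md(1))
    then show "N * (\<Sum>b\<in>basis. M b) \<ge> 0" using N(1) by simp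
    fix t p e assume tp: "\<bar>t\<bar> \<le> T" "dist p p0 < d0"
    show "norm (A (t, p) e) \<le> N * (\<Sum>b\<in>basis. M b) * norm e"
    proof (rule N(2)[OF lin M])
      fix b :: 'e assume b: "b \<in> basis"
      have "norm (A (t, p) b) \<le> M b" using Md(3)[OF tp(1), of p b] tp(2) d0(2)[OF b] by simp
      also have "\<dots> \<le> (\<Sum>b\<in>basis. M b)" by (rule member_le_sum[OF b Md(1) basis(1)[OF fd]])
      finally show "norm (A (t, p) b) \<le> (\<Sum>b\<in>basis. M b)" .
    qed
  qed (rule d0(1))
qed

lemma k_smooth_on_linear_family:
  fixes A :: "'p::real_normed_vector => 'e::real_normed_vector => 'c::real_normed_vector"
  assumes fd: "finite_dim TYPE('e)" and S: "open S" and lin: "!!x. x \<in> S ==> linear (A x)"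
    and A: "!!c. k_smooth_on k S (%x. A x c)" and u: "k_smooth_on k S u"
  shows "k_smooth_on k S (%x. A x (u x))"
proof -
  note B = basis[OF fd]
  have "k_smooth_on k S (%x. \<Sum>b\<in>basis. coord b (u x) *\<^sub>R A x b)"
    by (intro k_smooth_on_sum k_smooth_on_scaleR S k_smooth_on_bounded_linear_compose[OF B(2)] A u)
  then show ?thesis
    by (rule k_smooth_on_cong[OF S, THEN iffD1, rotated]) (simp add: linear_expand[OF B(3) lin, symmetric])
qed

text \<open>Differentiability is uniform along compact arcs of a curve.\<close>

lemma uniform_linearization:
  fixes f :: "real \<times> 'q::real_normed_vector => 'e::real_normed_vector"
  assumes fd: "finite_dim TYPE('q)" and f: "k_smooth_on (Suc k) UNIV f"
    and q: "continuous_on UNIV q" and e: "e > 0"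
  obtains d where "d > 0"
    "!!t h. \<bar>t\<bar> \<le> T ==> norm h < d ==>
      norm (f (t, q t + h) - f (t, q t) - frechet_derivative f (at (t, q t)) (0, h)) \<le> e * norm h"
proof -
  obtain N where N: "N > 0" "!!(A :: 'q => 'e) e v.
      linear A ==> e \<ge> 0 ==> (!!b. b \<in> basis ==> norm (A b) \<le> e) ==> norm (A v) \<le> N * e * norm v"
    by (rule finite_dim_linear_bound[OF fd]) blast
  let ?f' = "%x. frechet_derivative f (at x)"
  have f': "(f has_derivative ?f' x) (at x)" for x by (rule k_smooth_on_SucD(1)[OF f]) simp
  have lin: "linear (%h. ?f' x (0, h))" for x
    using bounded_linear_compose[OF has_derivative_bounded_linear[OF f'[of x]]
        bounded_linear_Pair[OF bounded_linear_zero bounded_linear_ident]] by (rule bounded_linear.linear)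
  have "\<exists>d>0. \<forall>t h. \<bar>t\<bar> \<le> T \<longrightarrow> norm h < d \<longrightarrow>
      dist (?f' (t, q t + h) (0, b)) (?f' (t, q t) (0, b)) < e / N" for b
  proof -
    have cf: "continuous_on UNIV (%x. ?f' x (0, b))"
      by (rule k_smooth_on_imp_continuous_on[OF k_smooth_on_SucD(2)[OF f]])
    have "continuous_on UNIV (%(t, h). ?f' (t, q t + h) (0, b))" unfolding split_beta
      by (rule continuous_on_compose2[OF cf])
        (auto intro!: continuous_intros continuous_on_compose2[OF q])
    from uniformly_close_on_compact[OF this, of "e / N" T 0] e N(1)
    show ?thesis by (metis (no_types, lifting) add.right_neutral case_prod_conv dist_norm diff_zero divide_pos_pos)
  qed
  then obtain d where d: "!!b. d b > 0"
    "!!b t h. \<bar>t\<bar> \<le> T ==> norm h < d b ==>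
      dist (?f' (t, q t + h) (0, b)) (?f' (t, q t) (0, b)) < e / N" by metis
  define d0 where "d0 = Min (insert 1 (d ` basis))"
  have d0: "d0 > 0" "!!b. b \<in> basis ==> d0 \<le> d b" using basis(1)[OF fd] d(1) by (auto simp: d0_def)
  show ?thesis
  proof (rule that[OF d0(1)])
    fix t and h :: 'q assume t: "\<bar>t\<bar> \<le> T" and h: "norm h < d0"
    let ?g = "%h. f (t, q t + h) - ?f' (t, q t) (0, h)"
    have "norm (?g h - ?g 0) \<le> e * norm (h - 0)"
    proof (rule differentiable_bound[where S = "ball 0 d0" and
          f' = "%h v. ?f' (t, q t + h) (0, v) - ?f' (t, q t) (0, v)"])
      fix k assume k: "k \<in> ball (0::'q) d0"
      have "((%h. (t, q t + h)) has_derivative (%v. (0, v))) (at k within ball 0 d0)"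
        by (auto intro!: derivative_eq_intros)
      from has_derivative_compose[OF this f']
        bounded_linear.has_derivative[OF linear_imp_bounded_linear_finite_dim[OF fd lin] has_derivative_ident]
      show "(?g has_derivative (%v. ?f' (t, q t + k) (0, v) - ?f' (t, q t) (0, v))) (at k within ball 0 d0)"
        by (intro has_derivative_diff)
      show "onorm (%v. ?f' (t, q t + k) (0, v) - ?f' (t, q t) (0, v)) \<le> e"
      proof (rule onorm_bound[OF less_imp_le[OF e]])
        fix v
        have "norm (?f' (t, q t + k) (0, v) - ?f' (t, q t) (0, v)) \<le> N * (e / N) * norm v"
          by (rule N(2)[OF linear_compose_sub[OF lin lin]])
            (use e N(1) k d(2)[OF t, of k] d0(2) in \<open>fastforce simp: dist_norm intro: less_imp_le\<close>)+
        then show "norm (?f' (t, q t + k) (0, v) - ?f' (t, q t) (0, v)) \<le> e * norm v" using N(1) by simp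
      qed
    qed (use h d0 in auto)
    moreover have "?f' (t, q t) (0, 0) = 0" using linear_0[OF lin] .
    ultimately show "norm (f (t, q t + h) - f (t, q t) - ?f' (t, q t) (0, h)) \<le> e * norm h"
      by (simp add: algebra_simps)
  qed
qed

text \<open>Gronwall for the difference of two solutions. The right-hand sides are compared along
  the single solution at \<open>p0\<close>, where continuity of \<open>f\<close> in the parameter is
  uniform over the time interval.\<close>

lemma ode_param_close:
  fixes f :: "real \<times> 'p::real_normed_vector \<times> 'e::real_normed_vector => 'e"
  assumes f: "continuous_on UNIV f" and lip: "locally_uniformly_lipschitz f"
    and w0: "continuous_on UNIV (%p. w 0 p)"
    and w: "!!t p. ((%t. w t p) has_vector_derivative f (t, p, w t p)) (at t)" and e: "e > 0"
  obtains d where "d > 0" "!!t p. \<bar>t\<bar> \<le> T ==> dist p p0 < d ==> norm (w t p - w t p0) < e"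
proof (cases "T \<ge> 0")
  case True
  obtain L d1 where L: "L \<ge> 0" "d1 > 0" "!!t p y y'. \<bar>t\<bar> \<le> T ==> dist p p0 < d1 ==>
      norm (f (t, p, y) - f (t, p, y')) \<le> L * norm (y - y')"
    using lip unfolding locally_uniformly_lipschitz_def by metis
  \<comment> \<open>The Gronwall factor for an error that enters both the initial value and the
    equation.\<close>
  define c where "c = (1 + T) * exp (L * T)"
  have c: "c > 0" using True by (simp add: c_def)
  define e' where "e' = e / (2 * c)"
  have e': "e' > 0" using e c by (simp add: e'_def)
  have cw: "continuous_on UNIV (%t. w t p0)"
    using w by (intro continuous_at_imp_continuous_on ballI has_vector_derivative_continuous) auto
  have "continuous_on UNIV (%(t, p). f (t, p, w t p0))" unfolding split_beta
    by (rule continuous_on_compose2[OF f]) (auto intro!: continuous_intros continuous_on_compose2[OF cw])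
  from uniformly_close_on_compact[OF this e', of T p0] obtain d2 where d2: "d2 > 0"
    "!!t p. \<bar>t\<bar> \<le> T ==> dist p p0 < d2 ==> dist (f (t, p, w t p0)) (f (t, p0, w t p0)) < e'" by auto
  obtain d3 where d3: "d3 > 0" "!!p. dist p p0 < d3 ==> dist (w 0 p) (w 0 p0) < e'"
    using w0 e' unfolding continuous_on_iff by (metis UNIV_I)
  show ?thesis
  proof (rule that[of "min d1 (min d2 d3)"])
    fix t p assume t: "\<bar>t\<bar> \<le> T" and p: "dist p p0 < min d1 (min d2 d3)"
    have "norm (w t p - w t p0) \<le> (norm (w 0 p - w 0 p0) + e' * T) * exp (L * T)"
    proof (rule gronwall[OF has_vector_derivative_diff[OF w w] _ less_imp_le[OF e'] L(1) t])
      fix s assume s: "\<bar>s\<bar> \<le> T"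
      have "norm (f (s, p, w s p) - f (s, p0, w s p0)) \<le>
          norm (f (s, p, w s p) - f (s, p, w s p0)) + norm (f (s, p, w s p0) - f (s, p0, w s p0))"
        by (rule norm_triangle_ineq[THEN order_trans[rotated]]) simp
      also have "\<dots> \<le> L * norm (w s p - w s p0) + e'"
        using L(3)[OF s, of p "w s p" "w s p0"] d2(2)[OF s, of p] p by (intro add_mono) (auto simp: dist_norm)
      finally show "norm (f (s, p, w s p) - f (s, p0, w s p0)) \<le> L * norm (w s p - w s p0) + e'" .
    qed
    also have "\<dots> \<le> (e' + e' * T) * exp (L * T)"
      using d3(2)[of p] p by (intro mult_right_mono add_right_mono) (auto simp: dist_norm)
    also have "(e' + e' * T) = e' * (1 + T)" by (simp add: algebra_simps)
    also have "e' * (1 + T) * exp (L * T) = e' * c" by (simp add: c_def)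
    also have "\<dots> = e / 2" using c by (simp add: e'_def)
    also have "\<dots> < e" using e by simp
    finally show "norm (w t p - w t p0) < e" .
  qed (use L d2 d3 in auto)
qed (use that[of 1] in auto)

lemma ode_param_continuous:
  fixes f :: "real \<times> 'p::real_normed_vector \<times> 'e::real_normed_vector => 'e"
  assumes f: "continuous_on UNIV f" and lip: "locally_uniformly_lipschitz f"
    and w0: "continuous_on UNIV (%p. w 0 p)"
    and w: "!!t p. ((%t. w t p) has_vector_derivative f (t, p, w t p)) (at t)"
  shows "continuous_on UNIV (%(t, p). w t p)" unfolding continuous_on_iff
proof (intro ballI allI impI)
  fix x :: "real \<times> 'p" and e :: real assume e: "0 < e"
  obtain t0 p0 where x: "x = (t0, p0)" by (cases x)
  obtain d1 where d1: "d1 > 0"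
    "!!t p. \<bar>t\<bar> \<le> \<bar>t0\<bar> + 1 ==> dist p p0 < d1 ==> norm (w t p - w t p0) < e / 2"
    using ode_param_close[OF f lip w0 w, of "e / 2" "\<bar>t0\<bar> + 1" p0] e by auto
  have "isCont (%t. w t p0) t0" using has_vector_derivative_continuous[OF w] .
  then obtain d2 where d2: "d2 > 0" "!!t. dist t t0 < d2 ==> dist (w t p0) (w t0 p0) < e / 2"
    unfolding continuous_at_eps_delta using e by (metis half_gt_zero)
  have "dist (w t p) (w t0 p0) < e" if tp: "dist (t, p) (t0, p0) < min 1 (min d1 d2)" for t p
  proof -
    have "dist t t0 < min 1 (min d1 d2)" "dist p p0 < min 1 (min d1 d2)"
      using tp dist_fst_le[of "(t, p)" "(t0, p0)"] dist_snd_le[of "(t, p)" "(t0, p0)"] by auto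
    then have "dist (w t p) (w t p0) < e / 2" "dist (w t p0) (w t0 p0) < e / 2"
      using d1(2)[of t p] d2(2)[of t] by (auto simp: dist_norm)
    then show ?thesis using dist_triangle[of "w t p" "w t0 p0" "w t p0"] by linarith
  qed
  then show "\<exists>d>0. \<forall>x'\<in>UNIV. dist x' x < d \<longrightarrow> dist (case x' of (t, p) => w t p) (case x of (t, p) => w t p) < e"
    using d1(1) d2(1) by (intro exI[of _ "min 1 (min d1 d2)"]) (auto simp: x)
qed

lemma has_vector_derivative_imp_continuous_on:
  "(!!t. (u has_vector_derivative u' t) (at t)) ==> continuous_on S u"
  by (intro continuous_at_imp_continuous_on ballI has_vector_derivative_continuous) auto

lemma linear_family_continuous:
  fixes A :: "'q::topological_space => 'e::real_normed_vector => 'c::real_normed_vector"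
  assumes fd: "finite_dim TYPE('e)" and lin: "!!x. linear (A x)"
    and cont: "!!c. continuous_on UNIV (%x. A x c)"
  shows "continuous_on UNIV (%(x, e). A x e)"
proof -
  note B = basis[OF fd]
  have "continuous_on UNIV (%(x, e). \<Sum>b\<in>basis. coord b e *\<^sub>R A x b)" unfolding split_beta
    by (intro continuous_intros bounded_linear.continuous_on[OF B(2)] continuous_on_compose2[OF cont]) auto
  then show ?thesis by (simp add: linear_expand[OF B(3) lin, symmetric])
qed

lemma linear_ode_solution:
  fixes A :: "real \<times> 'p::metric_space => 'e::real_normed_vector => 'e"
  assumes fd: "finite_dim TYPE('e)" and lin: "!!x. linear (A x)"
    and A: "!!c. continuous_on UNIV (%x. A x c)" and b: "continuous_on UNIV b"
  obtains z where "!!p. z 0 p = z0 p"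
    "!!t p. ((%t. z t p) has_vector_derivative A (t, p) (z t p) + b (t, p)) (at t)"
proof -
  have "\<exists>y. y 0 = z0 p \<and> (\<forall>t. (y has_vector_derivative A (t, p) (y t) + b (t, p)) (at t))" for p
  proof -
    obtain y where "y 0 = z0 p" "!!t. (y has_vector_derivative A (t, p) (y t) + b (t, p)) (at t)"
    proof (rule picard_lindeloef[OF fd, where f = "%t y. A (t, p) y + b (t, p)"])
      show "continuous_on UNIV (%(t, y). A (t, p) y + b (t, p))" unfolding split_beta
        using continuous_on_compose2[OF linear_family_continuous[OF fd lin A], of UNIV "%x. ((fst x, p), snd x)"]
          continuous_on_compose2[OF b, of UNIV "%x. (fst x, p)"] by (intro continuous_on_add)
          (simp_all add: continuous_on_Pair continuous_on_fst continuous_on_snd continuous_on_id)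
      fix T
      obtain L d where L: "d > 0" "!!t q e. \<bar>t\<bar> \<le> T ==> dist q p < d ==> norm (A (t, q) e) \<le> L * norm e"
        by (rule linear_family_bound[OF fd lin A]) blast
      then have "norm (A (t, p) x + b (t, p) - (A (t, p) y + b (t, p))) \<le> L * norm (x - y)" if "\<bar>t\<bar> \<le> T" for t x y
        using L(2)[OF that, of p "x - y"] by (simp add: linear_diff[OF lin])
      then show "\<exists>L. \<forall>t x y. \<bar>t\<bar> \<le> T \<longrightarrow>
          norm (A (t, p) x + b (t, p) - (A (t, p) y + b (t, p))) \<le> L * norm (x - y)" by blast
    qed blast
    then show ?thesis by blast
  qed
  then obtain y where "!!p. y p 0 = z0 p"
    "!!t p. (y p has_vector_derivative A (t, p) (y p t) + b (t, p)) (at t)" by metis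
  then show ?thesis using that[of "%t p. y p t"] by blast
qed

lemma locally_uniformly_lipschitz_linear:
  fixes A :: "real \<times> 'p::metric_space => 'e::real_normed_vector => 'e"
  assumes fd: "finite_dim TYPE('e)" and lin: "!!x. linear (A x)"
    and A: "!!c. continuous_on UNIV (%x. A x c)"
  shows "locally_uniformly_lipschitz (%(t, p, e). A (t, p) e + b (t, p))"
  unfolding locally_uniformly_lipschitz_def
proof (intro allI)
  fix T and p0 :: 'p
  obtain L d where L: "L \<ge> 0" "d > 0" "!!t q e. \<bar>t\<bar> \<le> T ==> dist q p0 < d ==> norm (A (t, q) e) \<le> L * norm e"
    by (rule linear_family_bound[OF fd lin A]) blast
  show "\<exists>L\<ge>0. \<exists>d>0. \<forall>t p y y'. \<bar>t\<bar> \<le> T \<longrightarrow> dist p p0 < d \<longrightarrow>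
      norm ((case (t, p, y) of (t, p, e) => A (t, p) e + b (t, p)) -
        (case (t, p, y') of (t, p, e) => A (t, p) e + b (t, p))) \<le> L * norm (y - y')"
    by (rule exI[of _ L], rule conjI[OF L(1)], rule exI[of _ d])
      (use L in \<open>auto simp: linear_diff[OF lin, symmetric]\<close>)
qed

text \<open>The derivative of the solution in the parameter direction \<open>h\<close> solves the equation
  linearised along the solution.\<close>

lemma ode_param_derivative:
  fixes f :: "real \<times> 'p::real_normed_vector \<times> 'e::real_normed_vector => 'e"
  assumes fdp: "finite_dim TYPE('p)" and fde: "finite_dim TYPE('e)"
    and f: "k_smooth_on (Suc k) UNIV f" and lip: "locally_uniformly_lipschitz f"
    and w0: "((%p. w 0 p) has_derivative w0') (at p0)" and cw0: "continuous_on UNIV (%p. w 0 p)"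
    and w: "!!t p. ((%t. w t p) has_vector_derivative f (t, p, w t p)) (at t)"
    and linZ: "!!t. linear (Z t)" and Z0: "Z 0 = w0'"
    and Z: "!!t h. ((%t. Z t h) has_vector_derivative
       frechet_derivative f (at (t, p0, w t p0)) (0, 0, Z t h) +
       frechet_derivative f (at (t, p0, w t p0)) (0, h, 0)) (at t)"
  shows "((%p. w t0 p) has_derivative Z t0) (at p0)"
proof -
  let ?T = "\<bar>t0\<bar>"
  let ?f' = "%t. frechet_derivative f (at (t, p0, w t p0))"
  have cf: "continuous_on UNIV f" by (rule k_smooth_on_imp_continuous_on[OF f])
  have linf: "bounded_linear (?f' t)" for t
    using k_smooth_on_SucD(1)[OF f] has_derivative_bounded_linear by blast
  have cw: "continuous_on UNIV (%t. w t p0)" by (rule has_vector_derivative_imp_continuous_on[OF w])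
  have cq: "continuous_on UNIV (%t. (p0, w t p0))" by (intro continuous_intros cw)
  have lA: "linear (%e. ?f' t (0, 0, e))" for t
    by (intro bounded_linear.linear bounded_linear_compose[OF linf] bounded_linear_Pair
        bounded_linear_zero bounded_linear_ident)
  have cF: "continuous_on UNIV (%x. frechet_derivative f (at (fst x, snd x, w (fst x) (snd x))) v)" for v
    using ode_param_continuous[OF cf lip cw0 w]
    by (intro continuous_on_compose2[OF k_smooth_on_imp_continuous_on[OF k_smooth_on_SucD(2)[OF f]]])
      (auto simp: split_beta intro!: continuous_intros)
  have linF: "bounded_linear (frechet_derivative f (at x))" for x
    using k_smooth_on_SucD(1)[OF f] has_derivative_bounded_linear by blast
  have lA': "linear (%e. frechet_derivative f (at x) (0, 0, e))" for x
    by (intro bounded_linear.linear bounded_linear_compose[OF linF] bounded_linear_Pair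
        bounded_linear_zero bounded_linear_ident)
  have lP': "linear (%h. frechet_derivative f (at x) (0, h, 0))" for x
    by (intro bounded_linear.linear bounded_linear_compose[OF linF] bounded_linear_Pair
        bounded_linear_zero bounded_linear_ident)
  obtain LA da where LA': "LA \<ge> 0" "da > 0" "!!t p e. \<bar>t\<bar> \<le> ?T ==> dist p p0 < da ==>
      norm (frechet_derivative f (at (fst (t, p), snd (t, p), w (fst (t, p)) (snd (t, p)))) (0, 0, e)) \<le> LA * norm e"
    by (rule linear_family_bound[OF fde lA' cF]) blast
  have LA: "LA \<ge> 0" "!!t e. \<bar>t\<bar> \<le> ?T ==> norm (?f' t (0, 0, e)) \<le> LA * norm e"
    using LA'(1,2) LA'(3)[of _ p0] by auto
  obtain LP dp where LP': "LP \<ge> 0" "dp > 0" "!!t p e. \<bar>t\<bar> \<le> ?T ==> dist p p0 < dp ==>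
      norm (frechet_derivative f (at (fst (t, p), snd (t, p), w (fst (t, p)) (snd (t, p)))) (0, e, 0)) \<le> LP * norm e"
    by (rule linear_family_bound[OF fdp lP' cF]) blast
  have LP: "LP \<ge> 0" "!!t h. \<bar>t\<bar> \<le> ?T ==> norm (?f' t (0, h, 0)) \<le> LP * norm h"
    using LP'(1,2) LP'(3)[of _ p0] by auto
  obtain L d1 where L: "L \<ge> 0" "d1 > 0" "!!t p y y'. \<bar>t\<bar> \<le> ?T ==> dist p p0 < d1 ==>
      norm (f (t, p, y) - f (t, p, y')) \<le> L * norm (y - y')"
    using lip unfolding locally_uniformly_lipschitz_def by metis
  obtain d2 where d2: "d2 > 0" "!!t h. \<bar>t\<bar> \<le> ?T ==> norm h < d2 ==>
      norm (f (t, (p0, w t p0) + h) - f (t, p0, w t p0) - ?f' t (0, h)) \<le> 1 * norm h"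
    using uniform_linearization[OF finite_dim_prod[OF fdp fde] f cq zero_less_one, of ?T] by metis
  obtain C0 where C0: "C0 \<ge> 0" "!!h. norm (w0' h) \<le> norm h * C0"
    using bounded_linear.nonneg_bounded[OF has_derivative_bounded_linear[OF w0]] by blast
  have w0e: "\<exists>d>0. \<forall>h. norm h < d \<longrightarrow> norm (w 0 (p0 + h) - w 0 p0 - w0' h) \<le> e * norm h" if "e > 0" for e
  proof -
    from w0[unfolded has_derivative_within_alt] that obtain d where "d > 0"
      "!!y. norm (y - p0) < d ==> norm (w 0 y - w 0 p0 - w0' (y - p0)) \<le> e * norm (y - p0)" by auto
    then show ?thesis by (intro exI[of _ d]) (metis add_diff_cancel_left')
  qed
  obtain d3 where d3: "d3 > 0" "!!h. norm h < d3 ==> norm (w 0 (p0 + h) - w 0 p0 - w0' h) \<le> 1 * norm h"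
    using w0e[OF zero_less_one] by blast
  define C1 where "C1 = (1 + C0 + (1 + LP) * ?T) * exp (L * ?T)"
  have C1: "C1 \<ge> 0" using C0 LP L by (simp add: C1_def)
  \<comment> \<open>A Lipschitz estimate in the parameter. It converts the linearisation error,
    which is small against the joint increment of parameter and solution, into one that is small
    against \<open>h\<close> alone.\<close>
  have lipw: "norm (w t (p0 + h) - w t p0) \<le> C1 * norm h"
    if t: "\<bar>t\<bar> \<le> ?T" and h: "norm h < min d1 (min d2 d3)" for t h
  proof -
    have "norm (w t (p0 + h) - w t p0) \<le>
        (norm (w 0 (p0 + h) - w 0 p0) + ((1 + LP) * norm h) * ?T) * exp (L * ?T)"
    proof (rule gronwall[OF has_vector_derivative_diff[OF w w] _ _ L(1) t])
      show "0 \<le> (1 + LP) * norm h" using LP by simp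
      fix s assume s: "\<bar>s\<bar> \<le> ?T"
      have "norm (f (s, p0 + h, w s (p0 + h)) - f (s, p0, w s p0)) \<le>
          norm (f (s, p0 + h, w s (p0 + h)) - f (s, p0 + h, w s p0)) +
          norm (f (s, p0 + h, w s p0) - f (s, p0, w s p0))"
        by (rule norm_triangle_ineq[THEN order_trans[rotated]]) simp
      moreover have "norm (f (s, p0 + h, w s (p0 + h)) - f (s, p0 + h, w s p0)) \<le> L * norm (w s (p0 + h) - w s p0)"
        by (rule L(3)[OF s]) (use h in \<open>simp add: dist_norm\<close>)
      moreover have "norm (f (s, p0 + h, w s p0) - f (s, p0, w s p0)) \<le> (1 + LP) * norm h"
      proof -
        have "norm (f (s, p0 + h, w s p0) - f (s, p0, w s p0)) \<le>
            norm (?f' s (0, h, 0)) + norm (f (s, p0 + h, w s p0) - f (s, p0, w s p0) - ?f' s (0, h, 0))"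
          by (rule norm_triangle_sub)
        also have "\<dots> \<le> LP * norm h + norm h"
          using LP(2)[OF s, of h] d2(2)[OF s, of "(h, 0)"] h by (intro add_mono) auto
        finally show ?thesis by (simp add: algebra_simps)
      qed
      ultimately show "norm (f (s, p0 + h, w s (p0 + h)) - f (s, p0, w s p0)) \<le>
          L * norm (w s (p0 + h) - w s p0) + (1 + LP) * norm h" by linarith
    qed
    also have "norm (w 0 (p0 + h) - w 0 p0) \<le> (1 + C0) * norm h"
    proof -
      have "norm (w 0 (p0 + h) - w 0 p0) \<le> norm (w0' h) + norm (w 0 (p0 + h) - w 0 p0 - w0' h)"
        by (rule norm_triangle_sub)
      also have "\<dots> \<le> norm h * C0 + 1 * norm h" using C0(2) d3(2) h by (intro add_mono) auto
      finally show ?thesis by (simp add: algebra_simps)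
    qed
    finally show ?thesis by (simp add: C1_def algebra_simps)
  qed
  define C2 where "C2 = (1 + (1 + C1) * ?T) * exp (LA * ?T)"
  have C2: "C2 > 0" using C1 by (simp add: C2_def add_pos_nonneg)
  show ?thesis unfolding has_derivative_within_alt
  proof (intro conjI allI impI)
    show "bounded_linear (Z t0)" by (rule linear_imp_bounded_linear_finite_dim[OF fdp linZ])
    fix e :: real assume e: "e > 0"
    define e' where "e' = e / C2"
    have e': "e' > 0" using e C2 by (simp add: e'_def)
    obtain d4 where d4: "d4 > 0" "!!t h. \<bar>t\<bar> \<le> ?T ==> norm h < d4 ==>
        norm (f (t, (p0, w t p0) + h) - f (t, p0, w t p0) - ?f' t (0, h)) \<le> e' * norm h"
      using uniform_linearization[OF finite_dim_prod[OF fdp fde] f cq e', of ?T] by metis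
    obtain d5 where d5: "d5 > 0" "!!h. norm h < d5 ==> norm (w 0 (p0 + h) - w 0 p0 - w0' h) \<le> e' * norm h"
      using w0e[OF e'] by blast
    \<comment> \<open>The bound \<open>d4 / (1 + C1)\<close> keeps the joint increment of parameter
      and solution below \<open>d4\<close>, where the linearisation at \<open>p0\<close> is
      accurate.\<close>
    define d where "d = min (min d1 (min d2 d3)) (min d5 (d4 / (1 + C1)))"
    have d: "d > 0" using L d2 d3 d4 d5 C1 by (simp add: d_def)
    have "norm (w t0 (p0 + h) - w t0 p0 - Z t0 h) \<le> e * norm h" if h: "norm h < d" for h
    proof -
      have h1: "norm h < min d1 (min d2 d3)" and h2: "norm h < d5" and h3: "norm h < d4 / (1 + C1)"
        using h by (auto simp: d_def)
      have h4: "(1 + C1) * norm h < d4" using h3 C1 by (simp add: pos_less_divide_eq mult.commute)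
      have "norm (w t0 (p0 + h) - w t0 p0 - Z t0 h) \<le>
          (norm (w 0 (p0 + h) - w 0 p0 - Z 0 h) + (e' * ((1 + C1) * norm h)) * ?T) * exp (LA * ?T)"
      proof (rule gronwall[OF has_vector_derivative_diff[OF has_vector_derivative_diff[OF w w] Z] _ _ LA(1) order_refl])
        show "0 \<le> e' * ((1 + C1) * norm h)" using e' C1 by simp
        fix s assume s: "\<bar>s\<bar> \<le> ?T"
        let ?u = "w s (p0 + h) - w s p0"
        have "norm (h, ?u) \<le> norm h + norm ?u" by (rule norm_Pair_le)
        also have "\<dots> \<le> (1 + C1) * norm h" using lipw[OF s h1] by (simp add: algebra_simps)
        finally have hu: "norm (h, ?u) \<le> (1 + C1) * norm h" .
        then have "norm (h, ?u) < d4" using h4 by linarith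
        from d4(2)[OF s this]
        have 1: "norm (f (s, p0 + h, w s (p0 + h)) - f (s, p0, w s p0) - ?f' s (0, h, ?u)) \<le> e' * norm (h, ?u)" by simp
        have "?f' s (0, h, ?u) = ?f' s (0, h, 0) + ?f' s (0, 0, ?u)"
          using linear_add[OF bounded_linear.linear[OF linf[of s]], of "(0, h, 0)" "(0, 0, ?u)"] by simp
        moreover have "?f' s (0, 0, ?u) - ?f' s (0, 0, Z s h) = ?f' s (0, 0, ?u - Z s h)"
          using linear_diff[OF lA[of s]] by simp
        ultimately have eq: "f (s, p0 + h, w s (p0 + h)) - f (s, p0, w s p0) -
            (?f' s (0, 0, Z s h) + ?f' s (0, h, 0)) =
            ?f' s (0, 0, ?u - Z s h) + (f (s, p0 + h, w s (p0 + h)) - f (s, p0, w s p0) - ?f' s (0, h, ?u))"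
          by (simp add: algebra_simps)
        have "norm (f (s, p0 + h, w s (p0 + h)) - f (s, p0, w s p0) -
            (?f' s (0, 0, Z s h) + ?f' s (0, h, 0))) \<le> LA * norm (?u - Z s h) + e' * norm (h, ?u)"
          unfolding eq by (rule order_trans[OF norm_triangle_ineq add_mono[OF LA(2)[OF s] 1]])
        also have "\<dots> \<le> LA * norm (?u - Z s h) + e' * ((1 + C1) * norm h)"
          using hu e' by (intro add_left_mono mult_left_mono) auto
        finally show "norm (f (s, p0 + h, w s (p0 + h)) - f (s, p0, w s p0) -
            (?f' s (0, 0, Z s h) + ?f' s (0, h, 0))) \<le> LA * norm (?u - Z s h) + e' * ((1 + C1) * norm h)" .
      qed
      also have "\<dots> \<le> (e' * norm h + (e' * ((1 + C1) * norm h)) * ?T) * exp (LA * ?T)"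
        using d5(2)[OF h2] by (intro mult_right_mono add_right_mono) (auto simp: Z0)
      also have "\<dots> = e' * C2 * norm h" by (simp add: C2_def algebra_simps)
      also have "\<dots> = e * norm h" using C2 by (simp add: e'_def)
      finally show ?thesis .
    qed
    then show "\<exists>d>0. \<forall>y\<in>UNIV. norm (y - p0) < d \<longrightarrow> norm (w t0 y - w t0 p0 - Z t0 (y - p0)) \<le> e * norm (y - p0)"
      using d by (intro exI[of _ d]) (metis add_diff_cancel_left' diff_add_cancel add.commute)
  qed
qed

text \<open>Induction on \<open>k\<close>. The derivative in the direction of a basis vector solves
  the variational equation, whose coefficients are derivatives of \<open>f\<close> along
  \<open>w\<close> and hence of class \<open>k\<close>, as \<open>w\<close> is of class
  \<open>k\<close> by the induction hypothesis. The variational equation is posed one direction at a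
  time, with values in the same space as the original one, so that the induction hypothesis applies
  to it as well.\<close>

theorem ode_param_smooth:
  fixes f :: "real \<times> 'p::real_normed_vector \<times> 'e::real_normed_vector => 'e"
  assumes fdp: "finite_dim TYPE('p)" and fde: "finite_dim TYPE('e)"
    and "k_smooth_on k UNIV f" "locally_uniformly_lipschitz f" "k_smooth_on k UNIV (%p. w 0 p)"
    "!!t p. ((%t. w t p) has_vector_derivative f (t, p, w t p)) (at t)"
  shows "k_smooth_on k UNIV (%(t, p). w t p)" using assms(3-)
proof (induction k arbitrary: f w)
  case 0
  then show ?case using ode_param_continuous[of f w] by simp
next
  case (Suc k)
  note f = Suc.prems(1) and lip = Suc.prems(2) and w0 = Suc.prems(3) and w = Suc.prems(4)
  note B = basis[OF fdp]
  have IHw: "k_smooth_on k UNIV (%(t, p). w t p)"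
    by (rule Suc.IH[OF k_smooth_on_Suc_imp[OF f] lip k_smooth_on_Suc_imp[OF w0] w])
  have fd3: "finite_dim TYPE(real \<times> 'p \<times> 'e)" by (intro finite_dim_prod finite_dim_real fdp fde)
  have graph: "k_smooth_on k UNIV (%x. (fst x, snd x, w (fst x) (snd x)))"
    by (intro k_smooth_on_Pair open_UNIV IHw[unfolded split_beta]
        k_smooth_on_bounded_linear[OF bounded_linear_fst] k_smooth_on_bounded_linear[OF bounded_linear_snd])
  define A where "A = (%(x::real \<times> 'p) e. frechet_derivative f (at (fst x, snd x, w (fst x) (snd x))) (0, 0, e))"
  define \<beta> where "\<beta> = (%h (x::real \<times> 'p). frechet_derivative f (at (fst x, snd x, w (fst x) (snd x))) (0, h, 0))"
  have F': "k_smooth_on k UNIV (%x. frechet_derivative f (at (fst x, snd x, w (fst x) (snd x))) v)" for v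
    using k_smooth_on_compose[OF fd3 open_UNIV open_UNIV _ k_smooth_on_SucD(2)[OF f] graph, of v] by simp
  have linf: "bounded_linear (frechet_derivative f (at x))" for x
    using k_smooth_on_SucD(1)[OF f] has_derivative_bounded_linear by blast
  have linA: "linear (A x)" for x unfolding A_def
    by (intro bounded_linear.linear bounded_linear_compose[OF linf] bounded_linear_Pair
        bounded_linear_zero bounded_linear_ident)
  have lin\<beta>: "linear (%h. \<beta> h x)" for x unfolding \<beta>_def
    by (intro bounded_linear.linear bounded_linear_compose[OF linf] bounded_linear_Pair
        bounded_linear_zero bounded_linear_ident)
  have sA: "k_smooth_on k UNIV (%x. A x c)" for c unfolding A_def by (rule F')
  have s\<beta>: "k_smooth_on k UNIV (\<beta> h)" for h unfolding \<beta>_def by (rule F')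
  note cA = k_smooth_on_imp_continuous_on[OF sA] and c\<beta> = k_smooth_on_imp_continuous_on[OF s\<beta>]
  let ?w0' = "%p. frechet_derivative (%p. w 0 p) (at p)"
  have "\<exists>z. \<forall>b. (\<forall>p. z b 0 p = ?w0' p b) \<and>
      (\<forall>t p. ((%t. z b t p) has_vector_derivative A (t, p) (z b t p) + \<beta> b (t, p)) (at t))"
  proof (rule choice, rule allI)
    fix b
    obtain z where "!!p. z 0 p = ?w0' p b"
      "!!t p. ((%t. z t p) has_vector_derivative A (t, p) (z t p) + \<beta> b (t, p)) (at t)"
      by (rule linear_ode_solution[OF fde linA cA c\<beta>, where ?z0.0 = "%p. ?w0' p b"]) blast
    then show "\<exists>z. (\<forall>p. z 0 p = ?w0' p b) \<and>
      (\<forall>t p. ((%t. z t p) has_vector_derivative A (t, p) (z t p) + \<beta> b (t, p)) (at t))" by blast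
  qed
  then obtain z where z0: "!!b p. z b 0 p = ?w0' p b"
    and z: "!!b t p. ((%t. z b t p) has_vector_derivative A (t, p) (z b t p) + \<beta> b (t, p)) (at t)" by blast
  have sz: "k_smooth_on k UNIV (%(t, p). z b t p)" for b
  proof (rule Suc.IH[where f = "%(t, p, e). A (t, p) e + \<beta> b (t, p)"])
    have 1: "k_smooth_on k UNIV (%x::real \<times> 'p \<times> 'e. (fst x, fst (snd x)))"
      by (intro k_smooth_on_Pair open_UNIV k_smooth_on_bounded_linear bounded_linear_fst
          bounded_linear_compose[OF bounded_linear_fst bounded_linear_snd])
    have fd2: "finite_dim TYPE(real \<times> 'p)" by (intro finite_dim_prod finite_dim_real fdp)
    have 2: "k_smooth_on k UNIV (%x::real \<times> 'p \<times> 'e. snd (snd x))"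
      by (intro k_smooth_on_bounded_linear open_UNIV bounded_linear_compose[OF bounded_linear_snd bounded_linear_snd])
    have "k_smooth_on k UNIV (%x::real \<times> 'p \<times> 'e. A (fst x, fst (snd x)) (snd (snd x)) + \<beta> b (fst x, fst (snd x)))"
      by (intro k_smooth_on_add open_UNIV k_smooth_on_linear_family[OF fde _ linA _ 2]
          k_smooth_on_compose[OF fd2 open_UNIV open_UNIV _ s\<beta> 1]
          k_smooth_on_compose[OF fd2 open_UNIV open_UNIV _ sA 1]) auto
    moreover have "(%(t, p, e). A (t, p) e + \<beta> b (t, p)) =
        (%x. A (fst x, fst (snd x)) (snd (snd x)) + \<beta> b (fst x, fst (snd x)))" by (intro ext) (simp add: split_beta)
    ultimately show "k_smooth_on k UNIV (%(t, p, e). A (t, p) e + \<beta> b (t, p))" by (simp only:)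
    show "locally_uniformly_lipschitz (%(t, p, e). A (t, p) e + \<beta> b (t, p))"
      by (rule locally_uniformly_lipschitz_linear[OF fde linA cA])
    show "k_smooth_on k UNIV (%p. z b 0 p)" unfolding z0 by (rule k_smooth_on_SucD(2)[OF w0])
  qed (use z in simp)
  define Z where "Z = (%p t h. \<Sum>b\<in>basis. coord b h *\<^sub>R z b t p)"
  have linZ: "linear (Z p t)" for p t unfolding Z_def
    by (intro bounded_linear.linear bounded_linear_sum bounded_linear_compose[OF bounded_linear_scaleR_left B(2)])
  have derp: "((%p. w t p) has_derivative Z p t) (at p)" for t p
  proof (rule ode_param_derivative[OF fdp fde f lip _ k_smooth_on_imp_continuous_on[OF w0] w linZ])
    show "((%p. w 0 p) has_derivative ?w0' p) (at p)" by (rule k_smooth_on_SucD(1)[OF w0]) simp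
    then have "linear (?w0' p)" by (rule has_derivative_linear)
    then show "Z p 0 = ?w0' p" by (intro ext) (simp add: Z_def z0 linear_expand[OF B(3), symmetric])
    fix t h
    have "((%t. Z p t h) has_vector_derivative
        (\<Sum>b\<in>basis. coord b h *\<^sub>R (A (t, p) (z b t p) + \<beta> b (t, p)))) (at t)" unfolding Z_def
      by (intro has_vector_derivative_sum bounded_linear.has_vector_derivative[OF bounded_linear_scaleR_right z])
    moreover have "(\<Sum>b\<in>basis. coord b h *\<^sub>R (A (t, p) (z b t p) + \<beta> b (t, p))) = A (t, p) (Z p t h) + \<beta> h (t, p)"
      by (subst linear_expand[OF B(3) lin\<beta>])
        (simp add: Z_def linear_sum[OF linA] linear_cmul[OF linA] scaleR_add_right sum.distrib)
    ultimately show "((%t. Z p t h) has_vector_derivative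
       frechet_derivative f (at (t, p, w t p)) (0, 0, Z p t h) +
       frechet_derivative f (at (t, p, w t p)) (0, h, 0)) (at t)" by (simp add: A_def \<beta>_def)
  qed
  let ?F = "%x. f (fst x, snd x, w (fst x) (snd x))"
  have sF: "k_smooth_on k UNIV ?F"
    using k_smooth_on_compose[OF fd3 open_UNIV open_UNIV _ k_smooth_on_Suc_imp[OF f] graph] by simp
  have der: "((%(t, p). w t p) has_derivative (%v. fst v *\<^sub>R ?F x + Z (snd x) (fst x) (snd v))) (at x)" for x
  proof -
    obtain t p where x: "x = (t, p)" by (cases x)
    have swap: "((%x. (snd x, fst x)) has_derivative (%v. (snd v, fst v))) (at (t, p))"
      by (auto intro!: derivative_eq_intros)
    \<comment> \<open>Joint differentiability from partial derivatives asks for continuity of the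
      partial derivative in the second argument. The time derivative is continuous by the equation,
      so time is put second and the swap is undone afterwards.\<close>
    have "((%(p, t). w t p) has_derivative
        (%(h, \<tau>). Z p t h + blinfun_apply (blinfun_scaleR_left (f (t, p, w t p))) \<tau>)) (at (p, t) within UNIV \<times> UNIV)"
    proof (rule has_derivative_partialsI[where fy = "%p t. blinfun_scaleR_left (f (t, p, w t p))"])
      show "((%p. w t p) has_derivative Z p t) (at p within UNIV)" by (rule derp)
      show "((%t. w t p) has_derivative blinfun_apply (blinfun_scaleR_left (f (t, p, w t p)))) (at t within UNIV)" for p t
        using w[of p t] by (simp add: has_vector_derivative_def)
      have "continuous_on UNIV (%(p, t). blinfun_scaleR_left (f (t, p, w t p)))"
        using continuous_on_compose2[OF k_smooth_on_imp_continuous_on[OF sF], of UNIV "%x. (snd x, fst x)"]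
        unfolding split_beta by (intro bounded_linear.continuous_on[OF bounded_linear_blinfun_scaleR_left])
          (simp add: continuous_on_Pair continuous_on_fst continuous_on_snd continuous_on_id)
      then show "continuous (at (p, t) within UNIV \<times> UNIV) (%(p, t). blinfun_scaleR_left (f (t, p, w t p)))"
        by (simp add: continuous_on_eq_continuous_at)
    qed auto
    then have "((%(p, t). w t p) has_derivative
        (%(h, \<tau>). Z p t h + blinfun_apply (blinfun_scaleR_left (f (t, p, w t p))) \<tau>)) (at (snd (t, p), fst (t, p)))"
      by simp
    from has_derivative_compose[OF swap this]
    show ?thesis by (simp add: x case_prod_unfold add.commute)
  qed
  show ?case
  proof (rule k_smooth_on_SucI[OF open_UNIV der])
    fix v :: "real \<times> 'p"
    show "k_smooth_on k UNIV (%x. fst v *\<^sub>R ?F x + Z (snd x) (fst x) (snd v))" unfolding Z_def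
      by (intro k_smooth_on_add k_smooth_on_sum k_smooth_on_scaleR k_smooth_on_const open_UNIV sF
          sz[unfolded split_beta])
  qed
qed

subsection \<open>Flows of smooth time-dependent vector fields\<close>

lemma has_vector_derivative_shift:
  assumes "!!t. (u has_vector_derivative u' t) (at t)"
  shows "((%t. u (r + t)) has_vector_derivative u' (r + t)) (at t)"
proof -
  have "((%t. r + t) has_real_derivative 1) (at t)" by (auto intro!: derivative_eq_intros)
  from vector_diff_chain_at[OF this[unfolded has_real_derivative_iff_has_vector_derivative] assms]
  show ?thesis by (simp add: o_def)
qed

lemma ode_unique:
  fixes f :: "real => 'a::real_normed_vector => 'a"
  assumes lip: "!!T. \<exists>L. \<forall>t x y. \<bar>t\<bar> \<le> T \<longrightarrow> norm (f t x - f t y) \<le> L * norm (x - y)"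
    and u: "!!t. (u has_vector_derivative f t (u t)) (at t)"
    and v: "!!t. (v has_vector_derivative f t (v t)) (at t)"
    and eq: "u s = v s"
  shows "u t = v t"
proof -
  define T where "T = \<bar>t - s\<bar>"
  obtain L where L: "!!t x y. \<bar>t\<bar> \<le> \<bar>s\<bar> + T ==> norm (f t x - f t y) \<le> L * norm (x - y)"
    using lip[of "\<bar>s\<bar> + T"] by blast
  have "norm (u (s + (t - s)) - v (s + (t - s))) \<le> (norm (u (s + 0) - v (s + 0)) + 0 * T) * exp (\<bar>L\<bar> * T)"
  proof (rule gronwall[OF has_vector_derivative_diff[OF has_vector_derivative_shift[OF u]
          has_vector_derivative_shift[OF v]]])
    fix r assume "\<bar>r\<bar> \<le> T"
    then have "\<bar>s + r\<bar> \<le> \<bar>s\<bar> + T" by linarith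
    from L[OF this, of "u (s + r)" "v (s + r)"]
    show "norm (f (s + r) (u (s + r)) - f (s + r) (v (s + r))) \<le> \<bar>L\<bar> * norm (u (s + r) - v (s + r)) + 0"
      using mult_right_mono[OF abs_ge_self[of L] norm_ge_zero[of "u (s + r) - v (s + r)"]] by simp
  qed (auto simp: T_def)
  then show ?thesis using eq by simp
qed

lemma C_inf_compose:
  fixes f :: "'b::real_normed_vector => 'c::real_normed_vector"
  assumes "finite_dim TYPE('b)" "C_inf_on UNIV f" "C_inf_on S g" "open S"
  shows "C_inf_on S (%x. f (g x))"
  using k_smooth_on_compose[OF assms(1) assms(4) open_UNIV subset_UNIV] assms(2,3) by blast

text \<open>The starting time is made part of the parameter: \<open>w t (r, y)\<close> is the
  position after time \<open>t\<close> of the solution through \<open>y\<close> at time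
  \<open>r\<close>. The inverse flow then runs from time \<open>t\<close> for the duration
  \<open>-t\<close>, and smooth dependence on parameters covers it too.\<close>

lemma smooth_flow:
  fixes V :: "real \<times> 'b::real_normed_vector => 'b"
  assumes fd: "finite_dim TYPE('b)" and V: "C_inf_on UNIV V"
    and lip: "!!T. \<exists>L. \<forall>t x y. \<bar>t\<bar> \<le> T \<longrightarrow> norm (V (t, x) - V (t, y)) \<le> L * norm (x - y)"
  obtains \<phi> \<psi> where "!!y. \<phi> 0 y = y" "!!t y. ((%t. \<phi> t y) has_vector_derivative V (t, \<phi> t y)) (at t)"
    "C_inf_on UNIV (%(t, y). \<phi> t y)" "C_inf_on UNIV (%(t, y). \<psi> t y)"
    "!!t y. \<phi> t (\<psi> t y) = y" "!!t y. \<psi> t (\<phi> t y) = y"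
proof -
  have cV: "continuous_on UNIV V" using V k_smooth_on_imp_continuous_on by blast
  have lipr: "\<exists>L. \<forall>t x y. \<bar>t\<bar> \<le> T \<longrightarrow> norm (V (r + t, x) - V (r + t, y)) \<le> L * norm (x - y)" for r T
  proof -
    obtain L where "!!t x y. \<bar>t\<bar> \<le> \<bar>r\<bar> + T ==> norm (V (t, x) - V (t, y)) \<le> L * norm (x - y)" using lip by blast
    moreover have "\<bar>r + t\<bar> \<le> \<bar>r\<bar> + T" if "\<bar>t\<bar> \<le> T" for t using that by linarith
    ultimately show ?thesis by blast
  qed
  have "\<exists>u. u 0 = y \<and> (\<forall>t. (u has_vector_derivative V (r + t, u t)) (at t))" for r y
  proof -
    obtain u where "u 0 = y" "!!t. (u has_vector_derivative V (r + t, u t)) (at t)"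
    proof (rule picard_lindeloef[OF fd, where f = "%t u. V (r + t, u)" and ?x0.0 = y])
      show "continuous_on UNIV (%(t, x). V (r + t, x))" unfolding case_prod_unfold
        by (rule continuous_on_compose2[OF cV]) (auto intro!: continuous_intros)
    qed (use lipr in blast)+
    then show ?thesis by blast
  qed
  note ex = this
  define w0 where "w0 = (%r y. SOME u. u 0 = y \<and> (\<forall>t. (u has_vector_derivative V (r + t, u t)) (at t)))"
  have w0: "w0 r y 0 = y" "(w0 r y has_vector_derivative V (r + t, w0 r y t)) (at t)" for r y t
    using someI_ex[OF ex[of y r]] by (auto simp: w0_def)
  define w where "w = (%t p. w0 (fst p) (snd p) t)"
  have w: "w 0 p = snd p" "((%t. w t p) has_vector_derivative V (fst p + t, w t p)) (at t)" for t p
    using w0 by (simp_all add: w_def)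
  have fd2: "finite_dim TYPE(real \<times> 'b)" by (intro finite_dim_prod finite_dim_real fd)
  have sw: "C_inf_on UNIV (%(t, p). w t p)"
  proof
    fix k
    show "k_smooth_on k UNIV (%(t, p). w t p)"
    proof (rule ode_param_smooth[OF fd2 fd, where f = "%x. V (fst (fst (snd x)) + fst x, snd (snd x))"])
      show "k_smooth_on k UNIV (%x::real \<times> (real \<times> 'b) \<times> 'b. V (fst (fst (snd x)) + fst x, snd (snd x)))"
        by (intro C_inf_compose[OF fd2 V, THEN spec] allI k_smooth_on_bounded_linear open_UNIV
            bounded_linear_Pair bounded_linear_add bounded_linear_fst bounded_linear_snd
            bounded_linear_compose[OF bounded_linear_fst] bounded_linear_compose[OF bounded_linear_snd])
      show "k_smooth_on k UNIV (%p. w 0 p)"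
        unfolding w(1) by (intro k_smooth_on_bounded_linear bounded_linear_snd open_UNIV)
      show "((%t. w t p) has_vector_derivative V (fst (fst (snd (t, p, w t p))) + fst (t, p, w t p),
          snd (snd (t, p, w t p)))) (at t)" for t p using w(2) by simp
      have "\<exists>L\<ge>0. \<exists>d>0. \<forall>t p y y'. \<bar>t\<bar> \<le> T \<longrightarrow> dist p p0 < d \<longrightarrow>
          norm (V (fst p + t, y) - V (fst p + t, y')) \<le> L * norm (y - y')" for T and p0 :: "real \<times> 'b"
      proof -
        obtain L where L: "!!t x y. \<bar>t\<bar> \<le> \<bar>fst p0\<bar> + 1 + T ==> norm (V (t, x) - V (t, y)) \<le> L * norm (x - y)"
          using lip by blast
        have "norm (V (fst p + t, y) - V (fst p + t, y')) \<le> \<bar>L\<bar> * norm (y - y')"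
          if "\<bar>t\<bar> \<le> T" "dist p p0 < 1" for t p y y'
        proof -
          have "\<bar>fst p - fst p0\<bar> < 1" using that(2) dist_fst_le[of p p0] by (simp add: dist_real_def)
          then have "\<bar>fst p + t\<bar> \<le> \<bar>fst p0\<bar> + 1 + T" using that(1) by linarith
          from L[OF this, of y y'] mult_right_mono[OF abs_ge_self[of L] norm_ge_zero[of "y - y'"]] show ?thesis by simp
        qed
        then show ?thesis by (intro exI[of _ "\<bar>L\<bar>"] exI[of _ 1] conjI) auto
      qed
      then show "locally_uniformly_lipschitz (%x::real \<times> (real \<times> 'b) \<times> 'b. V (fst (fst (snd x)) + fst x, snd (snd x)))"
        unfolding locally_uniformly_lipschitz_def fst_conv snd_conv by blast
    qed
  qed
  \<comment> \<open>Both sides solve, in \<open>s\<close>, the equation shifted by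
    \<open>r + t\<close>, and they agree at \<open>s = 0\<close>.\<close>
  have cocycle: "w s (r + t, w t (r, y)) = w (t + s) (r, y)" for s r t y
  proof (rule ode_unique[where f = "%s x. V (r + t + s, x)" and s = 0 and t = s, OF lipr])
    show "((%s. w s (r + t, w t (r, y))) has_vector_derivative V (r + t + s, w s (r + t, w t (r, y)))) (at s)" for s
      using w(2)[of "(r + t, w t (r, y))" s] by simp
    show "((%s. w (t + s) (r, y)) has_vector_derivative V (r + t + s, w (t + s) (r, y))) (at s)" for s
      using has_vector_derivative_shift[OF w(2)[of "(r, y)"], of t s] by (simp add: add.assoc)
  qed (simp add: w(1))
  define \<phi> where "\<phi> = (%t y. w t (0, y))"
  define \<psi> where "\<psi> = (%t y. w (- t) (t, y))"
  have fd3: "finite_dim TYPE(real \<times> real \<times> 'b)" by (intro finite_dim_prod finite_dim_real fd)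
  show ?thesis
  proof (rule that[of \<phi> \<psi>])
    show "\<phi> 0 y = y" for y by (simp add: \<phi>_def w)
    show "((%t. \<phi> t y) has_vector_derivative V (t, \<phi> t y)) (at t)" for t y
      using w(2)[of "(0, y)" t] by (simp add: \<phi>_def)
    show "\<phi> t (\<psi> t y) = y" for t y using cocycle[of t t "- t" y] by (simp add: \<phi>_def \<psi>_def w)
    show "\<psi> t (\<phi> t y) = y" for t y using cocycle[of "- t" 0 t y] by (simp add: \<phi>_def \<psi>_def w)
    have "C_inf_on UNIV (%x. (%(t, p). w t p) (fst x, 0, snd x))"
      by (intro C_inf_compose[OF fd3 sw] allI k_smooth_on_bounded_linear open_UNIV bounded_linear_Pair
          bounded_linear_fst bounded_linear_snd bounded_linear_zero)
    then show "C_inf_on UNIV (%(t, y). \<phi> t y)" by (simp add: \<phi>_def case_prod_unfold)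
    have "C_inf_on UNIV (%x. (%(t, p). w t p) (- fst x, fst x, snd x))"
      by (intro C_inf_compose[OF fd3 sw] allI k_smooth_on_bounded_linear open_UNIV bounded_linear_Pair
          bounded_linear_fst bounded_linear_snd bounded_linear_minus)
    then show "C_inf_on UNIV (%(t, y). \<psi> t y)" by (simp add: \<psi>_def case_prod_unfold)
  qed
qed

text \<open>The fundamental solution, obtained one initial vector at a time. Linearity and
  injectivity are uniqueness statements: linear combinations of solutions are solutions, and a
  solution that vanishes once vanishes always.\<close>

lemma smooth_linear_flow:
  fixes A :: "real \<times> 'p::real_normed_vector => 'e::real_normed_vector => 'e"
  assumes fdp: "finite_dim TYPE('p)" and fde: "finite_dim TYPE('e)"
    and lin: "!!x. linear (A x)" and A: "!!c. C_inf_on UNIV (%x. A x c)"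
  obtains M where "!!p v. M 0 p v = v" "!!t p. linear (M t p)" "!!t p. inj (M t p)"
    "!!v. C_inf_on UNIV (%(t, p). M t p v)"
    "!!t p v. ((%t. M t p v) has_vector_derivative A (t, p) (M t p v)) (at t)"
    "!!p u t. (!!t. (u has_vector_derivative A (t, p) (u t)) (at t)) ==> u t = M t p (u 0)"
proof -
  have cA: "continuous_on UNIV (%x. A x c)" for c using A[of c] k_smooth_on_imp_continuous_on by blast
  have "\<exists>z. (\<forall>p. z 0 p = v) \<and> (\<forall>t p. ((%t. z t p) has_vector_derivative A (t, p) (z t p) + 0) (at t))" for v
  proof -
    obtain z where "!!p. z 0 p = v" "!!t p. ((%t. z t p) has_vector_derivative A (t, p) (z t p) + (%_. 0) (t, p)) (at t)"
      by (rule linear_ode_solution[OF fde lin cA continuous_on_const, where ?z0.0 = "%p. v"]) blast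
    then show ?thesis by auto
  qed
  then obtain z where z: "!!v p. z v 0 p = v"
    "!!v t p. ((%t. z v t p) has_vector_derivative A (t, p) (z v t p)) (at t)" by (metis add.right_neutral)
  have lip: "\<exists>L. \<forall>t x y. \<bar>t\<bar> \<le> T \<longrightarrow> norm (A (t, p) x - A (t, p) y) \<le> L * norm (x - y)" for T p
  proof -
    obtain L d where L: "d > 0" "!!t q e. \<bar>t\<bar> \<le> T ==> dist q p < d ==> norm (A (t, q) e) \<le> L * norm e"
      by (rule linear_family_bound[OF fde lin cA]) blast
    then have "norm (A (t, p) (x - y)) \<le> L * norm (x - y)" if "\<bar>t\<bar> \<le> T" for t x y using that by simp
    then show ?thesis by (metis linear_diff[OF lin])
  qed
  define M where "M = (%t p v. z v t p)"
  have uniq: "u t = v t" if "!!t. (u has_vector_derivative A (t, p) (u t)) (at t)"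
    "!!t. (v has_vector_derivative A (t, p) (v t)) (at t)" "u s = v s" for u v t s p
    by (rule ode_unique[OF lip that])
  show ?thesis
  proof (rule that[of M])
    show "M 0 p v = v" for p v by (simp add: M_def z)
    show M': "((%t. M t p v) has_vector_derivative A (t, p) (M t p v)) (at t)" for t p v
      by (simp add: M_def z)
    show "u t = M t p (u 0)" if "!!t. (u has_vector_derivative A (t, p) (u t)) (at t)" for p u t
      by (rule uniq[OF that M', of 0]) (simp add: M_def z)
    show linM: "linear (M t p)" for t p
    proof (rule linearI)
      show "M t p (x + y) = M t p x + M t p y" for x y by (rule uniq[OF M', of "%t. M t p x + M t p y" p 0])
          (use has_vector_derivative_add[OF M' M'] in \<open>auto simp: linear_add[OF lin] M_def z\<close>)
      show "M t p (r *\<^sub>R x) = r *\<^sub>R M t p x" for r x by (rule uniq[OF M', of "%t. r *\<^sub>R M t p x" p 0])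
          (use bounded_linear.has_vector_derivative[OF bounded_linear_scaleR_right M'] in
            \<open>auto simp: linear_cmul[OF lin] M_def z\<close>)
    qed
    show "inj (M t p)" for t p
    proof (subst linear_injective_0[OF linM], intro allI impI)
      fix v assume v: "M t p v = 0"
      have "M 0 p v = 0" by (rule uniq[OF M', of "%t. 0" p t]) (use v in \<open>auto simp: linear_0[OF lin]\<close>)
      then show "v = 0" by (simp add: M_def z)
    qed
    show "C_inf_on UNIV (%(t, p). M t p v)" for v
    proof
      fix k
      have fdr: "finite_dim TYPE(real \<times> 'p)" by (intro finite_dim_prod finite_dim_real fdp)
      show "k_smooth_on k UNIV (%(t, p). M t p v)" unfolding M_def
      proof (rule ode_param_smooth[OF fdp fde, where f = "%(t, p, e). A (t, p) e + (%_. 0) (t, p)" and w = "z v"])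
        have 1: "k_smooth_on k UNIV (%x::real \<times> 'p \<times> 'e. (fst x, fst (snd x)))"
          by (intro k_smooth_on_bounded_linear open_UNIV bounded_linear_Pair bounded_linear_fst
              bounded_linear_compose[OF bounded_linear_fst bounded_linear_snd])
        have 2: "k_smooth_on k UNIV (%x::real \<times> 'p \<times> 'e. snd (snd x))"
          by (intro k_smooth_on_bounded_linear open_UNIV bounded_linear_compose[OF bounded_linear_snd bounded_linear_snd])
        have 3: "k_smooth_on k UNIV (%x::real \<times> 'p \<times> 'e. A (fst x, fst (snd x)) c)" for c
          using k_smooth_on_compose[OF fdr open_UNIV open_UNIV subset_UNIV spec[OF A] 1] .
        have "k_smooth_on k UNIV (%x::real \<times> 'p \<times> 'e. A (fst x, fst (snd x)) (snd (snd x)))"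
          by (rule k_smooth_on_linear_family[OF fde open_UNIV lin 3 2])
        then show "k_smooth_on k UNIV (%(t, p, e). A (t, p) e + (%_. 0) (t, p))"
          by (simp add: case_prod_unfold)
        show "locally_uniformly_lipschitz (%(t, p, e). A (t, p) e + (%_. 0) (t, p))"
          by (rule locally_uniformly_lipschitz_linear[OF fde lin cA])
      qed (use z in auto)
    qed
  qed
qed

section \<open>Functions on manifolds\<close>

lemma smooth_fun_on_subset: "smooth_fun_on \<A> D f ==> E \<subseteq> D ==> smooth_fun_on \<A> E f"
  unfolding smooth_fun_on_def by (fast elim: smooth_on_subset)

lemma smooth_fun_on_const: "smooth_fun_on \<A> D (%x. a)" by (auto simp: smooth_fun_on_def o_def smooth_on_const)

lemma smooth_fun_on_add: "smooth_fun_on \<A> D f ==> smooth_fun_on \<A> D g ==> smooth_fun_on \<A> D (%x. f x + g x)"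
  by (auto simp: smooth_fun_on_def o_def intro!: smooth_on_add)

lemma smooth_fun_on_diff: "smooth_fun_on \<A> D f ==> smooth_fun_on \<A> D g ==> smooth_fun_on \<A> D (%x. f x - g x)"
  by (auto simp: smooth_fun_on_def o_def intro!: smooth_on_diff)

lemma smooth_fun_on_minus: "smooth_fun_on \<A> D f ==> smooth_fun_on \<A> D (%x. - f x)"
  by (auto simp: smooth_fun_on_def o_def intro!: smooth_on_minus)

lemma smooth_fun_on_scaleR: "smooth_fun_on \<A> D f ==> smooth_fun_on \<A> D g ==> smooth_fun_on \<A> D (%x. f x *\<^sub>R g x)"
  by (auto simp: smooth_fun_on_def o_def intro!: smooth_on_scaleR)

lemma smooth_fun_on_mult:
  fixes f g :: "'m => real"
  shows "smooth_fun_on \<A> D f ==> smooth_fun_on \<A> D g ==> smooth_fun_on \<A> D (%x. f x * g x)"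
  by (auto simp: smooth_fun_on_def o_def intro!: smooth_on_mult)

lemma smooth_fun_on_sum:
  "(!!i. i \<in> I ==> smooth_fun_on \<A> D (f i)) ==> smooth_fun_on \<A> D (%x. \<Sum>i\<in>I. f i x)"
  by (induction I rule: infinite_finite_induct) (auto intro: smooth_fun_on_add smooth_fun_on_const)

lemma smooth_fun_on_prod:
  fixes f :: "'i => 'm => real"
  shows "(!!i. i \<in> I ==> smooth_fun_on \<A> D (f i)) ==> smooth_fun_on \<A> D (%x. \<Prod>i\<in>I. f i x)"
  by (induction I rule: infinite_finite_induct) (auto intro: smooth_fun_on_mult smooth_fun_on_const)

lemma smooth_fun_on_bounded_linear:
  "bounded_linear h ==> smooth_fun_on \<A> D f ==> smooth_fun_on \<A> D (%x. h (f x))" unfolding smooth_fun_on_def o_def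
  by (intro ballI) (clarsimp, rule smooth_on_bounded_linear_compose, assumption, fast)

lemma inv_into_map_prod_id:
  assumes "inj_on c U" "y \<in> c ` U"
  shows "inv_into (UNIV \<times> U) (map_prod id c) (t, y) = (t, inv_into U c y)"
proof (rule inv_into_f_eq)
  show "inj_on (map_prod id c) (UNIV \<times> U)" using assms(1) by (auto simp: inj_on_def)
qed (use assms in \<open>auto simp: f_inv_into_f inv_into_into\<close>)

locale manifold =
  fixes \<A> :: "('m::{t2_space,second_countable_topology}, 'b::real_normed_vector) atlas"
  assumes smooth_manifold: "smooth_manifold \<A>"
begin

lemma fd: "finite_dim TYPE('b)" using smooth_manifold by (simp add: smooth_manifold_def)

lemma chart_exists: "\<exists>U c. (U, c) \<in> \<A> \<and> x \<in> U"
proof -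
  have "x \<in> \<Union>(fst ` \<A>)" using smooth_manifold by (auto simp: smooth_manifold_def)
  then show ?thesis by force
qed

lemma chart:
  assumes "(U, c) \<in> \<A>"
  shows chart_open: "open U" and chart_open_range: "open (c ` U)"
    and chart_homeomorphism: "homeomorphism U (c ` U) c (inv_into U c)"
  using smooth_manifold assms by (auto simp: smooth_manifold_def)

lemma chart_inj: "(U, c) \<in> \<A> ==> inj_on c U"
  using homeomorphism_apply1[OF chart_homeomorphism] by (metis inj_on_inverseI)

lemma chart_inv [simp]: "(U, c) \<in> \<A> ==> x \<in> U ==> inv_into U c (c x) = x" using chart_inj by simp

lemma transition:
  "(U, c) \<in> \<A> ==> (V, d) \<in> \<A> ==> smooth_on (c ` (U \<inter> V)) (%y. d (inv_into U c y))"
  using smooth_manifold by (auto simp: smooth_manifold_def o_def)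

lemma chart_open_image:
  assumes "(U, c) \<in> \<A>" "open D" "D \<subseteq> U" shows "open (c ` D)"
proof -
  have "open (inv_into U c -` D \<inter> c ` U)"
    using homeomorphism_cont2[OF chart_homeomorphism[OF assms(1)]] chart_open_range[OF assms(1)] assms(2)
    by (intro open_vimage_Int)
  also have "inv_into U c -` D \<inter> c ` U = c ` D" using assms(1,3) by auto
  finally show ?thesis .
qed

text \<open>One chart around each point suffices, as the transition maps carry the smoothness over
  to every other chart.\<close>

lemma smooth_fun_onI_chart:
  assumes "!!x. x \<in> D ==> \<exists>U c N. (U, c) \<in> \<A> \<and> open N \<and> x \<in> N \<and> N \<subseteq> U \<and>
    smooth_on (c ` (N \<inter> D)) (%y. f (inv_into U c y))"
  shows "smooth_fun_on \<A> D f" unfolding smooth_fun_on_def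
proof (clarify)
  fix V d assume V: "(V, d) \<in> \<A>"
  show "smooth_on (d ` (V \<inter> D)) (f \<circ> inv_into V d)"
  proof (rule smooth_on_local)
    fix y assume "y \<in> d ` (V \<inter> D)"
    then obtain x where x: "x \<in> V" "x \<in> D" "y = d x" by blast
    obtain U c N where U: "(U, c) \<in> \<A>" "open N" "x \<in> N" "N \<subseteq> U"
      "smooth_on (c ` (N \<inter> D)) (%y. f (inv_into U c y))" using assms[OF x(2)] by blast
    have o: "open (d ` (V \<inter> N))" by (rule chart_open_image[OF V]) (use chart_open[OF V] U in auto)
    have sub: "d ` (V \<inter> D) \<inter> d ` (V \<inter> N) \<subseteq> d ` (V \<inter> N \<inter> D)" using chart_inj[OF V] by (auto simp: inj_on_def)
    have "smooth_on (d ` (V \<inter> N \<inter> D)) (%y. c (inv_into V d y))"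
      by (rule smooth_on_subset[OF transition[OF V U(1)]]) (use U in auto)
    then have "smooth_on (d ` (V \<inter> N \<inter> D)) (%y. f (inv_into U c (c (inv_into V d y))))"
      by (rule smooth_on_compose[OF fd U(5)]) (use V in auto)
    then have "smooth_on (d ` (V \<inter> N \<inter> D)) (f \<circ> inv_into V d)" by (rule smooth_on_cong) (use U V in auto)
    then show "\<exists>W. open W \<and> y \<in> W \<and> smooth_on (d ` (V \<inter> D) \<inter> W) (f \<circ> inv_into V d)"
      using o x U(3) sub by (intro exI[of _ "d ` (V \<inter> N)"]) (auto intro: smooth_on_subset)
  qed
qed

lemma smooth_fun_on_local:
  assumes "!!x. x \<in> D ==> \<exists>N. open N \<and> x \<in> N \<and> smooth_fun_on \<A> (N \<inter> D) f"
  shows "smooth_fun_on \<A> D f"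
proof (rule smooth_fun_onI_chart)
  fix x assume x: "x \<in> D"
  obtain N where N: "open N" "x \<in> N" "smooth_fun_on \<A> (N \<inter> D) f" using assms[OF x] by blast
  obtain U c where U: "(U, c) \<in> \<A>" "x \<in> U" using chart_exists by blast
  have "smooth_on (c ` (U \<inter> (N \<inter> D))) (f \<circ> inv_into U c)" using N(3) U(1) by (auto simp: smooth_fun_on_def)
  then show "\<exists>U c N. (U, c) \<in> \<A> \<and> open N \<and> x \<in> N \<and> N \<subseteq> U \<and>
      smooth_on (c ` (N \<inter> D)) (%y. f (inv_into U c y))" using U N chart_open[OF U(1)]
    by (intro exI[of _ U] exI[of _ c] exI[of _ "U \<inter> N"]) (auto simp: o_def Int_assoc)
qed

lemma smooth_fun_on_cong:
  assumes "smooth_fun_on \<A> D f" "!!x. x \<in> D ==> f x = g x"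
  shows "smooth_fun_on \<A> D g" unfolding smooth_fun_on_def
proof clarify
  fix U c assume U: "(U, c) \<in> \<A>"
  then have "smooth_on (c ` (U \<inter> D)) (f \<circ> inv_into U c)" using assms(1) by (auto simp: smooth_fun_on_def)
  then show "smooth_on (c ` (U \<inter> D)) (g \<circ> inv_into U c)" by (rule smooth_on_cong) (use U assms(2) in auto)
qed

lemma smooth_fun_on_chart:
  assumes "(U, c) \<in> \<A>" "N \<subseteq> U" "open N" "smooth_on (c ` N) (%y. f (inv_into U c y))"
  shows "smooth_fun_on \<A> N f"
  by (rule smooth_fun_onI_chart, rule exI[of _ U], rule exI[of _ c], rule exI[of _ N]) (use assms in auto)

lemma chart_smooth: "(U, c) \<in> \<A> ==> smooth_fun_on \<A> U c"
  by (rule smooth_fun_on_chart[of U c]) (auto intro!: smooth_on_cong[OF smooth_on_id] chart_open)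

lemma smooth_fun_on_extend_zero:
  assumes "smooth_fun_on \<A> N f" "open N" "closed C" "C \<subseteq> N" "!!x. x \<notin> C ==> f x = 0"
  shows "smooth_fun_on \<A> UNIV f"
proof (rule smooth_fun_on_local)
  fix x :: 'm
  show "\<exists>N. open N \<and> x \<in> N \<and> smooth_fun_on \<A> (N \<inter> UNIV) f"
  proof (cases "x \<in> N")
    case True
    then show ?thesis using assms by auto
  next
    case False
    have "smooth_fun_on \<A> (- C) f"
      by (rule smooth_fun_on_cong[OF smooth_fun_on_const[of \<A> _ 0]]) (use assms in auto)
    then show ?thesis using False assms by (intro exI[of _ "- C"]) auto
  qed
qed

lemma smooth_fun_on_compose:
  assumes "finite_dim TYPE('w)" "smooth_on T g" "smooth_fun_on \<A> D f" "!!x. x \<in> D ==> f x \<in> T"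
  shows "smooth_fun_on \<A> D (%x. g (f x :: 'w::real_normed_vector))" unfolding smooth_fun_on_def
proof clarify
  fix U c assume U: "(U, c) \<in> \<A>"
  then have "smooth_on (c ` (U \<inter> D)) (%y. f (inv_into U c y))" using assms(3) by (auto simp: smooth_fun_on_def o_def)
  then have "smooth_on (c ` (U \<inter> D)) (%y. g (f (inv_into U c y)))"
    by (rule smooth_on_compose[OF assms(1,2)]) (use U assms(4) in auto)
  then show "smooth_on (c ` (U \<inter> D)) ((%x. g (f x)) \<circ> inv_into U c)" by (simp add: o_def)
qed

lemma smooth_fun_on_imp_continuous_on:
  assumes "smooth_fun_on \<A> D f" "open D" shows "continuous_on D f"
proof (rule continuous_at_imp_continuous_on, rule ballI)
  fix x assume x: "x \<in> D"
  obtain U c where U: "(U, c) \<in> \<A>" "x \<in> U" using chart_exists by blast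
  have "smooth_on (c ` (U \<inter> D)) (f \<circ> inv_into U c)" using assms(1) U(1) by (auto simp: smooth_fun_on_def)
  then have "continuous_on (c ` (U \<inter> D)) (f \<circ> inv_into U c)" by (rule smooth_on_imp_continuous_on)
  moreover have "continuous_on (U \<inter> D) c"
    using homeomorphism_cont1[OF chart_homeomorphism[OF U(1)]] continuous_on_subset by blast
  ultimately have "continuous_on (U \<inter> D) (%x. (f \<circ> inv_into U c) (c x))" by (rule continuous_on_compose2) auto
  then have "continuous_on (U \<inter> D) f" by (rule continuous_on_eq) (use U(1) in auto)
  then show "isCont f x"
    using continuous_on_eq_continuous_at[of "U \<inter> D" f] chart_open[OF U(1)] assms(2) U(2) x by auto
qed

lemma smooth_manifold_line_times: "smooth_manifold (line_times \<A>)" unfolding smooth_manifold_def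
proof (intro conjI)
  show "finite_dim TYPE(real \<times> 'b)" by (intro finite_dim_prod finite_dim_real fd)
  show "\<Union>(fst ` line_times \<A>) = UNIV" using chart_exists by (fastforce simp: line_times_def image_iff)
  show "\<forall>(U, c)\<in>line_times \<A>. open U \<and> open (c ` U) \<and> homeomorphism U (c ` U) c (inv_into U c)"
  proof clarify
    fix U' c' assume "(U', c') \<in> line_times \<A>"
    then obtain U c where U: "(U, c) \<in> \<A>" and U': "U' = UNIV \<times> U" "c' = map_prod id c"
      by (auto simp: line_times_def)
    have im: "c' ` U' = UNIV \<times> c ` U" by (simp add: U' map_prod_surj_on)
    note h = chart_homeomorphism[OF U]
    have inv: "inv_into U' c' (t, y) = (t, inv_into U c y)" if "y \<in> c ` U" for t y
      unfolding U' by (rule inv_into_map_prod_id[OF chart_inj[OF U] that])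
    have "homeomorphism U' (c' ` U') c' (inv_into U' c')"
    proof (rule homeomorphismI)
      show "continuous_on U' c'" unfolding U' map_prod_def id_def case_prod_unfold
        by (intro continuous_intros continuous_on_compose2[OF homeomorphism_cont1[OF h]]) auto
      have "continuous_on (c' ` U') (%p. (fst p, inv_into U c (snd p)))" unfolding im
        by (intro continuous_intros continuous_on_compose2[OF homeomorphism_cont2[OF h]]) auto
      then show "continuous_on (c' ` U') (inv_into U' c')" by (rule continuous_on_eq) (auto simp: im inv)
      show "inv_into U' c' (c' p) = p" if "p \<in> U'" for p using that U by (auto simp: U' inv[unfolded U'])
      show "c' (inv_into U' c' q) = q" if "q \<in> c' ` U'" for q using that by (rule f_inv_into_f)
    qed (auto simp: inv_into_into)
    then show "open U' \<and> open (c' ` U') \<and> homeomorphism U' (c' ` U') c' (inv_into U' c')"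
      using chart_open[OF U] chart_open_range[OF U] unfolding im by (simp add: U' open_Times)
  qed
  show "\<forall>(U, c)\<in>line_times \<A>. \<forall>(V, d)\<in>line_times \<A>. smooth_on (c ` (U \<inter> V)) (d \<circ> inv_into U c)"
  proof clarify
    fix U' c' V' d' assume "(U', c') \<in> line_times \<A>" "(V', d') \<in> line_times \<A>"
    then obtain U c V d where U: "(U, c) \<in> \<A>" "(V, d) \<in> \<A>"
      and U': "U' = UNIV \<times> U" "c' = map_prod id c" "V' = UNIV \<times> V" "d' = map_prod id d"
      by (auto simp: line_times_def)
    have "U' \<inter> V' = UNIV \<times> (U \<inter> V)" by (auto simp: U')
    then have im: "c' ` (U' \<inter> V') = UNIV \<times> c ` (U \<inter> V)"
      unfolding U'(2) by (simp only:) (rule map_prod_surj_on; simp)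
    have "smooth_on (UNIV \<times> c ` (U \<inter> V)) (%p. (fst p, d (inv_into U c (snd p))))"
      by (intro smooth_on_Pair smooth_on_bounded_linear bounded_linear_fst
          smooth_on_compose[OF fd transition[OF U] smooth_on_bounded_linear[OF bounded_linear_snd]]) auto
    then show "smooth_on (c' ` (U' \<inter> V')) (d' \<circ> inv_into U' c')" unfolding im
      by (rule smooth_on_cong) (auto simp: U' inv_into_map_prod_id[OF chart_inj[OF U(1)]])
  qed
qed

lemma manifold_line: "manifold (line_times \<A>)" by unfold_locales (rule smooth_manifold_line_times)

end

lemma smooth_fun_on_compose_map:
  assumes "manifold \<A>" "manifold \<B>" "smooth_map_on \<A> \<B> D F" "open D" "smooth_fun_on \<B> E g"
    "!!x. x \<in> D ==> F x \<in> E"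
  shows "smooth_fun_on \<A> D (%x. g (F x))"
proof -
  interpret A: manifold \<A> by fact
  interpret B: manifold \<B> by fact
  show ?thesis
  proof (rule A.smooth_fun_on_local)
    fix x assume x: "x \<in> D"
    obtain V d where V: "(V, d) \<in> \<B>" "F x \<in> V" using B.chart_exists by blast
    let ?N = "F -` V \<inter> D"
    have o: "open ?N"
      using assms(3) by (intro open_vimage_Int assms(4) B.chart_open[OF V(1)]) (simp add: smooth_map_on_def)
    have "smooth_on (d ` (V \<inter> E)) (%y. g (inv_into V d y))"
      using assms(5) V(1) by (auto simp: smooth_fun_on_def o_def)
    moreover have "smooth_fun_on \<A> (D \<inter> F -` V) (%x. d (F x))"
      using assms(3) V(1) by (auto simp: smooth_map_on_def o_def)
    ultimately have "smooth_fun_on \<A> (D \<inter> F -` V) (%x. g (inv_into V d (d (F x))))"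
      by (rule A.smooth_fun_on_compose[OF B.fd]) (use assms(6) in blast)
    then have "smooth_fun_on \<A> (D \<inter> F -` V) (%x. g (F x))" by (rule A.smooth_fun_on_cong) (use V(1) in auto)
    then show "\<exists>N. open N \<and> x \<in> N \<and> smooth_fun_on \<A> (N \<inter> D) (%x. g (F x))"
      using o x V(2) by (intro exI[of _ ?N]) (auto simp: Int_commute Int_assoc)
  qed
qed

subsection \<open>Families of functions\<close>

abbreviation smooth_family :: "('m, 'b::real_normed_vector) atlas => (real => 'm => 'w::real_normed_vector) => bool" where
  "smooth_family \<A> h \<equiv> smooth_fun_on (line_times \<A>) UNIV (%(t, x). h t x)"

context manifold begin

lemma smooth_fun_on_line_iff:
  "smooth_fun_on (line_times \<A>) (I \<times> D) (%(t, x). h t x) \<longleftrightarrow>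
    (\<forall>(U, c)\<in>\<A>. smooth_on (I \<times> c ` (U \<inter> D)) (%(t, y). h t (inv_into U c y)))"
proof -
  have "smooth_on (map_prod id c ` (UNIV \<times> U \<inter> I \<times> D)) ((%(t, x). h t x) \<circ> inv_into (UNIV \<times> U) (map_prod id c)) \<longleftrightarrow>
      smooth_on (I \<times> c ` (U \<inter> D)) (%(t, y). h t (inv_into U c y))" (is "?L \<longleftrightarrow> ?R") if U: "(U, c) \<in> \<A>" for U c
  proof -
    have eq: "UNIV \<times> U \<inter> I \<times> D = I \<times> (U \<inter> D)" by auto
    have im: "map_prod id c ` (UNIV \<times> U \<inter> I \<times> D) = I \<times> c ` (U \<inter> D)"
      unfolding eq by (rule map_prod_surj_on) auto
    have val: "((%(t, x). h t x) \<circ> inv_into (UNIV \<times> U) (map_prod id c)) p = (%(t, y). h t (inv_into U c y)) p"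
      if "p \<in> I \<times> c ` (U \<inter> D)" for p using that by (auto simp: inv_into_map_prod_id[OF chart_inj[OF U]])
    show ?thesis
    proof
      assume ?L then show ?R unfolding im by (rule smooth_on_cong) (rule val)
    next
      assume ?R then show ?L unfolding im by (rule smooth_on_cong) (rule val[symmetric])
    qed
  qed
  then show ?thesis unfolding smooth_fun_on_def line_times_def by (auto simp: split_beta)
qed

lemma smooth_family_iff:
  "smooth_family \<A> h \<longleftrightarrow> (\<forall>(U, c)\<in>\<A>. smooth_on (UNIV \<times> c ` U) (%(t, y). h t (inv_into U c y)))"
  using smooth_fun_on_line_iff[of UNIV UNIV h] by simp

lemma smooth_on_snd_compose: "smooth_on T f ==> snd ` S \<subseteq> T ==> smooth_on S (%p. f (snd p :: 'b))"
  by (rule smooth_on_compose[OF fd _ smooth_on_bounded_linear[OF bounded_linear_snd]]) auto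

lemma smooth_family_static:
  assumes "smooth_fun_on \<A> D f" shows "smooth_fun_on (line_times \<A>) (I \<times> D) (%(t, x). f x)"
  unfolding smooth_fun_on_line_iff
proof clarify
  fix U c assume U: "(U, c) \<in> \<A>"
  then have "smooth_on (c ` (U \<inter> D)) (%y. f (inv_into U c y))" using assms by (auto simp: smooth_fun_on_def o_def)
  from smooth_on_snd_compose[OF this, of "I \<times> c ` (U \<inter> D)"]
  show "smooth_on (I \<times> c ` (U \<inter> D)) (%(t, y). f (inv_into U c y))" by (auto simp: case_prod_unfold)
qed

lemma smooth_family_time:
  assumes "smooth_on I \<phi>" shows "smooth_fun_on (line_times \<A>) (I \<times> D) (%(t, x). \<phi> t)"
  unfolding smooth_fun_on_line_iff
proof clarify
  fix U c assume U: "(U, c) \<in> \<A>"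
  have "smooth_on (I \<times> c ` (U \<inter> D)) (%p. \<phi> (fst p))"
    by (rule smooth_on_compose[OF finite_dim_real assms smooth_on_bounded_linear[OF bounded_linear_fst]]) auto
  then show "smooth_on (I \<times> c ` (U \<inter> D)) (%(t, y). \<phi> t)" by (simp add: case_prod_unfold)
qed

lemma smooth_family_reparam:
  assumes "smooth_fun_on (line_times \<A>) (J \<times> D) (%(t, x). h t x)" "smooth_on I \<phi>" "\<phi> ` I \<subseteq> J"
  shows "smooth_fun_on (line_times \<A>) (I \<times> D) (%(t, x). h (\<phi> t) x)" unfolding smooth_fun_on_line_iff
proof clarify
  fix U c assume U: "(U, c) \<in> \<A>"
  have h: "smooth_on (J \<times> c ` (U \<inter> D)) (%(t, y). h t (inv_into U c y))"
    using assms(1) U unfolding smooth_fun_on_line_iff by auto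
  have "smooth_on (I \<times> c ` (U \<inter> D)) (%p. (\<phi> (fst p), snd p))"
    by (intro smooth_on_Pair smooth_on_bounded_linear bounded_linear_snd
        smooth_on_compose[OF finite_dim_real assms(2) smooth_on_bounded_linear[OF bounded_linear_fst]]) auto
  from smooth_on_compose[OF finite_dim_prod[OF finite_dim_real fd] h this]
  show "smooth_on (I \<times> c ` (U \<inter> D)) (%(t, y). h (\<phi> t) (inv_into U c y))"
    using assms(3) by (force simp: case_prod_unfold)
qed

lemma smooth_family_slice:
  assumes "smooth_fun_on (line_times \<A>) (I \<times> D) (%(t, x). h t x)" "t \<in> I"
  shows "smooth_fun_on \<A> D (h t)" unfolding smooth_fun_on_def
proof clarify
  fix U c assume U: "(U, c) \<in> \<A>"
  have h: "smooth_on (I \<times> c ` (U \<inter> D)) (%(t, y). h t (inv_into U c y))"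
    using assms(1) U unfolding smooth_fun_on_line_iff by auto
  have "smooth_on (c ` (U \<inter> D)) (%y. (t, y))" by (intro smooth_on_Pair smooth_on_const smooth_on_id)
  from smooth_on_compose[OF finite_dim_prod[OF finite_dim_real fd] h this]
  show "smooth_on (c ` (U \<inter> D)) (h t \<circ> inv_into U c)" using assms(2) by (force simp: o_def)
qed

lemma smooth_family_imp_smooth_fun: "smooth_family \<A> h ==> smooth_fun_on \<A> UNIV (h t)"
  using smooth_family_slice[of UNIV UNIV h t] by simp

lemma smooth_family_C_inf:
  assumes "smooth_family \<A> h" "(U, c) \<in> \<A>"
  shows "C_inf_on (UNIV \<times> c ` U) (%(t, y). h t (inv_into U c y))" "open (UNIV \<times> c ` U)"
proof -
  show o: "open (UNIV \<times> c ` U)" using chart_open_range[OF assms(2)] by (simp add: open_Times)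
  show "C_inf_on (UNIV \<times> c ` U) (%(t, y). h t (inv_into U c y))"
    using assms unfolding smooth_family_iff smooth_on_open[OF o, symmetric] by auto
qed

text \<open>The time derivative at a fixed point does not refer to a chart, and in every chart it is
  a partial derivative of a jointly smooth function.\<close>

lemma smooth_family_has_derivative:
  fixes h :: "real => 'm => real"
  assumes h: "smooth_family \<A> h"
  shows "((%s. h s x) has_real_derivative deriv (%s. h s x) t) (at t)"
    and "smooth_family \<A> (%t x. deriv (%s. h s x) t)"
    and "(U, c) \<in> \<A> ==> x \<in> U ==> deriv (%s. h s x) t =
      frechet_derivative (%(t, y). h t (inv_into U c y)) (at (t, c x)) (1, 0)"
proof -
  have d: "((%s. h s x) has_real_derivative
      frechet_derivative (%(t, y). h t (inv_into U c y)) (at (t, c x)) (1, 0)) (at t)"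
    if U: "(U, c) \<in> \<A>" "x \<in> U" for U c x t
  proof -
    let ?H = "%(t, y). h t (inv_into U c y)"
    have "k_smooth_on (Suc 0) (UNIV \<times> c ` U) ?H" using smooth_family_C_inf(1)[OF h U(1)] by (rule spec)
    then have H: "(?H has_derivative frechet_derivative ?H (at (t, c x))) (at (t, c x))"
      by (rule k_smooth_on_SucD(1)) (use U in auto)
    have "((%s. (s, c x)) has_derivative (%s. s *\<^sub>R (1, 0))) (at t)" by (auto intro!: derivative_eq_intros)
    from has_derivative_compose[OF this H]
    have "((%s. h s x) has_derivative (%s. frechet_derivative ?H (at (t, c x)) (s *\<^sub>R (1, 0)))) (at t)"
      using U by simp
    then show ?thesis
      by (simp only: linear_cmul[OF has_derivative_linear[OF H]] has_field_derivative_def real_scaleR_def mult_commute_abs)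

  qed
  obtain U c where U: "(U, c) \<in> \<A>" "x \<in> U" using chart_exists by blast
  show "((%s. h s x) has_real_derivative deriv (%s. h s x) t) (at t)" using d[OF U] DERIV_imp_deriv by metis
  show "(U, c) \<in> \<A> ==> x \<in> U ==> deriv (%s. h s x) t =
      frechet_derivative (%(t, y). h t (inv_into U c y)) (at (t, c x)) (1, 0)" for U c
    using d DERIV_imp_deriv by metis
  show "smooth_family \<A> (%t x. deriv (%s. h s x) t)" unfolding smooth_family_iff
  proof clarify
    fix U c assume U: "(U, c) \<in> \<A>"
    let ?H = "%(t, y). h t (inv_into U c y)"
    note H = smooth_family_C_inf[OF h U]
    have "C_inf_on (UNIV \<times> c ` U) (%p. frechet_derivative ?H (at p) (1, 0))"
      using H(1) k_smooth_on_SucD(2) by blast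
    then have "smooth_on (UNIV \<times> c ` U) (%p. frechet_derivative ?H (at p) (1, 0))"
      using smooth_on_open[OF H(2)] by blast
    then show "smooth_on (UNIV \<times> c ` U) (%(t, y). deriv (%s. h s (inv_into U c y)) t)"
      by (rule smooth_on_cong) (use U d[OF U, THEN DERIV_imp_deriv] in \<open>auto simp: case_prod_unfold\<close>)
  qed
qed

end

subsection \<open>Bump functions\<close>

locale compact_manifold = manifold \<A>
  for \<A> :: "('m::{t2_space,second_countable_topology}, 'b::real_normed_vector) atlas" +
  assumes compact_UNIV: "compact (UNIV :: 'm set)"
begin

lemma closed_imp_compact: "closed (C :: 'm set) ==> compact C" using compact_Int_closed[OF compact_UNIV] by simp

lemma regular:
  assumes "open N" "x \<in> N"
  obtains W :: "'m set" where "open W" "x \<in> W" "closure W \<subseteq> N"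
proof -
  have "regular_space (euclidean :: 'm topology)"
  proof (rule compact_Hausdorff_imp_regular_space)
    show "compact_space (euclidean :: 'm topology)" using compact_UNIV by (simp add: compact_space_def)
    show "Hausdorff_space (euclidean :: 'm topology)"
      unfolding Hausdorff_space_def disjnt_def by simp (metis hausdorff)
  qed
  then obtain U V :: "'m set" where UV: "open U" "open V" "x \<in> U" "- N \<subseteq> V" "U \<inter> V = {}"
    using assms unfolding regular_space_def disjnt_def
    by (metis (no_types, opaque_lifting) Compl_iff DiffI UNIV_I closed_Compl closed_closedin open_openin topspace_euclidean)
  then have "closure U \<subseteq> - V" by (intro closure_minimal) auto
  then show ?thesis using UV that[of U] by blast
qed

text \<open>The norm of the model space need not be differentiable, so the distance from the centre
  is measured by \<open>q\<close>, the sum of the squared coordinates. Regularity of the compact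
  Hausdorff base supplies a neighbourhood whose closure lies in the chart domain, which makes the
  support \<open>C\<close> closed in the whole manifold.\<close>

lemma bump_function:
  assumes N: "open N" "x \<in> N"
  obtains \<zeta> C W where "smooth_fun_on \<A> UNIV \<zeta>" "closed C" "C \<subseteq> N" "!!y. y \<notin> C ==> \<zeta> y = (0::real)"
    "open W" "x \<in> W" "!!y. y \<in> W ==> \<zeta> y = 1"
proof -
  obtain U c where U: "(U, c) \<in> \<A>" "x \<in> U" using chart_exists by blast
  obtain W1 where W1: "open W1" "x \<in> W1" "closure W1 \<subseteq> N \<inter> U"
    using regular[of "N \<inter> U" x] N U chart_open[OF U(1)] by auto
  then have W1U: "W1 \<subseteq> U" using closure_subset by blast
  have "open (c ` W1)" by (rule chart_open_image[OF U(1) W1(1) W1U])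
  moreover have "c x \<in> c ` W1" using W1 by blast
  ultimately obtain \<rho> where \<rho>: "\<rho> > 0" "!!y. dist y (c x) < \<rho> ==> y \<in> c ` W1" unfolding open_dist by blast
  note B = basis[OF fd]
  define S where "S = (\<Sum>b\<in>basis. norm (b :: 'b)) + 1"
  have S: "S > 0" unfolding S_def by (intro add_nonneg_pos sum_nonneg) auto
  define q where "q = (%y. \<Sum>b\<in>basis. coord b (y - c x) * coord b (y - c x))"
  have q_norm: "norm (y - c x) \<le> sqrt (q y) * S" for y
  proof -
    have "\<bar>coord b (y - c x)\<bar> \<le> sqrt (q y)" if "b \<in> basis" for b
    proof -
      have "coord b (y - c x) * coord b (y - c x) \<le> q y"
        unfolding q_def by (rule member_le_sum[OF that]) (use B(1) in auto)
      then show ?thesis by (metis real_sqrt_abs2 real_sqrt_le_mono)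
    qed
    then have "norm (\<Sum>b\<in>basis. coord b (y - c x) *\<^sub>R b) \<le> (\<Sum>b\<in>basis. sqrt (q y) * norm (b :: 'b))"
      by (intro sum_norm_le) (auto intro!: mult_right_mono)
    also have "\<dots> \<le> sqrt (q y) * S" unfolding S_def sum_distrib_left[symmetric]
      by (intro mult_left_mono) (auto simp: q_def sum_nonneg)
    finally show ?thesis using B(3)[of "y - c x"] by simp
  qed
  \<comment> \<open>Then \<open>q y \<le> r\<close> forces
    \<open>norm (y - c x) \<le> \<rho> / 2\<close>, so the sublevel set of \<open>q\<close> stays
    inside the chart image.\<close>
  define r where "r = (\<rho> / (2 * S))\<^sup>2"
  have r: "r > 0" using \<rho> S by (simp add: r_def)
  have q_ball: "y \<in> c ` W1" if "q y \<le> r" for y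
  proof -
    have "sqrt (q y) \<le> \<rho> / (2 * S)" using that \<rho>(1) S real_sqrt_le_mono[OF that] by (simp add: r_def)
    then have "sqrt (q y) * S \<le> \<rho> / (2 * S) * S" using S by (intro mult_right_mono) auto
    also have "\<dots> < \<rho>" using S \<rho>(1) by simp
    finally have "dist y (c x) < \<rho>" using q_norm[of y] by (simp add: dist_norm)
    then show ?thesis by (rule \<rho>(2))
  qed
  have q0: "q (c x) = 0" using B(2) by (simp add: q_def linear_simps)
  have "smooth_on UNIV (%y. y - c x)" by (intro smooth_on_diff smooth_on_id smooth_on_const)
  then have sq: "smooth_on UNIV q" unfolding q_def
    by (intro smooth_on_sum smooth_on_mult smooth_on_bounded_linear_compose[OF B(2)])
  have cq: "continuous_on UNIV q" using smooth_on_imp_continuous_on[OF sq] .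
  have cc: "continuous_on U c" using homeomorphism_cont1[OF chart_homeomorphism[OF U(1)]] .
  define C where "C = closure W1 \<inter> (%y. q (c y)) -` {..r}"
  define W where "W = (%y. q (c y)) -` {..<r / 2} \<inter> W1"
  have cqc: "continuous_on V (%y. q (c y))" if "V \<subseteq> U" for V
    by (rule continuous_on_compose2[OF cq continuous_on_subset[OF cc that]]) auto
  have clC: "closed C" unfolding C_def
    using continuous_closed_preimage[OF cqc closed_closure closed_atMost, of W1] W1(3) by (simp add: Int_commute)
  have oW: "open W" unfolding W_def by (rule open_vimage_Int[OF cqc[OF W1U] W1(1)]) simp
  have CW1: "C \<subseteq> W1"
  proof
    fix y assume y: "y \<in> C"
    then have "y \<in> U" "q (c y) \<le> r" using W1(3) by (auto simp: C_def)
    from q_ball[OF this(2)] obtain z where "z \<in> W1" "c y = c z" by blast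
    then show "y \<in> W1" using \<open>y \<in> U\<close> W1U chart_inj[OF U(1)] by (auto simp: inj_on_def)
  qed
  \<comment> \<open>The argument of the step is at least 1 where \<open>q\<close> is at most
    \<open>r / 2\<close>, and at most 0 where \<open>q\<close> is at least \<open>r\<close>.\<close>
  define \<zeta> where "\<zeta> = (%y. if y \<in> W1 then smooth_step (2 + (- 2 / r) * q (c y)) else 0)"
  have \<zeta>0: "\<zeta> y = 0" if "y \<notin> C" for y
  proof (cases "y \<in> W1")
    case True
    then have "r < q (c y)" using that closure_subset by (auto simp: C_def)
    then have "2 + (- 2 / r) * q (c y) \<le> 0" using r by (simp add: field_simps)
    then show ?thesis by (simp only: \<zeta>_def smooth_step_le_0 if_cancel)
  qed (simp add: \<zeta>_def)
  have "smooth_on UNIV (%y. 2 + (- 2 / r) * q y)" by (intro smooth_on_add smooth_on_mult smooth_on_const sq)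
  then have "smooth_on UNIV (%y. smooth_step (2 + (- 2 / r) * q y))"
    using smooth_on_compose[OF finite_dim_real, of UNIV smooth_step UNIV "%y. 2 + (- 2 / r) * q y"]
    by (simp add: smooth_on_open C_inf_on_smooth_step)
  then have "smooth_on (c ` W1) (%y. smooth_step (2 + (- 2 / r) * q y))" by (rule smooth_on_subset) simp
  then have "smooth_on (c ` W1) (%y. \<zeta> (inv_into U c y))"
    by (rule smooth_on_cong) (use W1U U(1) in \<open>auto simp: \<zeta>_def subset_iff\<close>)
  then have "smooth_fun_on \<A> W1 \<zeta>" by (rule smooth_fun_on_chart[OF U(1) W1U W1(1)])
  then have "smooth_fun_on \<A> UNIV \<zeta>" by (rule smooth_fun_on_extend_zero[OF _ W1(1) clC CW1 \<zeta>0])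
  moreover have "\<zeta> y = 1" if "y \<in> W" for y
  proof -
    have "q (c y) < r / 2" "y \<in> W1" using that by (auto simp: W_def)
    then show ?thesis using r by (simp add: \<zeta>_def field_simps)
  qed
  moreover have "x \<in> W" using W1(2) r by (simp add: W_def q0)
  moreover have "C \<subseteq> N" using CW1 W1(3) closure_subset by blast
  ultimately show ?thesis by (intro that[of \<zeta> C W]) (use clC \<zeta>0 oW in auto)
qed

text \<open>The image of \<open>C\<close> under the chart is compact and therefore closed in the
  model space. Its complement and the image of \<open>N\<close> cover that space, so the extension
  by zero is smooth everywhere.\<close>

lemma push_to_chart:
  assumes U: "(U, c) \<in> \<A>" and N: "open N" "N \<subseteq> U" and C: "closed C" "C \<subseteq> N"
    and h: "smooth_fun_on (line_times \<A>) (UNIV \<times> N) (%(t, x). h t x)" "!!t x. x \<in> N ==> x \<notin> C ==> h t x = 0"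
  shows "C_inf_on UNIV (%(t, y). if y \<in> c ` N then h t (inv_into U c y) else 0)"
proof (rule C_inf_on_local)
  fix p :: "real \<times> 'b" assume "p \<in> UNIV"
  let ?h = "%(t, y). if y \<in> c ` N then h t (inv_into U c y) else 0"
  have oN: "open (c ` N)" by (rule chart_open_image[OF U N])
  have "continuous_on C c"
    using continuous_on_subset[OF homeomorphism_cont1[OF chart_homeomorphism[OF U]]] N C by blast
  from compact_continuous_image[OF this closed_imp_compact[OF C(1)]]
  have clC: "closed (c ` C)" by (rule compact_imp_closed)
  have "U \<inter> N = N" using N by blast
  then have "smooth_on (UNIV \<times> c ` N) (%(t, y). h t (inv_into U c y))"
    using h(1) U unfolding smooth_fun_on_line_iff by force
  then have "smooth_on (UNIV \<times> c ` N) ?h" by (rule smooth_on_cong) auto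
  then have 1: "C_inf_on (UNIV \<times> c ` N) ?h" using oN by (simp add: smooth_on_open open_Times)
  have "C_inf_on (UNIV \<times> - c ` C) (%p. 0)" by simp
  moreover have "?h p = 0" if "p \<in> UNIV \<times> - c ` C" for p
    using that N(2) chart_inv[OF U] by (auto simp: subset_iff intro!: h(2))
  moreover have o2: "open (UNIV \<times> - c ` C :: (real \<times> 'b) set)" using clC by (simp add: open_Times open_Compl)
  ultimately have 2: "C_inf_on (UNIV \<times> - c ` C) ?h" using k_smooth_on_cong[OF o2, of ?h "%p. 0"] by simp
  show "\<exists>W. open W \<and> p \<in> W \<and> C_inf_on W ?h"
  proof (cases "snd p \<in> c ` N")
    case True
    then show ?thesis using 1 oN by (intro exI[of _ "UNIV \<times> c ` N"]) (auto simp: open_Times mem_Times_iff)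
  next
    case False
    then have "snd p \<notin> c ` C" using C by blast
    then show ?thesis using 2 o2 by (intro exI[of _ "UNIV \<times> - c ` C"]) (auto simp: mem_Times_iff)
  qed
qed simp

end

subsection \<open>Hadamard's lemma and derivations\<close>

text \<open>The factor \<open>g b\<close> is the integral over \<open>t\<close> in [0,1] of the
  partial derivative of \<open>F\<close> at \<open>y0 + t (y - y0)\<close>. The integral is realised
  as the time-one value of a differential equation with parameter \<open>y\<close>, so that
  smoothness in \<open>y\<close> comes from \<open>ode_param_smooth\<close>.\<close>

lemma hadamard:
  fixes F :: "'b::real_normed_vector => real"
  assumes fd: "finite_dim TYPE('b)" and F: "C_inf_on UNIV F"
    and crd: "!!x. x = (\<Sum>b\<in>B. crd b x *\<^sub>R b)"
  obtains g where "!!b. C_inf_on UNIV (g b)"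
    "!!y. F y = F y0 + (\<Sum>b\<in>B. crd b (y - y0) * g b y)"
    "!!b. g b y0 = frechet_derivative F (at y0) b"
proof -
  let ?\<beta> = "%b p. frechet_derivative F (at (y0 + fst p *\<^sub>R (snd p - y0))) b"
  have F': "C_inf_on UNIV (%y. frechet_derivative F (at y) b)" for b using F k_smooth_on_SucD(2) by blast
  have derF: "(F has_derivative frechet_derivative F (at y)) (at y)" for y
    using F k_smooth_on_SucD(1)[of 0 UNIV F y] by simp
  have seg: "k_smooth_on k UNIV (%p::real \<times> 'b. y0 + fst p *\<^sub>R (snd p - y0))" for k
    by (intro k_smooth_on_add k_smooth_on_scaleR k_smooth_on_diff k_smooth_on_const open_UNIV
        k_smooth_on_bounded_linear[OF bounded_linear_fst] k_smooth_on_bounded_linear[OF bounded_linear_snd])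
  have \<beta>: "k_smooth_on k UNIV (?\<beta> b)" for b k
    by (rule k_smooth_on_compose[OF fd open_UNIV open_UNIV subset_UNIV F'[THEN spec] seg])
  have lin0: "linear (%e::real. 0::real)" by (rule linearI) auto
  have "\<exists>w. (\<forall>p. w 0 p = 0) \<and> (\<forall>t p. ((%t. w t p) has_vector_derivative ?\<beta> b (t, p)) (at t))" for b
  proof -
    obtain w where "!!p. w 0 p = (%_. 0::real) p"
      "!!t p. ((%t. w t p) has_vector_derivative (%_ e. 0) (t, p) (w t p) + ?\<beta> b (t, p)) (at t)"
      by (rule linear_ode_solution[OF finite_dim_real lin0 continuous_on_const
            k_smooth_on_imp_continuous_on[OF \<beta>], where ?z0.0 = "%_. 0"]) blast
    then show ?thesis by auto
  qed
  note ex = this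
  define w where "w = (%b. SOME w. (\<forall>p. w 0 p = 0) \<and>
    (\<forall>t p. ((%t. w t p) has_vector_derivative ?\<beta> b (t, p)) (at t)))"
  have w: "w b 0 p = 0" "((%t. w b t p) has_vector_derivative ?\<beta> b (t, p)) (at t)" for b p t
    using someI_ex[OF ex[of b]] by (auto simp: w_def)
  have w': "((%t. w b t p) has_real_derivative ?\<beta> b (t, p)) (at t)" for b p t
    using w(2) by (simp add: has_real_derivative_iff_has_vector_derivative)
  have sw: "k_smooth_on k UNIV (%(t, p). w b t p)" for k b
  proof (rule ode_param_smooth[OF fd finite_dim_real,
        where f = "%(t, p, e). (%_ e. 0) (t, p) e + ?\<beta> b (t, p)"])
    have 1: "k_smooth_on k UNIV (%x::real \<times> 'b \<times> real. (fst x, fst (snd x)))"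
      by (intro k_smooth_on_bounded_linear open_UNIV bounded_linear_Pair bounded_linear_fst
          bounded_linear_compose[OF bounded_linear_fst bounded_linear_snd])
    have "k_smooth_on k UNIV (%x::real \<times> 'b \<times> real. ?\<beta> b (fst x, fst (snd x)))"
      by (rule k_smooth_on_compose[OF finite_dim_prod[OF finite_dim_real fd] open_UNIV open_UNIV subset_UNIV \<beta> 1])
    then show "k_smooth_on k UNIV (%(t, p, e::real). (%_ e. 0) (t, p) e + ?\<beta> b (t, p))"
      by (simp add: case_prod_unfold)
    show "locally_uniformly_lipschitz (%(t, p, e::real). (%_ e. 0) (t, p) e + ?\<beta> b (t, p))"
      by (rule locally_uniformly_lipschitz_linear[OF finite_dim_real lin0 continuous_on_const])
    show "k_smooth_on k UNIV (%p. w b 0 p)" by (simp add: w)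
  qed (use w in simp)
  define g where "g = (%b y. w b 1 y)"
  show ?thesis
  proof (rule that[of g])
    show "C_inf_on UNIV (g b)" for b
    proof
      fix k
      have "k_smooth_on k UNIV (%y. (%(t, p). w b t p) (1, y))"
        by (rule k_smooth_on_compose[OF finite_dim_prod[OF finite_dim_real fd] open_UNIV open_UNIV subset_UNIV sw])
          (intro k_smooth_on_Pair k_smooth_on_const k_smooth_on_id open_UNIV)
      then show "k_smooth_on k UNIV (g b)" by (simp add: g_def)
    qed
    show "F y = F y0 + (\<Sum>b\<in>B. crd b (y - y0) * g b y)" for y
    proof -
      have Fl: "((%t. F (y0 + t *\<^sub>R (y - y0))) has_real_derivative
          frechet_derivative F (at (y0 + t *\<^sub>R (y - y0))) (y - y0)) (at t)" for t
      proof -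
        have "((%t. y0 + t *\<^sub>R (y - y0)) has_derivative (%s. s *\<^sub>R (y - y0))) (at t)"
          by (auto intro!: derivative_eq_intros)
        from has_derivative_compose[OF this derF] show ?thesis
          by (simp only: linear_cmul[OF has_derivative_linear[OF derF]] has_field_derivative_def
              real_scaleR_def mult_commute_abs)
      qed
      have exp: "frechet_derivative F (at z) (y - y0) = (\<Sum>b\<in>B. crd b (y - y0) * frechet_derivative F (at z) b)" for z
        using linear_expand[OF crd has_derivative_linear[OF derF], of z "y - y0"] by simp
      \<comment> \<open>Both terms have the same derivative, so \<open>?G\<close> is constant; its
        values at 0 and 1 give the expansion.\<close>
      let ?G = "%t. F (y0 + t *\<^sub>R (y - y0)) - (\<Sum>b\<in>B. crd b (y - y0) * w b t y)"
      have "(?G has_real_derivative frechet_derivative F (at (y0 + t *\<^sub>R (y - y0))) (y - y0) -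
          (\<Sum>b\<in>B. crd b (y - y0) * ?\<beta> b (t, y))) (at t)" for t
        by (intro DERIV_diff Fl DERIV_sum DERIV_cmult w')
      then have "(?G has_real_derivative 0) (at t)" for t by (simp add: exp)
      then have "?G 1 = ?G 0" by (intro DERIV_isconst_all) blast
      then show ?thesis by (simp add: w(1) g_def)
    qed
    show "g b y0 = frechet_derivative F (at y0) b" for b
    proof -
      have "((%t. w b t y0 - t * frechet_derivative F (at y0) b) has_real_derivative
          ?\<beta> b (t, y0) - 1 * frechet_derivative F (at y0) b) (at t)" for t
        by (intro DERIV_diff w' DERIV_cmult_right DERIV_ident)
      then have "((%t. w b t y0 - t * frechet_derivative F (at y0) b) has_real_derivative 0) (at t)" for t by simp
      then have "w b 1 y0 - 1 * frechet_derivative F (at y0) b = w b 0 y0 - 0 * frechet_derivative F (at y0) b"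
        by (intro DERIV_isconst_all) blast
      then show ?thesis by (simp add: g_def w(1))
    qed
  qed
qed

context compact_manifold begin

abbreviation "CF \<equiv> smooth_functions \<A>"

lemma CF_const: "(%x. a) \<in> CF" by (simp add: smooth_fun_on_const)
lemma CF_add: "f \<in> CF ==> g \<in> CF ==> (%x. f x + g x) \<in> CF" by (simp add: smooth_fun_on_add)
lemma CF_diff: "f \<in> CF ==> g \<in> CF ==> (%x. f x - g x) \<in> CF" by (simp add: smooth_fun_on_diff)
lemma CF_mult: "f \<in> CF ==> g \<in> CF ==> (%x. f x * g x) \<in> CF" by (simp add: smooth_fun_on_mult)
lemma CF_sum: "(!!i. i \<in> I ==> f i \<in> CF) ==> (%x. \<Sum>i\<in>I. f i x) \<in> CF" by (simp add: smooth_fun_on_sum)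

lemma tangent:
  assumes "D \<in> tangent_space \<A> x" "f \<in> CF"
  shows tangent_scale: "D (%y. r * f y) = r * D f"
    and tangent_add: "g \<in> CF ==> D (%y. f y + g y) = D f + D g"
    and tangent_mult: "g \<in> CF ==> D (%y. f y * g y) = f x * D g + g x * D f"
  using assms unfolding tangent_space_def by blast+

lemma tangent_const:
  assumes "D \<in> tangent_space \<A> x" shows "D (%y. a) = 0"
proof -
  have "D (%y. 1 * 1) = 1 * D (%y. 1) + 1 * D (%y. 1)" by (rule tangent_mult[OF assms CF_const CF_const])
  then have "D (%y. 1) = 0" by simp
  then show ?thesis using tangent_scale[OF assms CF_const, of a 1] by simp
qed

lemma tangent_diff:
  assumes "D \<in> tangent_space \<A> x" "f \<in> CF" "g \<in> CF"
  shows "D (%y. f y - g y) = D f - D g"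
proof -
  have "(%y. - 1 * g y) \<in> CF" by (rule CF_mult[OF CF_const assms(3)])
  from tangent_add[OF assms(1,2) this] tangent_scale[OF assms(1,3), of "- 1"] show ?thesis by simp
qed

lemma tangent_sum:
  assumes "D \<in> tangent_space \<A> x" "!!i. i \<in> I ==> f i \<in> CF"
  shows "D (%y. \<Sum>i\<in>I. f i y) = (\<Sum>i\<in>I. D (f i))" using assms(2)
proof (induction I rule: infinite_finite_induct)
  case (insert i I)
  have "D (%y. f i y + (\<Sum>i\<in>I. f i y)) = D (f i) + D (%y. \<Sum>i\<in>I. f i y)"
    by (intro tangent_add[OF assms(1)] CF_sum) (use insert.prems in auto)
  then show ?case using insert by simp
qed (simp_all add: tangent_const[OF assms(1)])

text \<open>With a bump function \<open>\<zeta>\<close> at \<open>x\<close> the difference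
  \<open>f - g\<close> equals \<open>(1 - \<zeta>) (f - g)\<close>, a product of two functions that
  vanish at \<open>x\<close>; the Leibniz rule annihilates it.\<close>

lemma tangent_local:
  assumes D: "D \<in> tangent_space \<A> x" and f: "f \<in> CF" "g \<in> CF"
    and N: "open N" "x \<in> N" "!!y. y \<in> N ==> f y = g y"
  shows "D f = D g"
proof -
  obtain \<zeta> C W where \<zeta>: "smooth_fun_on \<A> UNIV \<zeta>" "closed C" "C \<subseteq> N" "!!y. y \<notin> C ==> \<zeta> y = (0::real)"
    "open W" "x \<in> W" "!!y. y \<in> W ==> \<zeta> y = 1" using bump_function[OF N(1,2)] by blast
  let ?h = "%y. f y - g y"
  have h: "?h \<in> CF" using f by (rule CF_diff)
  have 1: "(%y. 1 - \<zeta> y) \<in> CF" using \<zeta>(1) by (intro CF_diff CF_const) simp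
  have "?h y = (1 - \<zeta> y) * ?h y" for y by (cases "y \<in> N") (use N(3) \<zeta>(3,4) in auto)
  then have "?h = (%y. (1 - \<zeta> y) * ?h y)" by (rule ext)
  then have "D ?h = D (%y. (1 - \<zeta> y) * ?h y)" by (rule arg_cong)
  also have "\<dots> = (1 - \<zeta> x) * D ?h + ?h x * D (%y. 1 - \<zeta> y)" by (rule tangent_mult[OF D 1 h])
  also have "\<dots> = 0" using N(2,3) \<zeta>(6,7) by simp
  finally show ?thesis using tangent_diff[OF D f] by simp
qed

text \<open>Hadamard's lemma writes \<open>f\<close> near \<open>x\<close> as a constant plus
  products whose first factor vanishes at \<open>x\<close>; the Leibniz rule then leaves the chart
  derivatives. Derivations act on globally defined functions, so coordinates and Hadamard factors
  are cut off by \<open>\<zeta>\<close>.\<close>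

lemma derivation_formula:
  assumes U: "(U, c) \<in> \<A>" and N: "open N" "x \<in> N" "N \<subseteq> U"
    and B: "!!b. bounded_linear (crd b)" "!!x. x = (\<Sum>b\<in>B. crd b x *\<^sub>R b)"
    and \<zeta>: "\<zeta> \<in> CF" "closed C" "C \<subseteq> N" "!!y. y \<notin> C ==> \<zeta> y = 0"
    and W: "open W" "x \<in> W" "!!y. y \<in> W ==> \<zeta> y = 1"
  shows "(%y. \<zeta> y * crd b (c y)) \<in> CF"
    and "D \<in> tangent_space \<A> x ==> f \<in> CF ==>
      D f = (\<Sum>b\<in>B. D (%y. \<zeta> y * crd b (c y)) * frechet_derivative (%y. f (inv_into U c y)) (at (c x)) b)"
proof -
  have cs: "smooth_fun_on \<A> N c" using smooth_fun_on_subset[OF chart_smooth[OF U] N(3)] .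
  have ext: "(%y. \<zeta> y * k (c y)) \<in> CF" if "smooth_on UNIV k" for k :: "'b => real"
  proof -
    have "smooth_fun_on \<A> N (%y. \<zeta> y * k (c y))"
      using \<zeta>(1) by (intro smooth_fun_on_mult smooth_fun_on_compose[OF fd that cs])
        (auto intro: smooth_fun_on_subset)
    then have "smooth_fun_on \<A> UNIV (%y. \<zeta> y * k (c y))"
      by (rule smooth_fun_on_extend_zero[OF _ N(1) \<zeta>(2,3)]) (simp add: \<zeta>(4))
    then show ?thesis by simp
  qed
  show X: "(%y. \<zeta> y * crd b (c y)) \<in> CF" for b by (intro ext smooth_on_bounded_linear B(1))
  assume D: "D \<in> tangent_space \<A> x" and f: "f \<in> CF"
  have f\<zeta>: "smooth_fun_on \<A> N (%y. \<zeta> y * f y)"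
    using f \<zeta>(1) by (intro smooth_fun_on_mult) (auto intro: smooth_fun_on_subset)
  define F where "F = (%y. if y \<in> c ` N then \<zeta> (inv_into U c y) * f (inv_into U c y) else 0)"
  have "C_inf_on UNIV (%(t::real, y). F y)"
    using push_to_chart[OF U N(1,3) \<zeta>(2,3), where h = "%t y. \<zeta> y * f y"]
      smooth_family_static[OF f\<zeta>] \<zeta>(4) by (simp add: F_def)
  then have "C_inf_on UNIV (%y. (%(t::real, y). F y) (0, y))"
    by (rule C_inf_compose[OF finite_dim_prod[OF finite_dim_real fd] _ _ open_UNIV])
      (intro allI k_smooth_on_Pair k_smooth_on_const k_smooth_on_id open_UNIV)
  then have F: "C_inf_on UNIV F" by simp
  obtain g where g: "!!b. C_inf_on UNIV (g b)"
    "!!y. F y = F (c x) + (\<Sum>b\<in>B. crd b (y - c x) * g b y)"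
    "!!b. g b (c x) = frechet_derivative F (at (c x)) b" by (rule hadamard[OF fd F B(2), of "c x"]) blast
  have gs: "smooth_on UNIV (g b)" for b using g(1) by (simp add: smooth_on_open)
  let ?X = "%b y. \<zeta> y * crd b (c y)"
  let ?g = "%b y. \<zeta> y * g b (c y)"
  have \<zeta>x: "\<zeta> x = 1" by (rule W(3)[OF W(2)])
  have eqF: "F (c y) = f y" if "y \<in> W \<inter> N" for y using that N(3) chart_inv[OF U] W(3) by (auto simp: F_def)
  have "D f = D (%y. f x + (\<Sum>b\<in>B. (?X b y - ?X b x) * ?g b y))"
  proof (rule tangent_local[OF D f, of _ "W \<inter> N"])
    show "(%y. f x + (\<Sum>b\<in>B. (?X b y - ?X b x) * ?g b y)) \<in> CF"
      by (intro CF_add CF_const CF_sum CF_mult CF_diff X ext gs)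
    fix y assume y: "y \<in> W \<inter> N"
    have "f y = F (c x) + (\<Sum>b\<in>B. crd b (c y - c x) * g b (c y))" using g(2)[of "c y"] eqF[OF y] by simp
    also have "F (c x) = f x" by (rule eqF) (use W N in auto)
    finally show "f y = f x + (\<Sum>b\<in>B. (?X b y - ?X b x) * ?g b y)"
      using y W(3) \<zeta>x by (simp add: linear_diff[OF bounded_linear.linear[OF B(1)]])
  qed (use W N in auto)
  also have "\<dots> = D (%y. f x) + (\<Sum>b\<in>B. D (%y. (?X b y - ?X b x) * ?g b y))"
  proof -
    have 1: "(%y. (?X b y - ?X b x) * ?g b y) \<in> CF" for b by (intro CF_mult CF_diff CF_const X ext gs)
    show ?thesis by (subst tangent_add[OF D CF_const CF_sum[OF 1]]) (simp only: tangent_sum[OF D 1])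
  qed
  finally have Df: "D f = D (%y. f x) + (\<Sum>b\<in>B. D (%y. (?X b y - ?X b x) * ?g b y))" .
  have Db: "D (%y. (?X b y - ?X b x) * ?g b y) = g b (c x) * D (?X b)" for b
  proof -
    have 1: "(%y. ?X b y - ?X b x) \<in> CF" by (intro CF_diff X CF_const)
    have "D (%y. (?X b y - ?X b x) * ?g b y) = (?X b x - ?X b x) * D (?g b) + ?g b x * D (%y. ?X b y - ?X b x)"
      by (rule tangent_mult[OF D 1 ext[OF gs]])
    also have "D (%y. ?X b y - ?X b x) = D (?X b)"
      using tangent_diff[OF D X CF_const] tangent_const[OF D] by simp
    finally show ?thesis using \<zeta>x by simp
  qed
  have fr: "frechet_derivative F (at (c x)) = frechet_derivative (%y. f (inv_into U c y)) (at (c x))"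
  proof -
    have o: "open (c ` (W \<inter> N))" by (rule chart_open_image[OF U]) (use W N in auto)
    have "(F has_derivative F') (at (c x)) \<longleftrightarrow> ((%y. f (inv_into U c y)) has_derivative F') (at (c x))" for F'
      by (rule has_derivative_cong_open[OF o]) (use eqF N W chart_inv[OF U] in auto)
    then show ?thesis unfolding frechet_derivative_def by simp
  qed
  show "D f = (\<Sum>b\<in>B. D (%y. \<zeta> y * crd b (c y)) * frechet_derivative (%y. f (inv_into U c y)) (at (c x)) b)"
    unfolding Df tangent_const[OF D] Db by (simp add: g(3) fr mult.commute)
qed

section \<open>Partitions of unity with accompanying cutoff functions\<close>

text \<open>Each \<open>\<psi> j\<close> comes with a larger bump function \<open>\<zeta> j\<close>
  that is 1 wherever \<open>\<psi> j\<close> is non-zero: it extends chart coordinates and frames to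
  the whole manifold without altering them where \<open>\<psi> j\<close> counts. Only the sum refers
  to \<open>n\<close>; the other clauses hold for every index, which spares side conditions.\<close>

definition partition_of_unity ::
  "('m => 'm set) => nat => (nat => 'm) => (nat => 'm => real) => (nat => 'm set) => (nat => 'm => real) => bool" where
  "partition_of_unity N n p \<zeta> C \<psi> \<longleftrightarrow>
    (\<forall>j. \<zeta> j \<in> CF \<and> closed (C j) \<and> C j \<subseteq> N (p j) \<and> \<psi> j \<in> CF) \<and>
    (\<forall>j y. y \<notin> C j \<longrightarrow> \<zeta> j y = 0) \<and> (\<forall>j y. \<psi> j y \<noteq> 0 \<longrightarrow> \<zeta> j y = 1) \<and>
    (\<forall>y. (\<Sum>j<n. \<psi> j y) = 1)"

lemma partition_of_unityD:
  assumes "partition_of_unity N n p \<zeta> C \<psi>"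
  shows "\<zeta> j \<in> CF" "closed (C j)" "C j \<subseteq> N (p j)" "y \<notin> C j ==> \<zeta> j y = 0" "\<psi> j \<in> CF"
    "\<psi> j y \<noteq> 0 ==> \<zeta> j y = 1" "(\<Sum>j<n. \<psi> j y) = 1" using assms unfolding partition_of_unity_def by blast+

text \<open>The construction avoids division: each bump function is multiplied by
  \<open>1 - \<phi>\<close> for all earlier ones, and the sum telescopes to one minus a product in
  which some factor vanishes at every point.\<close>

lemma partition_of_unity_exists:
  assumes N: "!!x. open (N x)" "!!x. x \<in> N x"
  shows "\<exists>n p \<zeta> C \<psi>. partition_of_unity N n p \<zeta> C \<psi>"
proof -
  have "\<exists>\<zeta> C W \<phi> V. \<zeta> \<in> CF \<and> closed C \<and> C \<subseteq> N x \<and> (\<forall>y. y \<notin> C \<longrightarrow> \<zeta> y = 0) \<and>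
      \<phi> \<in> CF \<and> (\<forall>y. \<phi> y \<noteq> 0 \<longrightarrow> \<zeta> y = 1) \<and> open V \<and> x \<in> V \<and> (\<forall>y\<in>V. \<phi> y = 1)" for x
  proof -
    obtain \<zeta> C W where 1: "smooth_fun_on \<A> UNIV \<zeta>" "closed C" "C \<subseteq> N x" "!!y. y \<notin> C ==> \<zeta> y = (0::real)"
      "open W" "x \<in> W" "!!y. y \<in> W ==> \<zeta> y = 1" using bump_function[OF N] by blast
    obtain \<phi> D V where 2: "smooth_fun_on \<A> UNIV \<phi>" "closed D" "D \<subseteq> W" "!!y. y \<notin> D ==> \<phi> y = (0::real)"
      "open V" "x \<in> V" "!!y. y \<in> V ==> \<phi> y = 1" using bump_function[OF 1(5,6)] by blast
    have "\<forall>y. \<phi> y \<noteq> 0 \<longrightarrow> \<zeta> y = 1" using 1(7) 2(3,4) by blast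
    then show ?thesis using 1(1-4) 2(1,5-7) by blast
  qed
  then obtain Z K \<phi> V where Z: "!!x. Z x \<in> CF" "!!x. closed (K x)" "!!x. K x \<subseteq> N x" "!!x y. y \<notin> K x ==> Z x y = 0"
    "!!x. \<phi> x \<in> CF" "!!x y. \<phi> x y \<noteq> 0 ==> Z x y = 1"
    and V: "!!x. open (V x)" "!!x. x \<in> V x" "!!x y. y \<in> V x ==> \<phi> x y = 1" by metis
  obtain T where T: "finite T" "UNIV \<subseteq> (\<Union>x\<in>T. V x)"
    by (rule compactE_image[OF compact_UNIV, of UNIV V]) (use V(1,2) in auto)
  obtain p where p: "bij_betw p {0..<card T} T" using ex_bij_betw_nat_finite[OF T(1)] by blast
  define \<psi> where "\<psi> = (%j y. \<phi> (p j) y * (\<Prod>i<j. 1 - \<phi> (p i) y))"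
  have tele: "(\<Sum>j<n. \<psi> j y) = 1 - (\<Prod>j<n. 1 - \<phi> (p j) y)" for n y
    by (induction n) (auto simp: \<psi>_def algebra_simps)
  have "partition_of_unity N (card T) p (%j. Z (p j)) (%j. K (p j)) \<psi>" unfolding partition_of_unity_def
  proof (intro conjI allI impI)
    show "\<psi> j \<in> CF" for j unfolding \<psi>_def using Z(5)
      by (auto intro!: smooth_fun_on_mult smooth_fun_on_prod smooth_fun_on_diff smooth_fun_on_const)
    show "Z (p j) y = 1" if "\<psi> j y \<noteq> 0" for j y using that Z(6) by (auto simp: \<psi>_def)
    show "(\<Sum>j<card T. \<psi> j y) = 1" for y
    proof -
      obtain x where x: "x \<in> T" "y \<in> V x" using T(2) by blast
      then obtain j where j: "j < card T" "x = p j"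
        using p by (metis atLeastLessThan_iff bij_betw_imp_surj_on imageE)
      then have "\<phi> (p j) y = 1" using V(3) x by blast
      then have "(\<Prod>j<card T. 1 - \<phi> (p j) y) = 0" using j(1) by (intro prod_zero) auto
      then show ?thesis by (simp add: tele)
    qed
  qed (use Z in auto)
  then show ?thesis by blast
qed

end

context manifold begin

lemma smooth_family_chart:
  assumes U: "(U, c) \<in> \<A>" "N \<subseteq> U" "open N" and h: "smooth_on (UNIV \<times> c ` N) (%(t, y). h t (inv_into U c y))"
  shows "smooth_fun_on (line_times \<A>) (UNIV \<times> N) (%(t, x). h t x)"
proof -
  interpret line: manifold "line_times \<A>" by (rule manifold_line)
  have U': "(UNIV \<times> U, map_prod id c) \<in> line_times \<A>" using U by (auto simp: line_times_def)
  have im: "map_prod id c ` (UNIV \<times> N) = UNIV \<times> c ` N" by (rule map_prod_surj_on) auto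
  show ?thesis
  proof (rule line.smooth_fun_on_chart[OF U'])
    show "smooth_on (map_prod id c ` (UNIV \<times> N))
        (%p. case inv_into (UNIV \<times> U) (map_prod id c) p of (t, x) => h t x)" unfolding im using h
      by (rule smooth_on_cong) (use U in \<open>auto simp: inv_into_map_prod_id[OF chart_inj[OF U(1)]] subset_iff\<close>)
  qed (use U in \<open>auto simp: open_Times\<close>)
qed

lemma smooth_family_extend_zero:
  assumes "smooth_fun_on (line_times \<A>) (UNIV \<times> N) (%(t, x). h t x)" "open N" "closed C" "C \<subseteq> N"
    "!!t x. x \<notin> C ==> h t x = 0"
  shows "smooth_family \<A> h"
proof -
  interpret line: manifold "line_times \<A>" by (rule manifold_line)
  show ?thesis by (rule line.smooth_fun_on_extend_zero[OF assms(1), of "UNIV \<times> C"])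
      (use assms in \<open>auto simp: open_Times closed_Times\<close>)
qed

end

section \<open>Global operators that express all derivations\<close>

lemma frechet_derivative_cong_open:
  assumes "open S" "x \<in> S" "!!y. y \<in> S ==> f y = g y"
  shows "frechet_derivative f (at x) = frechet_derivative g (at x)"
  unfolding frechet_derivative_def using has_derivative_cong_open[OF assms] by simp

lemma partial_derivative:
  fixes H :: "real \<times> 'b::real_normed_vector => 'c::real_normed_vector"
  assumes "k_smooth_on (Suc k) S H" "(t, y) \<in> S"
  shows "((%y. H (t, y)) has_derivative (%v. frechet_derivative H (at (t, y)) (0, v))) (at y)"
    and "frechet_derivative (%y. H (t, y)) (at y) = (%v. frechet_derivative H (at (t, y)) (0, v))"
    and "((%t. H (t, y)) has_vector_derivative frechet_derivative H (at (t, y)) (1, 0)) (at t)"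
proof -
  note H = k_smooth_on_SucD(1)[OF assms]
  have "((%y. (t, y)) has_derivative (%v. (0, v))) (at y)" by (auto intro!: derivative_eq_intros)
  from has_derivative_compose[OF this H]
  show d: "((%y. H (t, y)) has_derivative (%v. frechet_derivative H (at (t, y)) (0, v))) (at y)" .
  show "frechet_derivative (%y. H (t, y)) (at y) = (%v. frechet_derivative H (at (t, y)) (0, v))"
    using frechet_derivative_at[OF d] by simp
  have "((%s. (s, y)) has_derivative (%s. s *\<^sub>R (1, 0))) (at t)" by (auto intro!: derivative_eq_intros)
  from has_derivative_compose[OF this H]
  show "((%t. H (t, y)) has_vector_derivative frechet_derivative H (at (t, y)) (1, 0)) (at t)"
    by (simp only: linear_cmul[OF has_derivative_linear[OF H]] has_vector_derivative_def)
qed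

context compact_manifold begin

text \<open>Global substitutes for coordinate derivatives: \<open>\<Delta> (j, b)\<close> is the
  derivative in direction \<open>b\<close> of the \<open>j\<close>-th chart, weighted by the
  partition function \<open>\<psi> j\<close>, and \<open>X (j, b)\<close> is the cut-off coordinate.
  The operators do not depend on time and commute with the time derivative by the symmetry of second
  derivatives.\<close>

lemma derivation_operators:
  obtains I :: "(nat \<times> 'b) set" and X and \<Delta> :: "nat \<times> 'b => ('m => real) => 'm => real"
  where "finite I" "!!k. X k \<in> CF"
    "!!k h. smooth_family \<A> h ==> smooth_family \<A> (%t. \<Delta> k (h t))"
    "!!k h t x. smooth_family \<A> h ==>
      ((%s. \<Delta> k (h s) x) has_real_derivative \<Delta> k (%y. deriv (%s. h s y) t) x) (at t)"
    "!!x D f. D \<in> tangent_space \<A> x ==> f \<in> CF ==> D f = (\<Sum>k\<in>I. D (X k) * \<Delta> k f x)"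
proof -
  note B = basis[OF fd]
  obtain Uf cf where Uc: "!!x. (Uf x, cf x) \<in> \<A>" "!!x. x \<in> Uf x" using chart_exists by metis
  obtain n p \<zeta> C \<psi> where "partition_of_unity Uf n p \<zeta> C \<psi>"
    using partition_of_unity_exists[of Uf, OF chart_open[OF Uc(1)] Uc(2)] by blast
  note part = partition_of_unityD[OF this]
  define U where "U = (%j. Uf (p j))"
  define c where "c = (%j. cf (p j))"
  have U: "(U j, c j) \<in> \<A>" "open (U j)" for j using Uc chart_open[OF Uc(1)] by (auto simp: U_def c_def)
  have \<psi>C: "y \<in> C j" if "\<psi> j y \<noteq> 0" for j y using part(4)[of y j] part(6)[OF that] by auto
  have CU: "C j \<subseteq> U j" for j using part(3) by (simp add: U_def)
  define X where "X = (%k y. \<zeta> (fst k) y * coord (snd k) (c (fst k) y))"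
  define \<Delta> where "\<Delta> = (%k f x. \<psi> (fst k) x *
    frechet_derivative (%y. f (inv_into (U (fst k)) (c (fst k)) y)) (at (c (fst k) x)) (snd k))"
  have c\<psi>: "continuous_on UNIV (\<psi> j)" for j
    using smooth_fun_on_imp_continuous_on[of UNIV "\<psi> j"] part(5) by simp
  have o\<psi>: "open {y. \<psi> j y \<noteq> 0}" for j using open_Collect_neq[OF c\<psi> continuous_on_const] .
  have XCF: "X k \<in> CF" for k
  proof -
    have "smooth_fun_on \<A> (U (fst k)) (X k)" unfolding X_def using part(1) chart_smooth[OF U(1)]
      by (intro smooth_fun_on_mult smooth_fun_on_bounded_linear[OF B(2)]) (auto intro: smooth_fun_on_subset)
    then have "smooth_fun_on \<A> UNIV (X k)"
      by (rule smooth_fun_on_extend_zero[OF _ U(2) part(2) CU]) (simp add: X_def part(4))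
    then show ?thesis by simp
  qed
  show ?thesis
  proof (rule that[of "{..<n} \<times> (basis :: 'b set)" X \<Delta>])
    show "finite ({..<n} \<times> (basis :: 'b set))" using B(1) by simp
    show "X k \<in> CF" for k by (rule XCF)
    show "D f = (\<Sum>k\<in>{..<n} \<times> basis. D (X k) * \<Delta> k f x)" if D: "D \<in> tangent_space \<A> x" and f: "f \<in> CF" for x D f
    proof -
      have "\<psi> j x * D f = (\<Sum>b\<in>basis. D (X (j, b)) * \<Delta> (j, b) f x)" for j
      proof (cases "\<psi> j x = 0")
        case False
        then have xU: "x \<in> U j" using \<psi>C CU by blast
        have "D f = (\<Sum>b\<in>basis. D (%y. \<zeta> j y * coord b (c j y)) *
            frechet_derivative (%y. f (inv_into (U j) (c j) y)) (at (c j x)) b)"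
          by (rule derivation_formula(2)[OF U(1) U(2) xU order_refl B(2,3) part(1,2) CU part(4) o\<psi> _ _ D f])
            (use False part(6) in auto)
        then have "\<psi> j x * D f = \<psi> j x * (\<Sum>b\<in>basis. D (%y. \<zeta> j y * coord b (c j y)) *
            frechet_derivative (%y. f (inv_into (U j) (c j) y)) (at (c j x)) b)" by simp
        then show ?thesis by (simp add: X_def \<Delta>_def sum_distrib_left mult_ac)
      qed (simp add: \<Delta>_def)
      then have "(\<Sum>j<n. \<psi> j x * D f) = (\<Sum>k\<in>{..<n} \<times> basis. D (X k) * \<Delta> k f x)"
        by (simp add: sum.cartesian_product)
      then show ?thesis using part(7)[of x] by (simp add: sum_distrib_right[symmetric])
    qed
    fix k :: "nat \<times> 'b" and h :: "real => 'm => real" assume h: "smooth_family \<A> h"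
    obtain j b where k: "k = (j, b)" by (cases k)
    let ?S = "UNIV \<times> c j ` U j"
    let ?H = "%(t, y). h t (inv_into (U j) (c j) y)"
    note H = smooth_family_C_inf[OF h U(1), of j]
    have part1: "frechet_derivative (%y. h t (inv_into (U j) (c j) y)) (at y) b =
        frechet_derivative ?H (at (t, y)) (0, b)" if "y \<in> c j ` U j" for t y
      using partial_derivative(2)[OF spec[OF H(1)], of t y] that by simp
    have K: "C_inf_on ?S (%q. frechet_derivative ?H (at q) v)" for v using H(1) k_smooth_on_SucD(2) by blast
    show "smooth_family \<A> (%t. \<Delta> k (h t))"
    proof (rule smooth_family_extend_zero[OF _ U(2) part(2) CU])
      have "smooth_on ?S (%q. frechet_derivative ?H (at q) (0, b))" using K smooth_on_open[OF H(2)] by blast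
      then have "smooth_on (UNIV \<times> c j ` U j) (%(t, y). frechet_derivative
          (%y. h t (inv_into (U j) (c j) y)) (at (c j (inv_into (U j) (c j) y))) b)"
        by (rule smooth_on_cong) (use part1 chart_inv[OF U(1)] in auto)
      then have "smooth_fun_on (line_times \<A>) (UNIV \<times> U j)
          (%(t, x). frechet_derivative (%y. h t (inv_into (U j) (c j) y)) (at (c j x)) b)"
        by (rule smooth_family_chart[OF U(1) order_refl U(2)])
      moreover have "smooth_fun_on (line_times \<A>) (UNIV \<times> U j) (%(t::real, x). \<psi> j x)"
        by (rule smooth_family_static) (use part(5) in \<open>auto intro: smooth_fun_on_subset\<close>)
      ultimately have "smooth_fun_on (line_times \<A>) (UNIV \<times> U j) (%q. (case q of (t::real, x) => \<psi> j x) *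
          (case q of (t, x) => frechet_derivative (%y. h t (inv_into (U j) (c j) y)) (at (c j x)) b))"
        by (intro smooth_fun_on_mult)
      then show "smooth_fun_on (line_times \<A>) (UNIV \<times> U j) (%(t, x). \<Delta> k (h t) x)"
        by (simp add: \<Delta>_def k case_prod_unfold)
      show "\<Delta> k (h t) x = 0" if "x \<notin> C j" for t x using that \<psi>C by (auto simp: \<Delta>_def k)
    qed
    fix t x
    show "((%s. \<Delta> k (h s) x) has_real_derivative \<Delta> k (%y. deriv (%s. h s y) t) x) (at t)"
    proof (cases "\<psi> j x = 0")
      case True
      then show ?thesis by (simp add: \<Delta>_def k)
    next
      case False
      then have xU: "x \<in> U j" using \<psi>C CU by blast
      then have cx: "c j x \<in> c j ` U j" "(t, c j x) \<in> ?S" for t by auto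
      let ?H' = "%(t, y). deriv (%s. h s (inv_into (U j) (c j) y)) t"
      have 1: "((%s. frechet_derivative ?H (at (s, c j x)) (0, b)) has_real_derivative
          frechet_derivative (%q. frechet_derivative ?H (at q) (0, b)) (at (t, c j x)) (1, 0)) (at t)"
        using partial_derivative(3)[OF spec[OF K] cx(2)]
        by (simp add: has_real_derivative_iff_has_vector_derivative)
      have 2: "frechet_derivative (%q. frechet_derivative ?H (at q) (0, b)) (at (t, c j x)) (1, 0) =
          frechet_derivative (%q. frechet_derivative ?H (at q) (1, 0)) (at (t, c j x)) (0, b)"
        by (rule second_derivative_symmetric[OF H(2) cx(2) spec[OF H(1)]])
      have eq: "frechet_derivative ?H (at q) (1, 0) = ?H' q" if "q \<in> ?S" for q
      proof -
        from that obtain t x where q: "q = (t, c j x)" "x \<in> U j" by auto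
        show ?thesis using smooth_family_has_derivative(3)[OF h U(1) q(2), of t] q chart_inv[OF U(1) q(2)] by simp
      qed
      have 3: "frechet_derivative (%q. frechet_derivative ?H (at q) (1, 0)) (at (t, c j x)) =
          frechet_derivative ?H' (at (t, c j x))" by (rule frechet_derivative_cong_open[OF H(2) cx(2) eq])
      have 4: "frechet_derivative ?H' (at (t, c j x)) (0, b) =
          frechet_derivative (%y. deriv (%s. h s (inv_into (U j) (c j) y)) t) (at (c j x)) b"
        using partial_derivative(2)[OF spec[OF smooth_family_C_inf(1)[OF smooth_family_has_derivative(2)[OF h] U(1)]] cx(2)]
        by simp
      have "((%s. \<psi> j x * frechet_derivative ?H (at (s, c j x)) (0, b)) has_real_derivative
          \<psi> j x * frechet_derivative (%y. deriv (%s. h s (inv_into (U j) (c j) y)) t) (at (c j x)) b) (at t)"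
        using DERIV_cmult[OF 1[unfolded 2 3 4]] .
      then show ?thesis by (simp add: \<Delta>_def k part1[OF cx(1)])
    qed
  qed
qed

end

lemma (in manifold) smooth_fun_on_two_cover:
  assumes "open N" "closed C" "C \<subseteq> N" "smooth_fun_on \<A> (N \<inter> V) f" "smooth_fun_on \<A> (- C \<inter> V) f"
  shows "smooth_fun_on \<A> V f"
proof (rule smooth_fun_on_local)
  fix x
  show "\<exists>N. open N \<and> x \<in> N \<and> smooth_fun_on \<A> (N \<inter> V) f"
  proof (cases "x \<in> N")
    case True
    then show ?thesis using assms by blast
  next
    case False
    then show ?thesis using assms by (intro exI[of _ "- C"]) auto
  qed
qed

section \<open>Calculus on a Lie algebroid over a compact base\<close>

locale compact_lie_algebroid =
  fixes A :: "('m::{t2_space,second_countable_topology}, 'b::real_normed_vector,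
    'v::real_vector, 'f::real_normed_vector) algebroid"
  assumes lie_algebroid: "lie_algebroid A" and compact_base: "compact (UNIV :: 'm set)"
begin

lemma vector_bundle: "vector_bundle A" using lie_algebroid by (simp add: lie_algebroid_def)

end

sublocale compact_lie_algebroid \<subseteq> compact_manifold "base A"
  by unfold_locales (use vector_bundle compact_base in \<open>auto simp: vector_bundle_def\<close>)

lemma linear_between_sum:
  assumes "linear_between S T h" "subspace S" "!!i. i \<in> I ==> f i \<in> S"
  shows "h (\<Sum>i\<in>I. r i *\<^sub>R f i) = (\<Sum>i\<in>I. r i *\<^sub>R h (f i))"
proof (cases "finite I")
  case True
  then show ?thesis using assms(3)
  proof (induction I)
    case empty
    have "h (0 *\<^sub>R 0) = 0 *\<^sub>R h 0" using assms(1,2) unfolding linear_between_def by (metis subspace_0)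
    then show ?case by simp
  next
    case (insert i I)
    have "(\<Sum>i\<in>I. r i *\<^sub>R f i) \<in> S" "r i *\<^sub>R f i \<in> S"
      using insert assms(2) by (auto intro!: subspace_sum subspace_scale)
    then have "h (r i *\<^sub>R f i + (\<Sum>i\<in>I. r i *\<^sub>R f i)) = h (r i *\<^sub>R f i) + h (\<Sum>i\<in>I. r i *\<^sub>R f i)"
      using assms(1) by (auto simp: linear_between_def)
    also have "h (r i *\<^sub>R f i) = r i *\<^sub>R h (f i)" using assms(1) insert.prems by (auto simp: linear_between_def)
    finally show ?case using insert by simp
  qed
next
  case False
  have "h (0 *\<^sub>R 0) = 0 *\<^sub>R h 0" using assms(1,2) unfolding linear_between_def by (metis subspace_0)
  then show ?thesis using False by simp
qed

lemma linear_between_rules: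
  assumes "linear_between S T h" "a \<in> S"
  shows linear_between_add: "b \<in> S ==> h (a + b) = h a + h b"
    and linear_between_scale: "h (r *\<^sub>R a) = r *\<^sub>R h a"
    and linear_between_mem: "h a \<in> T" using assms unfolding linear_between_def by auto

lemma linear_between_minus: "linear_between S T h ==> a \<in> S ==> h (- a) = - h a"
  using linear_between_scale[of S T h a "-1"] by simp

lemma linear_between_0: "linear_between S T h ==> a \<in> S ==> h 0 = 0"
  unfolding linear_between_def by (metis scale_zero_left)

context compact_lie_algebroid begin

abbreviation "\<Gamma> \<equiv> sections A"
abbreviation "line \<equiv> line_times (base A)"
abbreviation "\<rho> \<equiv> anchor A"

lemma fdf: "finite_dim TYPE('f)" using vector_bundle by (simp add: vector_bundle_def)
lemma subspace_fibre: "subspace (fibre A x)" using vector_bundle by (simp add: vector_bundle_def)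

lemmas fibre_add = subspace_add[OF subspace_fibre]
  and fibre_scale = subspace_scale[OF subspace_fibre]
  and fibre_0 = subspace_0[OF subspace_fibre]
  and fibre_sum = subspace_sum[OF subspace_fibre]
  and fibre_neg = subspace_neg[OF subspace_fibre]
  and fibre_diff = subspace_diff[OF subspace_fibre]

lemma frame_exists: "\<exists>U \<tau>. (U, \<tau>) \<in> frames A \<and> x \<in> U"
proof -
  have "x \<in> \<Union>(fst ` frames A)" using vector_bundle by (auto simp: vector_bundle_def)
  then show ?thesis by force
qed

lemma frame:
  assumes "(U, \<tau>) \<in> frames A"
  shows frame_open: "open U" and frame_linear: "x \<in> U ==> linear (\<tau> x)"
    and frame_bij: "x \<in> U ==> bij_betw (\<tau> x) UNIV (fibre A x)"
  using vector_bundle assms by (auto simp: vector_bundle_def)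

lemma frame_transition:
  "(U, \<tau>) \<in> frames A ==> (V, \<sigma>) \<in> frames A ==> smooth_fun_on (base A) (U \<inter> V) (%x. inv (\<sigma> x) (\<tau> x v))"
  using vector_bundle unfolding vector_bundle_def by blast

lemma frame_mem: "(U, \<tau>) \<in> frames A ==> x \<in> U ==> \<tau> x v \<in> fibre A x" using bij_betwE[OF frame_bij] by blast

lemma frame_inv: "(U, \<tau>) \<in> frames A ==> x \<in> U ==> inv (\<tau> x) (\<tau> x v) = v"
  using frame_bij by (metis bij_betw_def inv_f_f)

lemma inv_frame: "(U, \<tau>) \<in> frames A ==> x \<in> U ==> a \<in> fibre A x ==> \<tau> x (inv (\<tau> x) a) = a"
  using frame_bij by (metis bij_betw_imp_surj_on f_inv_into_f)

lemma inv_frame_linear: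
  assumes "(U, \<tau>) \<in> frames A" "x \<in> U" shows "linear_between (fibre A x) UNIV (inv (\<tau> x))"
  unfolding linear_between_def
proof (intro conjI ballI allI)
  fix a b assume ab: "a \<in> fibre A x" "b \<in> fibre A x"
  show "inv (\<tau> x) (a + b) = inv (\<tau> x) a + inv (\<tau> x) b"
    using frame_inv[OF assms, of "inv (\<tau> x) a + inv (\<tau> x) b"] ab
    by (simp add: linear_add[OF frame_linear[OF assms]] inv_frame[OF assms])
next
  fix r a assume a: "a \<in> fibre A x"
  show "inv (\<tau> x) (r *\<^sub>R a) = r *\<^sub>R inv (\<tau> x) a" using frame_inv[OF assms, of "r *\<^sub>R inv (\<tau> x) a"] a
    by (simp add: linear_cmul[OF frame_linear[OF assms]] inv_frame[OF assms])
qed simp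

lemma functional_frame_bounded_linear:
  assumes "(U, \<tau>) \<in> frames A" "x \<in> U" "linear_between (fibre A x) UNIV \<alpha>"
  shows "bounded_linear (%v. \<alpha> (\<tau> x v) :: real)"
proof (rule linear_imp_bounded_linear_finite_dim[OF fdf linearI])
  show "\<alpha> (\<tau> x (u + v)) = \<alpha> (\<tau> x u) + \<alpha> (\<tau> x v)" for u v
    using frame_mem[OF assms(1,2)] assms(3) by (simp add: linear_add[OF frame_linear[OF assms(1,2)]] linear_between_def)
  show "\<alpha> (\<tau> x (r *\<^sub>R v)) = r *\<^sub>R \<alpha> (\<tau> x v)" for r v
    using frame_mem[OF assms(1,2)] assms(3) by (simp add: linear_cmul[OF frame_linear[OF assms(1,2)]] linear_between_def)
qed

lemma sectionD: "X \<in> \<Gamma> ==> X x \<in> fibre A x"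
  "X \<in> \<Gamma> ==> (U, \<tau>) \<in> frames A ==> smooth_fun_on (base A) U (%x. inv (\<tau> x) (X x))" by (auto simp: sections_def)

lemma sectionI:
  assumes "!!x. X x \<in> fibre A x"
    "!!U \<tau>. (U, \<tau>) \<in> frames A ==> smooth_fun_on (base A) U (%x. inv (\<tau> x) (X x))"
  shows "X \<in> \<Gamma>" using assms by (auto simp: sections_def)

lemma section_add:
  assumes "X \<in> \<Gamma>" "Y \<in> \<Gamma>" shows "(%x. X x + Y x) \<in> \<Gamma>"
proof (rule sectionI)
  fix U \<tau> assume U: "(U, \<tau>) \<in> frames A"
  have "smooth_fun_on (base A) U (%x. inv (\<tau> x) (X x) + inv (\<tau> x) (Y x))"
    by (intro smooth_fun_on_add sectionD assms U)
  then show "smooth_fun_on (base A) U (%x. inv (\<tau> x) (X x + Y x))"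
    by (rule smooth_fun_on_cong) (use linear_between_add[OF inv_frame_linear[OF U]] sectionD(1) assms in auto)
qed (use assms sectionD(1) fibre_add in auto)

lemma section_scale:
  assumes "f \<in> CF" "X \<in> \<Gamma>" shows "(%x. f x *\<^sub>R X x) \<in> \<Gamma>"
proof (rule sectionI)
  fix U \<tau> assume U: "(U, \<tau>) \<in> frames A"
  have "smooth_fun_on (base A) U (%x. f x *\<^sub>R inv (\<tau> x) (X x))"
    using assms(1) by (intro smooth_fun_on_scaleR sectionD assms U) (auto intro: smooth_fun_on_subset)
  then show "smooth_fun_on (base A) U (%x. inv (\<tau> x) (f x *\<^sub>R X x))"
    by (rule smooth_fun_on_cong) (use linear_between_scale[OF inv_frame_linear[OF U]] sectionD(1) assms in auto)
qed (use assms sectionD(1) fibre_scale in auto)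

lemma section_zero: "(%x. 0) \<in> \<Gamma>"
proof (rule sectionI)
  fix U \<tau> assume U: "(U, \<tau>) \<in> frames A"
  show "smooth_fun_on (base A) U (%x. inv (\<tau> x) 0)"
    by (rule smooth_fun_on_cong[OF smooth_fun_on_const[of _ _ 0]])
      (use linear_between_0[OF inv_frame_linear[OF U]] fibre_0 in auto)
qed (simp add: fibre_0)

lemma section_sum: "(!!i. i \<in> I ==> X i \<in> \<Gamma>) ==> (%x. \<Sum>i\<in>I. X i x) \<in> \<Gamma>"
  by (induction I rule: infinite_finite_induct) (auto intro: section_add section_zero)

lemma section_extend_zero:
  assumes U: "(U, \<tau>) \<in> frames A" and N: "open N" "N \<subseteq> U" and C: "closed C" "C \<subseteq> N"
    and s: "smooth_fun_on (base A) N s" "!!x. x \<in> N ==> x \<notin> C ==> s x = 0"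
  shows "(%x. if x \<in> N then \<tau> x (s x) else 0) \<in> \<Gamma>" (is "?X \<in> \<Gamma>")
proof (rule sectionI)
  show "?X x \<in> fibre A x" for x using frame_mem[OF U] N by (auto simp: fibre_0)
  fix V \<sigma> assume V: "(V, \<sigma>) \<in> frames A"
  note B = basis[OF fdf]
  have 1: "smooth_fun_on (base A) (N \<inter> V) (%x. inv (\<sigma> x) (?X x))"
  proof -
    have "smooth_fun_on (base A) (N \<inter> V) (%x. \<Sum>b\<in>basis. coord b (s x) *\<^sub>R inv (\<sigma> x) (\<tau> x b))"
      using N by (intro smooth_fun_on_sum smooth_fun_on_scaleR smooth_fun_on_bounded_linear[OF B(2)]
          smooth_fun_on_subset[OF s(1)] smooth_fun_on_subset[OF frame_transition[OF U V]]) auto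
    then show ?thesis
    proof (rule smooth_fun_on_cong)
      fix x assume x: "x \<in> N \<inter> V"
      then have xU: "x \<in> U" "x \<in> V" "x \<in> N" using N by auto
      have "inv (\<sigma> x) (\<tau> x (s x)) = inv (\<sigma> x) (\<Sum>b\<in>basis. coord b (s x) *\<^sub>R \<tau> x b)"
        by (subst linear_expand[OF B(3) frame_linear[OF U xU(1)]]) (rule refl)
      also have "\<dots> = (\<Sum>b\<in>basis. coord b (s x) *\<^sub>R inv (\<sigma> x) (\<tau> x b))"
        by (rule linear_between_sum[OF inv_frame_linear[OF V xU(2)] subspace_fibre frame_mem[OF U xU(1)]])
      finally show "(\<Sum>b\<in>basis. coord b (s x) *\<^sub>R inv (\<sigma> x) (\<tau> x b)) = inv (\<sigma> x) (?X x)" using xU by simp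
    qed
  qed
  have 2: "smooth_fun_on (base A) (- C \<inter> V) (%x. inv (\<sigma> x) (?X x))"
  proof (rule smooth_fun_on_cong[OF smooth_fun_on_const[of _ _ 0]])
    fix x assume x: "x \<in> - C \<inter> V"
    then have "?X x = 0" using s(2)[of x] linear_0[OF frame_linear[OF U, of x]] N by auto
    then show "0 = inv (\<sigma> x) (?X x)" using linear_between_0[OF inv_frame_linear[OF V] fibre_0] x by simp
  qed
  show "smooth_fun_on (base A) V (%x. inv (\<sigma> x) (?X x))" by (rule smooth_fun_on_two_cover[OF N(1) C 1 2])
qed

text \<open>A section is a finite combination of the global sections \<open>E k\<close>, with the globally defined
  coefficients \<open>\<theta> k\<close>. This turns the calculus of sections into a calculus of functions.\<close>

lemma generators:
  obtains K :: "(nat \<times> 'f) set" and E and \<theta> :: "nat \<times> 'f => 'm => 'v => real"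
  where "finite K" "!!k. E k \<in> \<Gamma>"
    "!!k x. linear_between (fibre A x) UNIV (\<theta> k x)"
    "!!k U \<tau> v. (U, \<tau>) \<in> frames A ==> smooth_fun_on (base A) U (%x. \<theta> k x (\<tau> x v))"
    "!!x a. a \<in> fibre A x ==> a = (\<Sum>k\<in>K. \<theta> k x a *\<^sub>R E k x)"
proof -
  note B = basis[OF fdf]
  obtain Uf \<tau>f where U\<tau>: "!!x. (Uf x, \<tau>f x) \<in> frames A" "!!x. x \<in> Uf x" using frame_exists by metis
  obtain n p \<zeta> C \<psi> where "partition_of_unity Uf n p \<zeta> C \<psi>"
    using partition_of_unity_exists[of Uf, OF frame_open[OF U\<tau>(1)] U\<tau>(2)] by blast
  note part = partition_of_unityD[OF this]
  define U where "U = (%j. Uf (p j))"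
  define \<tau> where "\<tau> = (%j. \<tau>f (p j))"
  have U: "(U j, \<tau> j) \<in> frames A" "open (U j)" for j using U\<tau> frame_open[OF U\<tau>(1)] by (auto simp: U_def \<tau>_def)
  have \<psi>C: "\<psi> j y = 0" if "y \<notin> C j" for j y using part(4)[OF that] part(6)[of j y] by fastforce
  have CU: "C j \<subseteq> U j" for j using part(3) by (simp add: U_def)
  \<comment> \<open>Summed over \<open>b\<close>, \<open>\<theta> (j, b)\<close> times
    \<open>E (j, b)\<close> is multiplication by \<open>\<psi> j * \<zeta> j\<close>, which is
    \<open>\<psi> j\<close> because \<open>\<zeta> j\<close> is 1 where \<open>\<psi> j\<close> is
    non-zero.\<close>
  define E where "E = (%k x. if x \<in> U (fst k) then \<tau> (fst k) x (\<zeta> (fst k) x *\<^sub>R snd k) else 0)"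
  define \<theta> where "\<theta> = (%k x a. if x \<in> U (fst k) then \<psi> (fst k) x * coord (snd k) (inv (\<tau> (fst k) x) a) else 0)"
  show ?thesis
  proof (rule that[of "{..<n} \<times> (basis :: 'f set)" E \<theta>])
    show "finite ({..<n} \<times> (basis :: 'f set))" using B(1) by simp
    show "E k \<in> \<Gamma>" for k unfolding E_def by (rule section_extend_zero[OF U(1) U(2) order_refl part(2) CU])
        (use part(1,4) in \<open>auto intro!: smooth_fun_on_scaleR smooth_fun_on_const intro: smooth_fun_on_subset\<close>)
    show lin: "linear_between (fibre A x) UNIV (\<theta> k x)" for k x
    proof (cases "x \<in> U (fst k)")
      case True
      note inv_frame_linear[OF U(1) True]
      moreover have "linear (coord (snd k))" using B(2) bounded_linear.linear by blast
      ultimately show ?thesis using True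
        by (auto simp: linear_between_def \<theta>_def linear_add linear_cmul distrib_left)
    qed (auto simp: linear_between_def \<theta>_def)
    show "smooth_fun_on (base A) V (%x. \<theta> k x (\<sigma> x v))" if V: "(V, \<sigma>) \<in> frames A" for k V \<sigma> v
    proof -
      have "smooth_fun_on (base A) (U (fst k) \<inter> V) (%x. \<psi> (fst k) x * coord (snd k) (inv (\<tau> (fst k) x) (\<sigma> x v)))"
        using part(5) by (intro smooth_fun_on_mult smooth_fun_on_bounded_linear[OF B(2)]
            smooth_fun_on_subset[OF frame_transition[OF V U(1)]]) (auto intro: smooth_fun_on_subset)
      then have 1: "smooth_fun_on (base A) (U (fst k) \<inter> V) (%x. \<theta> k x (\<sigma> x v))"
        by (rule smooth_fun_on_cong) (auto simp: \<theta>_def)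
      have 2: "smooth_fun_on (base A) (- C (fst k) \<inter> V) (%x. \<theta> k x (\<sigma> x v))"
        by (rule smooth_fun_on_cong[OF smooth_fun_on_const[of _ _ 0]]) (use \<psi>C in \<open>auto simp: \<theta>_def\<close>)
      show ?thesis by (rule smooth_fun_on_two_cover[OF U(2) part(2) CU 1 2])
    qed
    show "a = (\<Sum>k\<in>{..<n} \<times> basis. \<theta> k x a *\<^sub>R E k x)" if a: "a \<in> fibre A x" for x a
    proof -
      have "(\<Sum>b\<in>basis. \<theta> (j, b) x a *\<^sub>R E (j, b) x) = \<psi> j x *\<^sub>R a" for j
      proof (cases "\<psi> j x = 0")
        case False
        then have xU: "x \<in> U j" and \<zeta>: "\<zeta> j x = 1" using \<psi>C CU part(6) by blast+
        have "(\<Sum>b\<in>basis. \<theta> (j, b) x a *\<^sub>R E (j, b) x) = \<psi> j x *\<^sub>R (\<Sum>b\<in>basis. coord b (inv (\<tau> j x) a) *\<^sub>R \<tau> j x b)"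
          using xU \<zeta> by (simp add: \<theta>_def E_def scaleR_sum_right)
        also have "(\<Sum>b\<in>basis. coord b (inv (\<tau> j x) a) *\<^sub>R \<tau> j x b) = \<tau> j x (inv (\<tau> j x) a)"
          by (subst linear_expand[OF B(3) frame_linear[OF U(1) xU], of "inv (\<tau> j x) a"]) (rule refl)
        also have "\<dots> = a" by (rule inv_frame[OF U(1) xU a])
        finally show ?thesis .
      next
        case True
        then have "\<theta> (j, b) x a = 0" for b by (simp add: \<theta>_def)
        then show ?thesis using True by simp
      qed
      moreover have "(\<Sum>k\<in>{..<n} \<times> basis. \<theta> k x a *\<^sub>R E k x) = (\<Sum>j<n. \<Sum>b\<in>basis. \<theta> (j, b) x a *\<^sub>R E (j, b) x)"
        by (simp add: sum.cartesian_product)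
      ultimately have "(\<Sum>k\<in>{..<n} \<times> basis. \<theta> k x a *\<^sub>R E k x) = (\<Sum>j<n. \<psi> j x *\<^sub>R a)" by simp
      then show ?thesis using part(7)[of x] by (simp add: scaleR_sum_left[symmetric])
    qed
  qed
qed

end

section \<open>Calculus with a fixed choice of generators and derivation operators\<close>

text \<open>The generators are in general linearly dependent, so \<open>\<theta>\<close> is a dual
  frame only in the sense of \<open>expand\<close>. Together with \<open>\<Delta>_expand\<close>
  this reduces every statement on time-dependent sections to one on finitely many real
  functions.\<close>

locale lie_calculus = compact_lie_algebroid A
  for A :: "('m::{t2_space,second_countable_topology}, 'b::real_normed_vector,
    'v::real_vector, 'f::real_normed_vector) algebroid" +
  fixes K :: "(nat \<times> 'f) set" and E :: "nat \<times> 'f => 'm => 'v" and \<theta> :: "nat \<times> 'f => 'm => 'v => real"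
    and I :: "(nat \<times> 'b) set" and crdf :: "nat \<times> 'b => 'm => real"
    and \<Delta> :: "nat \<times> 'b => ('m => real) => 'm => real"
  assumes finite_K: "finite K" and E: "!!k. E k \<in> sections A"
    and \<theta>_linear: "!!k x. linear_between (fibre A x) UNIV (\<theta> k x)"
    and \<theta>_smooth: "!!k U \<tau> v. (U, \<tau>) \<in> frames A ==> smooth_fun_on (base A) U (%x. \<theta> k x (\<tau> x v))"
    and expand: "!!x a. a \<in> fibre A x ==> a = (\<Sum>k\<in>K. \<theta> k x a *\<^sub>R E k x)"
    and finite_I: "finite I" and crdf: "!!i. crdf i \<in> smooth_functions (base A)"
    and \<Delta>_family: "!!i h. smooth_family (base A) h ==> smooth_family (base A) (%t. \<Delta> i (h t))"
    and \<Delta>_derivative: "!!i h t x. smooth_family (base A) h ==>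
      ((%s. \<Delta> i (h s) x) has_real_derivative \<Delta> i (%y. deriv (%s. h s y) t) x) (at t)"
    and \<Delta>_expand: "!!x D f. D \<in> tangent_space (base A) x ==> f \<in> smooth_functions (base A) ==>
      D f = (\<Sum>i\<in>I. D (crdf i) * \<Delta> i f x)"

lemma (in compact_lie_algebroid) lie_calculus_exists:
  "\<exists>K E \<theta> I crdf \<Delta>. lie_calculus A K E \<theta> I crdf \<Delta>"
proof (rule generators)
  fix K :: "(nat \<times> 'f) set" and E \<theta>
  assume 1: "finite K" "!!k. E k \<in> \<Gamma>" "!!k x. linear_between (fibre A x) UNIV (\<theta> k x)"
    "!!k U \<tau> v. (U, \<tau>) \<in> frames A ==> smooth_fun_on (base A) U (%x. \<theta> k x (\<tau> x v))"
    "!!x a. a \<in> fibre A x ==> a = (\<Sum>k\<in>K. \<theta> k x a *\<^sub>R E k x)"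
  show ?thesis
  proof (rule derivation_operators)
    fix I :: "(nat \<times> 'b) set" and crdf \<Delta>
    assume 2: "finite I" "!!k. crdf k \<in> CF"
      "!!k h. smooth_family (base A) h ==> smooth_family (base A) (%t. \<Delta> k (h t))"
      "!!k h t x. smooth_family (base A) h ==>
        ((%s. \<Delta> k (h s) x) has_real_derivative \<Delta> k (%y. deriv (%s. h s y) t) x) (at t)"
      "!!x D f. D \<in> tangent_space (base A) x ==> f \<in> CF ==> D f = (\<Sum>k\<in>I. D (crdf k) * \<Delta> k f x)"
    have "lie_calculus A K E \<theta> I crdf \<Delta>"
      by (rule lie_calculus.intro[OF compact_lie_algebroid_axioms lie_calculus_axioms.intro]) (fact 1 2)+
    then show ?thesis by blast
  qed
qed

section \<open>Identities for anchor and bracket\<close>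

context compact_lie_algebroid begin

lemma anchor:
  shows anchor_tangent: "a \<in> fibre A x ==> \<rho> x a \<in> tangent_space (base A) x"
    and anchor_linear: "f \<in> CF ==> linear_between (fibre A x) UNIV (%a. \<rho> x a f)"
    and anchor_CF: "X \<in> \<Gamma> ==> f \<in> CF ==> (%x. \<rho> x (X x) f) \<in> CF"
proof -
  note L = lie_algebroid[unfolded lie_algebroid_def]
  show "a \<in> fibre A x ==> \<rho> x a \<in> tangent_space (base A) x" using L[THEN conjunct2, THEN conjunct1] by blast
  show "f \<in> CF ==> linear_between (fibre A x) UNIV (%a. \<rho> x a f)"
    using L[THEN conjunct2, THEN conjunct2, THEN conjunct1] by blast
  show "X \<in> \<Gamma> ==> f \<in> CF ==> (%x. \<rho> x (X x) f) \<in> CF"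
    using L[THEN conjunct2, THEN conjunct2, THEN conjunct2, THEN conjunct1] by blast
qed

lemma bracket:
  assumes X: "X \<in> \<Gamma>" and Y: "Y \<in> \<Gamma>"
  shows bracket_section: "bracket A X Y \<in> \<Gamma>"
    and bracket_linear: "Z \<in> \<Gamma> ==>
      bracket A (%x. r *\<^sub>R X x + s *\<^sub>R Y x) Z = (%x. r *\<^sub>R bracket A X Z x + s *\<^sub>R bracket A Y Z x)"
    and bracket_antisym: "bracket A X Y = (%x. - bracket A Y X x)"
    and bracket_jacobi: "Z \<in> \<Gamma> ==>
      bracket A X (bracket A Y Z) x + bracket A Y (bracket A Z X) x + bracket A Z (bracket A X Y) x = 0"
    and bracket_leibniz: "f \<in> CF ==>
      bracket A X (%x. f x *\<^sub>R Y x) = (%x. f x *\<^sub>R bracket A X Y x + \<rho> x (X x) f *\<^sub>R Y x)"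
proof -
  note L = lie_algebroid[unfolded lie_algebroid_def, THEN conjunct2, THEN conjunct2, THEN conjunct2, THEN conjunct2]
  show "bracket A X Y \<in> \<Gamma>" using L[THEN conjunct1] X Y by blast
  show "Z \<in> \<Gamma> ==>
      bracket A (%x. r *\<^sub>R X x + s *\<^sub>R Y x) Z = (%x. r *\<^sub>R bracket A X Z x + s *\<^sub>R bracket A Y Z x)"
    using L[THEN conjunct2, THEN conjunct1] X Y by blast
  show "bracket A X Y = (%x. - bracket A Y X x)"
    using L[THEN conjunct2, THEN conjunct2, THEN conjunct1] X Y by blast
  show "Z \<in> \<Gamma> ==>
      bracket A X (bracket A Y Z) x + bracket A Y (bracket A Z X) x + bracket A Z (bracket A X Y) x = 0"
    using L[THEN conjunct2, THEN conjunct2, THEN conjunct2, THEN conjunct1] X Y by blast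
  show "f \<in> CF ==>
      bracket A X (%x. f x *\<^sub>R Y x) = (%x. f x *\<^sub>R bracket A X Y x + \<rho> x (X x) f *\<^sub>R Y x)"
    using L[THEN conjunct2, THEN conjunct2, THEN conjunct2, THEN conjunct2] X Y by blast
qed

lemma bracket_antisym_at: "X \<in> \<Gamma> ==> Y \<in> \<Gamma> ==> bracket A X Y x = - bracket A Y X x" using bracket_antisym by metis

lemma bracket_add_right:
  assumes "X \<in> \<Gamma>" "Y \<in> \<Gamma>" "Z \<in> \<Gamma>"
  shows "bracket A X (%x. Y x + Z x) x = bracket A X Y x + bracket A X Z x"
proof -
  have "bracket A X (%x. Y x + Z x) x = - bracket A (%x. Y x + Z x) X x"
    by (rule bracket_antisym_at[OF assms(1) section_add[OF assms(2,3)]])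
  also have "bracket A (%x. Y x + Z x) X x = bracket A Y X x + bracket A Z X x"
    using bracket_linear[OF assms(2,3,1), of 1 1] by simp
  finally show ?thesis using bracket_antisym_at[OF assms(1,2)] bracket_antisym_at[OF assms(1,3)] by simp
qed

lemma bracket_diff_right:
  assumes "X \<in> \<Gamma>" "Y \<in> \<Gamma>" "Z \<in> \<Gamma>"
  shows "bracket A X (%x. Y x - Z x) x = bracket A X Y x - bracket A X Z x"
proof -
  have "bracket A (%x. 1 *\<^sub>R Y x + (-1) *\<^sub>R Z x) X x = 1 *\<^sub>R bracket A Y X x + (-1) *\<^sub>R bracket A Z X x"
    using bracket_linear[OF assms(2,3,1), of 1 "-1"] by simp
  moreover have "(%x. 1 *\<^sub>R Y x + (-1) *\<^sub>R Z x) \<in> \<Gamma>" by (intro section_add section_scale assms CF_const)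
  ultimately show ?thesis
    using bracket_antisym_at[OF assms(1), of "%x. Y x - Z x" x] bracket_antisym_at[OF assms(1,2), of x]
      bracket_antisym_at[OF assms(1,3), of x] by simp
qed

lemma bracket_zero_right: "X \<in> \<Gamma> ==> bracket A X (%x. 0) x = 0"
  using bracket_diff_right[OF _ section_zero section_zero, of X x] by simp

lemma bracket_sum_right:
  assumes "X \<in> \<Gamma>" "!!i. i \<in> S ==> f i \<in> CF" "!!i. i \<in> S ==> Y i \<in> \<Gamma>"
  shows "bracket A X (%x. \<Sum>i\<in>S. f i x *\<^sub>R Y i x) x =
    (\<Sum>i\<in>S. f i x *\<^sub>R bracket A X (Y i) x + \<rho> x (X x) (f i) *\<^sub>R Y i x)" using assms(2,3)
proof (induction S rule: infinite_finite_induct)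
  case (insert i S)
  have "bracket A X (%x. f i x *\<^sub>R Y i x + (\<Sum>i\<in>S. f i x *\<^sub>R Y i x)) x =
      bracket A X (%x. f i x *\<^sub>R Y i x) x + bracket A X (%x. \<Sum>i\<in>S. f i x *\<^sub>R Y i x) x"
    using insert.prems by (intro bracket_add_right assms(1) section_scale section_sum) auto
  then show ?case using insert bracket_leibniz[OF assms(1), of "Y i" "f i"] by simp
qed (simp_all add: bracket_zero_right[OF assms(1)])

text \<open>The anchor preserves brackets: expand \<open>[[X, Y], f Z]\<close> by the Leibniz rule and by the Jacobi
  identity, and compare the coefficients of a section \<open>Z\<close> not vanishing at the point.\<close>

lemma anchor_bracket:
  assumes X: "X \<in> \<Gamma>" and Y: "Y \<in> \<Gamma>" and f: "f \<in> CF"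
  shows "\<rho> x (bracket A X Y x) f = \<rho> x (X x) (%y. \<rho> y (Y y) f) - \<rho> x (Y x) (%y. \<rho> y (X y) f)"
proof -
  let ?Xf = "%y. \<rho> y (X y) f" and ?Yf = "%y. \<rho> y (Y y) f"
  have Xf: "?Xf \<in> CF" and Yf: "?Yf \<in> CF" using anchor_CF X Y f by auto
  have key: "(\<rho> x (bracket A X Y x) f - (\<rho> x (X x) ?Yf - \<rho> x (Y x) ?Xf)) *\<^sub>R Z x = 0" if Z: "Z \<in> \<Gamma>" for Z
  proof -
    \<comment> \<open>The two mixed terms are together symmetric in \<open>P\<close> and
      \<open>Q\<close>, so they cancel in the commutator; only the second derivatives of
      \<open>f\<close> along the anchors remain.\<close>
    have expand2: "bracket A P (bracket A Q (%x. f x *\<^sub>R Z x)) x =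
        f x *\<^sub>R bracket A P (bracket A Q Z) x + \<rho> x (P x) f *\<^sub>R bracket A Q Z x +
        (\<rho> x (Q x) f *\<^sub>R bracket A P Z x + \<rho> x (P x) (%y. \<rho> y (Q y) f) *\<^sub>R Z x)"
      if P: "P \<in> \<Gamma>" and Q: "Q \<in> \<Gamma>" for P Q
    proof -
      have QZ: "bracket A Q Z \<in> \<Gamma>" by (rule bracket_section[OF Q Z])
      have Qf: "(%y. \<rho> y (Q y) f) \<in> CF" by (rule anchor_CF[OF Q f])
      have "bracket A P (bracket A Q (%x. f x *\<^sub>R Z x)) x =
          bracket A P (%x. f x *\<^sub>R bracket A Q Z x + \<rho> x (Q x) f *\<^sub>R Z x) x"
        by (simp add: bracket_leibniz[OF Q Z f])
      also have "\<dots> = bracket A P (%x. f x *\<^sub>R bracket A Q Z x) x + bracket A P (%x. \<rho> x (Q x) f *\<^sub>R Z x) x"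
        by (intro bracket_add_right P section_scale f QZ Qf Z)
      finally show ?thesis by (simp add: bracket_leibniz[OF P QZ f] bracket_leibniz[OF P Z Qf])
    qed
    have fZ: "(%x. f x *\<^sub>R Z x) \<in> \<Gamma>" by (rule section_scale[OF f Z])
    have jac: "bracket A (bracket A X Y) W x = bracket A X (bracket A Y W) x - bracket A Y (bracket A X W) x"
      if W: "W \<in> \<Gamma>" for W
    proof -
      have "bracket A Y (bracket A W X) x = - bracket A Y (bracket A X W) x"
      proof -
        have "bracket A W X = (%x. 0 - bracket A X W x)" using bracket_antisym[OF W X] by simp
        then show ?thesis
          using bracket_diff_right[OF Y section_zero bracket_section[OF X W], of x] bracket_zero_right[OF Y, of x] by simp
      qed
      moreover have "bracket A W (bracket A X Y) x = - bracket A (bracket A X Y) W x"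
        by (rule bracket_antisym_at[OF W bracket_section[OF X Y]])
      ultimately show ?thesis using bracket_jacobi[OF X Y W, of x] by (simp add: algebra_simps)
    qed
    have "f x *\<^sub>R bracket A (bracket A X Y) Z x + \<rho> x (bracket A X Y x) f *\<^sub>R Z x =
        bracket A X (bracket A Y (%x. f x *\<^sub>R Z x)) x - bracket A Y (bracket A X (%x. f x *\<^sub>R Z x)) x"
      using jac[OF fZ] bracket_leibniz[OF bracket_section[OF X Y] Z f] by simp
    then show ?thesis unfolding expand2[OF X Y] expand2[OF Y X] jac[OF Z] by (simp add: algebra_simps)
  qed
  show ?thesis
  proof (cases "\<exists>Z\<in>\<Gamma>. Z x \<noteq> 0")
    case True
    then show ?thesis using key by auto
  next
    \<comment> \<open>Here all sections vanish at \<open>x\<close>, and both sides are 0 by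
      linearity of the anchor.\<close>
    case False
    have "\<rho> x 0 g = 0" if "g \<in> CF" for g by (rule linear_between_0[OF anchor_linear[OF that] fibre_0])
    moreover have "X x = 0" "Y x = 0" "bracket A X Y x = 0" using False X Y bracket_section[OF X Y] by blast+
    ultimately show ?thesis using Xf Yf f by simp
  qed
qed

lemma bracket_jacobi':
  assumes X: "X \<in> \<Gamma>" and Y: "Y \<in> \<Gamma>" and Z: "Z \<in> \<Gamma>"
  shows "bracket A X (bracket A Y Z) x = bracket A (bracket A X Y) Z x + bracket A Y (bracket A X Z) x"
proof -
  have "bracket A Z X = (%x. 0 - bracket A X Z x)" using bracket_antisym[OF Z X] by simp
  then have "bracket A Y (bracket A Z X) x = - bracket A Y (bracket A X Z) x"
    using bracket_diff_right[OF Y section_zero bracket_section[OF X Z], of x] bracket_zero_right[OF Y, of x] by simp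
  moreover have "bracket A Z (bracket A X Y) x = - bracket A (bracket A X Y) Z x"
    by (rule bracket_antisym_at[OF Z bracket_section[OF X Y]])
  ultimately show ?thesis using bracket_jacobi[OF X Y Z, of x] by (simp add: algebra_simps)
qed

subsection \<open>Forms of degree one and two\<close>

lemma form1_linear:
  assumes "\<eta> \<in> forms 1 A" shows "linear_between (fibre A x) UNIV (%a. \<eta> x [a])"
proof -
  have "alternating_form 1 (fibre A x) (\<eta> x)" using assms by (simp add: forms_def)
  moreover have "length [0] = 1 \<and> set [0] \<subseteq> fibre A x" using fibre_0 by simp
  ultimately have "\<forall>i<1. linear_between (fibre A x) UNIV (%a. \<eta> x ([0][i := a]))"
    unfolding alternating_form_def by blast
  then show ?thesis by simp
qed

lemma form2_linear:
  assumes "\<omega> \<in> forms 2 A" "b \<in> fibre A x"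
  shows "linear_between (fibre A x) UNIV (%a. \<omega> x [a, b])" "linear_between (fibre A x) UNIV (%a. \<omega> x [b, a])"
    "\<omega> x [b, b] = 0"
proof -
  have alt: "alternating_form 2 (fibre A x) (\<omega> x)" using assms by (simp add: forms_def)
  have l: "length [0, b] = 2" "set [0, b] \<subseteq> fibre A x" "length [b, 0] = 2" "set [b, 0] \<subseteq> fibre A x"
    "length [b, b] = 2" "set [b, b] \<subseteq> fibre A x" "\<not> distinct [b, b]" using assms(2) fibre_0 by auto
  have "\<forall>i<2. linear_between (fibre A x) UNIV (%a. \<omega> x ([0, b][i := a]))"
    using alt l(1,2) unfolding alternating_form_def by blast
  from this[rule_format, of 0] show "linear_between (fibre A x) UNIV (%a. \<omega> x [a, b])" by simp
  have "\<forall>i<2. linear_between (fibre A x) UNIV (%a. \<omega> x ([b, 0][i := a]))"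
    using alt l(3,4) unfolding alternating_form_def by blast
  from this[rule_format, of 1] show "linear_between (fibre A x) UNIV (%a. \<omega> x [b, a])" by simp
  show "\<omega> x [b, b] = 0" using alt l(5-7) unfolding alternating_form_def by blast
qed

lemma form2_antisym:
  assumes \<omega>: "\<omega> \<in> forms 2 A" and ab: "a \<in> fibre A x" "b \<in> fibre A x"
  shows "\<omega> x [a, b] = - \<omega> x [b, a]"
proof -
  have "\<omega> x [a + b, a + b] = 0" "\<omega> x [a, a] = 0" "\<omega> x [b, b] = 0"
    using form2_linear(3)[OF \<omega>] ab fibre_add by auto
  moreover have "\<omega> x [a + b, a + b] = \<omega> x [a, a + b] + \<omega> x [b, a + b]"
    by (rule linear_between_add[OF form2_linear(1)[OF \<omega> fibre_add[OF ab]] ab])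
  moreover have "\<omega> x [c, a + b] = \<omega> x [c, a] + \<omega> x [c, b]" if "c \<in> fibre A x" for c
    by (rule linear_between_add[OF form2_linear(2)[OF \<omega> that] ab])
  ultimately show ?thesis using ab by simp
qed

lemma forms1I:
  assumes "!!x. linear_between (fibre A x) UNIV (%a. \<eta> x [a])"
    "!!U \<tau> v. (U, \<tau>) \<in> frames A ==> smooth_fun_on (base A) U (%x. \<eta> x [\<tau> x v])"
  shows "\<eta> \<in> forms 1 A"
proof -
  have "alternating_form 1 (fibre A x) (\<eta> x)" for x unfolding alternating_form_def
  proof (intro allI impI conjI)
    fix as :: "'v list" assume as: "length as = 1 \<and> set as \<subseteq> fibre A x"
    then obtain a where a: "as = [a]" by (auto simp: length_Suc_conv)
    show "linear_between (fibre A x) UNIV (%a. \<eta> x (as[i := a]))" if "i < 1" for i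
      using assms(1)[of x] that a by simp
    assume "\<not> distinct as"
    then show "\<eta> x as = 0" using a by simp
  qed
  moreover have "smooth_fun_on (base A) U (%x. \<eta> x (map (\<tau> x) vs))"
    if "(U, \<tau>) \<in> frames A" "length vs = 1" for U \<tau> vs
    using assms(2)[OF that(1)] that(2) by (auto simp: length_Suc_conv)
  ultimately show ?thesis unfolding forms_def by auto
qed

lemma form_smooth:
  "\<eta> \<in> forms 1 A ==> (U, \<tau>) \<in> frames A ==> smooth_fun_on (base A) U (%x. \<eta> x [\<tau> x u])"
  "\<omega> \<in> forms 2 A ==> (U, \<tau>) \<in> frames A ==> smooth_fun_on (base A) U (%x. \<omega> x [\<tau> x u, \<tau> x v])"
proof -
  assume "\<eta> \<in> forms 1 A" "(U, \<tau>) \<in> frames A"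
  then have "\<forall>vs. length vs = 1 \<longrightarrow> smooth_fun_on (base A) U (%x. \<eta> x (map (\<tau> x) vs))" unfolding forms_def by blast
  from this[rule_format, of "[u]"] show "smooth_fun_on (base A) U (%x. \<eta> x [\<tau> x u])" by simp
next
  assume "\<omega> \<in> forms 2 A" "(U, \<tau>) \<in> frames A"
  then have "\<forall>vs. length vs = 2 \<longrightarrow> smooth_fun_on (base A) U (%x. \<omega> x (map (\<tau> x) vs))" unfolding forms_def by blast
  from this[rule_format, of "[u, v]"] show "smooth_fun_on (base A) U (%x. \<omega> x [\<tau> x u, \<tau> x v])" by simp
qed

lemma forms1_scale:
  assumes f: "f \<in> CF" and \<eta>: "\<eta> \<in> forms 1 A" shows "(%x as. f x * \<eta> x as) \<in> forms 1 A"
proof (rule forms1I)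
  show "linear_between (fibre A x) UNIV (%a. f x * \<eta> x [a])" for x
    using form1_linear[OF \<eta>, of x] by (simp add: linear_between_def algebra_simps)
  show "smooth_fun_on (base A) U (%x. f x * \<eta> x [\<tau> x v])" if "(U, \<tau>) \<in> frames A" for U \<tau> v
    using f form_smooth(1)[OF \<eta> that] by (intro smooth_fun_on_mult) (auto intro: smooth_fun_on_subset)
qed

lemma forms2I:
  assumes "!!x b. b \<in> fibre A x ==> linear_between (fibre A x) UNIV (%a. \<omega> x [a, b])"
    "!!x a b. a \<in> fibre A x ==> b \<in> fibre A x ==> \<omega> x [a, b] = - \<omega> x [b, a]"
    "!!U \<tau> u v. (U, \<tau>) \<in> frames A ==> smooth_fun_on (base A) U (%x. \<omega> x [\<tau> x u, \<tau> x v])"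
  shows "\<omega> \<in> forms 2 A"
proof -
  have "alternating_form 2 (fibre A x) (\<omega> x)" for x unfolding alternating_form_def
  proof (intro allI impI conjI)
    fix as :: "'v list" assume as: "length as = 2 \<and> set as \<subseteq> fibre A x"
    then obtain a b where a: "as = [a, b]" by (auto simp: length_Suc_conv numeral_2_eq_2)
    then have ab: "a \<in> fibre A x" "b \<in> fibre A x" using as by auto
    have "linear_between (fibre A x) UNIV (%b. \<omega> x [a, b])"
      using assms(1)[OF ab(1)] assms(2)[OF ab(1)] unfolding linear_between_def
      by (simp add: fibre_add fibre_scale)
    then show "linear_between (fibre A x) UNIV (%a. \<omega> x (as[i := a]))" if "i < 2" for i
      using assms(1)[OF ab(2)] that a by (auto simp: less_2_cases_iff)
    assume "\<not> distinct as"
    then have "as = [a, a]" using a by auto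
    then show "\<omega> x as = 0" using assms(2)[OF ab(1,1)] by simp
  qed
  moreover have "smooth_fun_on (base A) U (%x. \<omega> x (map (\<tau> x) vs))"
    if "(U, \<tau>) \<in> frames A" "length vs = 2" for U \<tau> vs
    using assms(3)[OF that(1)] that(2) by (auto simp: length_Suc_conv numeral_2_eq_2)
  ultimately show ?thesis unfolding forms_def by auto
qed

lemma d_A_1: "d_A A \<eta> [X, Y] x = \<rho> x (X x) (%y. \<eta> y [Y y]) - \<rho> x (Y x) (%y. \<eta> y [X y]) - \<eta> x [bracket A X Y x]"
  by (simp add: d_A_def eval_form_def remove_nth_def numeral_2_eq_2 lessThan_Suc)

lemma d_A_2: "d_A A \<omega> [X, Y, Z] x =
  \<rho> x (X x) (%y. \<omega> y [Y y, Z y]) - \<rho> x (Y x) (%y. \<omega> y [X y, Z y]) + \<rho> x (Z x) (%y. \<omega> y [X y, Y y])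
  - \<omega> x [bracket A X Y x, Z x] + \<omega> x [bracket A X Z x, Y x] - \<omega> x [bracket A Y Z x, X x]"
  by (simp add: d_A_def eval_form_def remove_nth_def numeral_2_eq_2 lessThan_Suc)

end

subsection \<open>Families of sections\<close>

lemma family_add: "smooth_fun_on \<A> D (%(t, x). f t x) ==> smooth_fun_on \<A> D (%(t, x). g t x) ==>
    smooth_fun_on \<A> D (%(t, x). f t x + g t x)"
  and family_diff: "smooth_fun_on \<A> D (%(t, x). f t x) ==> smooth_fun_on \<A> D (%(t, x). g t x) ==>
    smooth_fun_on \<A> D (%(t, x). f t x - g t x)"
  and family_scaleR: "smooth_fun_on \<A> D (%(t, x). r t x) ==> smooth_fun_on \<A> D (%(t, x). g t x) ==>
    smooth_fun_on \<A> D (%(t, x). r t x *\<^sub>R g t x)"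
  and family_mult: "smooth_fun_on \<A> D (%(t, x). r t x) ==> smooth_fun_on \<A> D (%(t, x). q t x) ==>
    smooth_fun_on \<A> D (%(t, x). r t x * q t x :: real)"
  and family_minus: "smooth_fun_on \<A> D (%(t, x). f t x) ==> smooth_fun_on \<A> D (%(t, x). - f t x)"
  and family_sum: "(!!i. i \<in> I ==> smooth_fun_on \<A> D (%(t, x). F i t x)) ==>
    smooth_fun_on \<A> D (%(t, x). \<Sum>i\<in>I. F i t x)"
  and family_bounded_linear: "bounded_linear h ==> smooth_fun_on \<A> D (%(t, x). f t x) ==>
    smooth_fun_on \<A> D (%(t, x). h (f t x))"
  by (simp_all add: case_prod_unfold smooth_fun_on_add smooth_fun_on_diff smooth_fun_on_scaleR smooth_fun_on_mult
      smooth_fun_on_minus smooth_fun_on_sum) (erule smooth_fun_on_bounded_linear)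

lemmas family_ops = family_add family_diff family_scaleR family_mult family_minus family_sum

lemma (in manifold) family_cong:
  "smooth_fun_on (line_times \<A>) D (%(t, x). f t x) ==> (!!t x. (t, x) \<in> D ==> f t x = g t x) ==>
    smooth_fun_on (line_times \<A>) D (%(t, x). g t x)"
  by (erule manifold.smooth_fun_on_cong[OF manifold_line]) auto

lemma (in manifold) family_compose:
  assumes "smooth_map_on (line_times \<A>) \<A> D (%(t, x). F t x)" "open D" "smooth_fun_on \<A> E g"
    "!!t x. (t, x) \<in> D ==> F t x \<in> E"
  shows "smooth_fun_on (line_times \<A>) D (%(t, x). g (F t x))"
  using smooth_fun_on_compose_map[OF manifold_line manifold_axioms assms(1-3)] assms(4) by (force simp: case_prod_unfold)

context compact_lie_algebroid begin

definition section_family :: "(real => 'm => 'v) => bool" where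
  "section_family W \<longleftrightarrow> (\<forall>t x. W t x \<in> fibre A x) \<and>
    (\<forall>(U, \<tau>)\<in>frames A. smooth_fun_on line (UNIV \<times> U) (%(t, x). inv (\<tau> x) (W t x)))"

text \<open>The fibres carry no topology, so the derivative of a family of sections is taken weakly.\<close>

definition section_derivative :: "(real => 'm => 'v) => (real => 'm => 'v) => bool" where
  "section_derivative W W' \<longleftrightarrow> section_family W \<and> section_family W' \<and>
    (\<forall>t x. \<forall>\<alpha> :: 'v => real. linear_between (fibre A x) UNIV \<alpha> \<longrightarrow>
      ((%s. \<alpha> (W s x)) has_real_derivative \<alpha> (W' t x)) (at t))"

lemma section_familyD:
  assumes "section_family W"
  shows section_family_mem: "W t x \<in> fibre A x" and section_family_section: "W t \<in> \<Gamma>"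
    and section_family_frame: "(U, \<tau>) \<in> frames A ==>
      smooth_fun_on line (UNIV \<times> U) (%(t, x). inv (\<tau> x) (W t x))"
proof -
  show 1: "W t x \<in> fibre A x" for t x using assms by (auto simp: section_family_def)
  show 2: "smooth_fun_on line (UNIV \<times> U) (%(t, x). inv (\<tau> x) (W t x))"
    if "(U, \<tau>) \<in> frames A" for U \<tau> using assms that unfolding section_family_def by blast
  show "W t \<in> \<Gamma>" by (rule sectionI[OF 1]) (use smooth_family_slice[OF 2] in auto)
qed

lemma section_derivativeD:
  assumes "section_derivative W W'"
  shows "section_family W" "section_family W'"
    "linear_between (fibre A x) UNIV \<alpha> ==> ((%s. \<alpha> (W s x)) has_real_derivative \<alpha> (W' t x)) (at t)"
  using assms unfolding section_derivative_def by blast+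

lemma section_family_static: "X \<in> \<Gamma> ==> section_family (%t. X)"
  unfolding section_family_def using smooth_family_static[OF sectionD(2)] sectionD(1) by fast

lemma section_derivative_static: "X \<in> \<Gamma> ==> section_derivative (%t. X) (%t x. 0)"
  unfolding section_derivative_def
proof (intro conjI allI impI)
  fix t x and \<alpha> :: "'v => real" assume "linear_between (fibre A x) UNIV \<alpha>"
  then have "\<alpha> 0 = 0" by (rule linear_between_0[OF _ fibre_0])
  then show "((%s. \<alpha> (X x)) has_real_derivative \<alpha> 0) (at t)" by simp
qed (auto intro: section_family_static section_zero)

lemma section_family_add:
  assumes "section_family V" "section_family W" shows "section_family (%t x. V t x + W t x)"
  unfolding section_family_def
proof (intro conjI allI ballI, goal_cases)
  case (1 t x) then show ?case by (intro fibre_add section_family_mem assms)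
next
  case (2 p)
  obtain U \<tau> where p: "p = (U, \<tau>)" by (cases p)
  then have U: "(U, \<tau>) \<in> frames A" using 2 by simp
  have "smooth_fun_on line (UNIV \<times> U) (%(t, x). inv (\<tau> x) (V t x + W t x))"
    by (rule family_cong[OF family_add[OF assms[THEN section_family_frame, OF U]]])
      (use linear_between_add[OF inv_frame_linear[OF U]] section_family_mem assms in auto)
  then show ?case by (simp add: p)
qed

lemma section_family_scale:
  assumes "smooth_family (base A) f" "section_family W" shows "section_family (%t x. f t x *\<^sub>R W t x)"
  unfolding section_family_def
proof (intro conjI allI ballI, goal_cases)
  case (1 t x) then show ?case by (intro fibre_scale section_family_mem assms)
next
  case (2 p)
  obtain U \<tau> where p: "p = (U, \<tau>)" by (cases p)
  then have U: "(U, \<tau>) \<in> frames A" using 2 by simp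
  have "smooth_fun_on line (UNIV \<times> U) (%(t, x). inv (\<tau> x) (f t x *\<^sub>R W t x))"
    by (rule family_cong[OF family_scaleR[OF smooth_fun_on_subset[OF assms(1) subset_UNIV] section_family_frame[OF assms(2) U]]])
      (use linear_between_scale[OF inv_frame_linear[OF U]] section_family_mem assms in auto)
  then show ?case by (simp add: p)
qed

lemma section_family_sum:
  "(!!i. i \<in> S ==> section_family (W i)) ==> section_family (%t x. \<Sum>i\<in>S. W i t x)"
  by (induction S rule: infinite_finite_induct)
    (auto intro: section_family_add section_family_static[OF section_zero])

text \<open>In a local frame the pairing is a finite sum of coordinates of \<open>W\<close> times
  values of the functional on frame vectors, and both factors are jointly smooth.\<close>

lemma functional_family:
  assumes lin: "!!t x. linear_between (fibre A x) UNIV (\<eta> t x)"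
    and sm: "!!U \<tau> v. (U, \<tau>) \<in> frames A ==> smooth_fun_on line (UNIV \<times> U) (%(t, x). \<eta> t x (\<tau> x v) :: real)"
    and W: "section_family W"
  shows "smooth_family (base A) (%t x. \<eta> t x (W t x))"
proof (rule manifold.smooth_fun_on_local[OF manifold_line])
  fix p :: "real \<times> 'm"
  obtain t0 x0 where p: "p = (t0, x0)" by (cases p)
  obtain U \<tau> where U: "(U, \<tau>) \<in> frames A" "x0 \<in> U" using frame_exists by blast
  note B = basis[OF fdf]
  have "smooth_fun_on line (UNIV \<times> U) (%(t, x). \<Sum>b\<in>basis. coord b (inv (\<tau> x) (W t x)) * \<eta> t x (\<tau> x b))"
    by (intro family_sum family_mult family_bounded_linear[OF B(2)] section_family_frame W U(1) sm)
  then have "smooth_fun_on line (UNIV \<times> U) (%(t, x). \<eta> t x (W t x))"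
  proof (rule family_cong)
    fix t :: real and x :: 'm assume "(t, x) \<in> UNIV \<times> U"
    then have x: "x \<in> U" by simp
    have "bounded_linear (%v. \<eta> t x (\<tau> x v))" by (rule functional_frame_bounded_linear[OF U(1) x lin])
    from linear_expand[OF B(3) bounded_linear.linear[OF this], of "inv (\<tau> x) (W t x)"]
    show "(\<Sum>b\<in>basis. coord b (inv (\<tau> x) (W t x)) * \<eta> t x (\<tau> x b)) = \<eta> t x (W t x)"
      using inv_frame[OF U(1) x section_family_mem[OF W]] by simp
  qed
  then show "\<exists>N. open N \<and> p \<in> N \<and> smooth_fun_on line (N \<inter> UNIV) (%(t, x). \<eta> t x (W t x))"
    using U frame_open[OF U(1)] by (intro exI[of _ "UNIV \<times> U"]) (auto simp: p open_Times)
qed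

end

context lie_calculus begin

lemma \<theta>_family: "section_family W ==> smooth_family (base A) (%t x. \<theta> k x (W t x))"
  by (rule functional_family[where \<eta> = "%t. \<theta> k"]) (auto intro: \<theta>_linear smooth_family_static \<theta>_smooth)

lemma \<theta>_CF: "X \<in> \<Gamma> ==> (%x. \<theta> k x (X x)) \<in> CF"
  using smooth_family_imp_smooth_fun[OF \<theta>_family[OF section_family_static]] by simp

lemma linear_expand_fibre:
  assumes "linear_between (fibre A x) UNIV \<alpha>" "a \<in> fibre A x"
  shows "\<alpha> a = (\<Sum>k\<in>K. \<theta> k x a *\<^sub>R (\<alpha> (E k x) :: 'w::real_vector))"
proof -
  have "\<alpha> (\<Sum>k\<in>K. \<theta> k x a *\<^sub>R E k x) = (\<Sum>k\<in>K. \<theta> k x a *\<^sub>R \<alpha> (E k x))"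
    by (rule linear_between_sum[OF assms(1) subspace_fibre sectionD(1)[OF E]])
  then show ?thesis using expand[OF assms(2)] by simp
qed

lemma linear_expand_fibre_real:
  assumes "linear_between (fibre A x) UNIV \<alpha>" "a \<in> fibre A x"
  shows "\<alpha> a = (\<Sum>k\<in>K. \<theta> k x a * (\<alpha> (E k x) :: real))" using linear_expand_fibre[OF assms] by simp

text \<open>Every functional on a fibre is a combination of the \<open>\<theta> k x\<close>, so
  these suffice as test functionals for the weak derivative.\<close>

lemma section_derivativeI:
  assumes W: "section_family W" "section_family W'"
    and d: "!!k t x. k \<in> K ==> ((%s. \<theta> k x (W s x)) has_real_derivative \<theta> k x (W' t x)) (at t)"
  shows "section_derivative W W'" unfolding section_derivative_def
proof (intro conjI allI impI W)
  fix t x and \<alpha> :: "'v => real" assume \<alpha>: "linear_between (fibre A x) UNIV \<alpha>"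
  have "((%s. \<Sum>k\<in>K. \<theta> k x (W s x) * \<alpha> (E k x)) has_real_derivative
      (\<Sum>k\<in>K. \<theta> k x (W' t x) * \<alpha> (E k x))) (at t)" by (intro DERIV_sum DERIV_cmult_right d)
  then show "((%s. \<alpha> (W s x)) has_real_derivative \<alpha> (W' t x)) (at t)"
    by (simp add: linear_expand_fibre_real[OF \<alpha> section_family_mem[OF W(1)], symmetric]
        linear_expand_fibre_real[OF \<alpha> section_family_mem[OF W(2)], symmetric])
qed

section \<open>Anchor and bracket of time-dependent sections\<close>

lemma anchor_expand:
  assumes "a \<in> fibre A x" "f \<in> CF"
  shows "\<rho> x a f = (\<Sum>i\<in>I. \<rho> x a (crdf i) * \<Delta> i f x)"
  by (rule \<Delta>_expand[OF anchor_tangent[OF assms(1)] assms(2)])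

lemma anchor_functional_family:
  assumes W: "section_family W" and f: "f \<in> CF"
  shows "smooth_family (base A) (%t x. \<rho> x (W t x) f)"
proof -
  have "smooth_family (base A) (%t x. \<Sum>k\<in>K. \<theta> k x (W t x) * \<rho> x (E k x) f)"
  proof -
    have "smooth_family (base A) (%t x. \<rho> x (E k x) f)" for k
      using smooth_family_static[of UNIV "%x. \<rho> x (E k x) f" UNIV] anchor_CF[OF E f] by simp
    then show ?thesis by (intro family_ops \<theta>_family[OF W])
  qed
  then show ?thesis
    by (simp add: linear_expand_fibre_real[OF anchor_linear[OF f] section_family_mem[OF W], symmetric])
qed

lemma anchor_family:
  assumes W: "section_family W" and h: "smooth_family (base A) h"
  shows "smooth_family (base A) (%t x. \<rho> x (W t x) (h t))"
proof -
  have hCF: "h t \<in> CF" for t using smooth_family_imp_smooth_fun[OF h] by simp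
  have "smooth_family (base A) (%t x. \<Sum>i\<in>I. \<rho> x (W t x) (crdf i) * \<Delta> i (h t) x)"
    by (intro family_ops anchor_functional_family[OF W crdf] \<Delta>_family[OF h])
  then show ?thesis by (simp add: anchor_expand[OF section_family_mem[OF W] hCF, symmetric])
qed

text \<open>The anchor is expanded into products of \<open>\<rho> x (W t x) (crdf i)\<close> and
  \<open>\<Delta> i (h t) x\<close>. The first factor is linear in the section at \<open>x\<close>,
  the second commutes with the time derivative, so the ordinary product rule applies.\<close>

lemma anchor_family_derivative:
  assumes W: "section_derivative W W'" and h: "smooth_family (base A) h"
    and h': "!!t x. ((%s. h s x) has_real_derivative h' t x) (at t)"
  shows "((%s. \<rho> x (W s x) (h s)) has_real_derivative \<rho> x (W' t x) (h t) + \<rho> x (W t x) (h' t)) (at t)"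
    and "smooth_family (base A) h'"
proof -
  have eq: "(%t x. deriv (%s. h s x) t) = h'" using h' by (intro ext) (rule DERIV_imp_deriv)
  show sh': "smooth_family (base A) h'" using smooth_family_has_derivative(2)[OF h] unfolding eq .
  have hCF: "h t \<in> CF" "h' t \<in> CF" for t
    using smooth_family_imp_smooth_fun[OF h] smooth_family_imp_smooth_fun[OF sh'] by auto
  have \<Delta>': "((%s. \<Delta> i (h s) x) has_real_derivative \<Delta> i (h' t) x) (at t)" for i
    using \<Delta>_derivative[OF h, of i x t] fun_cong[OF eq, of t] by simp
  note Wm = section_family_mem[OF section_derivativeD(1)[OF W]] section_family_mem[OF section_derivativeD(2)[OF W]]
  have "((%s. \<Sum>i\<in>I. \<rho> x (W s x) (crdf i) * \<Delta> i (h s) x) has_real_derivative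
      (\<Sum>i\<in>I. \<rho> x (W' t x) (crdf i) * \<Delta> i (h t) x + \<Delta> i (h' t) x * \<rho> x (W t x) (crdf i))) (at t)"
    by (intro DERIV_sum DERIV_mult section_derivativeD(3)[OF W anchor_linear[OF crdf]] \<Delta>')
  then show "((%s. \<rho> x (W s x) (h s)) has_real_derivative \<rho> x (W' t x) (h t) + \<rho> x (W t x) (h' t)) (at t)"
    by (simp add: sum.distrib mult.commute[of "\<Delta> _ _ _"] anchor_expand[OF Wm(1) hCF(1), symmetric]
        anchor_expand[OF Wm(2) hCF(1), symmetric] anchor_expand[OF Wm(1) hCF(2), symmetric])
qed

text \<open>Leibniz rule in both arguments. The brackets of generators act as structure functions,
  and all dependence on \<open>Y\<close> and \<open>Z\<close> is moved into scalar
  coefficients.\<close>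

lemma bracket_expand:
  assumes Y: "Y \<in> \<Gamma>" and Z: "Z \<in> \<Gamma>"
  shows "bracket A Y Z x =
    (\<Sum>k\<in>K. \<Sum>l\<in>K. (\<theta> k x (Y x) * \<theta> l x (Z x)) *\<^sub>R bracket A (E k) (E l) x) +
    (\<Sum>l\<in>K. \<rho> x (Y x) (%y. \<theta> l y (Z y)) *\<^sub>R E l x) - (\<Sum>k\<in>K. \<rho> x (Z x) (%y. \<theta> k y (Y y)) *\<^sub>R E k x)"
proof -
  let ?y = "%k x. \<theta> k x (Y x)" and ?z = "%k x. \<theta> k x (Z x)"
  have Yx: "(%x. \<Sum>k\<in>K. ?y k x *\<^sub>R E k x) = Y" and Zx: "(%x. \<Sum>k\<in>K. ?z k x *\<^sub>R E k x) = Z"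
    using expand[OF sectionD(1)[OF Y]] expand[OF sectionD(1)[OF Z]] by auto
  have YE: "bracket A Y (E l) x = (\<Sum>k\<in>K. ?y k x *\<^sub>R bracket A (E k) (E l) x) -
      (\<Sum>k\<in>K. \<rho> x (E l x) (?y k) *\<^sub>R E k x)" for l
  proof -
    have "bracket A (E l) Y x = (\<Sum>k\<in>K. ?y k x *\<^sub>R bracket A (E l) (E k) x + \<rho> x (E l x) (?y k) *\<^sub>R E k x)"
    proof -
      have "bracket A (E l) (%x. \<Sum>k\<in>K. ?y k x *\<^sub>R E k x) x =
          (\<Sum>k\<in>K. ?y k x *\<^sub>R bracket A (E l) (E k) x + \<rho> x (E l x) (?y k) *\<^sub>R E k x)"
        by (rule bracket_sum_right[OF E \<theta>_CF[OF Y] E])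
      then show ?thesis unfolding Yx .
    qed
    then show ?thesis using bracket_antisym_at[OF Y E, of l x] bracket_antisym_at[OF E E, of l _ x]
      by (simp add: sum.distrib sum_negf sum_subtractf)
  qed
  have Zr: "\<rho> x (Z x) f = (\<Sum>l\<in>K. ?z l x * \<rho> x (E l x) f)" if "f \<in> CF" for f
    by (rule linear_expand_fibre_real[OF anchor_linear[OF that] sectionD(1)[OF Z]])
  have "bracket A Y Z x = (\<Sum>l\<in>K. ?z l x *\<^sub>R bracket A Y (E l) x + \<rho> x (Y x) (?z l) *\<^sub>R E l x)"
  proof -
    have "bracket A Y (%x. \<Sum>k\<in>K. ?z k x *\<^sub>R E k x) x =
        (\<Sum>l\<in>K. ?z l x *\<^sub>R bracket A Y (E l) x + \<rho> x (Y x) (?z l) *\<^sub>R E l x)"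
      by (rule bracket_sum_right[OF Y \<theta>_CF[OF Z] E])
    then show ?thesis unfolding Zx .
  qed
  also have "\<dots> = (\<Sum>l\<in>K. \<Sum>k\<in>K. (?y k x * ?z l x) *\<^sub>R bracket A (E k) (E l) x) -
      (\<Sum>l\<in>K. \<Sum>k\<in>K. (?z l x * \<rho> x (E l x) (?y k)) *\<^sub>R E k x) + (\<Sum>l\<in>K. \<rho> x (Y x) (?z l) *\<^sub>R E l x)"
    unfolding YE by (simp add: scaleR_diff_right scaleR_sum_right sum.distrib sum_subtractf mult.commute)
  also have "(\<Sum>l\<in>K. \<Sum>k\<in>K. (?z l x * \<rho> x (E l x) (?y k)) *\<^sub>R E k x) = (\<Sum>k\<in>K. \<rho> x (Z x) (?y k) *\<^sub>R E k x)"
    by (subst sum.swap) (simp add: Zr[OF \<theta>_CF[OF Y]] scaleR_sum_left)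
  also have "(\<Sum>l\<in>K. \<Sum>k\<in>K. (?y k x * ?z l x) *\<^sub>R bracket A (E k) (E l) x) =
      (\<Sum>k\<in>K. \<Sum>l\<in>K. (?y k x * ?z l x) *\<^sub>R bracket A (E k) (E l) x)" by (rule sum.swap)
  finally show ?thesis by (simp add: algebra_simps)
qed

lemma bracket_family:
  assumes Y: "section_family Y" and Z: "section_family Z"
  shows "section_family (%t. bracket A (Y t) (Z t))"
proof -
  note YS = section_family_section[OF Y] and ZS = section_family_section[OF Z]
  have 1: "section_family (%t x. \<Sum>k\<in>K. \<Sum>l\<in>K. (\<theta> k x (Y t x) * \<theta> l x (Z t x)) *\<^sub>R bracket A (E k) (E l) x)"
    by (intro section_family_sum section_family_scale section_family_static bracket_section E family_mult \<theta>_family Y Z)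
  have 2: "section_family (%t x. \<Sum>l\<in>K. \<rho> x (Y t x) (%y. \<theta> l y (Z t y)) *\<^sub>R E l x)"
    by (intro section_family_sum section_family_scale section_family_static E anchor_family Y \<theta>_family Z)
  have 3: "section_family (%t x. \<Sum>k\<in>K. (- \<rho> x (Z t x) (%y. \<theta> k y (Y t y))) *\<^sub>R E k x)"
    by (intro section_family_sum section_family_scale section_family_static E family_minus anchor_family Z \<theta>_family Y)
  have "(%t. bracket A (Y t) (Z t)) = (%t x.
      (\<Sum>k\<in>K. \<Sum>l\<in>K. (\<theta> k x (Y t x) * \<theta> l x (Z t x)) *\<^sub>R bracket A (E k) (E l) x) +
      (\<Sum>l\<in>K. \<rho> x (Y t x) (%y. \<theta> l y (Z t y)) *\<^sub>R E l x) +
      (\<Sum>k\<in>K. (- \<rho> x (Z t x) (%y. \<theta> k y (Y t y))) *\<^sub>R E k x))"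
    by (intro ext) (simp add: bracket_expand[OF YS ZS] sum_negf)
  then show ?thesis using section_family_add[OF section_family_add[OF 1 2] 3] by simp
qed

text \<open>The three sums of \<open>bracket_expand\<close> are differentiated term by term after
  applying a functional: every summand is a fixed number times a product of coefficients or an
  anchor applied to a coefficient.\<close>

lemma bracket_family_derivative:
  assumes Y: "section_derivative Y Y'" and Z: "section_derivative Z Z'"
  shows "section_derivative (%t. bracket A (Y t) (Z t)) (%t x. bracket A (Y' t) (Z t) x + bracket A (Y t) (Z' t) x)"
  unfolding section_derivative_def
proof (intro conjI allI impI)
  note Yf = section_derivativeD(1,2)[OF Y] and Zf = section_derivativeD(1,2)[OF Z]
  show "section_family (%t. bracket A (Y t) (Z t))" by (rule bracket_family[OF Yf(1) Zf(1)])
  show "section_family (%t x. bracket A (Y' t) (Z t) x + bracket A (Y t) (Z' t) x)"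
    by (intro section_family_add bracket_family Yf Zf)
  fix t x and \<alpha> :: "'v => real" assume \<alpha>: "linear_between (fibre A x) UNIV \<alpha>"
  note sec = section_family_section[OF Yf(1)] section_family_section[OF Yf(2)]
    section_family_section[OF Zf(1)] section_family_section[OF Zf(2)]
  have ex: "\<alpha> (bracket A P Q x) =
    (\<Sum>k\<in>K. \<Sum>l\<in>K. (\<theta> k x (P x) * \<theta> l x (Q x)) * \<alpha> (bracket A (E k) (E l) x)) +
    (\<Sum>l\<in>K. \<rho> x (P x) (%y. \<theta> l y (Q y)) * \<alpha> (E l x)) - (\<Sum>k\<in>K. \<rho> x (Q x) (%y. \<theta> k y (P y)) * \<alpha> (E k x))"
    if P: "P \<in> \<Gamma>" and Q: "Q \<in> \<Gamma>" for P Q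
  proof -
    let ?a = "\<Sum>k\<in>K. \<Sum>l\<in>K. (\<theta> k x (P x) * \<theta> l x (Q x)) *\<^sub>R bracket A (E k) (E l) x"
    let ?b = "\<Sum>l\<in>K. \<rho> x (P x) (%y. \<theta> l y (Q y)) *\<^sub>R E l x"
    let ?c = "\<Sum>k\<in>K. \<rho> x (Q x) (%y. \<theta> k y (P y)) *\<^sub>R E k x"
    have m: "E k x \<in> fibre A x" "bracket A (E k) (E l) x \<in> fibre A x" for k l
      using sectionD(1)[OF E] sectionD(1)[OF bracket_section[OF E E]] by auto
    have in1: "(\<Sum>l\<in>K. (\<theta> k x (P x) * \<theta> l x (Q x)) *\<^sub>R bracket A (E k) (E l) x) \<in> fibre A x" for k
      by (intro fibre_sum fibre_scale m)
    have mem: "?a \<in> fibre A x" "?b \<in> fibre A x" "?c \<in> fibre A x" by (intro fibre_sum fibre_scale m in1)+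
    have "\<alpha> (bracket A P Q x) = \<alpha> (?a + ?b + - ?c)" using bracket_expand[OF P Q, of x] by simp
    also have "\<dots> = \<alpha> ?a + \<alpha> ?b - \<alpha> ?c"
      using linear_between_add[OF \<alpha> fibre_add[OF mem(1,2)] fibre_neg[OF mem(3)]]
        linear_between_add[OF \<alpha> mem(1,2)] linear_between_minus[OF \<alpha> mem(3)] by linarith
    also have "\<alpha> ?b = (\<Sum>l\<in>K. \<rho> x (P x) (%y. \<theta> l y (Q y)) * \<alpha> (E l x))"
      using linear_between_sum[OF \<alpha> subspace_fibre m(1)] by simp
    also have "\<alpha> ?c = (\<Sum>k\<in>K. \<rho> x (Q x) (%y. \<theta> k y (P y)) * \<alpha> (E k x))"
      using linear_between_sum[OF \<alpha> subspace_fibre m(1)] by simp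
    also have "\<alpha> ?a = (\<Sum>k\<in>K. \<Sum>l\<in>K. (\<theta> k x (P x) * \<theta> l x (Q x)) * \<alpha> (bracket A (E k) (E l) x))"
    proof -
      have "\<alpha> (\<Sum>k\<in>K. 1 *\<^sub>R (\<Sum>l\<in>K. (\<theta> k x (P x) * \<theta> l x (Q x)) *\<^sub>R bracket A (E k) (E l) x)) =
          (\<Sum>k\<in>K. 1 *\<^sub>R \<alpha> (\<Sum>l\<in>K. (\<theta> k x (P x) * \<theta> l x (Q x)) *\<^sub>R bracket A (E k) (E l) x))"
        by (rule linear_between_sum[OF \<alpha> subspace_fibre in1])
      moreover have "\<alpha> (\<Sum>l\<in>K. (\<theta> k x (P x) * \<theta> l x (Q x)) *\<^sub>R bracket A (E k) (E l) x) =
          (\<Sum>l\<in>K. (\<theta> k x (P x) * \<theta> l x (Q x)) *\<^sub>R \<alpha> (bracket A (E k) (E l) x))" for k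
        by (rule linear_between_sum[OF \<alpha> subspace_fibre m(2)])
      ultimately show ?thesis by simp
    qed
    finally show ?thesis .
  qed
  have y: "((%s. \<theta> k x (Y s x)) has_real_derivative \<theta> k x (Y' t x)) (at t)" for k t x
    by (rule section_derivativeD(3)[OF Y \<theta>_linear])
  have z: "((%s. \<theta> k x (Z s x)) has_real_derivative \<theta> k x (Z' t x)) (at t)" for k t x
    by (rule section_derivativeD(3)[OF Z \<theta>_linear])
  have d: "((%s. \<alpha> (bracket A (Y s) (Z s) x)) has_real_derivative
    (\<Sum>k\<in>K. \<Sum>l\<in>K. (\<theta> k x (Y' t x) * \<theta> l x (Z t x) + \<theta> l x (Z' t x) * \<theta> k x (Y t x)) * \<alpha> (bracket A (E k) (E l) x)) +
    (\<Sum>l\<in>K. (\<rho> x (Y' t x) (%y. \<theta> l y (Z t y)) + \<rho> x (Y t x) (%y. \<theta> l y (Z' t y))) * \<alpha> (E l x)) -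
    (\<Sum>k\<in>K. (\<rho> x (Z' t x) (%y. \<theta> k y (Y t y)) + \<rho> x (Z t x) (%y. \<theta> k y (Y' t y))) * \<alpha> (E k x))) (at t)"
    unfolding ex[OF sec(1,3)] by (intro DERIV_diff DERIV_add DERIV_sum DERIV_cmult_right DERIV_mult y z
        anchor_family_derivative(1)[OF Y \<theta>_family[OF Zf(1)] z]
        anchor_family_derivative(1)[OF Z \<theta>_family[OF Yf(1)] y])
  have "\<alpha> (bracket A (Y' t) (Z t) x + bracket A (Y t) (Z' t) x) =
      \<alpha> (bracket A (Y' t) (Z t) x) + \<alpha> (bracket A (Y t) (Z' t) x)"
    by (intro linear_between_add[OF \<alpha>] sectionD(1) bracket_section sec)
  then show "((%s. \<alpha> (bracket A (Y s) (Z s) x)) has_real_derivative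
      \<alpha> (bracket A (Y' t) (Z t) x + bracket A (Y t) (Z' t) x)) (at t)" by (intro DERIV_cong[OF d])
      (simp add: ex[OF sec(2,3)] ex[OF sec(1,4)] sum.distrib distrib_right algebra_simps)
qed

section \<open>Forms in the generators, and closedness of exact forms\<close>

lemma form2_expand:
  assumes \<omega>: "\<omega> \<in> forms 2 A" and ab: "a \<in> fibre A x" "b \<in> fibre A x"
  shows "\<omega> x [a, b] = (\<Sum>k\<in>K. \<Sum>l\<in>K. \<theta> k x a * (\<theta> l x b * \<omega> x [E k x, E l x]))"
proof -
  have "\<omega> x [a, b] = (\<Sum>k\<in>K. \<theta> k x a * \<omega> x [E k x, b])"
    by (rule linear_expand_fibre_real[OF form2_linear(1)[OF \<omega> ab(2)] ab(1)])
  moreover have "\<omega> x [E k x, b] = (\<Sum>l\<in>K. \<theta> l x b * \<omega> x [E k x, E l x])" for k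
    by (rule linear_expand_fibre_real[OF form2_linear(2)[OF \<omega> sectionD(1)[OF E]] ab(2)])
  ultimately show ?thesis by (simp add: sum_distrib_left)
qed

lemma form1_family:
  "\<eta> \<in> forms 1 A ==> section_family W ==> smooth_family (base A) (%t x. \<eta> x [W t x])"
  using functional_family[of "%t x a. \<eta> x [a]" W] form1_linear smooth_family_static[OF form_smooth(1)] by simp

lemma form1_CF: "\<eta> \<in> forms 1 A ==> X \<in> \<Gamma> ==> (%x. \<eta> x [X x]) \<in> CF"
  using smooth_family_imp_smooth_fun[OF form1_family[OF _ section_family_static]] by simp

lemma form2_contract:
  assumes \<omega>: "\<omega> \<in> forms 2 A" and X: "X \<in> \<Gamma>" shows "(%x as. \<omega> x [X x, hd as]) \<in> forms 1 A"
proof (rule forms1I)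
  show "linear_between (fibre A x) UNIV (%a. \<omega> x [X x, hd [a]])" for x
    using form2_linear(2)[OF \<omega> sectionD(1)[OF X]] by simp
  fix U \<tau> v assume U: "(U, \<tau>) \<in> frames A"
  note B = basis[OF fdf]
  have "smooth_fun_on (base A) U (%x. \<Sum>b\<in>basis. coord b (inv (\<tau> x) (X x)) * \<omega> x [\<tau> x b, \<tau> x v])"
    by (intro smooth_fun_on_sum smooth_fun_on_mult smooth_fun_on_bounded_linear[OF B(2)] sectionD X U form_smooth \<omega>)
  then show "smooth_fun_on (base A) U (%x. \<omega> x [X x, hd [\<tau> x v]])"
  proof (rule smooth_fun_on_cong)
    fix x assume x: "x \<in> U"
    have "bounded_linear (%u. \<omega> x [\<tau> x u, \<tau> x v])"
      by (rule functional_frame_bounded_linear[OF U x form2_linear(1)[OF \<omega> frame_mem[OF U x]]])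
    from linear_expand[OF B(3) bounded_linear.linear[OF this], of "inv (\<tau> x) (X x)"]
    show "(\<Sum>b\<in>basis. coord b (inv (\<tau> x) (X x)) * \<omega> x [\<tau> x b, \<tau> x v]) = \<omega> x [X x, hd [\<tau> x v]]"
      using inv_frame[OF U x sectionD(1)[OF X]] by simp
  qed
qed

lemma form2_CF: "\<omega> \<in> forms 2 A ==> X \<in> \<Gamma> ==> Y \<in> \<Gamma> ==> (%x. \<omega> x [X x, Y x]) \<in> CF"
  using form1_CF[OF form2_contract, of \<omega> X Y] by simp

text \<open>\<open>d\<^sup>2 = 0\<close> on forms of degree one.\<close>

lemma closed_d_A:
  assumes \<eta>: "\<eta> \<in> forms 1 A" and \<kappa>: "!!x X Y. X \<in> \<Gamma> ==> Y \<in> \<Gamma> ==> \<kappa> x [X x, Y x] = d_A A \<eta> [X, Y] x"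
  shows "closed_form 2 A \<kappa>" unfolding closed_form_def
proof (intro allI impI)
  fix Xs x assume "length Xs = Suc 2 \<and> set Xs \<subseteq> \<Gamma>"
  then obtain X Y Z where Xs: "Xs = [X, Y, Z]" and X: "X \<in> \<Gamma>" and Y: "Y \<in> \<Gamma>" and Z: "Z \<in> \<Gamma>"
    by (auto simp: length_Suc_conv numeral_2_eq_2)
  let ?e = "%X y. \<eta> y [X y]"
  have fn: "(%y. \<kappa> y [P y, Q y]) = (%y. \<rho> y (P y) (?e Q) - \<rho> y (Q y) (?e P) - ?e (bracket A P Q) y)"
    if "P \<in> \<Gamma>" "Q \<in> \<Gamma>" for P Q using \<kappa>[OF that] by (simp add: d_A_1)
  have e: "?e P \<in> CF" if "P \<in> \<Gamma>" for P by (rule form1_CF[OF \<eta> that])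
  have r: "\<rho> x (R x) (%y. \<kappa> y [P y, Q y]) =
      \<rho> x (R x) (%y. \<rho> y (P y) (?e Q)) - \<rho> x (R x) (%y. \<rho> y (Q y) (?e P)) - \<rho> x (R x) (?e (bracket A P Q))"
    if "P \<in> \<Gamma>" "Q \<in> \<Gamma>" "R \<in> \<Gamma>" for P Q R
  proof -
    note T = anchor_tangent[OF sectionD(1)[OF that(3)], of x]
    have cf: "(%y. \<rho> y (P y) (?e Q)) \<in> CF" "(%y. \<rho> y (Q y) (?e P)) \<in> CF" "?e (bracket A P Q) \<in> CF"
      using that e bracket_section anchor_CF by blast+
    show ?thesis unfolding fn[OF that(1,2)]
      by (simp only: tangent_diff[OF T CF_diff[OF cf(1,2)] cf(3)] tangent_diff[OF T cf(1,2)])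
  qed
  have k: "\<kappa> x [bracket A P Q x, R x] = \<rho> x (bracket A P Q x) (?e R) - \<rho> x (R x) (?e (bracket A P Q)) -
      ?e (bracket A (bracket A P Q) R) x" if "P \<in> \<Gamma>" "Q \<in> \<Gamma>" "R \<in> \<Gamma>" for P Q R
    using \<kappa>[OF bracket_section[OF that(1,2)] that(3)] by (simp add: d_A_1)
  \<comment> \<open>These are the only terms left once all anchor terms have cancelled; they are a
    linear form applied to a Jacobi sum.\<close>
  have jac: "?e (bracket A (bracket A X Y) Z) x - ?e (bracket A (bracket A X Z) Y) x + ?e (bracket A (bracket A Y Z) X) x = 0"
  proof -
    let ?P = "bracket A (bracket A X Y) Z x" and ?Q = "bracket A (bracket A X Z) Y x"
      and ?R = "bracket A (bracket A Y Z) X x"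
    have m: "?P \<in> fibre A x" "?Q \<in> fibre A x" "?R \<in> fibre A x"
      using bracket_section X Y Z sectionD(1) by blast+
    have "- ?R = ?P - ?Q"
      using bracket_jacobi'[OF X Y Z, of x] bracket_antisym_at[OF X bracket_section[OF Y Z], of x]
        bracket_antisym_at[OF Y bracket_section[OF X Z], of x] by simp
    then have "?P = ?Q + - ?R" by simp
    then have "\<eta> x [?P] = \<eta> x [?Q] + - \<eta> x [?R]"
      using linear_between_add[OF form1_linear[OF \<eta>] m(2) fibre_neg[OF m(3)]]
        linear_between_minus[OF form1_linear[OF \<eta>] m(3)] by simp
    then show ?thesis by simp
  qed
  show "d_A A \<kappa> Xs x = 0"
    unfolding Xs d_A_2 r[OF Y Z X] r[OF X Z Y] r[OF X Y Z] k[OF X Y Z] k[OF X Z Y] k[OF Y Z X]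
      anchor_bracket[OF X Y e[OF Z]] anchor_bracket[OF X Z e[OF Y]] anchor_bracket[OF Y Z e[OF X]]
    using jac by simp
qed

end

section \<open>Flows of sections supported in a chart\<close>

text \<open>Outside the compact set the derivative vanishes, and on it the derivative is bounded for
  bounded times. A Lipschitz constant valid on the whole space is what makes the flow
  complete.\<close>

lemma compactly_supported_lipschitz:
  fixes V :: "real \<times> 'b::real_normed_vector => 'c::real_normed_vector"
  assumes fd: "finite_dim TYPE('b)" and V: "C_inf_on UNIV V" and Q: "compact Q"
    and zero: "!!t y. y \<notin> Q ==> V (t, y) = 0"
  shows "\<exists>L. \<forall>t x y. \<bar>t\<bar> \<le> T \<longrightarrow> norm (V (t, x) - V (t, y)) \<le> L * norm (x - y)"
proof -
  obtain N where N: "N > 0" "!!(A :: 'b => 'c) e v.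
      linear A ==> e \<ge> 0 ==> (!!b. b \<in> basis ==> norm (A b) \<le> e) ==> norm (A v) \<le> N * e * norm v"
    by (rule finite_dim_linear_bound[OF fd]) blast
  let ?V' = "%t y v. frechet_derivative V (at (t, y)) (0, v)"
  have cV: "continuous_on UNIV (%p. frechet_derivative V (at p) v)" for v
    using k_smooth_on_imp_continuous_on[OF k_smooth_on_SucD(2)[OF spec[OF V, of 1, unfolded One_nat_def]]] .
  have der: "((%y. V (t, y)) has_derivative ?V' t y) (at y)" for t y
    using partial_derivative(1)[OF spec[OF V]] by simp
  have o: "open (UNIV \<times> - Q :: (real \<times> 'b) set)" using compact_imp_closed[OF Q] by (simp add: open_Times open_Compl)
  have out: "?V' t y v = 0" if "y \<notin> Q" for t y v
  proof -
    have "frechet_derivative V (at (t, y)) = frechet_derivative (%_. 0) (at (t, y))"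
      by (rule frechet_derivative_cong_open[OF o]) (use that zero in auto)
    then show ?thesis by simp
  qed
  have "\<exists>M. \<forall>t y. \<bar>t\<bar> \<le> T \<longrightarrow> norm (?V' t y b) \<le> M" for b
  proof -
    have "compact ((%p. frechet_derivative V (at p) (0, b)) ` ({-T..T} \<times> Q))"
      by (intro compact_continuous_image continuous_on_subset[OF cV] compact_Times compact_Icc Q) auto
    then obtain M where M: "!!p. p \<in> {-T..T} \<times> Q ==> norm (frechet_derivative V (at p) (0, b)) \<le> M"
      using compact_imp_bounded[of "(%p. frechet_derivative V (at p) (0, b)) ` ({-T..T} \<times> Q)"]
      unfolding bounded_iff by blast
    have "norm (?V' t y b) \<le> max M 0" if "\<bar>t\<bar> \<le> T" for t y
      using M[of "(t, y)"] out[of y t b] that by (cases "y \<in> Q") (auto simp: abs_le_iff)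
    then show ?thesis by blast
  qed
  then obtain M where M: "!!b t y. \<bar>t\<bar> \<le> T ==> norm (?V' t y b) \<le> M b" by metis
  have "norm (V (t, x) - V (t, y)) \<le> N * (\<Sum>b\<in>basis. \<bar>M b\<bar>) * norm (x - y)" if t: "\<bar>t\<bar> \<le> T" for t x y
  proof (rule differentiable_bound[where S = UNIV and f' = "?V' t"])
    fix z
    show "((%y. V (t, y)) has_derivative ?V' t z) (at z within UNIV)" by (rule der)
    have "norm (?V' t z b) \<le> (\<Sum>b\<in>basis. \<bar>M b\<bar>)" if b: "b \<in> basis" for b
      using M[OF t, of z b] member_le_sum[OF b, of "%b. \<bar>M b\<bar>"] basis(1)[OF fd] by simp
    then show "onorm (?V' t z) \<le> N * (\<Sum>b\<in>basis. \<bar>M b\<bar>)"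
      using N(1) by (intro onorm_bound N(2) has_derivative_linear[OF der] sum_nonneg mult_nonneg_nonneg) auto
  qed auto
  then show ?thesis by blast
qed

context lie_calculus begin

text \<open>A family of isomorphisms \<open>\<Phi> t\<close> of the bundle, covering \<open>F t\<close>, with inverses \<open>\<Psi> t\<close> covering
  \<open>G t\<close>. Smoothness of \<open>\<Phi>\<close> is stated in terms of its matrix in the generators.\<close>

definition smooth_matrix :: "(real => 'm => 'm) => (real => 'm => 'v => 'v) => bool" where
  "smooth_matrix F \<Phi> \<longleftrightarrow> smooth_map_on line (base A) UNIV (%(t, x). F t x) \<and>
    (\<forall>t x. linear_between (fibre A x) (fibre A (F t x)) (\<Phi> t x)) \<and>
    (\<forall>k l. smooth_family (base A) (%t x. \<theta> k (F t x) (\<Phi> t x (E l x))))"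

definition isotopy :: "(real => 'm => 'm) => (real => 'm => 'v => 'v) =>
    (real => 'm => 'm) => (real => 'm => 'v => 'v) => bool" where
  "isotopy F \<Phi> G \<Psi> \<longleftrightarrow> smooth_matrix F \<Phi> \<and> smooth_matrix G \<Psi> \<and>
    (\<forall>t x. F t (G t x) = x \<and> G t (F t x) = x) \<and>
    (\<forall>t x. \<forall>a\<in>fibre A x. \<Psi> t (F t x) (\<Phi> t x a) = a \<and> \<Phi> t (G t x) (\<Psi> t x a) = a) \<and>
    (\<forall>x. F 0 x = x) \<and> (\<forall>x. \<forall>a\<in>fibre A x. \<Phi> 0 x a = a)"

text \<open>The defining property of the flow of \<open>X\<close> on functions and on sections.\<close>

definition flow_of :: "(real => 'm => 'v) => (real => 'm => 'm) => (real => 'm => 'v => 'v) =>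
    (real => 'm => 'm) => (real => 'm => 'v => 'v) => bool" where
  "flow_of X F \<Phi> G \<Psi> \<longleftrightarrow> section_family X \<and> isotopy F \<Phi> G \<Psi> \<and>
    (\<forall>h h'. smooth_family (base A) h \<longrightarrow> (\<forall>t x. ((%s. h s x) has_real_derivative h' t x) (at t)) \<longrightarrow>
      (\<forall>t x. ((%s. h s (F s x)) has_real_derivative h' t (F t x) + \<rho> (F t x) (X t (F t x)) (h t)) (at t))) \<and>
    (\<forall>W W'. section_derivative W W' \<longrightarrow> (\<forall>t x. \<forall>\<alpha> :: 'v => real. linear_between (fibre A x) UNIV \<alpha> \<longrightarrow>
      ((%s. \<alpha> (\<Psi> s (F s x) (W s (F s x)))) has_real_derivative
        \<alpha> (\<Psi> t (F t x) (W' t (F t x) + bracket A (X t) (W t) (F t x)))) (at t)))"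

end

section \<open>Bundle maps supported in a patch with chart and frame\<close>

text \<open>Two nested cutoffs: \<open>\<psi>\<close> multiplies the section whose flow is wanted,
  \<open>\<zeta>\<close> extends coordinates and frame beyond the patch. Since
  \<open>\<zeta>\<close> is 1 wherever \<open>\<psi>\<close> is non-zero, it does not enter the
  formulas for the flow.\<close>

locale chart_patch = lie_calculus A K E \<theta> I crdf \<Delta>
  for A :: "('m::{t2_space,second_countable_topology}, 'b::real_normed_vector,
    'v::real_vector, 'f::real_normed_vector) algebroid" and K E \<theta> I crdf \<Delta> +
  fixes U :: "'m set" and c :: "'m => 'b" and U' :: "'m set" and \<tau> :: "'m => 'f => 'v"
    and N C :: "'m set" and \<zeta> \<psi> :: "'m => real"
  assumes chart_U: "(U, c) \<in> base A" and frame_U: "(U', \<tau>) \<in> frames A"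
    and N: "open N" "N \<subseteq> U" "N \<subseteq> U'" and C: "closed C" "C \<subseteq> N"
    and \<zeta>: "\<zeta> \<in> smooth_functions (base A)" "!!y. y \<notin> C ==> \<zeta> y = 0"
    and \<psi>: "\<psi> \<in> smooth_functions (base A)" "!!y. \<psi> y \<noteq> 0 ==> \<zeta> y = 1"
begin

lemma \<psi>_zero: "y \<notin> C ==> \<psi> y = 0" using \<zeta>(2) \<psi>(2) by fastforce

lemma N_chart: "x \<in> N ==> inv_into U c (c x) = x" using N chart_inv[OF chart_U] by blast

lemma c_inj: "x \<in> N ==> y \<in> N ==> c x = c y ==> x = y" using N_chart by metis

lemma compact_cC: "compact (c ` C)"
proof -
  have "continuous_on C c"
    using continuous_on_subset[OF homeomorphism_cont1[OF chart_homeomorphism[OF chart_U]]] N C by blast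
  then show ?thesis by (rule compact_continuous_image[OF _ closed_imp_compact[OF C(1)]])
qed

definition chart_map :: "(real => 'b => 'b) => real => 'm => 'm" where
  "chart_map \<phi> t x = (if x \<in> N then inv_into U c (\<phi> t (c x)) else x)"

definition chart_fibre_map :: "(real => 'b => 'b) => (real => 'b => 'f => 'f) => real => 'm => 'v => 'v" where
  "chart_fibre_map \<phi> m t x a = (if x \<in> N then \<tau> (chart_map \<phi> t x) (m t (c x) (inv (\<tau> x) a)) else a)"

lemma line_chart_family:
  assumes "C_inf_on UNIV (%(t, y). g t y)"
  shows "smooth_fun_on line (UNIV \<times> N) (%(t, x). g t (c x))"
proof (rule smooth_family_chart[OF chart_U N(2,1)])
  have "smooth_on UNIV (%(t, y). g t y)" using assms smooth_on_open[OF open_UNIV] by blast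
  then have "smooth_on (UNIV \<times> c ` N) (%(t, y). g t y)" by (rule smooth_on_subset) simp
  then show "smooth_on (UNIV \<times> c ` N) (%(t, y). g t (c (inv_into U c y)))"
    by (rule smooth_on_cong) (use N_chart in auto)
qed

lemma line_two_cover:
  assumes "smooth_fun_on line (UNIV \<times> N \<inter> D) f" "smooth_fun_on line (UNIV \<times> - C \<inter> D) f"
  shows "smooth_fun_on line D f"
proof -
  have "- (UNIV \<times> C) = (UNIV \<times> - C :: (real \<times> 'm) set)" by auto
  then show ?thesis
    using manifold.smooth_fun_on_two_cover[OF manifold_line, of "UNIV \<times> N" "UNIV \<times> C" D f] assms N C
    by (auto simp: open_Times closed_Times)
qed

text \<open>The set \<open>N\<close> and the complement of \<open>C\<close> cover the manifold; on
  the first the map is read in the chart, on the second it is the identity.\<close>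

lemma chart_map:
  assumes \<phi>: "C_inf_on UNIV (%(t, y). \<phi> t y)" "!!t y. y \<in> c ` N ==> \<phi> t y \<in> c ` N"
    "!!t x. x \<in> N ==> x \<notin> C ==> \<phi> t (c x) = c x"
  shows chart_map_N: "x \<in> N ==> chart_map \<phi> t x \<in> N \<and> c (chart_map \<phi> t x) = \<phi> t (c x)"
    and chart_map_outside: "x \<notin> C ==> chart_map \<phi> t x = x"
    and chart_map_smooth: "smooth_map_on line (base A) UNIV (%(t, x). chart_map \<phi> t x)"
proof -
  show inN: "chart_map \<phi> t x \<in> N \<and> c (chart_map \<phi> t x) = \<phi> t (c x)" if "x \<in> N" for t x
  proof -
    from \<phi>(2)[of "c x" t] that obtain z where "z \<in> N" "\<phi> t (c x) = c z" by blast
    then show ?thesis using that N_chart by (simp add: chart_map_def)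
  qed
  show out: "chart_map \<phi> t x = x" if "x \<notin> C" for t x using that \<phi>(3) N_chart by (auto simp: chart_map_def)
  show "smooth_map_on line (base A) UNIV (%(t, x). chart_map \<phi> t x)" unfolding smooth_map_on_def
  proof (intro conjI ballI)
    have sm: "smooth_fun_on line (UNIV \<times> N) (%(t, x). \<phi> t (c x))" by (rule line_chart_family[OF \<phi>(1)])
    have oN: "open (UNIV \<times> N :: (real \<times> 'm) set)" using N by (simp add: open_Times)
    have "continuous_on (UNIV \<times> N) (%(t::real, x). \<phi> t (c x))"
      by (rule manifold.smooth_fun_on_imp_continuous_on[OF manifold_line sm oN])
    then have "continuous_on (UNIV \<times> N) (%p. inv_into U c ((%(t::real, x). \<phi> t (c x)) p))"
      by (rule continuous_on_compose2[OF homeomorphism_cont2[OF chart_homeomorphism[OF chart_U]]])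
        (use \<phi>(2) N(2) in fastforce)
    then have c1: "continuous_on (UNIV \<times> N) (%(t::real, x). chart_map \<phi> t x)"
      by (rule continuous_on_eq) (auto simp: chart_map_def)
    have c2: "continuous_on (UNIV \<times> - C) (%(t::real, x). chart_map \<phi> t x)"
      by (rule continuous_on_eq[OF continuous_on_snd[OF continuous_on_id]]) (auto simp: out)
    have "UNIV = (UNIV \<times> N :: (real \<times> 'm) set) \<union> (UNIV \<times> - C)" using C by auto
    moreover have "continuous_on ((UNIV \<times> N) \<union> (UNIV \<times> - C)) (%(t::real, x). chart_map \<phi> t x)"
      by (rule continuous_on_open_Un[OF oN _ c1 c2]) (use C in \<open>simp add: open_Times open_Compl\<close>)
    ultimately show "continuous_on UNIV (%(t::real, x). chart_map \<phi> t x)" by simp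
    fix p assume "p \<in> base A"
    then obtain V d where V: "(V, d) \<in> base A" and p: "p = (V, d)" by (cases p) auto
    let ?D = "(%(t::real, x). chart_map \<phi> t x) -` V"
    have "smooth_fun_on line ?D (%(t, x). d (chart_map \<phi> t x))"
    proof (rule line_two_cover)
      have "smooth_fun_on line (UNIV \<times> N \<inter> ?D) (%q. d (inv_into U c ((%(t, x). \<phi> t (c x)) q)))"
      proof (rule manifold.smooth_fun_on_compose[OF manifold_line fd transition[OF chart_U V]
            smooth_fun_on_subset[OF sm]])
        fix q assume "q \<in> UNIV \<times> N \<inter> ?D"
        then show "(%(t, x). \<phi> t (c x)) q \<in> c ` (U \<inter> V)"
          using inN N(2) by (auto simp: image_iff) (metis IntI subsetD)
      qed auto
      then show "smooth_fun_on line (UNIV \<times> N \<inter> ?D) (%(t, x). d (chart_map \<phi> t x))"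
        by (rule manifold.smooth_fun_on_cong[OF manifold_line]) (auto simp: chart_map_def)
      have "smooth_fun_on line (UNIV \<times> V) (%(t::real, x). d x)"
        by (rule smooth_family_static[OF chart_smooth[OF V]])
      then have "smooth_fun_on line (UNIV \<times> - C \<inter> ?D) (%(t::real, x). d x)"
        by (rule smooth_fun_on_subset) (auto simp: out)
      then show "smooth_fun_on line (UNIV \<times> - C \<inter> ?D) (%(t, x). d (chart_map \<phi> t x))"
        by (rule family_cong) (auto simp: out)
    qed
    then show "case p of (V, d) => smooth_fun_on line (UNIV \<inter> (%(t, x). chart_map \<phi> t x) -` V)
        (d \<circ> (%(t, x). chart_map \<phi> t x))" by (simp add: p o_def case_prod_unfold)
  qed
qed

text \<open>Over \<open>N\<close> the matrix in the generators is assembled from \<open>m\<close>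
  and the coordinates of the generators in the frame; over the complement of \<open>C\<close> the
  map is the identity, and the two descriptions cover the manifold.\<close>

lemma chart_fibre_map:
  assumes \<phi>: "C_inf_on UNIV (%(t, y). \<phi> t y)" "!!t y. y \<in> c ` N ==> \<phi> t y \<in> c ` N"
    "!!t x. x \<in> N ==> x \<notin> C ==> \<phi> t (c x) = c x"
    and m: "!!t y. linear (m t y)" "!!v. C_inf_on UNIV (%(t, y). m t y v)"
    "!!t x v. x \<in> N ==> x \<notin> C ==> m t (c x) v = v"
  shows chart_fibre_map_outside: "x \<notin> C ==> a \<in> fibre A x ==> chart_fibre_map \<phi> m t x a = a"
    and chart_fibre_map_smooth: "smooth_matrix (chart_map \<phi>) (chart_fibre_map \<phi> m)"
proof -
  have inN: "chart_map \<phi> t x \<in> N \<and> c (chart_map \<phi> t x) = \<phi> t (c x)" if "x \<in> N" for t x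
    by (rule chart_map_N[OF \<phi> that])
  have out: "chart_map \<phi> t x = x" if "x \<notin> C" for t x by (rule chart_map_outside[OF \<phi> that])
  note smF = chart_map_smooth[OF \<phi>]
  have NU': "x \<in> U'" if "x \<in> N" for x using that N by blast
  show outf: "chart_fibre_map \<phi> m t x a = a" if "x \<notin> C" "a \<in> fibre A x" for t x a
    using that m(3) out inv_frame[OF frame_U NU'] by (auto simp: chart_fibre_map_def)
  show "smooth_matrix (chart_map \<phi>) (chart_fibre_map \<phi> m)" unfolding smooth_matrix_def
  proof (intro conjI allI smF)
    fix t x
    show "linear_between (fibre A x) (fibre A (chart_map \<phi> t x)) (chart_fibre_map \<phi> m t x)"
    proof (cases "x \<in> N")
      case True
      note l1 = inv_frame_linear[OF frame_U NU'[OF True]]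
        and l2 = frame_linear[OF frame_U NU'[OF conjunct1[OF inN[OF True, of t]]]]
      show ?thesis unfolding linear_between_def
        using True frame_mem[OF frame_U NU'[OF conjunct1[OF inN[OF True, of t]]]]
        by (auto simp: chart_fibre_map_def linear_between_add[OF l1] linear_between_scale[OF l1]
            linear_add[OF m(1)] linear_cmul[OF m(1)] linear_add[OF l2] linear_cmul[OF l2])
    next
      case False
      then show ?thesis by (auto simp: linear_between_def chart_fibre_map_def chart_map_def)
    qed
  next
    fix k l
    note B = basis[OF fdf]
    let ?e = "%x. inv (\<tau> x) (E l x)"
    show "smooth_family (base A) (%t x. \<theta> k (chart_map \<phi> t x) (chart_fibre_map \<phi> m t x (E l x)))"
    proof (rule line_two_cover)
      have s1: "smooth_fun_on line (UNIV \<times> N) (%(t::real, x). coord b (?e x))" for b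
        by (intro smooth_family_static smooth_fun_on_bounded_linear[OF B(2)]
            smooth_fun_on_subset[OF sectionD(2)[OF E frame_U] N(3)])
      have s2: "smooth_fun_on line (UNIV \<times> N) (%(t, x). m t (c x) b)" for b
        by (rule line_chart_family[OF m(2)])
      have s3: "smooth_fun_on line (UNIV \<times> N) (%(t, x). \<theta> k (chart_map \<phi> t x) (\<tau> (chart_map \<phi> t x) b))" for b
      proof (rule family_compose[OF _ _ smooth_fun_on_subset[OF \<theta>_smooth[OF frame_U] N(3)]])
        show "smooth_map_on line (base A) (UNIV \<times> N) (%(t, x). chart_map \<phi> t x)"
          using smF unfolding smooth_map_on_def
          by (fastforce intro: continuous_on_subset smooth_fun_on_subset)
      qed (use N inN in \<open>auto simp: open_Times\<close>)
      have "smooth_fun_on line (UNIV \<times> N) (%(t, x). \<Sum>b\<in>basis. \<Sum>b'\<in>basis. coord b' (?e x) *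
          coord b (m t (c x) b') * \<theta> k (chart_map \<phi> t x) (\<tau> (chart_map \<phi> t x) b))"
        by (intro family_sum family_mult family_bounded_linear[OF B(2)] s1 s2 s3)
      then have "smooth_fun_on line (UNIV \<times> N) (%(t, x). \<theta> k (chart_map \<phi> t x) (chart_fibre_map \<phi> m t x (E l x)))"
      proof (rule family_cong)
        fix t :: real and x :: 'm assume "(t, x) \<in> UNIV \<times> N"
        then have x: "x \<in> N" by simp
        let ?F = "chart_map \<phi> t x"
        have FU: "?F \<in> U'" using inN[OF x] NU' by blast
        have mx: "m t (c x) (?e x) = (\<Sum>b'\<in>basis. coord b' (?e x) *\<^sub>R m t (c x) b')"
          by (rule linear_expand[OF B(3) m(1)])
        have "coord b (m t (c x) (?e x)) = (\<Sum>b'\<in>basis. coord b' (?e x) * coord b (m t (c x) b'))" for b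
          unfolding mx using bounded_linear.linear[OF B(2)] by (simp add: linear_sum linear_cmul)
        moreover have "\<theta> k ?F (\<tau> ?F (m t (c x) (?e x))) =
            (\<Sum>b\<in>basis. coord b (m t (c x) (?e x)) * \<theta> k ?F (\<tau> ?F b))" unfolding real_scaleR_def[symmetric]
          by (rule linear_expand[OF B(3) bounded_linear.linear[OF functional_frame_bounded_linear[OF frame_U FU \<theta>_linear]]])
        ultimately show "(\<Sum>b\<in>basis. \<Sum>b'\<in>basis. coord b' (?e x) * coord b (m t (c x) b') * \<theta> k ?F (\<tau> ?F b)) =
            \<theta> k ?F (chart_fibre_map \<phi> m t x (E l x))"
          using x by (simp add: chart_fibre_map_def sum_distrib_right)
      qed
      then show "smooth_fun_on line (UNIV \<times> N \<inter> UNIV) (%(t, x). \<theta> k (chart_map \<phi> t x) (chart_fibre_map \<phi> m t x (E l x)))"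
        by simp
      have "smooth_fun_on line (UNIV \<times> UNIV) (%(t::real, x). \<theta> k x (E l x))"
        by (rule smooth_family_static) (use \<theta>_CF[OF E] in simp)
      then have "smooth_fun_on line (UNIV \<times> - C \<inter> UNIV) (%(t::real, x). \<theta> k x (E l x))"
        by (rule smooth_fun_on_subset) auto
      then show "smooth_fun_on line (UNIV \<times> - C \<inter> UNIV) (%(t, x). \<theta> k (chart_map \<phi> t x) (chart_fibre_map \<phi> m t x (E l x)))"
        by (rule family_cong) (auto simp: out outf sectionD(1)[OF E])
    qed
  qed
qed

end

section \<open>The flow of a section supported in a patch\<close>

locale chart_flow = chart_patch A K E \<theta> I crdf \<Delta> U c U' \<tau> N C \<zeta> \<psi>
  for A :: "('m::{t2_space,second_countable_topology}, 'b::real_normed_vector,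
    'v::real_vector, 'f::real_normed_vector) algebroid" and K E \<theta> I crdf \<Delta> U c U' \<tau> N C \<zeta> \<psi> +
  fixes X' :: "real => 'm => 'v"
  assumes X': "section_family X'"
begin

lemmas P = basis(2,3)[OF fd]

lemmas Q = basis(2,3)[OF fdf]

definition X :: "real => 'm => 'v" where "X t x = \<psi> x *\<^sub>R X' t x"

definition cutoff_coord :: "'b => 'm => real" where "cutoff_coord b x = \<zeta> x * coord b (c x)"

text \<open>The components in the chart of the vector field that the anchor assigns to
  \<open>X t\<close>. Coordinates have to be cut off to become global functions; where the cutoff
  changes them, \<open>X\<close> vanishes.\<close>

definition velocity :: "real => 'm => 'b" where
  "velocity t x = (\<Sum>b\<in>basis. \<rho> x (X t x) (cutoff_coord b) *\<^sub>R b)"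

definition V :: "real \<times> 'b => 'b" where
  "V = (%(t, y). if y \<in> c ` N then velocity t (inv_into U c y) else 0)"

definition cutoff_frame :: "'f => 'm => 'v" where
  "cutoff_frame v x = (if x \<in> N then \<tau> x (\<zeta> x *\<^sub>R v) else 0)"

definition cutoff_coeff :: "('m => 'v) => 'f => 'm => real" where
  "cutoff_coeff W b x = (if x \<in> N then \<zeta> x * coord b (inv (\<tau> x) (W x)) else 0)"

text \<open>One column of the zeroth-order part of the operator \<open>[X t, W]\<close> in the
  frame: the bracket with a frame section, in frame coordinates, carried to the chart and extended
  by zero.\<close>

definition bracket_column :: "'f => real \<times> 'b => 'f" where
  "bracket_column b = (%(t, y). if y \<in> c ` N then
    inv (\<tau> (inv_into U c y)) (bracket A (X t) (cutoff_frame b) (inv_into U c y)) else 0)"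

definition bracket_matrix :: "real \<times> 'b => 'f => 'f" where
  "bracket_matrix p v = (\<Sum>b\<in>basis. coord b v *\<^sub>R bracket_column b p)"

lemma NU': "x \<in> N ==> x \<in> U'" using N by blast

lemma X_family: "section_family X"
proof -
  have "smooth_family (base A) (%t. \<psi>)" using smooth_family_static[of UNIV \<psi> UNIV] \<psi>(1) by simp
  from section_family_scale[OF this X'] show ?thesis unfolding X_def[abs_def] .
qed

lemma X_section: "X t \<in> \<Gamma>" by (rule section_family_section[OF X_family])

lemma X_zero: "\<psi> x = 0 ==> X t x = 0" by (simp add: X_def)

lemma cutoff_coord_CF: "cutoff_coord b \<in> CF"
proof -
  have "smooth_fun_on (base A) N (cutoff_coord b)" unfolding cutoff_coord_def[abs_def] using \<zeta>(1)
    by (intro smooth_fun_on_mult smooth_fun_on_bounded_linear[OF P(1)]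
        smooth_fun_on_subset[OF chart_smooth[OF chart_U] N(2)]) (auto intro: smooth_fun_on_subset)
  from smooth_fun_on_extend_zero[OF this N(1) C] show ?thesis by (simp add: cutoff_coord_def \<zeta>(2))
qed

lemma anchor_X_zero: "\<psi> x = 0 ==> f \<in> CF ==> \<rho> x (X t x) f = 0"
  using linear_between_0[OF anchor_linear fibre_0] by (simp add: X_zero)

lemma velocity_zero: "\<psi> x = 0 ==> velocity t x = 0"
  by (simp add: velocity_def anchor_X_zero[OF _ cutoff_coord_CF])

lemma V_zero: "\<psi> x = 0 ==> x \<in> N ==> V (t, c x) = 0" by (simp add: V_def N_chart velocity_zero)

lemma V_outside: "y \<notin> c ` C ==> V (t, y) = 0"
proof (cases "y \<in> c ` N")
  case True
  assume "y \<notin> c ` C"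
  then obtain x where "x \<in> N" "x \<notin> C" "y = c x" using True by blast
  then show ?thesis using V_zero \<psi>_zero by blast
qed (simp add: V_def)

lemma V_smooth: "C_inf_on UNIV V" unfolding V_def
proof (rule push_to_chart[OF chart_U N(1,2) C])
  have "smooth_fun_on line UNIV (%(t, x). velocity t x)"
    unfolding velocity_def by (intro family_ops anchor_functional_family X_family cutoff_coord_CF)
      (simp add: case_prod_unfold smooth_fun_on_const)
  then show "smooth_fun_on line (UNIV \<times> N) (%(t, x). velocity t x)" by (rule smooth_fun_on_subset) simp
qed (simp add: velocity_zero \<psi>_zero)

lemma V_lipschitz: "\<exists>L. \<forall>t x y. \<bar>t\<bar> \<le> T \<longrightarrow> norm (V (t, x) - V (t, y)) \<le> L * norm (x - y)"
  by (rule compactly_supported_lipschitz[OF fd V_smooth compact_cC V_outside])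

lemma chart_CF:
  assumes "f \<in> CF" shows "C_inf_on (c ` U) (%y. f (inv_into U c y))"
proof -
  have "smooth_on (c ` U) (%y. f (inv_into U c y))"
    using assms chart_U by (fastforce simp: smooth_fun_on_def o_def)
  then show ?thesis by (rule smooth_on_open[OF chart_open_range[OF chart_U], THEN iffD1])
qed

text \<open>Where \<open>\<psi>\<close> is non-zero, \<open>\<zeta>\<close> is 1 on a neighbourhood
  and \<open>derivation_formula\<close> applies; elsewhere \<open>X\<close> and hence both sides
  vanish.\<close>

lemma anchor_V:
  assumes x: "x \<in> N" and f: "f \<in> CF"
  shows "\<rho> x (X t x) f = frechet_derivative (%y. f (inv_into U c y)) (at (c x)) (V (t, c x))"
proof -
  let ?f' = "frechet_derivative (%y. f (inv_into U c y)) (at (c x))"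
  have "(%y. f (inv_into U c y)) differentiable at (c x)"
    using k_smooth_on_SucD(1)[OF spec[OF chart_CF[OF f], of 1, unfolded One_nat_def], of "c x"] x N
    by (auto simp: differentiable_def)
  then have lin: "linear ?f'" by (rule linear_frechet_derivative)
  show ?thesis
  proof (cases "\<psi> x = 0")
    case True
    then show ?thesis using anchor_X_zero[OF True f] V_zero[OF True x] linear_0[OF lin] by simp
  next
    case False
    have o: "open {y. \<psi> y \<noteq> 0}" using \<psi>(1) smooth_fun_on_imp_continuous_on[of UNIV \<psi>]
      by (simp add: open_Collect_neq continuous_on_const)
    have "\<rho> x (X t x) f = (\<Sum>b\<in>basis. \<rho> x (X t x) (cutoff_coord b) * ?f' b)"
      unfolding cutoff_coord_def[abs_def]
      by (rule derivation_formula(2)[OF chart_U N(1) x N(2) P \<zeta>(1) C \<zeta>(2) o _ _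
            anchor_tangent[OF section_family_mem[OF X_family]] f])
        (use False \<psi>(2) in auto)
    also have "\<dots> = ?f' (velocity t x)"
      unfolding velocity_def by (simp add: linear_sum[OF lin] linear_cmul[OF lin])
    finally show ?thesis using x by (simp add: V_def N_chart)
  qed
qed

lemma cutoff_frame_section: "cutoff_frame v \<in> \<Gamma>" unfolding cutoff_frame_def
  by (rule section_extend_zero[OF frame_U N(1,3) C])
    (use \<zeta> in \<open>auto intro!: smooth_fun_on_scaleR smooth_fun_on_const intro: smooth_fun_on_subset\<close>)

lemma cutoff_coeff_family:
  assumes W: "section_family W" shows "smooth_family (base A) (%t. cutoff_coeff (W t) b)"
proof (rule smooth_family_extend_zero[OF _ N(1) C])
  have "smooth_fun_on line (UNIV \<times> N) (%(t, x). \<zeta> x * coord b (inv (\<tau> x) (W t x)))" using \<zeta>(1)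
    by (intro family_mult family_bounded_linear[OF Q(1)] smooth_family_static
        smooth_fun_on_subset[OF section_family_frame[OF W frame_U]]) (use N in \<open>auto intro: smooth_fun_on_subset\<close>)
  then show "smooth_fun_on line (UNIV \<times> N) (%(t, x). cutoff_coeff (W t) b x)"
    by (rule family_cong) (auto simp: cutoff_coeff_def)
qed (simp add: cutoff_coeff_def \<zeta>(2))

lemma cutoff_coeff_CF: "W \<in> \<Gamma> ==> cutoff_coeff W b \<in> CF"
  using smooth_family_imp_smooth_fun[OF cutoff_coeff_family[OF section_family_static]] by simp

text \<open>If \<open>\<zeta> x \<noteq> 1\<close>, then \<open>\<psi>\<close> vanishes on a
  neighbourhood of \<open>x\<close>, so in the Leibniz rule for \<open>[W, \<psi> X']\<close> both
  the term with \<open>\<psi>\<close> and the one with its derivative are zero.\<close>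

lemma bracket_zero:
  assumes W: "W \<in> \<Gamma>" and x: "\<zeta> x \<noteq> 1" shows "bracket A (X t) W x = 0"
proof -
  have o: "open {y. \<zeta> y \<noteq> 1}" using \<zeta>(1) smooth_fun_on_imp_continuous_on[of UNIV \<zeta>]
    by (simp add: open_Collect_neq continuous_on_const)
  note T = anchor_tangent[OF sectionD(1)[OF W], of x]
  have "\<rho> x (W x) \<psi> = \<rho> x (W x) (%_. 0)" by (rule tangent_local[OF T \<psi>(1) CF_const o]) (use x \<psi>(2) in auto)
  then have "\<rho> x (W x) \<psi> = 0" using tangent_const[OF T] by simp
  moreover have "\<psi> x = 0" using x \<psi>(2) by blast
  ultimately have "bracket A W (X t) x = 0"
    using bracket_leibniz[OF W section_family_section[OF X'] \<psi>(1), of t] by (simp add: X_def[abs_def])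
  then show ?thesis using bracket_antisym_at[OF X_section W] by simp
qed

text \<open>Coefficients and frame sections carry one factor \<open>\<zeta>\<close> each, so their
  products sum to \<open>\<zeta>^2 W\<close>. Replacing \<open>W\<close> by that section costs the
  derivative of \<open>\<zeta>^2\<close> along \<open>X\<close>, which is zero: either
  \<open>X\<close> vanishes at \<open>x\<close>, or \<open>\<zeta>\<close> is constant
  nearby.\<close>

lemma bracket_local:
  assumes W: "W \<in> \<Gamma>" and x: "x \<in> N" "\<zeta> x = 1"
  shows "bracket A (X t) W x = (\<Sum>b\<in>basis. cutoff_coeff W b x *\<^sub>R bracket A (X t) (cutoff_frame b) x +
    \<rho> x (X t x) (cutoff_coeff W b) *\<^sub>R \<tau> x b)"
proof -
  have sq: "(%x. \<zeta> x * \<zeta> x) \<in> CF" using CF_mult \<zeta>(1) by blast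
  note T = anchor_tangent[OF section_family_mem[OF X_family], of x t]
  have S: "(%x. \<Sum>b\<in>basis. cutoff_coeff W b x *\<^sub>R cutoff_frame b x) = (%x. (\<zeta> x * \<zeta> x) *\<^sub>R W x)"
  proof
    fix y
    show "(\<Sum>b\<in>basis. cutoff_coeff W b y *\<^sub>R cutoff_frame b y) = (\<zeta> y * \<zeta> y) *\<^sub>R W y"
    proof (cases "y \<in> N")
      case True
      note l = frame_linear[OF frame_U NU'[OF True]]
      have "(\<Sum>b\<in>basis. cutoff_coeff W b y *\<^sub>R cutoff_frame b y) =
          (\<zeta> y * \<zeta> y) *\<^sub>R \<tau> y (\<Sum>b\<in>basis. coord b (inv (\<tau> y) (W y)) *\<^sub>R b)"
        using True by (simp add: cutoff_coeff_def cutoff_frame_def linear_cmul[OF l] linear_sum[OF l] scaleR_sum_right mult_ac)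
      then show ?thesis
        using inv_frame[OF frame_U NU'[OF True] sectionD(1)[OF W]] Q(2)[of "inv (\<tau> y) (W y)"] by simp
    qed (use C \<zeta>(2) in \<open>auto simp: cutoff_frame_def\<close>)
  qed
  have "\<rho> x (X t x) (%x. \<zeta> x * \<zeta> x) = 0"
  proof (cases "\<psi> x = 0")
    case False
    have "open {y. \<psi> y \<noteq> 0}" using \<psi>(1) smooth_fun_on_imp_continuous_on[of UNIV \<psi>]
      by (simp add: open_Collect_neq continuous_on_const)
    then have "\<rho> x (X t x) (%x. \<zeta> x * \<zeta> x) = \<rho> x (X t x) (%_. 1)"
      by (rule tangent_local[OF T sq CF_const]) (use False \<psi>(2) in auto)
    then show ?thesis using tangent_const[OF T] by simp
  qed (rule anchor_X_zero[OF _ sq])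
  then have "bracket A (X t) W x = bracket A (X t) (%x. (\<zeta> x * \<zeta> x) *\<^sub>R W x) x"
    using bracket_leibniz[OF X_section W sq] x by simp
  also have "\<dots> = (\<Sum>b\<in>basis. cutoff_coeff W b x *\<^sub>R bracket A (X t) (cutoff_frame b) x +
      \<rho> x (X t x) (cutoff_coeff W b) *\<^sub>R cutoff_frame b x)" unfolding S[symmetric]
    by (rule bracket_sum_right[OF X_section cutoff_coeff_CF[OF W] cutoff_frame_section])
  finally show ?thesis using x by (simp add: cutoff_frame_def)
qed

lemma bracket_column_smooth: "C_inf_on UNIV (bracket_column b)" unfolding bracket_column_def
proof (rule push_to_chart[OF chart_U N(1,2) C])
  show "smooth_fun_on line (UNIV \<times> N) (%(t, x). inv (\<tau> x) (bracket A (X t) (cutoff_frame b) x))"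
    by (rule smooth_fun_on_subset[OF section_family_frame[OF bracket_family[OF X_family
            section_family_static[OF cutoff_frame_section]] frame_U]]) (use N in auto)
  show "inv (\<tau> x) (bracket A (X t) (cutoff_frame b) x) = 0" if "x \<in> N" "x \<notin> C" for t x
    using that bracket_zero[OF cutoff_frame_section] \<zeta>(2)
      linear_between_0[OF inv_frame_linear[OF frame_U NU'[OF that(1)]] fibre_0] by simp
qed

lemma bracket_matrix:
  shows bracket_matrix_linear: "linear (bracket_matrix p)"
    and bracket_matrix_smooth: "C_inf_on UNIV (%p. bracket_matrix p v)"
    and bracket_matrix_zero: "x \<in> N ==> \<zeta> x \<noteq> 1 ==> bracket_matrix (t, c x) v = 0"
proof -
  have l: "linear (coord b)" for b :: 'f by (rule bounded_linear.linear[OF Q(1)])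
  show "linear (bracket_matrix p)"
    by (rule linearI) (simp_all add: bracket_matrix_def linear_add[OF l] linear_cmul[OF l]
        scaleR_left_distrib sum.distrib scaleR_sum_right)
  show "C_inf_on UNIV (%p. bracket_matrix p v)" unfolding bracket_matrix_def using bracket_column_smooth
    by (intro allI k_smooth_on_sum k_smooth_on_scaleR k_smooth_on_const) auto
  show "bracket_matrix (t, c x) v = 0" if "x \<in> N" "\<zeta> x \<noteq> 1"
    using that by (simp add: bracket_matrix_def bracket_column_def N_chart bracket_zero[OF cutoff_frame_section]
        linear_between_0[OF inv_frame_linear[OF frame_U NU'[OF that(1)]] fibre_0])
qed

text \<open>In frame coordinates the bracket with \<open>X\<close> is the derivative of the
  coefficients along the anchor plus a matrix. This turns the flow on sections into a linear
  equation along the orbits.\<close>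

lemma inv_frame_bracket:
  assumes W: "W \<in> \<Gamma>" and x: "x \<in> N" "\<zeta> x = 1"
  shows "inv (\<tau> x) (bracket A (X t) W x) = bracket_matrix (t, c x) (inv (\<tau> x) (W x)) +
    (\<Sum>b\<in>basis. \<rho> x (X t x) (cutoff_coeff W b) *\<^sub>R b)"
proof -
  note l = inv_frame_linear[OF frame_U NU'[OF x(1)]]
  note m = fibre_scale[OF sectionD(1)[OF bracket_section[OF X_section cutoff_frame_section]]]
    fibre_scale[OF frame_mem[OF frame_U NU'[OF x(1)]]]
  have "inv (\<tau> x) (\<Sum>b\<in>basis. 1 *\<^sub>R (cutoff_coeff W b x *\<^sub>R bracket A (X t) (cutoff_frame b) x +
      \<rho> x (X t x) (cutoff_coeff W b) *\<^sub>R \<tau> x b)) = (\<Sum>b\<in>basis. 1 *\<^sub>R inv (\<tau> x) (cutoff_coeff W b x *\<^sub>R bracket A (X t) (cutoff_frame b) x +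
      \<rho> x (X t x) (cutoff_coeff W b) *\<^sub>R \<tau> x b))"
    by (rule linear_between_sum[OF l subspace_fibre fibre_add[OF m]])
  moreover have "inv (\<tau> x) (cutoff_coeff W b x *\<^sub>R bracket A (X t) (cutoff_frame b) x +
      \<rho> x (X t x) (cutoff_coeff W b) *\<^sub>R \<tau> x b) =
      cutoff_coeff W b x *\<^sub>R inv (\<tau> x) (bracket A (X t) (cutoff_frame b) x) + \<rho> x (X t x) (cutoff_coeff W b) *\<^sub>R b" for b
    by (simp add: linear_between_add[OF l m] frame_inv[OF frame_U NU'[OF x(1)]]
        linear_between_scale[OF l sectionD(1)[OF bracket_section[OF X_section cutoff_frame_section]]]
        linear_between_scale[OF l frame_mem[OF frame_U NU'[OF x(1)]]])
  ultimately show ?thesis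
    using x by (simp add: bracket_local[OF W x] sum.distrib bracket_matrix_def bracket_column_def
        N_chart cutoff_coeff_def)
qed

end

text \<open>Differentiability comes from the smoothness of the inverse family; the value is then
  found by differentiating the identity that \<open>M s\<close> applied to the left-hand side is
  \<open>d s\<close>, instead of differentiating the inverse.\<close>

lemma inv_linear_flow_derivative:
  fixes M :: "real => 'f::real_normed_vector => 'f"
  assumes fd: "finite_dim TYPE('f)" and M: "!!t. linear (M t)" "!!t. inj (M t)"
    "!!v. C_inf_on UNIV (%t. M t v)" "!!v t. ((%t. M t v) has_vector_derivative - B t (M t v)) (at t)"
    and B: "!!t. linear (B t)" and d: "(d has_vector_derivative d') (at t)"
  shows "((%s. inv (M s) (d s)) has_vector_derivative inv (M t) (d' + B t (d t))) (at t)"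
proof -
  note Q = basis[OF fd]
  have bij: "bij (M s)" for s by (rule linear_inj_imp_bij_finite_dim[OF fd M(1,2)])
  have inv1: "inv (M s) (M s v) = v" for s v by (rule inv_f_f[OF M(2)])
  have inv2: "M s (inv (M s) v) = v" for s v by (rule surj_f_inv_f[OF bij_is_surj[OF bij]])
  let ?e = "%s. inv (M s) (d s)"
  have "k_smooth_on (Suc 0) UNIV (%s. inv (M s) v)" for v
    by (rule k_smooth_on_inv_linear[OF fd open_UNIV M(1,2)]) (use M(3) in blast)
  then have "(%s. inv (M s) v) differentiable (at t)" for v by simp
  moreover have "(%s. coord b (d s)) differentiable (at t)" for b
    using bounded_linear.has_vector_derivative[OF Q(2) d] by (rule differentiableI_vector)
  ultimately have "(%s. \<Sum>b\<in>basis. coord b (d s) *\<^sub>R inv (M s) b) differentiable (at t)"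
    using Q(1) by (intro differentiable_sum differentiable_scaleR) auto
  moreover have "(%s. \<Sum>b\<in>basis. coord b (d s) *\<^sub>R inv (M s) b) = ?e"
    by (rule ext, subst linear_expand[OF Q(3) linear_inv_of_bij[OF M(1) bij]]) (rule refl)
  ultimately obtain e' where e': "(?e has_vector_derivative e') (at t)" using vector_derivative_works by metis
  have "((%s. \<Sum>b\<in>basis. coord b (?e s) *\<^sub>R M s b) has_vector_derivative
      (\<Sum>b\<in>basis. coord b (?e t) *\<^sub>R (- B t (M t b)) + coord b e' *\<^sub>R M t b)) (at t)"
    by (intro has_vector_derivative_sum has_vector_derivative_scaleR M(4)
        bounded_linear.has_vector_derivative[OF Q(2) e', folded has_real_derivative_iff_has_vector_derivative])
  also have "(%s. \<Sum>b\<in>basis. coord b (?e s) *\<^sub>R M s b) = d"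
    by (rule ext, subst linear_expand[OF Q(3) M(1), symmetric]) (rule inv2)
  also have "(\<Sum>b\<in>basis. coord b (?e t) *\<^sub>R (- B t (M t b)) + coord b e' *\<^sub>R M t b) = - B t (d t) + M t e'"
  proof -
    have "linear (%v. - B t (M t v))"
      by (rule linearI) (simp_all add: linear_add[OF M(1)] linear_cmul[OF M(1)] linear_add[OF B] linear_cmul[OF B])
    from linear_expand[OF Q(3) this, of "?e t"] have "(\<Sum>b\<in>basis. coord b (?e t) *\<^sub>R (- B t (M t b))) = - B t (d t)"
      by (simp add: inv2)
    moreover have "(\<Sum>b\<in>basis. coord b e' *\<^sub>R M t b) = M t e'" by (rule linear_expand[OF Q(3) M(1), symmetric])
    ultimately show ?thesis by (simp only: sum.distrib)
  qed
  finally have "d' = - B t (d t) + M t e'" using vector_derivative_unique_at[OF d] by blast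
  then have "inv (M t) (d' + B t (d t)) = e'" by (simp add: inv1)
  then show ?thesis using e' by simp
qed

text \<open>The base map is the flow of \<open>V\<close> in the chart. The fibre map is the
  fundamental solution, along its orbits, of the linear equation with the negative of
  \<open>bracket_matrix\<close>; the sign is dictated by the requirement that the inverse fibre map
  applied to \<open>W\<close> have derivative \<open>W' + [X, W]\<close>.\<close>

lemma (in chart_flow) flow_exists: "\<exists>F \<Phi> G \<Psi>. flow_of X F \<Phi> G \<Psi>"
proof -
  obtain \<phi> \<phi>' where \<phi>: "!!y. \<phi> 0 y = y" "!!t y. ((%t. \<phi> t y) has_vector_derivative V (t, \<phi> t y)) (at t)"
    and \<phi>_smooth: "C_inf_on UNIV (%(t, y). \<phi> t y)" "C_inf_on UNIV (%(t, y). \<phi>' t y)"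
    and \<phi>_inv: "!!t y. \<phi> t (\<phi>' t y) = y" "!!t y. \<phi>' t (\<phi> t y) = y"
    by (rule smooth_flow[OF fd V_smooth V_lipschitz]) blast
  \<comment> \<open>By uniqueness, a solution that ever meets a point where \<open>V\<close>
    vanishes at all times rests there. This traps the orbits in \<open>N\<close>, and also in the
    region where \<open>\<zeta>\<close> is 1.\<close>
  have stationary: "\<phi> s y = z" if z: "!!r. V (r, z) = 0" "\<phi> t y = z" for s t y z
    by (rule ode_unique[where f = "%t y. V (t, y)" and v = "%_. z" and s = t, OF V_lipschitz \<phi>(2)])
      (use z in simp_all)
  have \<phi>N: "\<phi> t y \<in> c ` N" if "y \<in> c ` N" for t y
  proof (rule ccontr)
    assume n: "\<phi> t y \<notin> c ` N"
    have "\<phi> 0 y = \<phi> t y" by (rule stationary[of "\<phi> t y" t]) (use n in \<open>simp_all add: V_def\<close>)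
    then show False using n that \<phi>(1) by simp
  qed
  have \<phi>'N: "\<phi>' t y \<in> c ` N" if "y \<in> c ` N" for t y
  proof (rule ccontr)
    assume n: "\<phi>' t y \<notin> c ` N"
    have "\<phi> t (\<phi>' t y) = \<phi>' t y" by (rule stationary[of _ 0]) (use n \<phi>(1) in \<open>simp_all add: V_def\<close>)
    then show False using n that \<phi>_inv(1) by simp
  qed
  have still: "\<phi> t (c x) = c x" if "x \<in> N" "\<zeta> x \<noteq> 1" for t x
    by (rule stationary[of _ 0]) (use that \<psi>(2) V_zero \<phi>(1) in auto)
  have still': "\<phi>' t (c x) = c x" if "x \<in> N" "\<zeta> x \<noteq> 1" for t x using still[OF that] \<phi>_inv(2) by metis
  have outC: "\<zeta> x \<noteq> 1" if "x \<notin> C" for x using \<zeta>(2)[OF that] by simp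
  note fd2 = finite_dim_prod[OF finite_dim_real fd]
  have pair: "C_inf_on UNIV (%p :: real \<times> 'b. (fst p, g p))" if "C_inf_on UNIV g" for g :: "real \<times> 'b => 'b"
    using that k_smooth_on_bounded_linear[OF bounded_linear_fst open_UNIV] by (auto intro: k_smooth_on_Pair)
  let ?B = "%t y. bracket_matrix (t, \<phi> t y)"
  have "\<exists>M. (\<forall>p v. M 0 p v = v) \<and> (\<forall>t p. linear (M t p)) \<and> (\<forall>t p. inj (M t p)) \<and>
    (\<forall>v. C_inf_on UNIV (%(t, p). M t p v)) \<and>
    (\<forall>t p v. ((%t. M t p v) has_vector_derivative - ?B t p (M t p v)) (at t)) \<and>
    (\<forall>p u t. (\<forall>t. (u has_vector_derivative - ?B t p (u t)) (at t)) \<longrightarrow> u t = M t p (u 0))"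
  proof (rule smooth_linear_flow[OF fd fdf])
    show "linear ((%(t, p) v. - ?B t p v) x)" for x
      by (cases x) (auto intro!: linear_compose_neg bracket_matrix_linear simp: case_prod_unfold)
    show "C_inf_on UNIV (%x. (%(t, p) v. - ?B t p v) x v)" for v
      using C_inf_compose[OF fd2 bracket_matrix_smooth pair[OF \<phi>_smooth(1)] open_UNIV, of v]
      by (auto simp: case_prod_unfold intro: k_smooth_on_minus)
  qed (unfold prod.case, blast)
  then obtain M where M: "!!p v. M 0 p v = v" "!!t p. linear (M t p)" "!!t p. inj (M t p)"
    "!!v. C_inf_on UNIV (%(t, p). M t p v)"
    "!!t p v. ((%t. M t p v) has_vector_derivative - ?B t p (M t p v)) (at t)"
    and M_unique: "!!p u t. (!!t. (u has_vector_derivative - ?B t p (u t)) (at t)) ==> u t = M t p (u 0)" by blast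
  have bijM: "bij (M t y)" for t y by (rule linear_inj_imp_bij_finite_dim[OF fdf M(2,3)])
  have invM: "inv (M t y) (M t y v) = v" "M t y (inv (M t y) v) = v" for t y v
    using inv_f_f[OF M(3)] surj_f_inv_f[OF bij_is_surj[OF bijM]] by auto
  have Mfix: "M t (c x) v = v" if x: "x \<in> N" "\<zeta> x \<noteq> 1" for t x v
    using M_unique[of "%_. v" "c x" t] by (simp add: still[OF x] bracket_matrix_zero[OF x])
  \<comment> \<open>The inverse fibre map starts over the image point, so the base point is first
    moved back by \<open>\<phi>'\<close>.\<close>
  define M' where "M' t y = inv (M t (\<phi>' t y))" for t y
  have M'_smooth: "C_inf_on UNIV (%(t, y). M' t y v)" for v
  proof
    fix k
    have "C_inf_on UNIV (%p. M (fst p) (\<phi>' (fst p) (snd p)) v)" for v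
      using C_inf_compose[OF fd2 M(4) pair[OF \<phi>_smooth(2)] open_UNIV, of v] by (simp add: case_prod_unfold)
    from k_smooth_on_inv_linear[OF fdf open_UNIV M(2,3) spec[OF this]]
    show "k_smooth_on k UNIV (%(t, y). M' t y v)" by (simp add: M'_def case_prod_unfold)
  qed
  have M'_linear: "linear (M' t y)" for t y unfolding M'_def by (rule linear_inv_of_bij[OF M(2) bijM])
  have M'fix: "M' t (c x) v = v" if x: "x \<in> N" "\<zeta> x \<noteq> 1" for t x v
    using invM(1)[of t "c x" v] by (simp add: M'_def still'[OF x] Mfix[OF x])
  define F G where "F = chart_map \<phi>" and "G = chart_map \<phi>'"
  define \<Phi> \<Psi> where "\<Phi> = chart_fibre_map \<phi> M" and "\<Psi> = chart_fibre_map \<phi>' M'"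
  have FN: "F t x \<in> N" "c (F t x) = \<phi> t (c x)" and GN: "G t x \<in> N" "c (G t x) = \<phi>' t (c x)" if "x \<in> N" for t x
    using chart_map_N[OF \<phi>_smooth(1) \<phi>N still[OF _ outC] that]
      chart_map_N[OF \<phi>_smooth(2) \<phi>'N still'[OF _ outC] that] by (simp_all add: F_def G_def)
  have F_out: "F t x = x" "G t x = x" if "x \<notin> N" for t x using that by (auto simp: F_def G_def chart_map_def)
  have FG: "F t (G t x) = x" "G t (F t x) = x" for t x using F_out FN GN \<phi>_inv c_inj by (cases "x \<in> N"; simp)+
  have \<Psi>F: "\<Psi> t (F t x) a = \<tau> x (inv (M t (c x)) (inv (\<tau> (F t x)) a))" if "x \<in> N" for t x a
  proof -
    have "chart_map \<phi>' t (F t x) = x" using FG(2) by (simp add: G_def)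
    then show ?thesis using FN[OF that] by (simp add: \<Psi>_def chart_fibre_map_def M'_def \<phi>_inv)
  qed
  have iso: "isotopy F \<Phi> G \<Psi>" unfolding isotopy_def
  proof (intro conjI allI ballI)
    show "smooth_matrix F \<Phi>" unfolding F_def \<Phi>_def
      by (rule chart_fibre_map_smooth[OF \<phi>_smooth(1) \<phi>N still[OF _ outC] M(2,4) Mfix[OF _ outC]])
    show "smooth_matrix G \<Psi>" unfolding G_def \<Psi>_def
      by (rule chart_fibre_map_smooth[OF \<phi>_smooth(2) \<phi>'N still'[OF _ outC] M'_linear M'_smooth M'fix[OF _ outC]])
    show "F t (G t x) = x" "G t (F t x) = x" for t x by (fact FG)+
    fix x
    show "F 0 x = x" using N_chart \<phi>(1) by (simp add: F_def chart_map_def)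
    fix a assume a: "a \<in> fibre A x"
    show "\<Phi> 0 x a = a"
      using a N_chart \<phi>(1) M(1) inv_frame[OF frame_U NU' a] by (auto simp: \<Phi>_def chart_fibre_map_def chart_map_def)
    show "\<Psi> t (F t x) (\<Phi> t x a) = a" for t
    proof (cases "x \<in> N")
      case True
      then have "\<Phi> t x a = \<tau> (F t x) (M t (c x) (inv (\<tau> x) a))" by (simp add: \<Phi>_def chart_fibre_map_def F_def)
      then show ?thesis
        by (simp add: \<Psi>F[OF True] frame_inv[OF frame_U NU'[OF FN(1)[OF True]]] invM inv_frame[OF frame_U NU'[OF True] a])
    qed (simp add: F_out \<Phi>_def \<Psi>_def chart_fibre_map_def)
    show "\<Phi> t (G t x) (\<Psi> t x a) = a" for t
    proof (cases "x \<in> N")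
      case True
      note GN = GN[OF True, of t]
      have "\<Psi> t x a = \<tau> (G t x) (inv (M t (c (G t x))) (inv (\<tau> x) a))"
        using \<Psi>F[OF GN(1), of t a] FG(1) by simp
      moreover have "\<Phi> t (G t x) b = \<tau> x (M t (c (G t x)) (inv (\<tau> (G t x)) b))" for b
        using GN(1) FG(1)[of t x] by (simp add: \<Phi>_def chart_fibre_map_def F_def)
      ultimately show ?thesis
        by (simp add: frame_inv[OF frame_U NU'[OF GN(1)]] invM inv_frame[OF frame_U NU'[OF True] a])
    qed (simp add: F_out \<Phi>_def \<Psi>_def chart_fibre_map_def)
  qed
  have D0: "((%s. h s (F s x)) has_real_derivative h' t (F t x) + \<rho> (F t x) (X t (F t x)) (h t)) (at t)"
    if h: "smooth_family (base A) h" and h': "!!t x. ((%s. h s x) has_real_derivative h' t x) (at t)" for h h' t x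
  proof (cases "x \<in> N")
    case False
    then have "\<psi> x = 0" using \<psi>_zero C by blast
    moreover have "h t \<in> CF" using smooth_family_imp_smooth_fun[OF h] by simp
    ultimately show ?thesis using h'[of x t] by (simp add: F_out[OF False] anchor_X_zero)
  next
    case True
    let ?H = "%(t, y). h t (inv_into U c y)" and ?p = "(t, \<phi> t (c x))"
    let ?D = "frechet_derivative ?H (at ?p)"
    note FN = FN[OF True]
    have H: "k_smooth_on (Suc 0) (UNIV \<times> c ` U) ?H" using smooth_family_C_inf(1)[OF h chart_U] by blast
    have mem: "?p \<in> UNIV \<times> c ` U" using FN[of t] N(2) by (metis SigmaI UNIV_I image_eqI subsetD)
    have HD: "(?H has_derivative ?D) (at ?p)" by (rule k_smooth_on_SucD(1)[OF H mem])
    have "((%s. (s, \<phi> s (c x))) has_vector_derivative (1, V ?p)) (at t)"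
      by (rule has_vector_derivative_Pair[OF has_vector_derivative_id \<phi>(2)])
    from vector_derivative_diff_chain_within[OF this has_derivative_at_withinI[OF HD]]
    have d: "((%s. ?H (s, \<phi> s (c x))) has_vector_derivative ?D (1, V ?p)) (at t)" by (simp add: o_def)
    have 1: "?D (1, 0) = h' t (F t x)"
      using smooth_family_has_derivative(3)[OF h chart_U, of "F t x" t] DERIV_imp_deriv[OF h'] FN N(2) by (metis subsetD)
    have 2: "?D (0, V ?p) = \<rho> (F t x) (X t (F t x)) (h t)"
      using anchor_V[OF FN(1), of "h t" t t] smooth_family_imp_smooth_fun[OF h, of t] FN(2)
        fun_cong[OF partial_derivative(2)[OF H mem]] by simp
    have "?D (1, V ?p) = ?D (1, 0) + ?D (0, V ?p)"
      using linear_add[OF has_derivative_linear[OF HD], of "(1, 0)" "(0, V ?p)"] by simp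
    moreover have "?H (s, \<phi> s (c x)) = h s (F s x)" for s using True by (simp add: F_def chart_map_def)
    ultimately show ?thesis using d 1 2 by (simp add: has_real_derivative_iff_has_vector_derivative)
  qed
  have D: "((%s. \<alpha> (\<Psi> s (F s x) (W s (F s x)))) has_real_derivative
      \<alpha> (\<Psi> t (F t x) (W' t (F t x) + bracket A (X t) (W t) (F t x)))) (at t)"
    if W: "section_derivative W W'" and \<alpha>: "linear_between (fibre A x) UNIV \<alpha>" for W W' t x and \<alpha> :: "'v => real"
  proof -
    note Wf = section_derivativeD(1,2)[OF W]
    note WS = section_family_section[OF Wf(1)] and Wm = section_family_mem[OF Wf(1)] section_family_mem[OF Wf(2)]
    show ?thesis
    proof (cases "x \<in> N \<and> \<zeta> x = 1")
      \<comment> \<open>At such a point the flow moves neither the point nor the fibre, and the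
        bracket vanishes; the claim is the meaning of \<open>W'\<close>.\<close>
      case False
      then have z: "\<zeta> x \<noteq> 1" using outC C by blast
      have F: "F s x = x" for s using still[OF _ z] N_chart by (auto simp: F_def chart_map_def)
      have "\<Psi> s x a = a" if "a \<in> fibre A x" for s a
        using FG(2)[of s x] M'fix[OF _ z, of s] inv_frame[OF frame_U NU' that]
        by (simp add: F \<Psi>_def chart_fibre_map_def G_def)
      then show ?thesis using section_derivativeD(3)[OF W \<alpha>] Wm bracket_zero[OF WS z] by (simp add: F)
    next
      case True
      note x = conjunct1[OF True]
      note FN = FN[OF x]
      have \<zeta>F: "\<zeta> (F s x) = 1" for s
      proof (rule ccontr)
        assume n: "\<zeta> (F s x) \<noteq> 1"
        have "\<phi> 0 (c x) = c (F s x)" by (rule stationary[of _ s]) (use V_zero[OF _ FN(1)] \<psi>(2) n FN in auto)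
        then show False using \<phi>(1) c_inj[OF x FN(1)] n True by metis
      qed
      let ?y = "c x" and ?d = "%s. inv (\<tau> (F s x)) (W s (F s x))"
      let ?d' = "inv (\<tau> (F t x)) (W' t (F t x))" and ?r = "%b. \<rho> (F t x) (X t (F t x)) (cutoff_coeff (W t) b)"
      note inl = inv_frame_linear[OF frame_U NU'[OF FN(1)]]
      have w': "((%s. cutoff_coeff (W s) b z) has_real_derivative cutoff_coeff (W' t) b z) (at t)" for b t z
      proof (cases "z \<in> N")
        case True
        have "linear_between (fibre A z) UNIV (%a. coord b (inv (\<tau> z) a))"
          using inv_frame_linear[OF frame_U NU'[OF True]] bounded_linear.linear[OF Q(1)]
          by (auto simp: linear_between_def linear_add linear_cmul)
        from section_derivativeD(3)[OF W this] show ?thesis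
          using True by (auto simp: cutoff_coeff_def intro: DERIV_cmult)
      qed (simp add: cutoff_coeff_def)
      have "((%s. \<Sum>b\<in>basis. cutoff_coeff (W s) b (F s x) *\<^sub>R b) has_vector_derivative
          (\<Sum>b\<in>basis. (cutoff_coeff (W' t) b (F t x) + ?r b) *\<^sub>R b)) (at t)"
      proof (intro has_vector_derivative_sum)
        fix b
        show "((%s. cutoff_coeff (W s) b (F s x) *\<^sub>R b) has_vector_derivative
            (cutoff_coeff (W' t) b (F t x) + ?r b) *\<^sub>R b) (at t)"
          using has_vector_derivative_scaleR[OF D0[OF cutoff_coeff_family[OF Wf(1)] w'] has_vector_derivative_const[of b]]
          by simp
      qed
      also have "(%s. \<Sum>b\<in>basis. cutoff_coeff (W s) b (F s x) *\<^sub>R b) = ?d"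
        by (rule ext, subst Q(2)) (simp add: cutoff_coeff_def FN \<zeta>F)
      also have "(\<Sum>b\<in>basis. (cutoff_coeff (W' t) b (F t x) + ?r b) *\<^sub>R b) = ?d' + (\<Sum>b\<in>basis. ?r b *\<^sub>R b)"
        by (subst (4) Q(2)) (simp add: cutoff_coeff_def FN \<zeta>F scaleR_left_distrib sum.distrib)
      finally have d: "(?d has_vector_derivative ?d' + (\<Sum>b\<in>basis. ?r b *\<^sub>R b)) (at t)" .
      have Mt: "C_inf_on UNIV (%t. M t ?y v)" for v
      proof -
        have "C_inf_on UNIV (%t::real. (t, ?y))"
          by (intro allI k_smooth_on_Pair open_UNIV k_smooth_on_id k_smooth_on_const)
        from C_inf_compose[OF fd2 M(4) this open_UNIV] show ?thesis by simp
      qed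
      \<comment> \<open>The coordinates of \<open>W\<close> along the orbit contribute
        \<open>W'\<close> and the anchor term, the inverse fundamental solution contributes the
        matrix term, and \<open>inv_frame_bracket\<close> recognises the last two as the bracket
        with \<open>X\<close>.\<close>
      have e: "((%s. inv (M s ?y) (?d s)) has_vector_derivative
          inv (M t ?y) (?d' + (\<Sum>b\<in>basis. ?r b *\<^sub>R b) + ?B t ?y (?d t))) (at t)"
        by (rule inv_linear_flow_derivative[OF fdf M(2,3) Mt M(5) bracket_matrix_linear d])
      have "?d' + (\<Sum>b\<in>basis. ?r b *\<^sub>R b) + ?B t ?y (?d t) =
          inv (\<tau> (F t x)) (W' t (F t x) + bracket A (X t) (W t) (F t x))"
        using inv_frame_bracket[OF WS FN(1) \<zeta>F, of t t t] FN(2)[of t]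
          linear_between_add[OF inl Wm(2) sectionD(1)[OF bracket_section[OF X_section WS]], of t t t] by simp
      then have "((%s. \<alpha> (\<tau> x (inv (M s ?y) (?d s)))) has_vector_derivative
          \<alpha> (\<tau> x (inv (M t ?y) (inv (\<tau> (F t x)) (W' t (F t x) + bracket A (X t) (W t) (F t x)))))) (at t)"
        using bounded_linear.has_vector_derivative[OF functional_frame_bounded_linear[OF frame_U NU'[OF x] \<alpha>] e] by simp
      then show ?thesis by (simp add: \<Psi>F[OF x] has_real_derivative_iff_has_vector_derivative)
    qed
  qed
  have "flow_of X F \<Phi> G \<Psi>" unfolding flow_of_def using X_family iso D0 D by blast
  then show ?thesis by blast
qed

section \<open>Automorphisms generated by flows\<close>

lemma smooth_fun_on_Pair:
  "smooth_fun_on \<A> D f ==> smooth_fun_on \<A> D g ==> smooth_fun_on \<A> D (%x. (f x, g x))"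
  by (auto simp: smooth_fun_on_def o_def intro!: smooth_on_Pair)

lemma smooth_map_on_subset: "smooth_map_on \<A> \<B> D F ==> D' \<subseteq> D ==> smooth_map_on \<A> \<B> D' F"
  unfolding smooth_map_on_def by (fastforce intro: continuous_on_subset smooth_fun_on_subset)

lemma smooth_map_on_compose:
  assumes "manifold \<A>" "manifold \<B>" "smooth_map_on \<A> \<B> UNIV F" "smooth_map_on \<B> \<C> UNIV G" "manifold \<C>"
  shows "smooth_map_on \<A> \<C> UNIV (%x. G (F x))" unfolding smooth_map_on_def
proof (intro conjI ballI)
  interpret B: manifold \<B> by fact
  have F: "continuous_on UNIV F" and G: "continuous_on UNIV G" using assms by (auto simp: smooth_map_on_def)
  show "continuous_on UNIV (%x. G (F x))" by (rule continuous_on_compose2[OF G F]) simp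
  fix p assume p: "p \<in> \<C>"
  obtain V d where V: "p = (V, d)" by (cases p)
  show "case p of (V, d) => smooth_fun_on \<A> (UNIV \<inter> (%x. G (F x)) -` V) (d \<circ> (%x. G (F x)))"
  proof -
    have "open V" using manifold.chart_open[OF assms(5)] p V by blast
    then have "open (F -` (G -` V))" using F G by (intro open_vimage) auto
    moreover have "smooth_fun_on \<B> (G -` V) (d \<circ> G)" using assms(4) p V by (auto simp: smooth_map_on_def)
    ultimately show ?thesis
      using smooth_fun_on_compose_map[OF assms(1,2) smooth_map_on_subset[OF assms(3) subset_UNIV],
          of "F -` (G -` V)" "G -` V" "d \<circ> G"] by (simp add: V o_def vimage_def)
  qed
qed

context manifold begin

lemma smooth_map_time_Pair:
  assumes F: "smooth_map_on (line_times \<A>) \<A> UNIV (%(t, x). F t x)"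
  shows "smooth_map_on (line_times \<A>) (line_times \<A>) UNIV (%(t, x). (t, F t x))" unfolding smooth_map_on_def
proof (intro conjI ballI)
  show "continuous_on UNIV (%(t::real, x). (t, F t x))"
    using F unfolding smooth_map_on_def case_prod_unfold by (auto intro!: continuous_intros)
  fix p assume "p \<in> line_times \<A>"
  then obtain V d where V: "(V, d) \<in> \<A>" and p: "p = (UNIV \<times> V, map_prod id d)" by (auto simp: line_times_def)
  let ?D = "(%(t::real, x). (t, F t x)) -` (UNIV \<times> V)"
  have "smooth_fun_on (line_times \<A>) ?D (%(t, x). d (F t x))"
  proof -
    have "(%(t::real, x). F t x) -` V = ?D" by auto
    then show ?thesis using F V by (auto simp: smooth_map_on_def o_def case_prod_unfold)
  qed
  moreover have "smooth_fun_on (line_times \<A>) ?D (%(t, x). t)"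
    using smooth_family_time[OF smooth_on_id[of UNIV], of UNIV] by (auto intro: smooth_fun_on_subset)
  ultimately show "case p of (V, d) => smooth_fun_on (line_times \<A>)
      (UNIV \<inter> (%(t, x). (t, F t x)) -` V) (d \<circ> (%(t, x). (t, F t x)))"
    using smooth_fun_on_Pair by (fastforce simp: p o_def case_prod_unfold)
qed

lemma smooth_map_fixed_time: "smooth_map_on \<A> (line_times \<A>) UNIV (%x. (t, x))" unfolding smooth_map_on_def
proof (intro conjI ballI)
  show "continuous_on UNIV (%x::'m. (t, x))" by (intro continuous_intros)
  fix p assume "p \<in> line_times \<A>"
  then obtain V d where V: "(V, d) \<in> \<A>" and p: "p = (UNIV \<times> V, map_prod id d)" by (auto simp: line_times_def)
  show "case p of (V, d) => smooth_fun_on \<A> (UNIV \<inter> (%x. (t, x)) -` V) (d \<circ> (%x. (t, x)))"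
    using smooth_fun_on_Pair[OF smooth_fun_on_const chart_smooth[OF V], of t] by (simp add: p o_def vimage_def)
qed

lemma smooth_fun_on_fixed_time:
  assumes "smooth_fun_on (line_times \<A>) D (%(t, x). h t x)" "open D"
  shows "smooth_fun_on \<A> {x. (t, x) \<in> D} (h t)"
proof -
  have "open {x. (t, x) \<in> D}"
    using open_vimage[OF assms(2), of "%x. (t, x)"] by (simp add: vimage_def continuous_on_Pair continuous_on_const)
  from smooth_fun_on_compose_map[OF manifold_axioms manifold_line
      smooth_map_on_subset[OF smooth_map_fixed_time subset_UNIV] this assms(1)]
  show ?thesis by simp
qed

lemma smooth_family_compose:
  assumes "smooth_map_on (line_times \<A>) \<A> UNIV (%(t, x). F t x)" "smooth_family \<A> h"
  shows "smooth_family \<A> (%t x. h t (F t x))"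
  using smooth_fun_on_compose_map[OF manifold_line manifold_line smooth_map_time_Pair[OF assms(1)] open_UNIV assms(2)]
  by (simp add: case_prod_unfold)

end

context lie_calculus begin

abbreviation push :: "('m => 'm) => ('m => 'v => 'v) => ('m => 'v) => 'm => 'v" where
  "push G \<Phi> Y \<equiv> %x. \<Phi> (G x) (Y (G x))"

lemma isotopyD:
  assumes "isotopy F \<Phi> G \<Psi>"
  shows "smooth_matrix F \<Phi>" "smooth_matrix G \<Psi>" "F t (G t x) = x" "G t (F t x) = x"
    "a \<in> fibre A x ==> \<Psi> t (F t x) (\<Phi> t x a) = a" "a \<in> fibre A x ==> \<Phi> t (G t x) (\<Psi> t x a) = a"
    "F 0 x = x" "a \<in> fibre A x ==> \<Phi> 0 x a = a" using assms unfolding isotopy_def by blast+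

lemma smooth_matrixD:
  assumes "smooth_matrix F \<Phi>"
  shows "smooth_map_on line (base A) UNIV (%(t, x). F t x)"
    "linear_between (fibre A x) (fibre A (F t x)) (\<Phi> t x)"
    "smooth_family (base A) (%t x. \<theta> k (F t x) (\<Phi> t x (E l x)))"
    "a \<in> fibre A x ==> \<Phi> t x a \<in> fibre A (F t x)"
  using assms unfolding smooth_matrix_def linear_between_def by blast+

lemma linear_expand_fibre_between:
  assumes "linear_between (fibre A x) T \<alpha>" "a \<in> fibre A x"
  shows "\<alpha> a = (\<Sum>k\<in>K. \<theta> k x a *\<^sub>R \<alpha> (E k x))"
proof -
  have "linear_between (fibre A x) UNIV \<alpha>" using assms(1) unfolding linear_between_def by blast
  then show ?thesis by (rule linear_expand_fibre[OF _ assms(2)])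
qed

lemma section_through:
  assumes "a \<in> fibre A x" obtains Y where "Y \<in> \<Gamma>" "Y x = a"
proof
  show "(%y. \<Sum>k\<in>K. \<theta> k x a *\<^sub>R E k y) \<in> \<Gamma>" by (intro section_sum section_scale CF_const E)
qed (use expand[OF assms] in simp)

lemma fibre_eqI:
  assumes "a \<in> fibre A x" "b \<in> fibre A x"
    "!!\<alpha> :: 'v => real. linear_between (fibre A x) UNIV \<alpha> ==> \<alpha> a = \<alpha> b"
  shows "a = b"
proof -
  have "a = (\<Sum>k\<in>K. \<theta> k x a *\<^sub>R E k x)" by (rule expand[OF assms(1)])
  also have "\<dots> = (\<Sum>k\<in>K. \<theta> k x b *\<^sub>R E k x)" by (simp add: assms(3)[OF \<theta>_linear])
  also have "\<dots> = b" by (rule expand[OF assms(2), symmetric])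
  finally show ?thesis .
qed

text \<open>The coefficients in the generators are ordinary functions of time, and the generators
  themselves do not depend on time.\<close>

lemma section_derivative_exists:
  assumes W: "section_family W" obtains W' where "section_derivative W W'"
proof
  let ?w' = "%k t x. deriv (%s. \<theta> k x (W s x)) t"
  note d = smooth_family_has_derivative(1,2)[OF \<theta>_family[OF W]]
  show "section_derivative W (%t x. \<Sum>k\<in>K. ?w' k t x *\<^sub>R E k x)"
  proof (rule section_derivativeI[OF W])
    show "section_family (%t x. \<Sum>k\<in>K. ?w' k t x *\<^sub>R E k x)"
      by (intro section_family_sum section_family_scale section_family_static E d(2))
    fix l t x
    have "((%s. \<Sum>k\<in>K. \<theta> k x (W s x) * \<theta> l x (E k x)) has_real_derivative
        (\<Sum>k\<in>K. ?w' k t x * \<theta> l x (E k x))) (at t)" by (intro DERIV_sum DERIV_cmult_right d(1))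
    then show "((%s. \<theta> l x (W s x)) has_real_derivative \<theta> l x (\<Sum>k\<in>K. ?w' k t x *\<^sub>R E k x)) (at t)"
      by (simp add: linear_expand_fibre_real[OF \<theta>_linear section_family_mem[OF W], symmetric]
          linear_between_sum[OF \<theta>_linear subspace_fibre sectionD(1)[OF E]])
  qed
qed

text \<open>The coefficients of the pushed section are those of \<open>Y\<close> multiplied by the
  matrix of \<open>\<Phi>\<close> in the generators, composed with the inverse base map.\<close>

lemma push_family:
  assumes F: "smooth_matrix F \<Phi>" and G: "smooth_map_on line (base A) UNIV (%(t, x). G t x)"
    and FG: "!!t x. F t (G t x) = x" and Y: "Y \<in> \<Gamma>"
  shows "section_family (%t. push (G t) (\<Phi> t) Y)"
proof -
  have m: "push (G t) (\<Phi> t) Y x \<in> fibre A x" for t x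
    using smooth_matrixD(4)[OF F sectionD(1)[OF Y], of t "G t x"] FG by simp
  have "smooth_family (base A) (%t x. \<theta> k x (push (G t) (\<Phi> t) Y x))" for k
  proof -
    have "smooth_family (base A) (%t x. \<theta> l x (Y x))" for l
      using \<theta>_family[OF section_family_static[OF Y]] by simp
    then have "smooth_family (base A) (%t x. \<Sum>l\<in>K. \<theta> l x (Y x) * \<theta> k (F t x) (\<Phi> t x (E l x)))"
      by (intro family_ops smooth_matrixD(3)[OF F])
    from smooth_family_compose[OF G this] show ?thesis
    proof (rule back_subst[of "smooth_family (base A)"], intro ext)
      fix t x
      let ?x = "G t x"
      have "\<Phi> t ?x (Y ?x) = (\<Sum>l\<in>K. \<theta> l ?x (Y ?x) *\<^sub>R \<Phi> t ?x (E l ?x))"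
        by (rule linear_expand_fibre_between[OF smooth_matrixD(2)[OF F] sectionD(1)[OF Y]])
      moreover have "\<theta> k x (\<Sum>l\<in>K. \<theta> l ?x (Y ?x) *\<^sub>R \<Phi> t ?x (E l ?x)) =
          (\<Sum>l\<in>K. \<theta> l ?x (Y ?x) *\<^sub>R \<theta> k x (\<Phi> t ?x (E l ?x)))"
        by (rule linear_between_sum[OF \<theta>_linear subspace_fibre])
          (use smooth_matrixD(4)[OF F sectionD(1)[OF E], of t ?x] FG in simp)
      ultimately show "(\<Sum>l\<in>K. \<theta> l ?x (Y ?x) * \<theta> k (F t ?x) (\<Phi> t ?x (E l ?x))) = \<theta> k x (push (G t) (\<Phi> t) Y x)"
        by (simp add: FG)
    qed
  qed
  then have "section_family (%t x. \<Sum>k\<in>K. \<theta> k x (push (G t) (\<Phi> t) Y x) *\<^sub>R E k x)"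
    by (intro section_family_sum section_family_scale section_family_static E)
  then show ?thesis using expand[OF m] by simp
qed

end

context lie_calculus begin

section \<open>Transport equations along a flow\<close>

lemma flow_ofD:
  assumes "flow_of X F \<Phi> G \<Psi>"
  shows "section_family X" "isotopy F \<Phi> G \<Psi>"
    "smooth_family (base A) h ==> (!!t x. ((%s. h s x) has_real_derivative h' t x) (at t)) ==>
      ((%s. h s (F s x)) has_real_derivative h' t (F t x) + \<rho> (F t x) (X t (F t x)) (h t)) (at t)"
    "section_derivative W W' ==> linear_between (fibre A x) UNIV \<alpha> ==>
      ((%s. \<alpha> (\<Psi> s (F s x) (W s (F s x)))) has_real_derivative
        \<alpha> (\<Psi> t (F t x) (W' t (F t x) + bracket A (X t) (W t) (F t x)))) (at t)"
  using assms unfolding flow_of_def by blast+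

lemma fibre_isomorphism:
  assumes iso: "isotopy F \<Phi> G \<Psi>" and a: "a \<in> fibre A (F t x)"
  shows "\<Psi> t (F t x) a \<in> fibre A x" "\<Phi> t x (\<Psi> t (F t x) a) = a"
  using smooth_matrixD(4)[OF isotopyD(2)[OF iso] a, of t] isotopyD(6)[OF iso a, of t] by (simp_all add: isotopyD(4)[OF iso])

lemma fibre_isomorphism_zero: "isotopy F \<Phi> G \<Psi> ==> \<Phi> t x 0 = 0"
  using linear_between_0[OF smooth_matrixD(2)[OF isotopyD(1)] fibre_0] by blast

context
  fixes X :: "real => 'm => 'v" and F \<Phi> G \<Psi>
  assumes flow: "flow_of X F \<Phi> G \<Psi>"
begin

lemmas flow_iso = flow_ofD(2)[OF flow]

text \<open>The equation says precisely that \<open>h\<close> has derivative zero along each orbit.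
  It is the uniqueness principle for the defect of the anchor and for the invariance of
  forms.\<close>

lemma flow_transport_function:
  assumes h: "smooth_family (base A) h"
    and d: "!!t x. ((%s. h s x) has_real_derivative - \<rho> x (X t x) (h t)) (at t)"
  shows "h t (F t x) = h 0 x"
proof -
  have "\<forall>t. ((%s. h s (F s x)) has_real_derivative 0) (at t)" using flow_ofD(3)[OF flow h d, of x] by simp
  then have "h t (F t x) = h 0 (F 0 x)" by (rule DERIV_isconst_all)
  then show ?thesis by (simp add: isotopyD(7)[OF flow_iso])
qed

text \<open>Pulled back along the flow, the section has weak derivative zero and so keeps its
  initial value; functionals separate the points of a fibre.\<close>

lemma flow_transport_section:
  assumes D: "section_derivative D (%t x. - bracket A (X t) (D t) x)" and 0: "!!x. D 0 x = 0"
  shows "D t x = 0"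
proof -
  let ?x = "G t x"
  note Dm = section_family_mem[OF section_derivativeD(1)[OF D]]
  have "\<Psi> t (F t ?x) (D t (F t ?x)) = 0"
  proof (rule fibre_eqI)
    fix \<alpha> :: "'v => real" assume \<alpha>: "linear_between (fibre A ?x) UNIV \<alpha>"
    have "\<Psi> s (F s ?x) 0 = 0" for s
      using linear_between_0[OF smooth_matrixD(2)[OF isotopyD(2)[OF flow_iso]] fibre_0] .
    then have "\<forall>s. ((%s. \<alpha> (\<Psi> s (F s ?x) (D s (F s ?x)))) has_real_derivative 0) (at s)"
      and z: "\<alpha> (\<Psi> 0 (F 0 ?x) (D 0 (F 0 ?x))) = 0"
      using flow_ofD(4)[OF flow D \<alpha>] linear_between_0[OF \<alpha> fibre_0] 0 by simp_all
    from DERIV_isconst_all[OF this(1), of t 0] z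
    show "\<alpha> (\<Psi> t (F t ?x) (D t (F t ?x))) = \<alpha> 0" using linear_between_0[OF \<alpha> fibre_0] by simp
  qed (use fibre_isomorphism(1)[OF flow_iso Dm] fibre_0 in auto)
  then have "\<Phi> t ?x 0 = D t x" using fibre_isomorphism(2)[OF flow_iso Dm, of t ?x t] isotopyD(3)[OF flow_iso] by simp
  then show ?thesis by (simp add: fibre_isomorphism_zero[OF flow_iso])
qed

text \<open>The inverse flow is not differentiated directly: \<open>f (G s (F s y))\<close> does not
  depend on \<open>s\<close>, and the derivative along the flow of the family
  \<open>f (G s x)\<close> then determines its time derivative.\<close>

lemma flow_push_function:
  assumes f: "f \<in> CF"
  shows "smooth_family (base A) (%t x. f (G t x))"
    and "((%s. f (G s x)) has_real_derivative - \<rho> x (X t x) (%y. f (G t y))) (at t)"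
proof -
  have "smooth_family (base A) (%t. f)" using smooth_family_static[of UNIV f UNIV] f by simp
  then show s: "smooth_family (base A) (%t x. f (G t x))"
    by (rule smooth_family_compose[OF smooth_matrixD(1)[OF isotopyD(2)[OF flow_iso]]])
  let ?h' = "%t x. deriv (%s. f (G s x)) t"
  note d = smooth_family_has_derivative(1)[OF s]
  have "((%s. f (G s (F s (G t x)))) has_real_derivative
      ?h' t (F t (G t x)) + \<rho> (F t (G t x)) (X t (F t (G t x))) (%y. f (G t y))) (at t)"
    by (rule flow_ofD(3)[OF flow s d])
  then have "?h' t x + \<rho> x (X t x) (%y. f (G t y)) = 0"
    using DERIV_unique[OF _ DERIV_const] by (simp add: isotopyD(3,4)[OF flow_iso])
  then have "?h' t x = - \<rho> x (X t x) (%y. f (G t y))" by simp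
  then show "((%s. f (G s x)) has_real_derivative - \<rho> x (X t x) (%y. f (G t y))) (at t)"
    using d[of x t] by simp
qed

text \<open>Pulling the pushed section back gives the constant \<open>Y\<close>, so its time
  derivative and its bracket with \<open>X\<close> must cancel.\<close>

lemma flow_push_section:
  assumes Y: "Y \<in> \<Gamma>"
  shows "section_derivative (%t. push (G t) (\<Phi> t) Y) (%t x. - bracket A (X t) (push (G t) (\<Phi> t) Y) x)"
proof -
  let ?Y = "%t. push (G t) (\<Phi> t) Y"
  have Yf: "section_family ?Y"
    by (rule push_family[OF isotopyD(1)[OF flow_iso] smooth_matrixD(1)[OF isotopyD(2)[OF flow_iso]] isotopyD(3)[OF flow_iso] Y])
  obtain Y' where Y': "section_derivative ?Y Y'" by (rule section_derivative_exists[OF Yf])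
  have br: "bracket A (X t) (?Y t) x \<in> fibre A x" for t x
    by (intro sectionD(1) bracket_section section_family_section flow_ofD(1)[OF flow] Yf)
  note Y'm = section_family_mem[OF section_derivativeD(2)[OF Y']]
  have "Y' t x = - bracket A (X t) (?Y t) x" for t x
  proof -
    let ?x = "G t x" and ?r = "%x. Y' t x + bracket A (X t) (?Y t) x"
    have r: "?r y \<in> fibre A y" for y by (intro fibre_add Y'm br)
    have "\<Psi> t (F t ?x) (?r (F t ?x)) = 0"
    proof (rule fibre_eqI)
      fix \<alpha> :: "'v => real" assume \<alpha>: "linear_between (fibre A ?x) UNIV \<alpha>"
      have "((%s. \<alpha> (\<Psi> s (F s ?x) (?Y s (F s ?x)))) has_real_derivative \<alpha> (\<Psi> t (F t ?x) (?r (F t ?x)))) (at t)"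
        by (rule flow_ofD(4)[OF flow Y' \<alpha>])
      moreover have "\<Psi> s (F s ?x) (?Y s (F s ?x)) = Y ?x" for s
        using isotopyD(5)[OF flow_iso sectionD(1)[OF Y], of s ?x] isotopyD(4)[OF flow_iso] by simp
      ultimately show "\<alpha> (\<Psi> t (F t ?x) (?r (F t ?x))) = \<alpha> 0"
        using DERIV_unique[OF _ DERIV_const] linear_between_0[OF \<alpha> fibre_0] by simp
    qed (use fibre_isomorphism(1)[OF flow_iso r] fibre_0 in auto)
    then have "\<Phi> t ?x 0 = ?r x"
      using fibre_isomorphism(2)[OF flow_iso r, of t ?x] isotopyD(3)[OF flow_iso] by simp
    then show ?thesis by (simp add: fibre_isomorphism_zero[OF flow_iso] eq_neg_iff_add_eq_0)
  qed
  then have "Y' = (%t x. - bracket A (X t) (?Y t) x)" by (intro ext)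
  then show ?thesis using Y' by simp
qed

text \<open>The defect of compatibility with the anchor satisfies the homogeneous transport
  equation, where \<open>anchor_bracket\<close> supplies the commutator of \<open>X\<close> with the
  pushed section; the defect vanishes at time 0.\<close>

lemma flow_anchor_push:
  assumes Y: "Y \<in> \<Gamma>" and f: "f \<in> CF"
  shows "\<rho> x (push (G t) (\<Phi> t) Y x) (%y. f (G t y)) = \<rho> (G t x) (Y (G t x)) f"
proof -
  let ?Y = "%t. push (G t) (\<Phi> t) Y" and ?f = "%t y. f (G t y)" and ?g = "%y. \<rho> y (Y y) f"
  let ?h = "%t x. \<rho> x (?Y t x) (?f t) - ?g (G t x)"
  have g: "?g \<in> CF" by (rule anchor_CF[OF Y f])
  note XS = section_family_section[OF flow_ofD(1)[OF flow]]
  note Yd = flow_push_section[OF Y]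
  note YS = section_family_section[OF section_derivativeD(1)[OF Yd]]
  have fCF: "?f t \<in> CF" "(%y. ?g (G t y)) \<in> CF" for t
    using smooth_family_imp_smooth_fun[OF flow_push_function(1)] f g by blast+
  have hf: "smooth_family (base A) ?h"
    using smooth_fun_on_diff[OF anchor_family[OF section_derivativeD(1)[OF Yd] flow_push_function(1)[OF f]] flow_push_function(1)[OF g]]
    by (simp add: case_prod_unfold)
  have d: "((%s. ?h s x) has_real_derivative - \<rho> x (X t x) (?h t)) (at t)" for t x
  proof -
    note T = anchor_tangent[OF section_family_mem[OF flow_ofD(1)[OF flow]], of x t]
      anchor_tangent[OF sectionD(1)[OF YS], of x t]
    have Xf: "(%y. \<rho> y (X t y) (?f t)) \<in> CF" by (rule anchor_CF[OF XS fCF(1)])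
    have 1: "\<rho> x (- bracket A (X t) (?Y t) x) (?f t) = - \<rho> x (bracket A (X t) (?Y t) x) (?f t)"
      by (rule linear_between_minus[OF anchor_linear[OF fCF(1)] sectionD(1)[OF bracket_section[OF XS YS]]])
    have 2: "\<rho> x (?Y t x) (%y. - \<rho> y (X t y) (?f t)) = - \<rho> x (?Y t x) (%y. \<rho> y (X t y) (?f t))"
      using tangent_scale[OF T(2) Xf, of "-1"] by simp
    have 3: "\<rho> x (X t x) (?h t) = \<rho> x (X t x) (%x. \<rho> x (?Y t x) (?f t)) - \<rho> x (X t x) (%y. ?g (G t y))"
      by (rule tangent_diff[OF T(1) anchor_CF[OF YS fCF(1)] fCF(2)])
    show ?thesis
      by (rule DERIV_cong[OF DERIV_diff[OF anchor_family_derivative(1)[OF Yd flow_push_function[OF f]] flow_push_function(2)[OF g]]])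
        (unfold 1 2 3, simp add: anchor_bracket[OF XS YS fCF(1)])
  qed
  have "?h t (F t (G t x)) = ?h 0 (G t x)" by (rule flow_transport_function[OF hf d])
  moreover have "G 0 y = y" for y using isotopyD(4,7)[OF flow_iso] by metis
  ultimately show ?thesis using isotopyD(3)[OF flow_iso] isotopyD(8)[OF flow_iso sectionD(1)[OF Y]] by simp
qed

text \<open>By the Jacobi identity the bracket with \<open>X\<close> acts as a derivation, so the
  difference between the bracket of the pushed sections and the pushed bracket satisfies the
  homogeneous transport equation; it is zero initially.\<close>

lemma flow_bracket_push:
  assumes Y: "Y \<in> \<Gamma>" and Z: "Z \<in> \<Gamma>"
  shows "bracket A (push (G t) (\<Phi> t) Y) (push (G t) (\<Phi> t) Z) x = push (G t) (\<Phi> t) (bracket A Y Z) x"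
proof -
  let ?P = "%Y t. push (G t) (\<Phi> t) Y"
  let ?D = "%t x. bracket A (?P Y t) (?P Z t) x - ?P (bracket A Y Z) t x"
  note YZ = bracket_section[OF Y Z]
  note XS = section_family_section[OF flow_ofD(1)[OF flow]]
  note d = flow_push_section[OF Y] flow_push_section[OF Z] flow_push_section[OF YZ]
  note S = section_family_section[OF section_derivativeD(1)[OF d(1)]] section_family_section[OF section_derivativeD(1)[OF d(2)]]
    section_family_section[OF section_derivativeD(1)[OF d(3)]]
  note bd = bracket_family_derivative[OF d(1,2)]
  have m: "bracket A (?P Y t) (?P Z t) \<in> \<Gamma>" for t by (rule bracket_section[OF S(1,2)])
  have Df: "section_family ?D" using section_family_add[OF section_derivativeD(1)[OF bd]
        section_family_scale[OF smooth_family_time[OF smooth_on_const[of UNIV "-1"], of UNIV, simplified] section_derivativeD(1)[OF d(3)]]]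
    by simp
  have D'f: "section_family (%t x. - bracket A (X t) (?D t) x)"
    using section_family_scale[OF smooth_family_time[OF smooth_on_const[of UNIV "-1"], of UNIV, simplified]
        bracket_family[OF flow_ofD(1)[OF flow] Df]] by simp
  have key: "bracket A (%x. - bracket A (X t) (?P Y t) x) (?P Z t) x + bracket A (?P Y t) (%x. - bracket A (X t) (?P Z t) x) x =
      - bracket A (X t) (bracket A (?P Y t) (?P Z t)) x" for t x
  proof -
    have "bracket A (%x. - bracket A (X t) (?P Y t) x) (?P Z t) x = - bracket A (bracket A (X t) (?P Y t)) (?P Z t) x"
      using bracket_linear[OF bracket_section[OF XS S(1)] bracket_section[OF XS S(1)] S(2), where r = "-1" and s = 0] by simp
    moreover have "bracket A (?P Y t) (%x. - bracket A (X t) (?P Z t) x) x = - bracket A (?P Y t) (bracket A (X t) (?P Z t)) x"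
      using bracket_diff_right[OF S(1) section_zero bracket_section[OF XS S(2)], where x = x] bracket_zero_right[OF S(1)] by simp
    ultimately show ?thesis by (simp add: bracket_jacobi'[OF XS S(1,2)])
  qed
  have "section_derivative ?D (%t x. - bracket A (X t) (?D t) x)"
  proof (rule section_derivativeI[OF Df D'f])
    fix k t x
    have diff: "\<theta> k x (a - b) = \<theta> k x a - \<theta> k x b" if "a \<in> fibre A x" "b \<in> fibre A x" for a b
      using linear_between_add[OF \<theta>_linear that(1) fibre_neg[OF that(2)]] linear_between_minus[OF \<theta>_linear that(2)] by simp
    have "((%s. \<theta> k x (bracket A (?P Y s) (?P Z s) x) - \<theta> k x (?P (bracket A Y Z) s x)) has_real_derivative
        \<theta> k x (- bracket A (X t) (bracket A (?P Y t) (?P Z t)) x) - \<theta> k x (- bracket A (X t) (?P (bracket A Y Z) t) x)) (at t)"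
      using DERIV_diff[OF section_derivativeD(3)[OF bd \<theta>_linear[where k = k and x = x]]
          section_derivativeD(3)[OF d(3) \<theta>_linear[where k = k and x = x]], of t] by (simp only: key)
    moreover have "bracket A (X t) (?D t) x = bracket A (X t) (bracket A (?P Y t) (?P Z t)) x - bracket A (X t) (?P (bracket A Y Z) t) x"
      by (rule bracket_diff_right[OF XS m S(3)])
    ultimately show "((%s. \<theta> k x (?D s x)) has_real_derivative \<theta> k x (- bracket A (X t) (?D t) x)) (at t)"
      using diff[OF sectionD(1)[OF m] sectionD(1)[OF S(3)]]
        diff[OF fibre_neg[OF sectionD(1)[OF bracket_section[OF XS m]]] fibre_neg[OF sectionD(1)[OF bracket_section[OF XS S(3)]]]]
      by simp
  qed
  moreover have G0: "G 0 y = y" for y using isotopyD(4,7)[OF flow_iso] by metis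
  have P0: "?P W 0 x = W x" if "W \<in> \<Gamma>" for W x using isotopyD(8)[OF flow_iso sectionD(1)[OF that]] G0 by auto
  have "?P Y 0 = Y" "?P Z 0 = Z" using P0 Y Z by auto
  then have "?D 0 x = 0" for x by (simp only: P0[OF YZ]) simp
  ultimately have "?D t x = 0" by (rule flow_transport_section)
  then show ?thesis by simp
qed

end

end

context lie_calculus begin

section \<open>Isotopies through Lie algebroid automorphisms\<close>

definition algebroid_isotopy :: "(real => 'm => 'm) => (real => 'm => 'v => 'v) =>
    (real => 'm => 'm) => (real => 'm => 'v => 'v) => bool" where
  "algebroid_isotopy F \<Phi> G \<Psi> \<longleftrightarrow> isotopy F \<Phi> G \<Psi> \<and>
    (\<forall>t x. \<forall>a\<in>fibre A x. \<forall>f\<in>CF. \<rho> (F t x) (\<Phi> t x a) f = \<rho> x a (%y. f (F t y))) \<and>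
    (\<forall>t. \<forall>Y\<in>\<Gamma>. \<forall>Z\<in>\<Gamma>. bracket A (push (G t) (\<Phi> t) Y) (push (G t) (\<Phi> t) Z) = push (G t) (\<Phi> t) (bracket A Y Z))"

lemma algebroid_isotopyD:
  assumes "algebroid_isotopy F \<Phi> G \<Psi>"
  shows "isotopy F \<Phi> G \<Psi>" "a \<in> fibre A x ==> f \<in> CF ==> \<rho> (F t x) (\<Phi> t x a) f = \<rho> x a (%y. f (F t y))"
    "Y \<in> \<Gamma> ==> Z \<in> \<Gamma> ==> bracket A (push (G t) (\<Phi> t) Y) (push (G t) (\<Phi> t) Z) = push (G t) (\<Phi> t) (bracket A Y Z)"
  using assms unfolding algebroid_isotopy_def by blast+

lemma isotopy_function_CF:
  assumes "smooth_matrix F \<Phi>" "f \<in> CF" shows "(%y. f (F t y)) \<in> CF"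
proof -
  have "smooth_family (base A) (%t. f)" using smooth_family_static[of UNIV f UNIV] assms(2) by simp
  from smooth_family_compose[OF smooth_matrixD(1)[OF assms(1)] this]
  show ?thesis using smooth_family_imp_smooth_fun by blast
qed

text \<open>For the anchor, a section is drawn through the given vector and
  \<open>flow_anchor_push\<close> is applied at the image point to the function \<open>f\<close>
  composed with \<open>F t\<close>.\<close>

lemma flow_algebroid_isotopy:
  assumes flow: "flow_of X F \<Phi> G \<Psi>" shows "algebroid_isotopy F \<Phi> G \<Psi>" unfolding algebroid_isotopy_def
proof (intro conjI allI ballI)
  show iso: "isotopy F \<Phi> G \<Psi>" by (rule flow_iso[OF flow])
  show "bracket A (push (G t) (\<Phi> t) Y) (push (G t) (\<Phi> t) Z) = push (G t) (\<Phi> t) (bracket A Y Z)"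
    if "Y \<in> \<Gamma>" "Z \<in> \<Gamma>" for t Y Z by (rule ext) (rule flow_bracket_push[OF flow that])
  fix t x a f assume a: "a \<in> fibre A x" and f: "f \<in> CF"
  obtain Y where Y: "Y \<in> \<Gamma>" "Y x = a" by (rule section_through[OF a])
  show "\<rho> (F t x) (\<Phi> t x a) f = \<rho> x a (%y. f (F t y))"
    using flow_anchor_push[OF flow Y(1) isotopy_function_CF[OF isotopyD(1)[OF iso] f, of t], of "F t x" t]
    by (simp add: isotopyD(3,4)[OF iso] Y(2))
qed

lemma smooth_matrix_id: "smooth_matrix (%t x. x) (%t x a. a)" unfolding smooth_matrix_def
proof (intro conjI allI)
  show "smooth_map_on line (base A) UNIV (%(t::real, x). x)" unfolding smooth_map_on_def
  proof (intro conjI ballI)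
    show "continuous_on UNIV (%(t::real, x::'m). x)" unfolding case_prod_unfold by (intro continuous_intros)
    fix p assume "p \<in> base A"
    then obtain V d where V: "(V, d) \<in> base A" "p = (V, d)" by (cases p) auto
    have "smooth_fun_on line (UNIV \<times> V) (%(t::real, x). d x)" by (rule smooth_family_static[OF chart_smooth[OF V(1)]])
    moreover have "(%(t::real, x). x) -` V = UNIV \<times> V" by auto
    ultimately show "case p of (V, d) => smooth_fun_on line (UNIV \<inter> (%(t::real, x). x) -` V) (d \<circ> (%(t, x). x))"
      by (simp add: V(2) o_def case_prod_unfold)
  qed
  show "smooth_family (base A) (%t x. \<theta> k x (E l x))" for k l by (rule \<theta>_family[OF section_family_static[OF E]])
qed (auto simp: linear_between_def)

lemma smooth_matrix_compose:
  assumes 1: "smooth_matrix F1 \<Phi>1" and 2: "smooth_matrix F2 \<Phi>2"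
  shows "smooth_matrix (%t x. F2 t (F1 t x)) (%t x a. \<Phi>2 t (F1 t x) (\<Phi>1 t x a))" unfolding smooth_matrix_def
proof (intro conjI allI)
  note m1 = smooth_matrixD(1)[OF 1]
  show "smooth_map_on line (base A) UNIV (%(t, x). F2 t (F1 t x))"
    using smooth_map_on_compose[OF manifold_line manifold_line smooth_map_time_Pair[OF m1] smooth_matrixD(1)[OF 2] manifold_axioms]
    by (simp add: case_prod_unfold)
  show "linear_between (fibre A x) (fibre A (F2 t (F1 t x))) (%a. \<Phi>2 t (F1 t x) (\<Phi>1 t x a))" for t x
    using smooth_matrixD(2)[OF 1, of x t] smooth_matrixD(2)[OF 2, of "F1 t x" t]
    unfolding linear_between_def image_subset_iff by auto
  fix k l
  have "smooth_family (base A) (%t x. \<Sum>j\<in>K. \<theta> j (F1 t x) (\<Phi>1 t x (E l x)) *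
      \<theta> k (F2 t (F1 t x)) (\<Phi>2 t (F1 t x) (E j (F1 t x))))"
    by (intro family_ops smooth_matrixD(3)[OF 1] smooth_family_compose[OF m1 smooth_matrixD(3)[OF 2]])
  then show "smooth_family (base A) (%t x. \<theta> k (F2 t (F1 t x)) (\<Phi>2 t (F1 t x) (\<Phi>1 t x (E l x))))"
  proof (rule back_subst[of "smooth_family (base A)"], intro ext)
    fix t x
    let ?a = "\<Phi>1 t x (E l x)" and ?y = "F1 t x"
    have a: "?a \<in> fibre A ?y" by (rule smooth_matrixD(4)[OF 1 sectionD(1)[OF E]])
    have "\<Phi>2 t ?y ?a = (\<Sum>j\<in>K. \<theta> j ?y ?a *\<^sub>R \<Phi>2 t ?y (E j ?y))"
      by (rule linear_expand_fibre_between[OF smooth_matrixD(2)[OF 2] a])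
    moreover have "\<theta> k (F2 t ?y) (\<Sum>j\<in>K. \<theta> j ?y ?a *\<^sub>R \<Phi>2 t ?y (E j ?y)) =
        (\<Sum>j\<in>K. \<theta> j ?y ?a *\<^sub>R \<theta> k (F2 t ?y) (\<Phi>2 t ?y (E j ?y)))"
      by (rule linear_between_sum[OF \<theta>_linear subspace_fibre smooth_matrixD(4)[OF 2 sectionD(1)[OF E]]])
    ultimately show "(\<Sum>j\<in>K. \<theta> j ?y ?a * \<theta> k (F2 t ?y) (\<Phi>2 t ?y (E j ?y))) = \<theta> k (F2 t ?y) (\<Phi>2 t ?y ?a)"
      by simp
  qed
qed

lemma algebroid_isotopy_id: "algebroid_isotopy (%t x. x) (%t x a. a) (%t x. x) (%t x a. a)"
  by (simp add: algebroid_isotopy_def isotopy_def smooth_matrix_id)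

lemma algebroid_isotopy_compose:
  assumes 1: "algebroid_isotopy F1 \<Phi>1 G1 \<Psi>1" and 2: "algebroid_isotopy F2 \<Phi>2 G2 \<Psi>2"
  shows "algebroid_isotopy (%t x. F2 t (F1 t x)) (%t x a. \<Phi>2 t (F1 t x) (\<Phi>1 t x a))
    (%t x. G1 t (G2 t x)) (%t x a. \<Psi>1 t (G2 t x) (\<Psi>2 t x a))" unfolding algebroid_isotopy_def
proof (intro conjI allI ballI)
  note i1 = algebroid_isotopyD(1)[OF 1] and i2 = algebroid_isotopyD(1)[OF 2]
  note m1 = isotopyD(1,2)[OF i1] and m2 = isotopyD(1,2)[OF i2]
  note mem = smooth_matrixD(4)[OF m1(1)] smooth_matrixD(4)[OF m2(2)]
  show "isotopy (%t x. F2 t (F1 t x)) (%t x a. \<Phi>2 t (F1 t x) (\<Phi>1 t x a))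
      (%t x. G1 t (G2 t x)) (%t x a. \<Psi>1 t (G2 t x) (\<Psi>2 t x a))" unfolding isotopy_def
    using smooth_matrix_compose[OF m1(1) m2(1)] smooth_matrix_compose[OF m2(2) m1(2)]
    by (simp add: isotopyD[OF i1] isotopyD[OF i2] mem)
  show "\<rho> (F2 t (F1 t x)) (\<Phi>2 t (F1 t x) (\<Phi>1 t x a)) f = \<rho> x a (%y. f (F2 t (F1 t y)))"
    if "a \<in> fibre A x" "f \<in> CF" for t x a f
    using algebroid_isotopyD(2)[OF 2 mem(1)[OF that(1)] that(2), of t t]
      algebroid_isotopyD(2)[OF 1 that(1) isotopy_function_CF[OF m2(1) that(2)], of t t] by simp
  fix t Y Z assume Y: "Y \<in> \<Gamma>" and Z: "Z \<in> \<Gamma>"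
  let ?P1 = "push (G1 t) (\<Phi>1 t)" and ?P2 = "push (G2 t) (\<Phi>2 t)"
  have P1: "?P1 W \<in> \<Gamma>" if "W \<in> \<Gamma>" for W
    using section_family_section[OF push_family[OF m1(1) smooth_matrixD(1)[OF m1(2)] isotopyD(3)[OF i1] that]] .
  have "bracket A (?P2 (?P1 Y)) (?P2 (?P1 Z)) = ?P2 (bracket A (?P1 Y) (?P1 Z))"
    by (rule algebroid_isotopyD(3)[OF 2 P1[OF Y] P1[OF Z]])
  also have "bracket A (?P1 Y) (?P1 Z) = ?P1 (bracket A Y Z)" by (rule algebroid_isotopyD(3)[OF 1 Y Z])
  finally show "bracket A (push (%x. G1 t (G2 t x)) (%x a. \<Phi>2 t (F1 t x) (\<Phi>1 t x a)) Y)
      (push (%x. G1 t (G2 t x)) (%x a. \<Phi>2 t (F1 t x) (\<Phi>1 t x a)) Z) =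
      push (%x. G1 t (G2 t x)) (%x a. \<Phi>2 t (F1 t x) (\<Phi>1 t x a)) (bracket A Y Z)"
    by (simp add: isotopyD(3)[OF i1])
qed

text \<open>Smoothness is known in the generators, while bundle maps are tested in frames. The frame
  matrix is a product of three: the coefficients of the first frame, the matrix in the generators,
  and the coordinates of the generators in the second frame.\<close>

lemma smooth_matrix_frames:
  assumes m: "smooth_matrix F \<Phi>" and U: "(U, \<tau>) \<in> frames A" and V: "(V, \<sigma>) \<in> frames A"
  shows "open {(t, x). x \<in> U \<and> F t x \<in> V}"
    and "smooth_fun_on line {(t, x). x \<in> U \<and> F t x \<in> V} (%(t, x). inv (\<sigma> (F t x)) (\<Phi> t x (\<tau> x v)))"
proof -
  let ?D = "{(t, x). x \<in> U \<and> F t x \<in> V}"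
  have "continuous_on UNIV (%(t, x). F t x)" using smooth_matrixD(1)[OF m] by (simp add: smooth_map_on_def)
  then have "open (UNIV \<times> U \<inter> (%(t, x). F t x) -` V)"
    using frame_open[OF U] frame_open[OF V] by (intro open_Int open_Times open_vimage) auto
  moreover have "UNIV \<times> U \<inter> (%(t, x). F t x) -` V = ?D" by auto
  ultimately show oD: "open ?D" by simp
  have s1: "smooth_fun_on line ?D (%(t, x). \<theta> l x (\<tau> x v))" for l
    by (rule smooth_fun_on_subset[OF smooth_family_static[OF \<theta>_smooth[OF U]]]) auto
  have s2: "smooth_fun_on line ?D (%(t, x). \<theta> k (F t x) (\<Phi> t x (E l x)))" for k l
    by (rule smooth_fun_on_subset[OF smooth_matrixD(3)[OF m]]) simp
  have s3: "smooth_fun_on line ?D (%(t, x). inv (\<sigma> (F t x)) (E k (F t x)))" for k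
    by (rule family_compose[OF smooth_map_on_subset[OF smooth_matrixD(1)[OF m] subset_UNIV] oD sectionD(2)[OF E V]]) auto
  have "smooth_fun_on line ?D (%(t, x). \<Sum>l\<in>K. \<Sum>k\<in>K. (\<theta> l x (\<tau> x v) * \<theta> k (F t x) (\<Phi> t x (E l x))) *\<^sub>R
      inv (\<sigma> (F t x)) (E k (F t x)))" by (intro family_sum family_scaleR family_mult s1 s2 s3)
  then show "smooth_fun_on line ?D (%(t, x). inv (\<sigma> (F t x)) (\<Phi> t x (\<tau> x v)))"
  proof (rule family_cong)
    fix t x assume "(t, x) \<in> ?D"
    then have x: "x \<in> U" "F t x \<in> V" by auto
    note li = inv_frame_linear[OF V x(2)]
    have "inv (\<sigma> (F t x)) (\<Phi> t x (\<tau> x v)) = inv (\<sigma> (F t x)) (\<Sum>l\<in>K. \<theta> l x (\<tau> x v) *\<^sub>R \<Phi> t x (E l x))"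
      by (subst linear_expand_fibre_between[OF smooth_matrixD(2)[OF m] frame_mem[OF U x(1)]]) (rule refl)
    also have "\<dots> = (\<Sum>l\<in>K. \<theta> l x (\<tau> x v) *\<^sub>R inv (\<sigma> (F t x)) (\<Phi> t x (E l x)))"
      by (rule linear_between_sum[OF li subspace_fibre smooth_matrixD(4)[OF m sectionD(1)[OF E]]])
    also have "\<dots> = (\<Sum>l\<in>K. \<Sum>k\<in>K. (\<theta> l x (\<tau> x v) * \<theta> k (F t x) (\<Phi> t x (E l x))) *\<^sub>R
        inv (\<sigma> (F t x)) (E k (F t x)))"
      by (subst linear_expand_fibre[OF li smooth_matrixD(4)[OF m sectionD(1)[OF E]]]) (simp add: scaleR_sum_right)
    finally show "(\<Sum>l\<in>K. \<Sum>k\<in>K. (\<theta> l x (\<tau> x v) * \<theta> k (F t x) (\<Phi> t x (E l x))) *\<^sub>R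
        inv (\<sigma> (F t x)) (E k (F t x))) = inv (\<sigma> (F t x)) (\<Phi> t x (\<tau> x v))" by simp
  qed
qed

text \<open>Agreement is asked on fibres only, because the inverse in
  \<open>bundle_automorphism\<close> is an \<open>inv_into\<close>, which is determined there and
  arbitrary elsewhere.\<close>

lemma bundle_map_cong:
  assumes "smooth_matrix F \<Phi>" and \<Phi>': "!!x a. a \<in> fibre A x ==> \<Phi>' x a = \<Phi> t x a"
  shows "bundle_map A (F t) \<Phi>'" unfolding bundle_map_def
proof (intro conjI allI ballI)
  note m = smooth_matrixD(1,2)[OF assms(1)]
  show "smooth_map_on (base A) (base A) UNIV (F t)"
    using smooth_map_on_compose[OF manifold_axioms manifold_line smooth_map_fixed_time m(1) manifold_axioms] by simp
  show "linear_between (fibre A x) (fibre A (F t x)) (\<Phi>' x)" for x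
    using m(2)[of x t] \<Phi>' by (simp add: linear_between_def fibre_add fibre_scale image_subset_iff)
  fix p assume "p \<in> frames A"
  then obtain U \<tau> where U: "(U, \<tau>) \<in> frames A" "p = (U, \<tau>)" by (cases p) auto
  have "smooth_fun_on (base A) (U \<inter> F t -` V) (%x. inv (\<sigma> (F t x)) (\<Phi>' x (\<tau> x v)))"
    if V: "(V, \<sigma>) \<in> frames A" for V \<sigma> v
  proof (rule smooth_fun_on_cong)
    have "{x. (t, x) \<in> {(t, x). x \<in> U \<and> F t x \<in> V}} = U \<inter> F t -` V" by auto
    with smooth_fun_on_fixed_time[OF smooth_matrix_frames(2,1)[OF assms(1) U(1) V], where t = t]
    show "smooth_fun_on (base A) (U \<inter> F t -` V) (%x. inv (\<sigma> (F t x)) (\<Phi> t x (\<tau> x v)))" by simp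
  qed (use \<Phi>' frame_mem[OF U(1)] in auto)
  then show "case p of (U, \<tau>) => \<forall>(V, \<sigma>)\<in>frames A. \<forall>v. smooth_fun_on (base A) (U \<inter> F t -` V)
      (%x. inv (\<sigma> (F t x)) (\<Phi>' x (\<tau> x v)))" by (auto simp: U(2))
qed

lemma algebroid_isotopy_automorphism:
  assumes alg: "algebroid_isotopy F \<Phi> G \<Psi>"
  shows "algebroid_automorphism A (F t) (\<Phi> t)"
proof -
  note iso = algebroid_isotopyD(1)[OF alg]
  note m = isotopyD(1,2)[OF iso] and FG = isotopyD(3,4)[OF iso]
  have bij: "bij (F t)" by (rule bij_betw_byWitness[where f' = "G t"]) (simp_all add: FG)
  have invF: "inv (F t) = G t" by (rule inv_equality) (simp_all add: FG)
  have bijb: "bij_betw (\<Phi> t x) (fibre A x) (fibre A (F t x))" for x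
    by (rule bij_betw_byWitness[where f' = "\<Psi> t (F t x)"])
      (use isotopyD(5)[OF iso] fibre_isomorphism[OF iso] smooth_matrixD(4)[OF m(1)] in auto)
  have inv\<Phi>: "inv_into (fibre A (G t x)) (\<Phi> t (G t x)) a = \<Psi> t x a" if a: "a \<in> fibre A x" for x a
  proof (rule inv_into_f_eq)
    show "inj_on (\<Phi> t (G t x)) (fibre A (G t x))" using bijb by (simp add: bij_betw_def)
  qed (use isotopyD(6)[OF iso a] smooth_matrixD(4)[OF m(2) a] in auto)
  have push: "push_section (F t) (\<Phi> t) Y = push (G t) (\<Phi> t) Y" for Y by (simp add: push_section_def invF)
  show ?thesis unfolding algebroid_automorphism_def bundle_automorphism_def push
    using bij bijb bundle_map_cong[OF m(1)] bundle_map_cong[OF m(2) inv\<Phi>] algebroid_isotopyD(2,3)[OF alg]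
    by (simp add: invF o_def)
qed

lemma algebroid_isotopy_isotopic:
  assumes alg: "algebroid_isotopy F \<Phi> G \<Psi>"
  shows "isotopic_to_identity A (F 1) (\<Phi> 1)" unfolding isotopic_to_identity_def
proof (intro exI[of _ F] exI[of _ \<Phi>] conjI)
  note iso = algebroid_isotopyD(1)[OF alg]
  show "\<forall>t\<in>{0..1}. algebroid_automorphism A (F t) (\<Phi> t)" using algebroid_isotopy_automorphism[OF alg] by blast
  show "smooth_map_on line (base A) ({0..1} \<times> UNIV) (%(t, x). F t x)"
    by (rule smooth_map_on_subset[OF smooth_matrixD(1)[OF isotopyD(1)[OF iso]] subset_UNIV])
  have "smooth_fun_on line {(t, x). t \<in> {0..1} \<and> x \<in> U \<and> F t x \<in> V} (%(t, x). inv (\<sigma> (F t x)) (\<Phi> t x (\<tau> x v)))"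
    if "(U, \<tau>) \<in> frames A" "(V, \<sigma>) \<in> frames A" for U \<tau> V \<sigma> v
    by (rule smooth_fun_on_subset[OF smooth_matrix_frames(2)[OF isotopyD(1)[OF iso] that]]) auto
  then show "\<forall>(U, \<tau>)\<in>frames A. \<forall>(V, \<sigma>)\<in>frames A. \<forall>v.
        smooth_fun_on line {(t, x). t \<in> {0..1} \<and> x \<in> U \<and> F t x \<in> V} (%(t, x). inv (\<sigma> (F t x)) (\<Phi> t x (\<tau> x v)))"
    by fast
qed (use isotopyD(7,8)[OF algebroid_isotopyD(1)[OF alg]] in auto)

end

section \<open>Families of forms\<close>

text \<open>Antiderivatives in time are taken point by point. The content is joint smoothness, a
  local matter, so \<open>h\<close> may be cut off in a chart and carried to the model
  space.\<close>

lemma (in compact_manifold) smooth_family_antiderivative: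
  fixes h :: "real => 'm => real"
  assumes h: "smooth_family \<A> h"
  obtains H where "smooth_family \<A> H" "!!x. H 0 x = 0" "!!t x. ((%s. H s x) has_real_derivative h t x) (at t)"
proof -
  have "\<exists>G. G 0 = 0 \<and> (\<forall>t. (G has_vector_derivative h t x) (at t))" for x
  proof -
    have "continuous_on UNIV (%t. h t x)"
      using DERIV_isCont[OF smooth_family_has_derivative(1)[OF h]] by (simp add: continuous_at_imp_continuous_on)
    then show ?thesis by (metis antiderivative_exists)
  qed
  then obtain G where G: "!!x. G x 0 = 0" "!!x t. (G x has_real_derivative h t x) (at t)"
    unfolding has_real_derivative_iff_has_vector_derivative by metis
  have "smooth_family \<A> (%t x. G x t)"
  proof (rule manifold.smooth_fun_on_local[OF manifold_line])
    fix p :: "real \<times> 'm"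
    obtain t0 x0 where p: "p = (t0, x0)" by (cases p)
    obtain U c where U: "(U, c) \<in> \<A>" "x0 \<in> U" using chart_exists by blast
    obtain \<zeta> C W where \<zeta>: "smooth_fun_on \<A> UNIV \<zeta>" "closed C" "C \<subseteq> U" "!!y. y \<notin> C ==> \<zeta> y = (0::real)"
      and W: "open W" "x0 \<in> W" "!!y. y \<in> W ==> \<zeta> y = 1" using bump_function[OF chart_open[OF U(1)] U(2)] by blast
    define g where "g = (%(t, y). if y \<in> c ` U then \<zeta> (inv_into U c y) * h t (inv_into U c y) else 0)"
    have g: "C_inf_on UNIV g" unfolding g_def
    proof (rule push_to_chart[OF U(1) chart_open[OF U(1)] subset_refl \<zeta>(2,3)])
      show "smooth_fun_on (line_times \<A>) (UNIV \<times> U) (%(t, x). \<zeta> x * h t x)"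
        by (intro family_mult smooth_family_static smooth_fun_on_subset[OF \<zeta>(1)] smooth_fun_on_subset[OF h]) auto
    qed (simp add: \<zeta>(4))
    text \<open>A parametrised integral is a component of the flow of a nilpotent linear equation.\<close>
    have "\<exists>M. (\<forall>q v. M 0 q v = v) \<and> (\<forall>v. C_inf_on UNIV (%(t, q). M t q v)) \<and>
        (\<forall>t q v. ((%t. M t q v) has_vector_derivative (g (t, q) * snd (M t q v), 0)) (at t))"
    proof (rule smooth_linear_flow[OF fd finite_dim_prod[OF finite_dim_real finite_dim_real]])
      show "linear (%v :: real \<times> real. (g q * snd v, 0 :: real))" for q
        by (rule linearI) (simp_all add: algebra_simps)
      show "C_inf_on UNIV (%q. (g q * snd v, 0 :: real))" for v :: "real \<times> real"
        using g by (intro allI k_smooth_on_Pair k_smooth_on_mult k_smooth_on_const open_UNIV) auto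
    qed blast
    then obtain M :: "real => 'b => real \<times> real => real \<times> real" where M: "!!q v. M 0 q v = v" "!!v. C_inf_on UNIV (%(t, q). M t q v)"
      "!!t q v. ((%t. M t q v) has_vector_derivative (g (t, q) * snd (M t q v), 0)) (at t)" by blast
    let ?m = "%t q. M t q (0, 1)"
    have snd1: "snd (?m t q) = 1" for t q
    proof -
      have "\<forall>t. ((%t. snd (?m t q)) has_real_derivative 0) (at t)"
        using bounded_linear.has_vector_derivative[OF bounded_linear_snd M(3)]
        by (simp add: has_real_derivative_iff_has_vector_derivative)
      from DERIV_isconst_all[OF this, of t 0] show ?thesis by (simp add: M(1))
    qed
    have G_eq: "G x t = fst (?m t (c x))" if x: "x \<in> W" "x \<in> U" for t x
    proof -
      have "((%t. fst (?m t (c x))) has_real_derivative h t x) (at t)" for t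
        using bounded_linear.has_vector_derivative[OF bounded_linear_fst M(3), of "c x" "(0, 1)" t] x W(3) snd1
        by (simp add: g_def has_real_derivative_iff_has_vector_derivative chart_inv[OF U(1)])
      then have "\<forall>t. ((%t. G x t - fst (?m t (c x))) has_real_derivative 0) (at t)"
        using DERIV_diff[OF G(2)[of x]] by (metis diff_self)
      from DERIV_isconst_all[OF this, of t 0] show ?thesis by (simp add: M(1) G(1))
    qed
    let ?N = "W \<inter> U"
    have oN: "open ?N" using W chart_open[OF U(1)] by auto
    have "smooth_fun_on (line_times \<A>) (UNIV \<times> ?N) (%(t, x). G x t)"
    proof (rule smooth_family_chart[OF U(1) _ oN])
      have "smooth_on UNIV (%p. fst (case p of (t, y) => ?m t y))"
        using M(2) by (intro smooth_on_bounded_linear_compose[OF bounded_linear_fst]) (simp add: smooth_on_open)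
      then have "smooth_on (UNIV \<times> c ` ?N) (%p. fst (case p of (t, y) => ?m t y))" by (rule smooth_on_subset) simp
      then show "smooth_on (UNIV \<times> c ` ?N) (%(t, y). G (inv_into U c y) t)"
        by (rule smooth_on_cong) (auto simp: G_eq chart_inv[OF U(1)])
    qed simp
    then show "\<exists>N. open N \<and> p \<in> N \<and> smooth_fun_on (line_times \<A>) (N \<inter> UNIV) (%(t, x). G x t)"
      using U(2) W(2) oN by (intro exI[of _ "UNIV \<times> ?N"]) (auto simp: p open_Times)
  qed
  then show ?thesis by (rule that) (use G in auto)
qed

lemma (in manifold) smooth_fun_on_inv_linear:
  fixes L :: "'m => 'f::real_normed_vector => 'f"
  assumes fdf: "finite_dim TYPE('f)" and D: "open D" and lin: "!!x. x \<in> D ==> linear (L x)" "!!x. x \<in> D ==> inj (L x)"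
    and sm: "!!v. smooth_fun_on \<A> D (%x. L x v)"
  shows "smooth_fun_on \<A> D (%x. inv (L x) w)" unfolding smooth_fun_on_def
proof clarify
  fix U c assume U: "(U, c) \<in> \<A>"
  have o: "open (c ` (U \<inter> D))" using chart_open_image[OF U, of "U \<inter> D"] chart_open[OF U] D by auto
  have s: "C_inf_on (c ` (U \<inter> D)) (%y. L (inv_into U c y) v)" for v
  proof -
    have "smooth_on (c ` (U \<inter> D)) (%y. L (inv_into U c y) v)"
      using sm[of v] U by (fastforce simp: smooth_fun_on_def o_def)
    then show ?thesis by (rule smooth_on_open[OF o, THEN iffD1])
  qed
  have "k_smooth_on k (c ` (U \<inter> D)) (%y. inv (L (inv_into U c y)) w)" for k
    by (rule k_smooth_on_inv_linear[OF fdf o]) (use lin s chart_inv[OF U] in auto)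
  then show "smooth_on (c ` (U \<inter> D)) ((%x. inv (L x) w) \<circ> inv_into U c)"
    unfolding o_def smooth_on_open[OF o] by (rule allI)
qed

context lie_calculus begin

lemma form2_family:
  assumes \<omega>: "\<omega> \<in> forms 2 A" and Y: "section_derivative Y Y'" and Z: "section_derivative Z Z'"
  shows "smooth_family (base A) (%t x. \<omega> x [Y t x, Z t x])"
    and "((%s. \<omega> x [Y s x, Z s x]) has_real_derivative \<omega> x [Y' t x, Z t x] + \<omega> x [Y t x, Z' t x]) (at t)"
proof -
  note Yf = section_derivativeD(1,2)[OF Y] and Zf = section_derivativeD(1,2)[OF Z]
  note m = section_family_mem[OF Yf(1)] section_family_mem[OF Yf(2)] section_family_mem[OF Zf(1)] section_family_mem[OF Zf(2)]
  have "smooth_family (base A) (%t x. \<omega> x [E k x, E l x])" for k l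
    using smooth_family_static[of UNIV "%x. \<omega> x [E k x, E l x]" UNIV] form2_CF[OF \<omega> E E] by simp
  then have "smooth_family (base A) (%t x. \<Sum>k\<in>K. \<Sum>l\<in>K. \<theta> k x (Y t x) * (\<theta> l x (Z t x) * \<omega> x [E k x, E l x]))"
    by (intro family_sum family_mult \<theta>_family Yf Zf)
  then show "smooth_family (base A) (%t x. \<omega> x [Y t x, Z t x])" by (simp only: form2_expand[OF \<omega> m(1,3)])
  have d: "((%s. \<Sum>k\<in>K. \<Sum>l\<in>K. \<theta> k x (Y s x) * (\<theta> l x (Z s x) * \<omega> x [E k x, E l x])) has_real_derivative
      (\<Sum>k\<in>K. \<Sum>l\<in>K. \<theta> k x (Y' t x) * (\<theta> l x (Z t x) * \<omega> x [E k x, E l x]) +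
        (\<theta> l x (Z' t x) * \<omega> x [E k x, E l x]) * \<theta> k x (Y t x))) (at t)"
    by (intro DERIV_sum DERIV_mult DERIV_cmult_right section_derivativeD(3)[OF Y \<theta>_linear] section_derivativeD(3)[OF Z \<theta>_linear])
  show "((%s. \<omega> x [Y s x, Z s x]) has_real_derivative \<omega> x [Y' t x, Z t x] + \<omega> x [Y t x, Z' t x]) (at t)"
    unfolding form2_expand[OF \<omega> m(1,3)] form2_expand[OF \<omega> m(2,3)] form2_expand[OF \<omega> m(1,4)]
    by (rule DERIV_cong[OF d]) (simp add: sum.distrib mult_ac)
qed

lemma forms2_combine:
  assumes \<omega>: "\<omega> \<in> forms 2 A" and \<kappa>: "\<kappa> \<in> forms 2 A"
  shows "(%x as. \<omega> x as - r * \<kappa> x as) \<in> forms 2 A"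
proof (rule forms2I)
  fix x b assume b: "b \<in> fibre A x"
  note l = form2_linear(1)[OF \<omega> b] form2_linear(1)[OF \<kappa> b]
  show "linear_between (fibre A x) UNIV (%a. \<omega> x [a, b] - r * \<kappa> x [a, b])" unfolding linear_between_def
    by (simp add: linear_between_add[OF l(1)] linear_between_add[OF l(2)] linear_between_scale[OF l(1)]
        linear_between_scale[OF l(2)] algebra_simps)
next
  show "\<omega> x [a, b] - r * \<kappa> x [a, b] = - (\<omega> x [b, a] - r * \<kappa> x [b, a])"
    if "a \<in> fibre A x" "b \<in> fibre A x" for x a b
    using form2_antisym[OF \<omega> that] form2_antisym[OF \<kappa> that] by simp
next
  show "smooth_fun_on (base A) U (%x. \<omega> x [\<tau> x u, \<tau> x v] - r * \<kappa> x [\<tau> x u, \<tau> x v])"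
    if "(U, \<tau>) \<in> frames A" for U \<tau> u v
    by (intro smooth_fun_on_diff smooth_fun_on_mult smooth_fun_on_const form_smooth(2)[OF \<omega> that] form_smooth(2)[OF \<kappa> that])
qed

lemma closed_form_combine:
  assumes \<omega>: "\<omega> \<in> forms 2 A" "closed_form 2 A \<omega>" and \<kappa>: "\<kappa> \<in> forms 2 A" "closed_form 2 A \<kappa>"
  shows "closed_form 2 A (%x as. \<omega> x as - r * \<kappa> x as)" unfolding closed_form_def
proof (intro allI impI)
  fix Xs x assume "length Xs = Suc 2 \<and> set Xs \<subseteq> \<Gamma>"
  then obtain X Y Z where Xs: "Xs = [X, Y, Z]" and X: "X \<in> \<Gamma>" and Y: "Y \<in> \<Gamma>" and Z: "Z \<in> \<Gamma>"
    by (auto simp: length_Suc_conv numeral_2_eq_2)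
  have r: "\<rho> x (R x) (%y. \<omega> y [P y, Q y] - r * \<kappa> y [P y, Q y]) =
      \<rho> x (R x) (%y. \<omega> y [P y, Q y]) - r * \<rho> x (R x) (%y. \<kappa> y [P y, Q y])"
    if "P \<in> \<Gamma>" "Q \<in> \<Gamma>" "R \<in> \<Gamma>" for P Q R
  proof -
    note T = anchor_tangent[OF sectionD(1)[OF that(3)], of x]
    show ?thesis
      using tangent_diff[OF T form2_CF[OF \<omega>(1) that(1,2)] CF_mult[OF CF_const form2_CF[OF \<kappa>(1) that(1,2)]]]
        tangent_scale[OF T form2_CF[OF \<kappa>(1) that(1,2)]] by simp
  qed
  have "d_A A \<omega> Xs x = 0" "d_A A \<kappa> Xs x = 0" using \<omega>(2) \<kappa>(2) X Y Z unfolding closed_form_def Xs by auto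
  then have "d_A A \<omega> Xs x - r * d_A A \<kappa> Xs x = 0" by simp
  then show "d_A A (%x as. \<omega> x as - r * \<kappa> x as) Xs x = 0"
    unfolding Xs d_A_2 r[OF X Y Z] r[OF X Z Y] r[OF Y Z X] by (simp add: algebra_simps)
qed

section \<open>Non-degeneracy and the Gram matrix\<close>

text \<open>The injectivity half of non-degeneracy, at one point. For the Gram matrix it becomes
  injectivity of a linear map, which is an open condition and gives bijectivity by
  dimension.\<close>

definition kernel_trivial :: "('m => 'v list => real) => 'm => bool" where
  "kernel_trivial \<omega> x \<longleftrightarrow> (\<forall>a\<in>fibre A x. (\<forall>b\<in>fibre A x. \<omega> x [a, b] = 0) \<longrightarrow> a = 0)"

lemma nondegenerate_kernel_trivial:
  assumes "\<omega> \<in> forms 2 A" "nondegenerate A \<omega>" shows "kernel_trivial \<omega> x" unfolding kernel_trivial_def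
proof (intro ballI impI)
  fix a assume a: "a \<in> fibre A x" "\<forall>b\<in>fibre A x. \<omega> x [a, b] = 0"
  have "\<omega> x [0, b] = 0" if "b \<in> fibre A x" for b
    by (rule linear_between_0[OF form2_linear(1)[OF assms(1) that] fibre_0])
  moreover have "linear_between (fibre A x) UNIV (%_. 0 :: real)" by (simp add: linear_between_def)
  then have "\<exists>!a. a \<in> fibre A x \<and> (\<forall>b\<in>fibre A x. \<omega> x [a, b] = 0)"
    using assms(2) unfolding nondegenerate_def by blast
  ultimately show "a = 0" using a fibre_0 by blast
qed

text \<open>The Gram matrix of the form in a frame, written as an endomorphism of the model fibre so
  that the lemmas on inverses of smooth families of linear maps apply.\<close>

definition gram :: "('m => 'v list => real) => ('m => 'f => 'v) => 'm => 'f => 'f" where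
  "gram \<omega> \<tau> x v = (\<Sum>b\<in>basis. \<omega> x [\<tau> x v, \<tau> x b] *\<^sub>R b)"

lemma gram:
  assumes \<omega>: "\<omega> \<in> forms 2 A" and U: "(U, \<tau>) \<in> frames A" "x \<in> U"
  shows gram_linear: "linear (gram \<omega> \<tau> x)"
    and gram_inj_iff: "inj (gram \<omega> \<tau> x) \<longleftrightarrow> kernel_trivial \<omega> x"
    and gram_solution: "linear_between (fibre A x) UNIV \<alpha> ==> gram \<omega> \<tau> x v = (\<Sum>b\<in>basis. \<alpha> (\<tau> x b) *\<^sub>R b) ==>
      b \<in> fibre A x ==> \<omega> x [\<tau> x v, b] = \<alpha> b"
proof -
  note Q = basis[OF fdf]
  note mem = frame_mem[OF U] and lin = frame_linear[OF U]
  show L: "linear (gram \<omega> \<tau> x)"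
    using linear_between_add[OF form2_linear(1)[OF \<omega> mem]] linear_between_scale[OF form2_linear(1)[OF \<omega> mem]]
    by (intro linearI) (simp_all add: gram_def linear_add[OF lin] linear_cmul[OF lin] mem scaleR_left_distrib sum.distrib scaleR_sum_right)
  have coeff: "coord b (\<Sum>b\<in>basis. r b *\<^sub>R b) = r b" if b: "b \<in> basis" for b :: 'f and r
  proof -
    have "coord b (\<Sum>b'\<in>basis. r b' *\<^sub>R b') = (\<Sum>b'\<in>basis. r b' * coord b b')"
      using bounded_linear.linear[OF Q(2)] by (simp add: linear_sum linear_cmul)
    also have "\<dots> = (\<Sum>b'\<in>basis. if b = b' then r b' else 0)" by (intro sum.cong refl) (simp add: Q(4))
    finally show ?thesis using b Q(1) by simp
  qed
  have determined: "\<alpha> b = \<beta> b" if "linear_between (fibre A x) UNIV \<alpha>" "linear_between (fibre A x) UNIV \<beta>"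
      "!!b. b \<in> basis ==> \<alpha> (\<tau> x b) = \<beta> (\<tau> x b)" "b \<in> fibre A x" for \<alpha> \<beta> :: "'v => real" and b
  proof -
    let ?w = "inv (\<tau> x) b"
    have 1: "\<gamma> (\<tau> x ?w) = (\<Sum>b\<in>basis. coord b ?w *\<^sub>R \<gamma> (\<tau> x b))" if "linear_between (fibre A x) UNIV \<gamma>" for \<gamma> :: "'v => real"
      by (rule linear_expand[OF Q(3) bounded_linear.linear[OF functional_frame_bounded_linear[OF U that]]])
    show ?thesis using 1[OF that(1)] 1[OF that(2)] that(3) inv_frame[OF U that(4)] by simp
  qed
  show sol: "\<omega> x [\<tau> x v, b] = \<alpha> b"
    if "linear_between (fibre A x) UNIV \<alpha>" "gram \<omega> \<tau> x v = (\<Sum>b\<in>basis. \<alpha> (\<tau> x b) *\<^sub>R b)" "b \<in> fibre A x" for \<alpha> v b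
  proof (rule determined[OF form2_linear(2)[OF \<omega> mem] that(1) _ that(3)])
    fix b :: 'f assume b: "b \<in> basis"
    show "\<omega> x [\<tau> x v, \<tau> x b] = \<alpha> (\<tau> x b)"
      using arg_cong[OF that(2), of "coord b"] unfolding gram_def coeff[OF b] .
  qed
  show "inj (gram \<omega> \<tau> x) \<longleftrightarrow> kernel_trivial \<omega> x"
  proof
    assume inj: "inj (gram \<omega> \<tau> x)"
    show "kernel_trivial \<omega> x" unfolding kernel_trivial_def
    proof (intro ballI impI)
      fix a assume a: "a \<in> fibre A x" "\<forall>b\<in>fibre A x. \<omega> x [a, b] = 0"
      have "gram \<omega> \<tau> x (inv (\<tau> x) a) = gram \<omega> \<tau> x 0"
        using a mem by (simp add: gram_def inv_frame[OF U a(1)] linear_0[OF L, unfolded gram_def])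
      then have "inv (\<tau> x) a = 0" using inj by (simp add: inj_eq)
      then show "a = 0" using inv_frame[OF U a(1)] linear_0[OF lin] by simp
    qed
  next
    assume kt: "kernel_trivial \<omega> x"
    have "v = 0" if "gram \<omega> \<tau> x v = 0" for v
    proof -
      have "linear_between (fibre A x) UNIV (%_. 0 :: real)" by (simp add: linear_between_def)
      then have "\<omega> x [\<tau> x v, b] = 0" if "b \<in> fibre A x" for b
        by (rule sol) (use \<open>gram \<omega> \<tau> x v = 0\<close> that in auto)
      then have "\<tau> x v = 0" using kt mem unfolding kernel_trivial_def by blast
      then show "v = 0" using frame_inv[OF U, of v] frame_inv[OF U, of 0] linear_0[OF lin] by simp
    qed
    then show "inj (gram \<omega> \<tau> x)" using linear_injective_0[OF L] by blast
  qed
qed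

text \<open>In a frame the section is the inverse Gram matrix applied to the components of the
  one-form, and inverses of smooth families of linear maps are smooth.\<close>

lemma form_dual_section:
  assumes w: "!!u. w u \<in> forms 2 A" "!!u x. kernel_trivial (w u) x"
    "!!U \<tau> v v'. (U, \<tau>) \<in> frames A ==> smooth_fun_on line (UNIV \<times> U) (%(u, x). w u x [\<tau> x v, \<tau> x v'])"
    and \<gamma>: "!!u. \<gamma> u \<in> forms 1 A"
    "!!U \<tau> v. (U, \<tau>) \<in> frames A ==> smooth_fun_on line (UNIV \<times> U) (%(u, x). \<gamma> u x [\<tau> x v])"
  obtains X where "section_family X" "!!u x b. b \<in> fibre A x ==> w u x [X u x, b] = \<gamma> u x [b]"
proof -
  note Q = basis[OF fdf]
  let ?rhs = "%u \<tau> x. \<Sum>b\<in>basis. \<gamma> u x [\<tau> x b] *\<^sub>R b"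
  have lin: "linear (gram (w u) \<tau> x)" and inj: "inj (gram (w u) \<tau> x)"
    and sol: "b \<in> fibre A x ==> w u x [\<tau> x (inv (gram (w u) \<tau> x) (?rhs u \<tau> x)), b] = \<gamma> u x [b]"
    if U: "(U, \<tau>) \<in> frames A" "x \<in> U" for U \<tau> x u b
  proof -
    note g = gram[OF w(1) U]
    show lin: "linear (gram (w u) \<tau> x)" and inj: "inj (gram (w u) \<tau> x)" using g(1,2) w(2) by auto
    show "w u x [\<tau> x (inv (gram (w u) \<tau> x) (?rhs u \<tau> x)), b] = \<gamma> u x [b]" if b: "b \<in> fibre A x"
      by (rule g(3)[OF form1_linear[OF \<gamma>(1)] _ b])
        (rule surj_f_inv_f[OF bij_is_surj[OF linear_inj_imp_bij_finite_dim[OF fdf lin inj]]])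
  qed
  have "\<exists>a\<in>fibre A x. \<forall>b\<in>fibre A x. w u x [a, b] = \<gamma> u x [b]" for u x
  proof -
    obtain U \<tau> where U: "(U, \<tau>) \<in> frames A" "x \<in> U" using frame_exists by blast
    show ?thesis by (rule bexI[OF _ frame_mem[OF U]]) (use sol[OF U] in blast)
  qed
  then have ex: "\<exists>a. a \<in> fibre A x \<and> (\<forall>b\<in>fibre A x. w u x [a, b] = \<gamma> u x [b])" for u x by blast
  \<comment> \<open>The solution is unique because the kernel is trivial, so this choice agrees with
    the formula in every frame.\<close>
  define X where "X u x = (SOME a. a \<in> fibre A x \<and> (\<forall>b\<in>fibre A x. w u x [a, b] = \<gamma> u x [b]))" for u x
  have X: "X u x \<in> fibre A x" "b \<in> fibre A x ==> w u x [X u x, b] = \<gamma> u x [b]" for u x b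
    using someI_ex[OF ex[of x u], folded X_def] by blast+
  have "section_family X" unfolding section_family_def
  proof (intro conjI allI X(1) ballI)
    fix p assume "p \<in> frames A"
    then obtain U \<tau> where U: "(U, \<tau>) \<in> frames A" "p = (U, \<tau>)" by (cases p) auto
    let ?L = "%q. gram (w (fst q)) \<tau> (snd q)"
    have L: "smooth_fun_on line (UNIV \<times> U) (%q. inv (?L q) b)" for b
    proof (rule manifold.smooth_fun_on_inv_linear[OF manifold_line fdf])
      show "smooth_fun_on line (UNIV \<times> U) (%q. ?L q v)" for v unfolding gram_def using w(3)[OF U(1)]
        by (intro smooth_fun_on_sum smooth_fun_on_scaleR smooth_fun_on_const) (simp add: case_prod_unfold)
    qed (use lin[OF U(1)] inj[OF U(1)] frame_open[OF U(1)] in \<open>auto simp: open_Times\<close>)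
    have "smooth_fun_on line (UNIV \<times> U) (%q. \<Sum>b\<in>basis. \<gamma> (fst q) (snd q) [\<tau> (snd q) b] *\<^sub>R inv (?L q) b)"
      using \<gamma>(2)[OF U(1)] L by (intro smooth_fun_on_sum smooth_fun_on_scaleR) (auto simp: case_prod_unfold)
    then have "smooth_fun_on line (UNIV \<times> U) (%(u, x). inv (\<tau> x) (X u x))"
    proof (rule manifold.smooth_fun_on_cong[OF manifold_line])
      fix q :: "real \<times> 'm" assume "q \<in> UNIV \<times> U"
      then obtain u x where q: "q = (u, x)" and x: "x \<in> U" by auto
      let ?v = "inv (gram (w u) \<tau> x) (?rhs u \<tau> x)"
      have "linear (inv (gram (w u) \<tau> x))"
        by (intro linear_inv_of_bij linear_inj_imp_bij_finite_dim[OF fdf] lin[OF U(1) x] inj[OF U(1) x])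
      then have v: "?v = (\<Sum>b\<in>basis. \<gamma> u x [\<tau> x b] *\<^sub>R inv (gram (w u) \<tau> x) b)" by (simp add: linear_sum linear_cmul)
      have "X u x - \<tau> x ?v = 0"
      proof -
        have m: "X u x - \<tau> x ?v \<in> fibre A x" by (rule fibre_diff[OF X(1) frame_mem[OF U(1) x]])
        have "w u x [X u x - \<tau> x ?v, b] = 0" if b: "b \<in> fibre A x" for b
        proof -
          note l = form2_linear(1)[OF w(1)[of u] b]
          note t = frame_mem[OF U(1) x, of ?v]
          have "w u x [X u x - \<tau> x ?v, b] = w u x [X u x, b] - w u x [\<tau> x ?v, b]"
            using linear_between_add[OF l X(1) fibre_neg[OF t]] linear_between_minus[OF l t] by simp
          then show ?thesis using X(2)[OF b] sol[OF U(1) x b] by simp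
        qed
        then show ?thesis using w(2)[of u x] m unfolding kernel_trivial_def by blast
      qed
      then have "inv (\<tau> x) (X u x) = ?v" using frame_inv[OF U(1) x] by simp
      then show "(\<Sum>b\<in>basis. \<gamma> (fst q) (snd q) [\<tau> (snd q) b] *\<^sub>R inv (?L q) b) = (case q of (u, x) => inv (\<tau> x) (X u x))"
        using v by (simp add: q)
    qed
    then show "case p of (U, \<tau>) => smooth_fun_on line (UNIV \<times> U) (%(u, x). inv (\<tau> x) (X u x))" by (simp add: U(2))
  qed
  then show ?thesis by (rule that) (rule X(2))
qed

end

section \<open>Moser's argument\<close>

lemma smooth_on_smooth_step: "smooth_on UNIV smooth_step"
  unfolding smooth_on_open[OF open_UNIV] by (rule C_inf_on_smooth_step)

lemma smooth_step_deriv: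
  shows "(smooth_step has_real_derivative deriv smooth_step u) (at u)" and "smooth_on UNIV (deriv smooth_step)"
proof -
  show 1: "(smooth_step has_real_derivative deriv smooth_step u) (at u)" for u
    using k_smooth_on_SucD(1)[OF spec[OF C_inf_on_smooth_step, of "Suc 0"], of u]
    by (metis DERIV_deriv_iff_real_differentiable differentiable_def UNIV_I)
  have "frechet_derivative smooth_step (at u) 1 = deriv smooth_step u" for u
    using frechet_derivative_at[OF 1[unfolded has_field_derivative_def]] by (metis mult.right_neutral)
  then have "(%u. frechet_derivative smooth_step (at u) 1) = deriv smooth_step" by (rule ext)
  moreover have "C_inf_on UNIV (%u. frechet_derivative smooth_step (at u) 1)"
    using k_smooth_on_SucD(2)[OF spec[OF C_inf_on_smooth_step]] by (intro allI)
  ultimately show "smooth_on UNIV (deriv smooth_step)" unfolding smooth_on_open[OF open_UNIV] by simp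
qed

context lie_calculus begin

text \<open>The pullback is compared on pairs of fibre vectors only, since a form is arbitrary on
  lists of other lengths or outside the fibre. The isotopy is part of the relation, so that chaining
  steps also produces an isotopy to the identity.\<close>

definition related :: "('m => 'v list => real) => ('m => 'v list => real) => bool" where
  "related \<omega> \<omega>' \<longleftrightarrow> (\<exists>F \<Phi> G \<Psi>. algebroid_isotopy F \<Phi> G \<Psi> \<and>
    (\<forall>x. \<forall>a\<in>fibre A x. \<forall>b\<in>fibre A x. \<omega>' (F 1 x) [\<Phi> 1 x a, \<Phi> 1 x b] = \<omega> x [a, b]))"

lemma relatedI:
  "algebroid_isotopy F \<Phi> G \<Psi> ==>
    (!!x a b. a \<in> fibre A x ==> b \<in> fibre A x ==> \<omega>' (F 1 x) [\<Phi> 1 x a, \<Phi> 1 x b] = \<omega> x [a, b]) ==> related \<omega> \<omega>'"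
  unfolding related_def by blast

lemma related_cong: "(!!x a b. a \<in> fibre A x ==> b \<in> fibre A x ==> \<omega> x [a, b] = \<omega>' x [a, b]) ==> related \<omega> \<omega>'"
  by (rule relatedI[OF algebroid_isotopy_id]) simp

lemma related_trans:
  assumes "related \<omega>0 \<omega>1" "related \<omega>1 \<omega>2" shows "related \<omega>0 \<omega>2"
proof -
  obtain F \<Phi> G \<Psi> where 1: "algebroid_isotopy F \<Phi> G \<Psi>"
    "!!x a b. a \<in> fibre A x ==> b \<in> fibre A x ==> \<omega>1 (F 1 x) [\<Phi> 1 x a, \<Phi> 1 x b] = \<omega>0 x [a, b]"
    using assms(1) unfolding related_def by blast
  obtain F' \<Phi>' G' \<Psi>' where 2: "algebroid_isotopy F' \<Phi>' G' \<Psi>'"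
    "!!x a b. a \<in> fibre A x ==> b \<in> fibre A x ==> \<omega>2 (F' 1 x) [\<Phi>' 1 x a, \<Phi>' 1 x b] = \<omega>1 x [a, b]"
    using assms(2) unfolding related_def by blast
  note mem = smooth_matrixD(4)[OF isotopyD(1)[OF algebroid_isotopyD(1)[OF 1(1)]]]
  show ?thesis by (rule relatedI[OF algebroid_isotopy_compose[OF 1(1) 2(1)]]) (simp add: 1(2) 2(2) mem)
qed

end

section \<open>The Moser step for a primitive supported in one patch\<close>

context chart_patch begin

text \<open>With \<beta> the smooth step, the path \<open>\<omega> - \<beta> \<kappa>\<close> has
  derivative \<open>- \<beta>' d(\<psi> \<eta>)\<close>. The section dual to
  \<open>\<beta>' \<psi> \<eta>\<close> is \<open>\<psi>\<close> times the one dual to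
  \<open>\<beta>' \<eta>\<close>, so it has a flow, and closedness makes the pullback of the path
  along this flow constant.\<close>

lemma moser_step:
  assumes \<omega>: "\<omega> \<in> forms 2 A" "closed_form 2 A \<omega>" and \<eta>: "\<eta> \<in> forms 1 A" and \<kappa>: "\<kappa> \<in> forms 2 A"
    and \<kappa>_d: "!!x Y Z. Y \<in> \<Gamma> ==> Z \<in> \<Gamma> ==> \<kappa> x [Y x, Z x] = d_A A (%x as. \<psi> x * \<eta> x as) [Y, Z] x"
    and kt: "!!r x. 0 \<le> r ==> r \<le> 1 ==> kernel_trivial (%x as. \<omega> x as - r * \<kappa> x as) x"
  shows "related \<omega> (%x as. \<omega> x as - \<kappa> x as)"
proof -
  note \<psi>\<eta> = forms1_scale[OF \<psi>(1) \<eta>]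
  have \<kappa>_closed: "closed_form 2 A \<kappa>" by (rule closed_d_A[OF \<psi>\<eta> \<kappa>_d])
  note \<beta>' = smooth_step_deriv(1) and \<beta>'_smooth = smooth_step_deriv(2)
  \<comment> \<open>The smooth step keeps the coefficient of \<open>\<kappa>\<close> in the interval
    [0,1], the range covered by \<open>kt\<close>, for all real times.\<close>
  define w where "w u = (%x as. \<omega> x as - smooth_step u * \<kappa> x as)" for u
  define \<gamma> where "\<gamma> u = (%x (as :: 'v list). deriv smooth_step u * \<eta> x as)" for u
  have w: "w u \<in> forms 2 A" "closed_form 2 A (w u)" for u
    unfolding w_def by (rule forms2_combine[OF \<omega>(1) \<kappa>], rule closed_form_combine[OF \<omega> \<kappa> \<kappa>_closed])
  obtain X' where dual: "section_family X'" "!!u x b. b \<in> fibre A x ==> w u x [X' u x, b] = \<gamma> u x [b]"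
  proof (rule form_dual_section[of w \<gamma>])
    show "w u \<in> forms 2 A" for u by (rule w)
    show "kernel_trivial (w u) x" for u x unfolding w_def by (rule kt[OF smooth_step_bounds])
    show "smooth_fun_on line (UNIV \<times> U) (%(u, x). w u x [\<tau> x v, \<tau> x v'])" if U: "(U, \<tau>) \<in> frames A" for U \<tau> v v'
      unfolding w_def by (intro family_diff family_mult smooth_family_static smooth_family_time
          form_smooth(2)[OF \<omega>(1) U] form_smooth(2)[OF \<kappa> U] smooth_on_smooth_step)
    show "\<gamma> u \<in> forms 1 A" for u unfolding \<gamma>_def by (rule forms1_scale[OF CF_const \<eta>])
    show "smooth_fun_on line (UNIV \<times> U) (%(u, x). \<gamma> u x [\<tau> x v])" if U: "(U, \<tau>) \<in> frames A" for U \<tau> v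
      unfolding \<gamma>_def
      by (intro family_mult smooth_family_static smooth_family_time form_smooth(1)[OF \<eta> U] \<beta>'_smooth)
  qed blast
  interpret chart_flow A K E \<theta> I crdf \<Delta> U c U' \<tau> N C \<zeta> \<psi> X'
    by (rule chart_flow.intro[OF chart_patch_axioms chart_flow_axioms.intro]) (fact dual(1))
  obtain F \<Phi> G \<Psi> where flow: "flow_of X F \<Phi> G \<Psi>" using flow_exists by blast
  note iso = flow_iso[OF flow]
  have wX: "w u x [X u x, b] = deriv smooth_step u * (\<psi> x * \<eta> x [b])" if b: "b \<in> fibre A x" for u x b
    using linear_between_scale[OF form2_linear(1)[OF w(1) b] section_family_mem[OF dual(1)], of u "\<psi> x" u] dual(2)[OF b]
    by (simp add: X_def \<gamma>_def)
  \<comment> \<open>The form evaluated on two pushed sections satisfies the transport equation of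
    the flow; its constancy along orbits is the invariance of the form.\<close>
  have pull: "w 1 (F 1 x) [\<Phi> 1 x (Y x), \<Phi> 1 x (Z x)] = w 0 x [Y x, Z x]" if Y: "Y \<in> \<Gamma>" and Z: "Z \<in> \<Gamma>" for Y Z x
  proof -
    let ?Y = "%t. push (G t) (\<Phi> t) Y" and ?Z = "%t. push (G t) (\<Phi> t) Z"
    let ?g = "%t x. w t x [?Y t x, ?Z t x]"
    note Yd = flow_push_section[OF flow Y] and Zd = flow_push_section[OF flow Z]
    note YS = section_family_section[OF section_derivativeD(1)[OF Yd]] and ZS = section_family_section[OF section_derivativeD(1)[OF Zd]]
    note f\<omega> = form2_family[OF \<omega>(1) Yd Zd] and f\<kappa> = form2_family[OF \<kappa> Yd Zd]
    have "smooth_family (base A) (%t x. smooth_step t)"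
      using smooth_family_time[OF smooth_on_smooth_step, of UNIV] by simp
    then have g: "smooth_family (base A) ?g" unfolding w_def by (intro family_diff family_mult f\<omega>(1) f\<kappa>(1))
    have d: "((%s. ?g s x) has_real_derivative - \<rho> x (X t x) (?g t)) (at t)" for t x
    proof -
      let ?XY = "bracket A (X t) (?Y t)" and ?XZ = "bracket A (X t) (?Z t)" and ?YZ = "bracket A (?Y t) (?Z t)"
      have S: "?XY \<in> \<Gamma>" "?XZ \<in> \<Gamma>" "?YZ \<in> \<Gamma>" by (intro bracket_section X_section YS ZS)+
      note m = sectionD(1)[OF YS[of t], of x] sectionD(1)[OF ZS[of t], of x] sectionD(1)[OF S(1), of x]
        sectionD(1)[OF S(2), of x] sectionD(1)[OF S(3), of x] sectionD(1)[OF X_section, of t x]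
      have 1: "((%s. ?g s x) has_real_derivative \<omega> x [- ?XY x, ?Z t x] + \<omega> x [?Y t x, - ?XZ x] -
          (deriv smooth_step t * \<kappa> x [?Y t x, ?Z t x] + (\<kappa> x [- ?XY x, ?Z t x] + \<kappa> x [?Y t x, - ?XZ x]) * smooth_step t)) (at t)"
        unfolding w_def by (intro DERIV_diff DERIV_mult f\<omega>(2) f\<kappa>(2) \<beta>')
      have neg: "\<omega> x [- ?XY x, ?Z t x] = - \<omega> x [?XY x, ?Z t x]" "\<omega> x [?Y t x, - ?XZ x] = - \<omega> x [?Y t x, ?XZ x]"
        "\<kappa> x [- ?XY x, ?Z t x] = - \<kappa> x [?XY x, ?Z t x]" "\<kappa> x [?Y t x, - ?XZ x] = - \<kappa> x [?Y t x, ?XZ x]"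
        by (rule linear_between_minus[OF form2_linear(1)[OF \<omega>(1) m(2)] m(3)]
            linear_between_minus[OF form2_linear(2)[OF \<omega>(1) m(1)] m(4)]
            linear_between_minus[OF form2_linear(1)[OF \<kappa> m(2)] m(3)]
            linear_between_minus[OF form2_linear(2)[OF \<kappa> m(1)] m(4)])+
      have \<psi>\<eta>_CF: "(%y. \<psi> y * \<eta> y [W y]) \<in> CF" if "W \<in> \<Gamma>" for W using form1_CF[OF \<psi>\<eta> that] .
      have r: "\<rho> x (V x) (%y. w t y [X t y, W y]) = deriv smooth_step t * \<rho> x (V x) (%y. \<psi> y * \<eta> y [W y])" if "V \<in> \<Gamma>" "W \<in> \<Gamma>" for V W
        using tangent_scale[OF anchor_tangent[OF sectionD(1)[OF that(1)]] \<psi>\<eta>_CF[OF that(2)], of x "deriv smooth_step t"]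
        by (simp add: wX sectionD(1)[OF that(2)])
      \<comment> \<open>Closedness in the role of Cartan's formula: the terms in which
        \<open>X t\<close> is an argument of \<open>w t\<close> make up the differential of the
        contraction, which is \<open>deriv smooth_step t\<close> times
        \<open>\<kappa>\<close>.\<close>
      have "d_A A (w t) [X t, ?Y t, ?Z t] x = 0"
        using w(2)[of t] X_section YS ZS unfolding closed_form_def by (auto simp: numeral_2_eq_2)
      then have "\<rho> x (X t x) (?g t) = deriv smooth_step t * \<kappa> x [?Y t x, ?Z t x] + w t x [?XY x, ?Z t x] + w t x [?Y t x, ?XZ x]"
        unfolding d_A_2 r[OF YS ZS] r[OF ZS YS] \<kappa>_d[OF YS ZS] d_A_1
          form2_antisym[OF w(1) m(4,1)] form2_antisym[OF w(1) m(5,6)] wX[OF m(5)] by (simp add: algebra_simps)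
      then show ?thesis by (intro DERIV_cong[OF 1]) (simp add: neg w_def algebra_simps)
    qed
    have "?g 1 (F 1 x) = ?g 0 x" by (rule flow_transport_function[OF flow g d])
    moreover have "G 0 x = x" using isotopyD(4,7)[OF iso] by metis
    ultimately show ?thesis
      by (simp add: isotopyD(4)[OF iso] isotopyD(8)[OF iso sectionD(1)[OF Y]] isotopyD(8)[OF iso sectionD(1)[OF Z]])
  qed
  have "\<omega> (F 1 x) [\<Phi> 1 x a, \<Phi> 1 x b] - \<kappa> (F 1 x) [\<Phi> 1 x a, \<Phi> 1 x b] = \<omega> x [a, b]"
    if ab: "a \<in> fibre A x" "b \<in> fibre A x" for x a b
  proof -
    obtain Y Z where "Y \<in> \<Gamma>" "Y x = a" "Z \<in> \<Gamma>" "Z x = b" using section_through[OF ab(1)] section_through[OF ab(2)] by metis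
    then show ?thesis using pull[of Y Z x] by (simp add: w_def)
  qed
  then show ?thesis unfolding related_def using flow_algebroid_isotopy[OF flow] by blast
qed

end

section \<open>The reparametrised path and a primitive of its increments\<close>

locale moser_path = lie_calculus A K E \<theta> I crdf \<Delta>
  for A :: "('m::{t2_space,second_countable_topology}, 'b::real_normed_vector,
    'v::real_vector, 'f::real_normed_vector) algebroid" and K E \<theta> I crdf \<Delta> +
  fixes \<Omega> \<xi> :: "real => 'm => 'v list => real"
  assumes \<Omega>_smooth: "smooth_form_family 2 A \<Omega>" and symplectic: "!!t. t \<in> {0..1} ==> symplectic_form A (\<Omega> t)"
    and \<xi>_smooth: "smooth_form_family 1 A \<xi>"
    and \<Omega>_derivative: "!!t X Y x. [|t \<in> {0..1}; X \<in> sections A; Y \<in> sections A|] ==>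
      ((%s. eval_form (\<Omega> s) [X, Y] x) has_real_derivative - d_A A (\<xi> t) [X, Y] x) (at t within {0..1})"
begin

text \<open>The path is reparametrised so as to be defined for all times.\<close>

definition w :: "real => 'm => 'v list => real" where "w t = \<Omega> (smooth_step t)"

text \<open>The factor is that of the chain rule: the time derivative of \<open>w\<close> is then
  minus the differential of this one-form.\<close>

definition \<zeta> :: "real => 'm => 'v list => real" where
  "\<zeta> t x as = deriv smooth_step t * \<xi> (smooth_step t) x as"

lemma step_mem: "smooth_step t \<in> {0..1}" using smooth_step_bounds by simp

lemma w:
  shows w_forms: "w t \<in> forms 2 A" and w_closed: "closed_form 2 A (w t)" and w_kernel: "kernel_trivial (w t) x"
    and w_frame: "(U, \<tau>) \<in> frames A ==> smooth_fun_on line (UNIV \<times> U) (%(t, x). w t x [\<tau> x v, \<tau> x v'])"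
proof -
  have "symplectic_form A (w t)" for t unfolding w_def by (rule symplectic[OF step_mem])
  then show "w t \<in> forms 2 A" "closed_form 2 A (w t)" "kernel_trivial (w t) x"
    using nondegenerate_kernel_trivial by (auto simp: symplectic_form_def)
  assume U: "(U, \<tau>) \<in> frames A"
  then have "\<forall>vs. length vs = 2 \<longrightarrow> smooth_fun_on line ({0..1} \<times> U) (%(t, x). \<Omega> t x (map (\<tau> x) vs))"
    using \<Omega>_smooth unfolding smooth_form_family_def by blast
  from this[rule_format, of "[v, v']"]
  have "smooth_fun_on line ({0..1} \<times> U) (%(t, x). \<Omega> t x [\<tau> x v, \<tau> x v'])" by simp
  from smooth_family_reparam[OF this smooth_on_smooth_step] step_mem
  show "smooth_fun_on line (UNIV \<times> U) (%(t, x). w t x [\<tau> x v, \<tau> x v'])" unfolding w_def by blast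
qed

lemma \<zeta>:
  shows \<zeta>_linear: "linear_between (fibre A x) UNIV (%a. \<zeta> t x [a])"
    and \<zeta>_frame: "(U, \<tau>) \<in> frames A ==> smooth_fun_on line (UNIV \<times> U) (%(t, x). \<zeta> t x [\<tau> x v])"
proof -
  have "\<xi> (smooth_step t) \<in> forms 1 A" using \<xi>_smooth step_mem by (auto simp: smooth_form_family_def)
  from form1_linear[OF this, of x] show "linear_between (fibre A x) UNIV (%a. \<zeta> t x [a])"
    by (simp add: \<zeta>_def linear_between_def algebra_simps)
  assume U: "(U, \<tau>) \<in> frames A"
  then have "\<forall>vs. length vs = 1 \<longrightarrow> smooth_fun_on line ({0..1} \<times> U) (%(t, x). \<xi> t x (map (\<tau> x) vs))"
    using \<xi>_smooth unfolding smooth_form_family_def by blast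
  from this[rule_format, of "[v]"]
  have "smooth_fun_on line ({0..1} \<times> U) (%(t, x). \<xi> t x [\<tau> x v])" by simp
  from smooth_family_reparam[OF this smooth_on_smooth_step] step_mem
  have 1: "smooth_fun_on line (UNIV \<times> U) (%(t, x). \<xi> (smooth_step t) x [\<tau> x v])" by blast
  show "smooth_fun_on line (UNIV \<times> U) (%(t, x). \<zeta> t x [\<tau> x v])"
    unfolding \<zeta>_def by (intro family_mult 1 smooth_family_time smooth_step_deriv)
qed

lemma \<zeta>_family: "section_family W ==> smooth_family (base A) (%t x. \<zeta> t x [W t x])"
  by (rule functional_family[where \<eta> = "%t x a. \<zeta> t x [a]"]) (rule \<zeta>_linear, rule \<zeta>_frame)

lemma w_derivative:
  assumes X: "X \<in> \<Gamma>" and Y: "Y \<in> \<Gamma>"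
  shows "((%s. w s x [X x, Y x]) has_real_derivative - d_A A (\<zeta> t) [X, Y] x) (at t)"
proof -
  let ?b = "smooth_step t"
  have f: "\<xi> ?b \<in> forms 1 A" using \<xi>_smooth step_mem by (auto simp: smooth_form_family_def)
  \<comment> \<open>The inner function takes its values in [0,1], so a derivative within the range
    of the smooth step, one-sided at the endpoints, is enough for the chain rule.\<close>
  have "((%s. eval_form (\<Omega> s) [X, Y] x) has_real_derivative - d_A A (\<xi> ?b) [X, Y] x) (at ?b within smooth_step ` UNIV)"
    by (rule DERIV_subset[OF \<Omega>_derivative[OF step_mem X Y]]) (use step_mem in auto)
  from DERIV_image_chain[OF this, of "deriv smooth_step t"] smooth_step_deriv(1)[of t]
  have "((%s. w s x [X x, Y x]) has_real_derivative - d_A A (\<xi> ?b) [X, Y] x * deriv smooth_step t) (at t)"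
    by (simp add: o_def w_def eval_form_def)
  moreover have "\<rho> x (V x) (%y. deriv smooth_step t * \<xi> ?b y [W y]) = deriv smooth_step t * \<rho> x (V x) (%y. \<xi> ?b y [W y])"
    if "V \<in> \<Gamma>" "W \<in> \<Gamma>" for V W
    by (rule tangent_scale[OF anchor_tangent[OF sectionD(1)[OF that(1)]] form1_CF[OF f that(2)]])
  then have "d_A A (\<zeta> t) [X, Y] x = d_A A (\<xi> ?b) [X, Y] x * deriv smooth_step t"
    using X Y by (simp add: d_A_1 \<zeta>_def algebra_simps)
  ultimately show ?thesis by simp
qed

text \<open>The coefficients of \<open>\<zeta>\<close> in the generators are integrated in time. As
  \<open>d_A\<close> commutes with the time derivative, the sum of \<open>d_A A (H t)\<close> and
  \<open>w t\<close> on a fixed pair of sections does not depend on \<open>t\<close>.\<close>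

lemma primitive:
  obtains H where "!!t. H t \<in> forms 1 A"
    "!!U \<tau> v. (U, \<tau>) \<in> frames A ==> smooth_fun_on line (UNIV \<times> U) (%(t, x). H t x [\<tau> x v])"
    "!!s t X Y x. X \<in> \<Gamma> ==> Y \<in> \<Gamma> ==>
      d_A A (H t) [X, Y] x - d_A A (H s) [X, Y] x = w s x [X x, Y x] - w t x [X x, Y x]"
proof -
  have "\<exists>G. smooth_family (base A) G \<and> (\<forall>t x. ((%s. G s x) has_real_derivative \<zeta> t x [E k x]) (at t))" for k
    by (rule smooth_family_antiderivative[OF \<zeta>_family[OF section_family_static[OF E[of k]]]]) blast
  then obtain G where G: "!!k. smooth_family (base A) (G k)"
      "!!k t x. ((%s. G k s x) has_real_derivative \<zeta> t x [E k x]) (at t)" by metis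
  define H where "H t x as = (\<Sum>k\<in>K. \<theta> k x (hd as) * G k t x)" for t x and as :: "'v list"
  have Hl: "linear_between (fibre A x) UNIV (%a. H t x [a])" for t x unfolding linear_between_def
    by (simp add: H_def linear_between_add[OF \<theta>_linear] linear_between_scale[OF \<theta>_linear]
        distrib_right sum.distrib sum_distrib_left mult.assoc)
  have Hf: "smooth_fun_on line (UNIV \<times> U) (%(t, x). H t x [\<tau> x v])" if U: "(U, \<tau>) \<in> frames A" for U \<tau> v
    unfolding H_def list.sel
    by (intro family_sum family_mult smooth_family_static[OF \<theta>_smooth[OF U]] smooth_fun_on_subset[OF G(1)]) simp
  have H1: "H t \<in> forms 1 A" for t by (rule forms1I[OF Hl]) (use smooth_family_slice[OF Hf] in auto)
  have Hd: "((%s. H s x [a]) has_real_derivative \<zeta> t x [a]) (at t)" if a: "a \<in> fibre A x" for t x a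
  proof -
    have "((%s. H s x [a]) has_real_derivative (\<Sum>k\<in>K. \<theta> k x a * \<zeta> t x [E k x])) (at t)"
      unfolding H_def list.sel by (intro DERIV_sum DERIV_cmult G)
    then show ?thesis using linear_expand_fibre_real[OF \<zeta>_linear a, of t] by simp
  qed
  have prim: "d_A A (H t) [X, Y] x - d_A A (H s) [X, Y] x = w s x [X x, Y x] - w t x [X x, Y x]"
    if X: "X \<in> \<Gamma>" and Y: "Y \<in> \<Gamma>" for s t X Y x
  proof -
    have r: "((%s. \<rho> x (P x) (%y. H s y [Q y])) has_real_derivative \<rho> x (P x) (%y. \<zeta> t y [Q y])) (at t)"
      if P: "P \<in> \<Gamma>" and Q: "Q \<in> \<Gamma>" for P Q t
    proof -
      have s: "smooth_family (base A) (%t x. H t x [Q x])"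
        by (rule functional_family[where \<eta> = "%t x a. H t x [a]"])
          (rule Hl, rule Hf, assumption, rule section_family_static[OF Q])
      then have "\<rho> x 0 (%y. H t y [Q y]) = 0"
        using linear_between_0[OF anchor_linear fibre_0] smooth_family_imp_smooth_fun[OF s, of t] by simp
      then show ?thesis
        using anchor_family_derivative(1)[OF section_derivative_static[OF P] s Hd[OF sectionD(1)[OF Q]], of x t] by simp
    qed
    have "((%s. d_A A (H s) [X, Y] x + w s x [X x, Y x]) has_real_derivative 0) (at t)" for t
    proof -
      have "((%s. d_A A (H s) [X, Y] x) has_real_derivative d_A A (\<zeta> t) [X, Y] x) (at t)"
        unfolding d_A_1 by (intro DERIV_diff r X Y Hd sectionD(1) bracket_section)
      from DERIV_add[OF this w_derivative[OF X Y, where x = x]] show ?thesis by simp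
    qed
    then have "\<forall>t. ((%s. d_A A (H s) [X, Y] x + w s x [X x, Y x]) has_real_derivative 0) (at t)" ..
    from DERIV_isconst_all[OF this, of t s] show ?thesis by simp
  qed
  show ?thesis by (rule that[of H]) (rule H1, rule Hf, assumption, rule prim)
qed

end

section \<open>Interpolating forms and their non-degeneracy\<close>

context lie_calculus begin

lemma anchor_frame_smooth:
  assumes U: "(U, \<tau>) \<in> frames A" and f: "f \<in> CF"
  shows "smooth_fun_on (base A) U (%x. \<rho> x (\<tau> x v) f)"
proof -
  have "smooth_fun_on (base A) U (%x. \<Sum>k\<in>K. \<theta> k x (\<tau> x v) * \<rho> x (E k x) f)"
    using anchor_CF[OF E f] by (intro smooth_fun_on_sum smooth_fun_on_mult \<theta>_smooth U) (auto intro: smooth_fun_on_subset)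
  then show ?thesis
    by (rule smooth_fun_on_cong) (use linear_expand_fibre_real[OF anchor_linear[OF f] frame_mem[OF U]] in auto)
qed

end

text \<open>With \<open>d\<eta> = w s - w s'\<close>, \<open>cut s s' \<phi>\<close> is the exact form \<open>d(\<phi> \<eta>)\<close>; the cutoff forms
  \<open>w s - d(\<phi> \<eta>)\<close> interpolate between \<open>w s\<close> and \<open>w s'\<close> as \<open>\<phi>\<close> runs from \<open>0\<close> to \<open>1\<close>.\<close>

locale moser_primitive = moser_path A K E \<theta> I crdf \<Delta> \<Omega> \<xi>
  for A :: "('m::{t2_space,second_countable_topology}, 'b::real_normed_vector,
    'v::real_vector, 'f::real_normed_vector) algebroid" and K E \<theta> I crdf \<Delta> \<Omega> \<xi> +
  fixes H :: "real => 'm => 'v list => real"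
  assumes H_forms: "!!t. H t \<in> forms 1 A"
    and H_frame: "!!U \<tau> v. (U, \<tau>) \<in> frames A ==> smooth_fun_on line (UNIV \<times> U) (%(t, x). H t x [\<tau> x v])"
    and H_d: "!!s t X Y x. X \<in> \<Gamma> ==> Y \<in> \<Gamma> ==>
      d_A A (H t) [X, Y] x - d_A A (H s) [X, Y] x = w s x [X x, Y x] - w t x [X x, Y x]"
begin

definition \<eta> :: "real => real => 'm => 'v list => real" where "\<eta> s s' x as = H s' x as - H s x as"

text \<open>The Leibniz rule \<open>\<phi> d\<eta> + d\<phi> \<and> \<eta>\<close> with the known
  value of \<open>d\<eta>\<close> inserted. In this form it takes fibre vectors instead of sections,
  and its components in a frame are visibly continuous in \<open>s\<close> and
  \<open>s'\<close>.\<close>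

definition cut :: "real => real => ('m => real) => 'm => 'v list => real" where
  "cut s s' \<phi> x as = \<phi> x * (w s x as - w s' x as) +
    (\<rho> x (as ! 0) \<phi> * \<eta> s s' x [as ! 1] - \<rho> x (as ! 1) \<phi> * \<eta> s s' x [as ! 0])"

lemma \<eta>_forms: "\<eta> s s' \<in> forms 1 A"
proof (rule forms1I)
  note l = form1_linear[OF H_forms]
  show "linear_between (fibre A x) UNIV (%a. \<eta> s s' x [a])" for x unfolding linear_between_def
    by (simp add: \<eta>_def linear_between_add[OF l] linear_between_scale[OF l] algebra_simps)
  show "smooth_fun_on (base A) U (%x. \<eta> s s' x [\<tau> x v])" if "(U, \<tau>) \<in> frames A" for U \<tau> v
    unfolding \<eta>_def by (intro smooth_fun_on_diff form_smooth(1)[OF H_forms that])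
qed

lemma d_\<eta>:
  assumes X: "X \<in> \<Gamma>" and Y: "Y \<in> \<Gamma>"
  shows "d_A A (\<eta> s s') [X, Y] x = w s x [X x, Y x] - w s' x [X x, Y x]"
proof -
  have "\<rho> x (P x) (%y. H s' y [Q y] - H s y [Q y]) = \<rho> x (P x) (%y. H s' y [Q y]) - \<rho> x (P x) (%y. H s y [Q y])"
    if "P \<in> \<Gamma>" "Q \<in> \<Gamma>" for P Q
    by (rule tangent_diff[OF anchor_tangent[OF sectionD(1)[OF that(1)]] form1_CF[OF H_forms that(2)] form1_CF[OF H_forms that(2)]])
  then have "d_A A (\<eta> s s') [X, Y] x = d_A A (H s') [X, Y] x - d_A A (H s) [X, Y] x"
    using X Y by (simp add: d_A_1 \<eta>_def)
  then show ?thesis using H_d[OF X Y] by simp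
qed

lemma cut_d:
  assumes \<phi>: "\<phi> \<in> CF" and X: "X \<in> \<Gamma>" and Y: "Y \<in> \<Gamma>"
  shows "cut s s' \<phi> x [X x, Y x] = d_A A (%x as. \<phi> x * \<eta> s s' x as) [X, Y] x"
proof -
  have "\<rho> x (P x) (%y. \<phi> y * \<eta> s s' y [Q y]) = \<phi> x * \<rho> x (P x) (%y. \<eta> s s' y [Q y]) + \<eta> s s' x [Q x] * \<rho> x (P x) \<phi>"
    if "P \<in> \<Gamma>" "Q \<in> \<Gamma>" for P Q
    by (rule tangent_mult[OF anchor_tangent[OF sectionD(1)[OF that(1)]] \<phi> form1_CF[OF \<eta>_forms that(2)]])
  then show ?thesis using X Y by (simp add: cut_def d_\<eta>[OF X Y, symmetric] d_A_1 algebra_simps)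
qed

lemma cut_forms:
  assumes \<phi>: "\<phi> \<in> CF" shows "cut s s' \<phi> \<in> forms 2 A"
proof (rule forms2I)
  fix x b assume b: "b \<in> fibre A x"
  note l = form2_linear(1)[OF w_forms b] form1_linear[OF \<eta>_forms, of x s s'] anchor_linear[OF \<phi>, of x]
  show "linear_between (fibre A x) UNIV (%a. cut s s' \<phi> x [a, b])" unfolding linear_between_def
    by (simp add: cut_def linear_between_add[OF l(1)] linear_between_scale[OF l(1)] linear_between_add[OF l(2)]
        linear_between_scale[OF l(2)] linear_between_add[OF l(3)] linear_between_scale[OF l(3)] algebra_simps)
next
  show "cut s s' \<phi> x [a, b] = - cut s s' \<phi> x [b, a]" if "a \<in> fibre A x" "b \<in> fibre A x" for x a b
    using form2_antisym[OF w_forms that, of s] form2_antisym[OF w_forms that, of s'] by (simp add: cut_def algebra_simps)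
next
  fix U \<tau> u v assume U: "(U, \<tau>) \<in> frames A"
  have "smooth_fun_on (base A) U \<phi>" using \<phi> by (auto intro: smooth_fun_on_subset)
  then show "smooth_fun_on (base A) U (%x. cut s s' \<phi> x [\<tau> x u, \<tau> x v])" unfolding cut_def
    by (simp, intro smooth_fun_on_add smooth_fun_on_diff smooth_fun_on_mult form_smooth(2)[OF w_forms U]
        form_smooth(1)[OF \<eta>_forms U] anchor_frame_smooth[OF U \<phi>])
qed

lemma cut_closed: "\<phi> \<in> CF ==> closed_form 2 A (cut s s' \<phi>)"
  by (rule closed_d_A[OF forms1_scale[OF _ \<eta>_forms] cut_d])

lemma cut_add:
  assumes "\<phi> \<in> CF" "\<psi> \<in> CF" "a \<in> fibre A x" "b \<in> fibre A x"
  shows "cut s s' (%x. \<phi> x + \<psi> x) x [a, b] = cut s s' \<phi> x [a, b] + cut s s' \<psi> x [a, b]"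
  using tangent_add[OF anchor_tangent[OF assms(3)] assms(1,2)] tangent_add[OF anchor_tangent[OF assms(4)] assms(1,2)]
  by (simp add: cut_def algebra_simps)

lemma cut_const:
  assumes "a \<in> fibre A x" "b \<in> fibre A x"
  shows "cut s s' (%x. r) x [a, b] = r * (w s x [a, b] - w s' x [a, b])"
  using tangent_const[OF anchor_tangent[OF assms(1)]] tangent_const[OF anchor_tangent[OF assms(2)]]
  by (simp add: cut_def)

abbreviation cutoff :: "real => real => ('m => real) => 'm => 'v list => real" where
  "cutoff s s' \<phi> \<equiv> %x as. w s x as - 1 * cut s s' \<phi> x as"

lemma cutoff_forms: "\<phi> \<in> CF ==> cutoff s s' \<phi> \<in> forms 2 A" by (rule forms2_combine[OF w_forms cut_forms])

lemma cutoff_closed: "\<phi> \<in> CF ==> closed_form 2 A (cutoff s s' \<phi>)"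
  by (rule closed_form_combine[OF w_forms w_closed cut_forms cut_closed])

text \<open>For \<open>s' = s\<close> both \<open>cut\<close> terms vanish and the form is
  \<open>w s\<close>. Non-degeneracy is open in all parameters jointly, by the lower bound for the
  Gram matrix, and compactness in \<open>s\<close>, \<open>r\<close> and \<open>x\<close> makes the
  admissible distance from the diagonal uniform.\<close>

lemma nondegenerate_near_diagonal:
  assumes \<phi>: "\<phi> \<in> CF" and \<psi>: "\<psi> \<in> CF"
  shows "\<exists>\<delta>>0. \<forall>s\<in>{0..1}. \<forall>s'. \<bar>s' - s\<bar> < \<delta> \<longrightarrow> (\<forall>r\<in>{0..1}. \<forall>x.
    kernel_trivial (%x as. cutoff s s' \<phi> x as - r * cut s s' \<psi> x as) x)"
proof -
  let ?f = "%s s' r x as. cutoff s s' \<phi> x as - r * cut s s' \<psi> x as"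
  have f: "?f s s' r \<in> forms 2 A" for s s' r by (rule forms2_combine[OF cutoff_forms[OF \<phi>] cut_forms[OF \<psi>]])
  let ?g = "%p x. kernel_trivial (?f (fst (snd p)) (fst (snd p) + fst p) (fst (snd (snd p)))) x"
  \<comment> \<open>The first coordinate stands for \<open>s' - s\<close>: the diagonal becomes the
    slice over 0, around which the tube lemma provides a product neighbourhood.\<close>
  define T where "T = interior {p :: real \<times> real \<times> real \<times> 'm. ?g p (snd (snd (snd p)))}"
  have diag: "(0, s, r, x0) \<in> T" for s r x0
  proof -
    obtain U \<tau> where U: "(U, \<tau>) \<in> frames A" "x0 \<in> U" using frame_exists by blast
    let ?S = "UNIV \<times> UNIV \<times> UNIV \<times> U :: (real \<times> real \<times> real \<times> 'm) set"
    let ?F = "%p. ?f (fst (snd p)) (fst (snd p) + fst p) (fst (snd (snd p)))"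
    let ?L = "%p. gram (?F p) \<tau> (snd (snd (snd p)))"
    have oS: "open ?S" using frame_open[OF U(1)] by (simp add: open_Times)
    have fam: "continuous_on ?S (%p. h (g p) (snd (snd (snd p))))"
      if "smooth_fun_on line (UNIV \<times> U) (%(t, x). h t x :: real)" "continuous_on ?S g" for h g
    proof -
      have "continuous_on (UNIV \<times> U) (%(t, x). h t x)"
        by (rule manifold.smooth_fun_on_imp_continuous_on[OF manifold_line that(1)])
          (use frame_open[OF U(1)] in \<open>simp add: open_Times\<close>)
      moreover have "continuous_on ?S (%p. (g p, snd (snd (snd p))))" by (intro continuous_intros that(2))
      moreover have "(%p. (g p, snd (snd (snd p)))) ` ?S \<subseteq> UNIV \<times> U" by auto
      ultimately show ?thesis using continuous_on_compose2 by fastforce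
    qed
    have st: "continuous_on ?S (%p. h (snd (snd (snd p))))" if "smooth_fun_on (base A) U h" for h :: "'m => real"
      using fam[OF smooth_family_static[OF that], of "%_. 0"] by simp
    have CFU: "smooth_fun_on (base A) U \<phi>" "smooth_fun_on (base A) U \<psi>"
      using \<phi> \<psi> by (auto intro: smooth_fun_on_subset)
    have cont: "continuous_on ?S (%p. ?L p v)" for v unfolding gram_def cut_def \<eta>_def
      by (simp, intro continuous_intros fam[OF w_frame[OF U(1)]] fam[OF H_frame[OF U(1)]]
          st[OF CFU(1)] st[OF CFU(2)] st[OF anchor_frame_smooth[OF U(1) \<phi>]] st[OF anchor_frame_smooth[OF U(1) \<psi>]])
    have lin: "linear (?L p)" if "p \<in> ?S" for p by (rule gram_linear[OF f U(1)]) (use that in auto)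
    have "cut s s q x [a, b] = 0" for q x a b by (simp add: cut_def \<eta>_def)
    then have "kernel_trivial (?F (0, s, r, x0)) x0" using w_kernel[of s x0] by (simp add: kernel_trivial_def)
    then have inj: "inj (?L (0, s, r, x0))" using gram_inj_iff[OF f U] by simp
    obtain m W where W: "m > 0" "open W" "(0, s, r, x0) \<in> W" "W \<subseteq> ?S"
      "!!p v. p \<in> W ==> m * norm v \<le> norm (?L p v)"
      by (rule injective_linear_lower_bound[OF fdf oS _ lin inj cont]) (use U in auto)
    have "?g p (snd (snd (snd p)))" if p: "p \<in> W" for p
    proof -
      have pU: "snd (snd (snd p)) \<in> U" and pS: "p \<in> ?S" using p W(4) by auto
      have "v = 0" if "?L p v = 0" for v using W(5)[OF p, of v] W(1) that by (simp add: mult_le_0_iff)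
      then have "inj (?L p)" using linear_injective_0[OF lin[OF pS]] by blast
      then show ?thesis using gram_inj_iff[OF f U(1) pU] by simp
    qed
    then have "W \<subseteq> {p. ?g p (snd (snd (snd p)))}" by blast
    then show ?thesis unfolding T_def using W(2,3) by (meson interiorI)
  qed
  have "compact ({0..1} \<times> {0..1} \<times> UNIV :: (real \<times> real \<times> 'm) set)"
    by (intro compact_Times compact_Icc compact_base)
  then obtain X0 where X0: "0 \<in> X0" "open X0" "X0 \<times> ({0..1} \<times> {0..1} \<times> UNIV) \<subseteq> T"
    using Elementary_Topology.tube_lemma[of "{0..1} \<times> {0..1} \<times> UNIV" T 0] diag by (auto simp: T_def)
  obtain \<delta> where \<delta>: "\<delta> > 0" "ball 0 \<delta> \<subseteq> X0" using X0(1,2) openE by blast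
  have "kernel_trivial (?f s s' r) x" if "s \<in> {0..1}" "\<bar>s' - s\<bar> < \<delta>" "r \<in> {0..1}" for s s' r x
  proof -
    have "s' - s \<in> ball 0 \<delta>" using that(2) by (simp add: dist_real_def abs_minus_commute)
    then have "(s' - s, s, r, x) \<in> T" using \<delta>(2) X0(3) that(1,3) by blast
    then have "?g (s' - s, s, r, x) x" unfolding T_def using interior_subset by fastforce
    then show ?thesis by simp
  qed
  then show ?thesis using \<delta>(1) by blast
qed

end

section \<open>Fragmentation of the path\<close>

context moser_primitive begin

text \<open>The partial sums \<open>\<sigma> j\<close> of the partition of unity lead from 0 to 1,
  and so the forms \<open>cutoff s s' (\<sigma> j)\<close> lead from \<open>w s\<close> to
  \<open>w s'\<close>. Consecutive ones differ by \<open>cut s s' (\<psi> j)\<close>, the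
  differential of a one-form supported in a single patch, to which \<open>moser_step\<close>
  applies.\<close>

lemma related_nearby: "\<exists>\<delta>>0. \<forall>s\<in>{0..1}. \<forall>s'. \<bar>s' - s\<bar> < \<delta> \<longrightarrow> related (w s) (w s')"
proof -
  have "\<exists>U c U' \<tau>. (U, c) \<in> base A \<and> (U', \<tau>) \<in> frames A \<and> x \<in> U \<inter> U'" for x
    using chart_exists[of x] frame_exists[of x] by blast
  then obtain U c U' \<tau> where patch: "!!x. (U x, c x) \<in> base A" "!!x. (U' x, \<tau> x) \<in> frames A" "!!x. x \<in> U x \<inter> U' x"
    by metis
  let ?N = "%x. U x \<inter> U' x"
  have N: "open (?N x)" for x using chart_open[OF patch(1)] frame_open[OF patch(2)] by blast
  obtain n p z C \<psi> where "partition_of_unity ?N n p z C \<psi>"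
    using partition_of_unity_exists[of ?N, OF N patch(3)] by blast
  note pu = partition_of_unityD[OF this]
  define \<sigma> where "\<sigma> j x = (\<Sum>i<j. \<psi> i x)" for j x
  have \<sigma>: "\<sigma> j \<in> CF" for j unfolding \<sigma>_def by (rule CF_sum) (rule pu(5))
  let ?d = "%j \<delta>. \<delta> > 0 \<and> (\<forall>s\<in>{0..1}. \<forall>s'. \<bar>s' - s\<bar> < \<delta> \<longrightarrow> (\<forall>r\<in>{0..1}. \<forall>x.
      kernel_trivial (%x as. cutoff s s' (\<sigma> j) x as - r * cut s s' (\<psi> j) x as) x))"
  have "\<forall>j. \<exists>\<delta>. ?d j \<delta>" by (intro allI nondegenerate_near_diagonal \<sigma> pu(5))
  then have "\<exists>d. \<forall>j. ?d j (d j)" by (rule choice)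
  then obtain d where "\<forall>j. ?d j (d j)" ..
  then have d: "d j > 0" "s \<in> {0..1} ==> \<bar>s' - s\<bar> < d j ==> r \<in> {0..1} ==>
      kernel_trivial (%x as. cutoff s s' (\<sigma> j) x as - r * cut s s' (\<psi> j) x as) x" for j s s' r x by blast+
  \<comment> \<open>A minimum over the finitely many steps, independent of \<open>s\<close> and
    \<open>s'\<close>; the inserted 1 avoids a case distinction on \<open>n = 0\<close>.\<close>
  define \<delta> where "\<delta> = Min (insert 1 (d ` {..<n}))"
  have \<delta>: "\<delta> > 0" "!!j. j < n ==> \<delta> \<le> d j" using d(1) by (auto simp: \<delta>_def)
  have "related (w s) (w s')" if s: "s \<in> {0..1}" "\<bar>s' - s\<bar> < \<delta>" for s s'
  proof -
    have "related (w s) (cutoff s s' (\<sigma> j))" if "j \<le> n" for j using that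
    proof (induction j)
      case 0
      have "cut s s' (\<sigma> 0) x [a, b] = 0" if "a \<in> fibre A x" "b \<in> fibre A x" for x a b
        using cut_const[OF that, of s s' 0] by (simp add: \<sigma>_def[abs_def])
      then show ?case by (intro related_cong) simp
    next
      case (Suc j)
      interpret patch: chart_patch A K E \<theta> I crdf \<Delta> "U (p j)" "c (p j)" "U' (p j)" "\<tau> (p j)" "?N (p j)" "C j" "z j" "\<psi> j"
        by (rule chart_patch.intro[OF lie_calculus_axioms chart_patch_axioms.intro])
          (use patch N pu in auto)
      have "related (cutoff s s' (\<sigma> j)) (%x as. cutoff s s' (\<sigma> j) x as - cut s s' (\<psi> j) x as)"
        by (rule patch.moser_step[OF cutoff_forms[OF \<sigma>] cutoff_closed[OF \<sigma>] \<eta>_forms cut_forms[OF pu(5)] cut_d[OF pu(5)] d(2)])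
          (use s \<delta>(2)[of j] Suc.prems in auto)
      moreover have "related (%x as. cutoff s s' (\<sigma> j) x as - cut s s' (\<psi> j) x as) (cutoff s s' (\<sigma> (Suc j)))"
      proof (rule related_cong)
        fix x a b assume "a \<in> fibre A x" "b \<in> fibre A x"
        from cut_add[OF \<sigma> pu(5) this, of s s' j j]
        show "cutoff s s' (\<sigma> j) x [a, b] - cut s s' (\<psi> j) x [a, b] = cutoff s s' (\<sigma> (Suc j)) x [a, b]"
          by (simp add: \<sigma>_def[abs_def])
      qed
      ultimately show ?case using Suc related_trans by (meson Suc_leD)
    qed
    \<comment> \<open>\<open>\<sigma> n\<close> is the constant 1, whose derivative vanishes, so the
      form subtracted is \<open>w s - w s'\<close>.\<close>
    moreover have "related (cutoff s s' (\<sigma> n)) (w s')"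
    proof (rule related_cong)
      fix x a b assume "a \<in> fibre A x" "b \<in> fibre A x"
      from cut_const[OF this, of s s' 1] show "cutoff s s' (\<sigma> n) x [a, b] = w s' x [a, b]"
        by (simp add: \<sigma>_def[abs_def] pu(7))
    qed
    ultimately show ?thesis using related_trans by blast
  qed
  then show ?thesis using \<delta>(1) by blast
qed

text \<open>Since \<open>\<delta>\<close> does not depend on the starting time, finitely many equal
  steps cover [0,1], and transitivity joins them.\<close>

lemma related_endpoints: "related (\<Omega> 0) (\<Omega> 1)"
proof -
  obtain \<delta> where \<delta>: "\<delta> > 0" "!!s s'. s \<in> {0..1} ==> \<bar>s' - s\<bar> < \<delta> ==> related (w s) (w s')"
    using related_nearby by blast
  obtain m :: nat where m: "m > 0" "1 / real m < \<delta>"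
    using reals_Archimedean[OF \<delta>(1)] by (auto simp: inverse_eq_divide intro: that[of "Suc _"])
  have "related (w 0) (w (real i / real m))" if "i \<le> m" for i using that
  proof (induction i)
    case 0
    show ?case by (simp add: related_cong)
  next
    case (Suc i)
    have "real (Suc i) / real m - real i / real m = 1 / real m" by (simp add: add_divide_distrib)
    then have "related (w (real i / real m)) (w (real (Suc i) / real m))"
      using Suc.prems m by (intro \<delta>(2)) auto
    then show ?case using Suc related_trans by (meson Suc_leD)
  qed
  \<comment> \<open>The smooth step fixes 0 and 1, so the endpoints of \<open>w\<close> are those of
    \<open>\<Omega>\<close>.\<close>
  from this[of m] m(1) show ?thesis by (simp add: w_def)
qed

end

theorem corollary5p1:
  fixes A :: "('m::{t2_space,second_countable_topology}, 'b::real_normed_vector,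
                'v::real_vector, 'f::real_normed_vector) algebroid"
    and \<Omega> \<xi> :: "real \<Rightarrow> 'm \<Rightarrow> 'v list \<Rightarrow> real"
  assumes "compact (UNIV :: 'm set)"
    and "lie_algebroid A"
    and "smooth_form_family 2 A \<Omega>"
    and "\<And>t. t \<in> {0..1} \<Longrightarrow> symplectic_form A (\<Omega> t)"
    and "smooth_form_family 1 A \<xi>"
    and "\<And>t X Y x. \<lbrakk>t \<in> {0..1}; X \<in> sections A; Y \<in> sections A\<rbrakk> \<Longrightarrow>
           ((\<lambda>s. eval_form (\<Omega> s) [X, Y] x) has_real_derivative - d_A A (\<xi> t) [X, Y] x)
             (at t within {0..1})"
  shows "\<exists>F \<Phi>. algebroid_automorphism A F \<Phi> \<and> isotopic_to_identity A F \<Phi> \<and>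
           (\<forall>x. \<forall>a\<in>fibre A x. \<forall>b\<in>fibre A x.
              pullback_form F \<Phi> (\<Omega> 1) x [a, b] = \<Omega> 0 x [a, b])"
proof -
  interpret compact_lie_algebroid A by unfold_locales (fact assms)+
  obtain K E \<theta> I crdf \<Delta> where calculus: "lie_calculus A K E \<theta> I crdf \<Delta>" using lie_calculus_exists by blast
  interpret lie_calculus A K E \<theta> I crdf \<Delta> by (rule calculus)
  interpret moser_path A K E \<theta> I crdf \<Delta> \<Omega> \<xi>
    by (rule moser_path.intro[OF calculus moser_path_axioms.intro]) (fact assms)+
  obtain H where H: "moser_primitive A K E \<theta> I crdf \<Delta> \<Omega> \<xi> H"
    by (rule primitive) (use moser_primitive.intro[OF moser_path_axioms moser_primitive_axioms.intro] in blast)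
  obtain F \<Phi> G \<Psi> where iso: "algebroid_isotopy F \<Phi> G \<Psi>"
    "!!x a b. a \<in> fibre A x ==> b \<in> fibre A x ==> \<Omega> 1 (F 1 x) [\<Phi> 1 x a, \<Phi> 1 x b] = \<Omega> 0 x [a, b]"
    using moser_primitive.related_endpoints[OF H] unfolding related_def by blast
  then show ?thesis
    using algebroid_isotopy_automorphism[OF iso(1), of 1] algebroid_isotopy_isotopic[OF iso(1)]
    by (intro exI[of _ "F 1"] exI[of _ "\<Phi> 1"]) (simp add: pullback_form_def)
qed

end
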